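(* Let $A$ and $B$ be separably equivalent rings. (i) Injectives generate for $A$ if and only if injectives generate for $B$. (ii) Projectives cogenerate for $A$ if and only if projectives cogenerate for $B$.
   Context: All rings are unital and modules are right modules unless otherwise stated. For a ring $A$, $\mathcal{D}(A)$ is the unbounded derived category of cochain complexes of $A$-modules. A localising (respectively colocalising) subcategory of $\mathcal{D}(A)$ is a triangulated subcategory closed under set indexed coproducts (respectively products). Injectives generate for $A$ if the smallest localising subcategory of $\mathcal{D}(A)$ containing all injective $A$-modules is $\mathcal{D}(A)$. Projectives cogenerate for $A$ if the smallest colocalising subcategory of $\mathcal{D}(A)$ containing all projective $A$-modules is $\mathcal{D}(A)$. A ring $B$ separably divides a ring $A$ (via bimodules ${}_AM_B$ and ${}_BN_A$) if the modules ${}_AM$, $M_B$, ${}_BN$ and $N_A$ are all finitely generated projective and there exists a bimodule ${}_BY_B$ such that ${}_BN\otimes_A M_B$ and ${}_BB_B\oplus {}_BY_B$ are isomorphic as $(B,B)$-bimodules. Rings $A$ and $B$ are separably equivalent if $A$ separably divides $B$ via bimodules ${}_AM_B$ and ${}_BN_A$ and $B$ separably divides $A$ via the same bimodules ${}_AM_B$ and ${}_BN_A$. *)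

theory Defs
  imports "HOL-Algebra.Module" "HOL-Algebra.AbelCoset" "HOL-Algebra.Free_Abelian_Groups"
begin

section \<open>The universe of sets\<close>

text \<open>
  HOL has no type of all sets, so "all modules" and "set indexed coproducts" are read relative to a
  Grothendieck universe. It is given by a type \<open>'u\<close> whose cardinality is uncountable, strong limit
  and regular (i.e. strongly inaccessible); the sets of the universe are, up to bijection, the
  subsets of \<open>'u\<close> of smaller cardinality than \<open>'u\<close>. All rings, modules and index sets are carried
  by such small sets.
\<close>

definition small :: "'u set \<Rightarrow> bool"
  where "small X \<longleftrightarrow> X \<prec> (UNIV :: 'u set)"

definition grothendieck_universe :: "'u itself \<Rightarrow> bool"
  where "grothendieck_universe _ \<longleftrightarrow>
    (UNIV :: nat set) \<prec> (UNIV :: 'u set) \<and>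
    (\<forall>X :: 'u set. small X \<longrightarrow> Pow X \<prec> (UNIV :: 'u set)) \<and>
    (\<forall>(I :: 'u set) (X :: 'u \<Rightarrow> 'u set).
       small I \<and> (\<forall>i\<in>I. small (X i)) \<longrightarrow> small (\<Union>i\<in>I. X i))"

text \<open>A fixed coding of pairs, used to form binary direct sums inside the universe.\<close>

definition enc :: "'u \<times> 'u \<Rightarrow> 'u"
  where "enc = (SOME e. inj e)"

definition dec :: "'u \<Rightarrow> 'u \<times> 'u"
  where "dec = inv_into UNIV enc"

lemma inj_enc:
  assumes "grothendieck_universe TYPE('u)"
  shows "inj (enc :: 'u \<times> 'u \<Rightarrow> 'u)"
proof -
  have "infinite (UNIV :: 'u set)"
    using assms by (auto simp: grothendieck_universe_def lesspoll_def infinite_le_lepoll)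
  then have "\<exists>e :: 'u \<times> 'u \<Rightarrow> 'u. bij_betw e (UNIV \<times> UNIV) UNIV"
    using card_of_Times_same_infinite card_of_ordIso by blast
  then have "\<exists>e :: 'u \<times> 'u \<Rightarrow> 'u. inj e"
    by (auto simp: bij_betw_def)
  then show ?thesis
    unfolding enc_def by (rule someI_ex)
qed


section \<open>Modules over not necessarily commutative rings\<close>

text \<open>
  The record \<^typ>\<open>('a, 'm) module\<close> is used for right modules: \<open>r \<odot>\<^bsub>M\<^esub> x\<close> stands for \<open>x \<cdot> r\<close>, whence the
  order of the factors in \<open>smult_assoc\<close>. As usual for this record, its multiplicative fields
  \<open>mult\<close> and \<open>one\<close> carry no information.
\<close>

locale right_module = R: ring R + M: abelian_group M
  for R :: "('a, 'r) ring_scheme" (structure) and M :: "('a, 'm, 's) module_scheme" (structure) +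
  assumes smult_closed:
      "\<lbrakk> r \<in> carrier R; x \<in> carrier M \<rbrakk> \<Longrightarrow> r \<odot>\<^bsub>M\<^esub> x \<in> carrier M"
    and smult_l_distr:
      "\<lbrakk> r \<in> carrier R; s \<in> carrier R; x \<in> carrier M \<rbrakk> \<Longrightarrow>
        (r \<oplus>\<^bsub>R\<^esub> s) \<odot>\<^bsub>M\<^esub> x = (r \<odot>\<^bsub>M\<^esub> x) \<oplus>\<^bsub>M\<^esub> (s \<odot>\<^bsub>M\<^esub> x)"
    and smult_r_distr:
      "\<lbrakk> r \<in> carrier R; x \<in> carrier M; y \<in> carrier M \<rbrakk> \<Longrightarrow>
        r \<odot>\<^bsub>M\<^esub> (x \<oplus>\<^bsub>M\<^esub> y) = (r \<odot>\<^bsub>M\<^esub> x) \<oplus>\<^bsub>M\<^esub> (r \<odot>\<^bsub>M\<^esub> y)"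
    and smult_assoc:
      "\<lbrakk> r \<in> carrier R; s \<in> carrier R; x \<in> carrier M \<rbrakk> \<Longrightarrow>
        (r \<otimes>\<^bsub>R\<^esub> s) \<odot>\<^bsub>M\<^esub> x = s \<odot>\<^bsub>M\<^esub> (r \<odot>\<^bsub>M\<^esub> x)"
    and smult_one: "x \<in> carrier M \<Longrightarrow> \<one>\<^bsub>R\<^esub> \<odot>\<^bsub>M\<^esub> x = x"

definition modules :: "'u ring \<Rightarrow> ('u, 'u) module set"
  where "modules A = {M. right_module A M \<and> small (carrier M)}"

definition rmod_hom ::
    "('a, 'r) ring_scheme \<Rightarrow> ('a, 'm, 's) module_scheme \<Rightarrow> ('a, 'n, 't) module_scheme \<Rightarrow> ('m \<Rightarrow> 'n) set"
  where "rmod_hom R M N = {f \<in> carrier M \<rightarrow> carrier N.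
    (\<forall>x\<in>carrier M. \<forall>y\<in>carrier M. f (x \<oplus>\<^bsub>M\<^esub> y) = f x \<oplus>\<^bsub>N\<^esub> f y) \<and>
    (\<forall>r\<in>carrier R. \<forall>x\<in>carrier M. f (r \<odot>\<^bsub>M\<^esub> x) = r \<odot>\<^bsub>N\<^esub> f x)}"

definition injective_module :: "'u ring \<Rightarrow> ('u, 'u) module \<Rightarrow> bool"
  where "injective_module A J \<longleftrightarrow> J \<in> modules A \<and>
    (\<forall>X\<in>modules A. \<forall>Y\<in>modules A. \<forall>i\<in>rmod_hom A X Y. \<forall>f\<in>rmod_hom A X J.
       inj_on i (carrier X) \<longrightarrow> (\<exists>g\<in>rmod_hom A Y J. \<forall>x\<in>carrier X. g (i x) = f x))"

definition projective_module :: "'u ring \<Rightarrow> ('u, 'u) module \<Rightarrow> bool"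
  where "projective_module A P \<longleftrightarrow> P \<in> modules A \<and>
    (\<forall>X\<in>modules A. \<forall>Y\<in>modules A. \<forall>p\<in>rmod_hom A X Y. \<forall>f\<in>rmod_hom A P Y.
       p ` carrier X = carrier Y \<longrightarrow> (\<exists>g\<in>rmod_hom A P X. \<forall>x\<in>carrier P. p (g x) = f x))"

definition finitely_generated ::
    "('a, 'r) ring_scheme \<Rightarrow> ('a, 'm, 's) module_scheme \<Rightarrow> bool"
  where "finitely_generated R M \<longleftrightarrow> (\<exists>S. finite S \<and> S \<subseteq> carrier M \<and>
    (\<forall>x\<in>carrier M. \<exists>c\<in>S \<rightarrow> carrier R. x = (\<Oplus>\<^bsub>M\<^esub>s\<in>S. c s \<odot>\<^bsub>M\<^esub> s)))"


section \<open>Bimodules and separable equivalence\<close>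

text \<open>An \<open>(L, R)\<close>-bimodule: \<open>smult\<close> is the right action of \<open>R\<close>, \<open>lsmult\<close> the left action of \<open>L\<close>.\<close>

record ('l, 'r, 'm) bimodule = "('r, 'm) module" +
  lsmult :: "'l \<Rightarrow> 'm \<Rightarrow> 'm"

definition opposite :: "'a ring \<Rightarrow> 'a ring"
  where "opposite R = R\<lparr>monoid.mult := \<lambda>x y. y \<otimes>\<^bsub>R\<^esub> x\<rparr>"

text \<open>The underlying right and left module; left \<open>L\<close>-modules are right modules over \<open>opposite L\<close>.\<close>

definition right_part :: "('l, 'r, 'm) bimodule \<Rightarrow> ('r, 'm) module"
  where "right_part M = \<lparr>carrier = carrier M, monoid.mult = monoid.mult M, monoid.one = \<one>\<^bsub>M\<^esub>,
    ring.zero = \<zero>\<^bsub>M\<^esub>, ring.add = ring.add M, smult = smult M\<rparr>"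

definition left_part :: "('l, 'r, 'm) bimodule \<Rightarrow> ('l, 'm) module"
  where "left_part M = \<lparr>carrier = carrier M, monoid.mult = monoid.mult M, monoid.one = \<one>\<^bsub>M\<^esub>,
    ring.zero = \<zero>\<^bsub>M\<^esub>, ring.add = ring.add M, smult = lsmult M\<rparr>"

definition is_bimodule :: "'l ring \<Rightarrow> 'r ring \<Rightarrow> ('l, 'r, 'm) bimodule \<Rightarrow> bool"
  where "is_bimodule L R M \<longleftrightarrow>
    right_module R (right_part M) \<and> right_module (opposite L) (left_part M) \<and>
    (\<forall>l\<in>carrier L. \<forall>r\<in>carrier R. \<forall>x\<in>carrier M.
       r \<odot>\<^bsub>M\<^esub> lsmult M l x = lsmult M l (r \<odot>\<^bsub>M\<^esub> x))"

definition bimodule_isomorphic ::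
    "'l ring \<Rightarrow> 'r ring \<Rightarrow> ('l, 'r, 'm) bimodule \<Rightarrow> ('l, 'r, 'n) bimodule \<Rightarrow> bool"
  where "bimodule_isomorphic L R M N \<longleftrightarrow> (\<exists>f. bij_betw f (carrier M) (carrier N) \<and>
    f \<in> rmod_hom R (right_part M) (right_part N) \<and>
    f \<in> rmod_hom (opposite L) (left_part M) (left_part N))"

definition regular_bimodule :: "'a ring \<Rightarrow> ('a, 'a, 'a) bimodule"
  where "regular_bimodule R = \<lparr>carrier = carrier R, monoid.mult = monoid.mult R, monoid.one = \<one>\<^bsub>R\<^esub>,
    ring.zero = \<zero>\<^bsub>R\<^esub>, ring.add = ring.add R, smult = (\<lambda>r x. x \<otimes>\<^bsub>R\<^esub> r), lsmult = (\<lambda>r x. r \<otimes>\<^bsub>R\<^esub> x)\<rparr>"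

definition bimodule_sum ::
    "('l, 'r, 'm) bimodule \<Rightarrow> ('l, 'r, 'n) bimodule \<Rightarrow> ('l, 'r, 'm \<times> 'n) bimodule"
  where "bimodule_sum M N = \<lparr>carrier = carrier M \<times> carrier N,
    monoid.mult = undefined, monoid.one = undefined,
    ring.zero = (\<zero>\<^bsub>M\<^esub>, \<zero>\<^bsub>N\<^esub>),
    ring.add = (\<lambda>(x, y) (x', y'). (x \<oplus>\<^bsub>M\<^esub> x', y \<oplus>\<^bsub>N\<^esub> y')),
    smult = (\<lambda>r (x, y). (r \<odot>\<^bsub>M\<^esub> x, r \<odot>\<^bsub>N\<^esub> y)),
    lsmult = (\<lambda>l (x, y). (lsmult M l x, lsmult N l y))\<rparr>"

text \<open>
  The tensor product \<open>N \<otimes>\<^sub>A M\<close>: the free abelian group on \<open>N \<times> M\<close> modulo the subgroup generated by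
  the additivity and balancing relations, with the outer actions \<open>l (n \<otimes> m) r = l n \<otimes> m r\<close>.
\<close>

definition tensor_relations ::
    "'a ring \<Rightarrow> ('l, 'a, 'n) bimodule \<Rightarrow> ('a, 'r, 'm) bimodule \<Rightarrow> ('n \<times> 'm \<Rightarrow>\<^sub>0 int) set"
  where "tensor_relations A N M =
    {frag_of (n \<oplus>\<^bsub>N\<^esub> n', m) - frag_of (n, m) - frag_of (n', m) | n n' m.
       n \<in> carrier N \<and> n' \<in> carrier N \<and> m \<in> carrier M} \<union>
    {frag_of (n, m \<oplus>\<^bsub>M\<^esub> m') - frag_of (n, m) - frag_of (n, m') | n m m'.
       n \<in> carrier N \<and> m \<in> carrier M \<and> m' \<in> carrier M} \<union>
    {frag_of (a \<odot>\<^bsub>N\<^esub> n, m) - frag_of (n, lsmult M a m) | a n m.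
       a \<in> carrier A \<and> n \<in> carrier N \<and> m \<in> carrier M}"

definition tensor_kernel ::
    "'a ring \<Rightarrow> ('l, 'a, 'n) bimodule \<Rightarrow> ('a, 'r, 'm) bimodule \<Rightarrow> ('n \<times> 'm \<Rightarrow>\<^sub>0 int) set"
  where "tensor_kernel A N M =
    generate (free_Abelian_group (carrier N \<times> carrier M)) (tensor_relations A N M)"

definition tensor_class ::
    "'a ring \<Rightarrow> ('l, 'a, 'n) bimodule \<Rightarrow> ('a, 'r, 'm) bimodule \<Rightarrow>
      ('n \<times> 'm \<Rightarrow>\<^sub>0 int) \<Rightarrow> ('n \<times> 'm \<Rightarrow>\<^sub>0 int) set"
  where "tensor_class A N M t =
    tensor_kernel A N M #>\<^bsub>free_Abelian_group (carrier N \<times> carrier M)\<^esub> t"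

definition tensor ::
    "'a ring \<Rightarrow> ('l, 'a, 'n) bimodule \<Rightarrow> ('a, 'r, 'm) bimodule \<Rightarrow>
      ('l, 'r, ('n \<times> 'm \<Rightarrow>\<^sub>0 int) set) bimodule"
  where "tensor A N M =
    (let F = free_Abelian_group (carrier N \<times> carrier M); Q = F Mod tensor_kernel A N M in
     \<lparr>carrier = carrier Q, monoid.mult = undefined, monoid.one = undefined,
      ring.zero = \<one>\<^bsub>Q\<^esub>, ring.add = monoid.mult Q,
      smult = (\<lambda>r c. \<Union>t\<in>c. tensor_class A N M (frag_extend (\<lambda>(n, m). frag_of (n, r \<odot>\<^bsub>M\<^esub> m)) t)),
      lsmult = (\<lambda>l c. \<Union>t\<in>c. tensor_class A N M (frag_extend (\<lambda>(n, m). frag_of (lsmult N l n, m)) t))\<rparr>)"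

text \<open>\<open>separably_divides B A M N\<close>: the ring \<open>B\<close> separably divides \<open>A\<close> via \<open>\<^sub>AM\<^sub>B\<close> and \<open>\<^sub>BN\<^sub>A\<close>.\<close>

definition separably_divides ::
    "'u ring \<Rightarrow> 'u ring \<Rightarrow> ('u, 'u, 'u) bimodule \<Rightarrow> ('u, 'u, 'u) bimodule \<Rightarrow> bool"
  where "separably_divides B A M N \<longleftrightarrow>
    is_bimodule A B M \<and> is_bimodule B A N \<and>
    finitely_generated (opposite A) (left_part M) \<and> projective_module (opposite A) (left_part M) \<and>
    finitely_generated B (right_part M) \<and> projective_module B (right_part M) \<and>
    finitely_generated (opposite B) (left_part N) \<and> projective_module (opposite B) (left_part N) \<and>
    finitely_generated A (right_part N) \<and> projective_module A (right_part N) \<and>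
    (\<exists>Y :: ('u, 'u, 'u) bimodule. is_bimodule B B Y \<and> small (carrier Y) \<and>
       bimodule_isomorphic B B (tensor A N M) (bimodule_sum (regular_bimodule B) Y))"

definition separably_equivalent :: "'u ring \<Rightarrow> 'u ring \<Rightarrow> bool"
  where "separably_equivalent A B \<longleftrightarrow>
    (\<exists>M N. separably_divides A B N M \<and> separably_divides B A M N)"


section \<open>Cochain complexes\<close>

record 'u cochain =
  obj :: "int \<Rightarrow> ('u, 'u) module"
  dif :: "int \<Rightarrow> 'u \<Rightarrow> 'u"

type_synonym 'u cmap = "int \<Rightarrow> 'u \<Rightarrow> 'u"

definition complexes :: "'u ring \<Rightarrow> 'u cochain set"
  where "complexes A = {X. \<forall>n. obj X n \<in> modules A \<and>
    dif X n \<in> rmod_hom A (obj X n) (obj X (n + 1)) \<and>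
    (\<forall>x\<in>carrier (obj X n). dif X (n + 1) (dif X n x) = \<zero>\<^bsub>obj X (n + 1 + 1)\<^esub>)}"

definition chain_maps :: "'u ring \<Rightarrow> 'u cochain \<Rightarrow> 'u cochain \<Rightarrow> 'u cmap set"
  where "chain_maps A X Y = {f. \<forall>n. f n \<in> rmod_hom A (obj X n) (obj Y n) \<and>
    (\<forall>x\<in>carrier (obj X n). f (n + 1) (dif X n x) = dif Y n (f n x))}"

definition cid :: "'u cmap"
  where "cid = (\<lambda>n x. x)"

definition ccomp :: "'u cmap \<Rightarrow> 'u cmap \<Rightarrow> 'u cmap"  (infixl "\<circ>\<^sub>c" 55)
  where "g \<circ>\<^sub>c f = (\<lambda>n x. g n (f n x))"

definition homotopic ::
    "'u ring \<Rightarrow> 'u cochain \<Rightarrow> 'u cochain \<Rightarrow> 'u cmap \<Rightarrow> 'u cmap \<Rightarrow> bool"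
  where "homotopic A X Y f g \<longleftrightarrow>
    (\<exists>h. \<forall>n. h n \<in> rmod_hom A (obj X n) (obj Y (n - 1)) \<and>
      (\<forall>x\<in>carrier (obj X n).
         f n x = g n x \<oplus>\<^bsub>obj Y n\<^esub> (dif Y (n - 1) (h n x) \<oplus>\<^bsub>obj Y n\<^esub> h (n + 1) (dif X n x))))"

definition cocycles :: "'u cochain \<Rightarrow> int \<Rightarrow> 'u set"
  where "cocycles X n = {x \<in> carrier (obj X n). dif X n x = \<zero>\<^bsub>obj X (n + 1)\<^esub>}"

definition coboundaries :: "'u cochain \<Rightarrow> int \<Rightarrow> 'u set"
  where "coboundaries X n = dif X (n - 1) ` carrier (obj X (n - 1))"

definition cohomology :: "'u cochain \<Rightarrow> int \<Rightarrow> 'u set set"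
  where "cohomology X n = (\<lambda>z. coboundaries X n +>\<^bsub>obj X n\<^esub> z) ` cocycles X n"

definition cohomology_map :: "'u cochain \<Rightarrow> 'u cmap \<Rightarrow> int \<Rightarrow> 'u set \<Rightarrow> 'u set"
  where "cohomology_map Y f n c = (\<Union>z\<in>c. coboundaries Y n +>\<^bsub>obj Y n\<^esub> f n z)"

definition quasi_isos :: "'u ring \<Rightarrow> 'u cochain \<Rightarrow> 'u cochain \<Rightarrow> 'u cmap set"
  where "quasi_isos A X Y = {f \<in> chain_maps A X Y.
    \<forall>n. bij_betw (cohomology_map Y f n) (cohomology X n) (cohomology Y n)}"

text \<open>The shift \<open>X[1]\<close>, with differential \<open>-d\<close>.\<close>

definition shift :: "'u cochain \<Rightarrow> 'u cochain"
  where "shift X = \<lparr>obj = (\<lambda>n. obj X (n + 1)),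
    dif = (\<lambda>n x. \<ominus>\<^bsub>obj X (n + 1 + 1)\<^esub> dif X (n + 1) x)\<rparr>"

definition shift_map :: "'u cmap \<Rightarrow> 'u cmap"
  where "shift_map f = (\<lambda>n. f (n + 1))"

definition module_sum :: "('u, 'u) module \<Rightarrow> ('u, 'u) module \<Rightarrow> ('u, 'u) module"
  where "module_sum M N = \<lparr>carrier = enc ` (carrier M \<times> carrier N),
    monoid.mult = undefined, monoid.one = undefined,
    ring.zero = enc (\<zero>\<^bsub>M\<^esub>, \<zero>\<^bsub>N\<^esub>),
    ring.add = (\<lambda>u v. enc (fst (dec u) \<oplus>\<^bsub>M\<^esub> fst (dec v), snd (dec u) \<oplus>\<^bsub>N\<^esub> snd (dec v))),
    smult = (\<lambda>r u. enc (r \<odot>\<^bsub>M\<^esub> fst (dec u), r \<odot>\<^bsub>N\<^esub> snd (dec u)))\<rparr>"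

text \<open>
  The mapping cone of \<open>f : X \<rightarrow> Y\<close>: in degree \<open>n\<close> it is \<open>X\<^sup>n\<^sup>+\<^sup>1 \<oplus> Y\<^sup>n\<close> with
  \<open>d (x, y) = (- d x, f x + d y)\<close>.
\<close>

definition cone :: "'u cochain \<Rightarrow> 'u cochain \<Rightarrow> 'u cmap \<Rightarrow> 'u cochain"
  where "cone X Y f = \<lparr>obj = (\<lambda>n. module_sum (obj X (n + 1)) (obj Y n)),
    dif = (\<lambda>n u. enc (\<ominus>\<^bsub>obj X (n + 1 + 1)\<^esub> dif X (n + 1) (fst (dec u)),
                      f (n + 1) (fst (dec u)) \<oplus>\<^bsub>obj Y (n + 1)\<^esub> dif Y n (snd (dec u))))\<rparr>"

definition cone_in :: "'u cochain \<Rightarrow> 'u cmap"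
  where "cone_in X = (\<lambda>n y. enc (\<zero>\<^bsub>obj X (n + 1)\<^esub>, y))"

definition cone_out :: "'u cmap"
  where "cone_out = (\<lambda>n u. fst (dec u))"

definition stalk :: "('u, 'u) module \<Rightarrow> 'u cochain"
  where "stalk M = \<lparr>obj = (\<lambda>n. if n = 0 then M else M\<lparr>carrier := {\<zero>\<^bsub>M\<^esub>}\<rparr>), dif = (\<lambda>n x. \<zero>\<^bsub>M\<^esub>)\<rparr>"


section \<open>The derived category\<close>

text \<open>
  The objects of \<open>\<D>(A)\<close> are the complexes in \<^term>\<open>complexes A\<close>. It is the localisation of the
  homotopy category at the quasi-isomorphisms: a morphism \<open>X \<rightarrow> Y\<close> is an equivalence class of roofs
  \<open>X \<leftarrow> Z \<rightarrow> Y\<close> whose left leg is a quasi-isomorphism.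
\<close>

type_synonym 'u roof = "'u cochain \<times> 'u cmap \<times> 'u cmap"

definition roofs :: "'u ring \<Rightarrow> 'u cochain \<Rightarrow> 'u cochain \<Rightarrow> 'u roof set"
  where "roofs A X Y = {(Z, s, f). Z \<in> complexes A \<and> s \<in> quasi_isos A Z X \<and> f \<in> chain_maps A Z Y}"

definition roof_rel :: "'u ring \<Rightarrow> 'u cochain \<Rightarrow> 'u cochain \<Rightarrow> ('u roof \<times> 'u roof) set"
  where "roof_rel A X Y = {((Z, s, f), (Z', s', f')).
    (Z, s, f) \<in> roofs A X Y \<and> (Z', s', f') \<in> roofs A X Y \<and>
    (\<exists>W\<in>complexes A. \<exists>a\<in>chain_maps A W Z. \<exists>b\<in>chain_maps A W Z'.
       s \<circ>\<^sub>c a \<in> quasi_isos A W X \<and>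
       homotopic A W X (s \<circ>\<^sub>c a) (s' \<circ>\<^sub>c b) \<and> homotopic A W Y (f \<circ>\<^sub>c a) (f' \<circ>\<^sub>c b))}"

type_synonym 'u dmor = "'u roof set"

definition D_hom :: "'u ring \<Rightarrow> 'u cochain \<Rightarrow> 'u cochain \<Rightarrow> 'u dmor set"
  where "D_hom A X Y = roofs A X Y // roof_rel A X Y"

definition D_map :: "'u ring \<Rightarrow> 'u cochain \<Rightarrow> 'u cochain \<Rightarrow> 'u cmap \<Rightarrow> 'u dmor"
  where "D_map A X Y f = roof_rel A X Y `` {(X, cid, f)}"

definition D_id :: "'u ring \<Rightarrow> 'u cochain \<Rightarrow> 'u dmor"
  where "D_id A X = D_map A X X cid"

text \<open>
  \<open>D_comp A X Y V \<beta> \<alpha>\<close> is the composite of \<open>\<alpha> : X \<rightarrow> Y\<close> and \<open>\<beta> : Y \<rightarrow> V\<close>: the class of any roof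
  \<open>X \<leftarrow> Z \<leftarrow> P \<rightarrow> W \<rightarrow> V\<close> obtained by completing \<open>Z \<rightarrow> Y \<leftarrow> W\<close> to a square commuting up to homotopy.
\<close>

definition D_comp ::
    "'u ring \<Rightarrow> 'u cochain \<Rightarrow> 'u cochain \<Rightarrow> 'u cochain \<Rightarrow> 'u dmor \<Rightarrow> 'u dmor \<Rightarrow> 'u dmor"
  where "D_comp A X Y V \<beta> \<alpha> =
    {r. \<exists>Z s f W t g P p q. (Z, s, f) \<in> \<alpha> \<and> (W, t, g) \<in> \<beta> \<and>
       P \<in> complexes A \<and> p \<in> quasi_isos A P Z \<and> q \<in> chain_maps A P W \<and>
       homotopic A P Y (f \<circ>\<^sub>c p) (t \<circ>\<^sub>c q) \<and> ((P, s \<circ>\<^sub>c p, g \<circ>\<^sub>c q), r) \<in> roof_rel A X V}"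

definition D_shift :: "'u ring \<Rightarrow> 'u cochain \<Rightarrow> 'u cochain \<Rightarrow> 'u dmor \<Rightarrow> 'u dmor"
  where "D_shift A X Y \<alpha> = {r. \<exists>Z s f. (Z, s, f) \<in> \<alpha> \<and>
    ((shift Z, shift_map s, shift_map f), r) \<in> roof_rel A (shift X) (shift Y)}"

definition D_isos :: "'u ring \<Rightarrow> 'u cochain \<Rightarrow> 'u cochain \<Rightarrow> 'u dmor set"
  where "D_isos A X Y = {\<alpha> \<in> D_hom A X Y. \<exists>\<beta>\<in>D_hom A Y X.
    D_comp A X Y X \<beta> \<alpha> = D_id A X \<and> D_comp A Y X Y \<alpha> \<beta> = D_id A Y}"

text \<open>
  Distinguished triangles \<open>X \<rightarrow> Y \<rightarrow> Z \<rightarrow> X[1]\<close>: those isomorphic in \<open>\<D>(A)\<close> to a standard triangle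
  \<open>X' \<rightarrow> Y' \<rightarrow> cone f \<rightarrow> X'[1]\<close>.
\<close>

definition distinguished_triangle ::
    "'u ring \<Rightarrow> 'u cochain \<Rightarrow> 'u cochain \<Rightarrow> 'u cochain \<Rightarrow> 'u dmor \<Rightarrow> 'u dmor \<Rightarrow> 'u dmor \<Rightarrow> bool"
  where "distinguished_triangle A X Y Z u v w \<longleftrightarrow>
    X \<in> complexes A \<and> Y \<in> complexes A \<and> Z \<in> complexes A \<and>
    u \<in> D_hom A X Y \<and> v \<in> D_hom A Y Z \<and> w \<in> D_hom A Z (shift X) \<and>
    (\<exists>X'\<in>complexes A. \<exists>Y'\<in>complexes A. \<exists>f\<in>chain_maps A X' Y'.
      \<exists>a\<in>D_isos A X X'. \<exists>b\<in>D_isos A Y Y'. \<exists>c\<in>D_isos A Z (cone X' Y' f).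
        D_comp A X Y Y' b u = D_comp A X X' Y' (D_map A X' Y' f) a \<and>
        D_comp A Y Z (cone X' Y' f) c v =
          D_comp A Y Y' (cone X' Y' f) (D_map A Y' (cone X' Y' f) (cone_in X')) b \<and>
        D_comp A Z (shift X) (shift X') (D_shift A X X' a) w =
          D_comp A Z (cone X' Y' f) (shift X') (D_map A (cone X' Y' f) (shift X') cone_out) c)"

definition is_coproduct ::
    "'u ring \<Rightarrow> 'u set \<Rightarrow> ('u \<Rightarrow> 'u cochain) \<Rightarrow> 'u cochain \<Rightarrow> ('u \<Rightarrow> 'u dmor) \<Rightarrow> bool"
  where "is_coproduct A I X C \<iota> \<longleftrightarrow>
    C \<in> complexes A \<and> (\<forall>i\<in>I. \<iota> i \<in> D_hom A (X i) C) \<and>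
    (\<forall>Y\<in>complexes A. \<forall>\<phi>. (\<forall>i\<in>I. \<phi> i \<in> D_hom A (X i) Y) \<longrightarrow>
      (\<exists>!\<psi>. \<psi> \<in> D_hom A C Y \<and> (\<forall>i\<in>I. D_comp A (X i) C Y \<psi> (\<iota> i) = \<phi> i)))"

definition is_product ::
    "'u ring \<Rightarrow> 'u set \<Rightarrow> ('u \<Rightarrow> 'u cochain) \<Rightarrow> 'u cochain \<Rightarrow> ('u \<Rightarrow> 'u dmor) \<Rightarrow> bool"
  where "is_product A I X P \<pi> \<longleftrightarrow>
    P \<in> complexes A \<and> (\<forall>i\<in>I. \<pi> i \<in> D_hom A P (X i)) \<and>
    (\<forall>Y\<in>complexes A. \<forall>\<phi>. (\<forall>i\<in>I. \<phi> i \<in> D_hom A Y (X i)) \<longrightarrow>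
      (\<exists>!\<psi>. \<psi> \<in> D_hom A Y P \<and> (\<forall>i\<in>I. D_comp A Y P (X i) (\<pi> i) \<psi> = \<phi> i)))"


section \<open>Localising and colocalising subcategories\<close>

text \<open>Full subcategories of \<open>\<D>(A)\<close> are identified with their sets of objects.\<close>

definition triangulated_subcategory :: "'u ring \<Rightarrow> 'u cochain set \<Rightarrow> bool"
  where "triangulated_subcategory A S \<longleftrightarrow>
    S \<subseteq> complexes A \<and> S \<noteq> {} \<and>
    (\<forall>X\<in>S. \<forall>Y\<in>complexes A. D_isos A X Y \<noteq> {} \<longrightarrow> Y \<in> S) \<and>
    (\<forall>X\<in>complexes A. X \<in> S \<longleftrightarrow> shift X \<in> S) \<and>
    (\<forall>X Y Z u v w. distinguished_triangle A X Y Z u v w \<and> X \<in> S \<and> Y \<in> S \<longrightarrow> Z \<in> S)"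

definition localising_subcategory :: "'u ring \<Rightarrow> 'u cochain set \<Rightarrow> bool"
  where "localising_subcategory A S \<longleftrightarrow> triangulated_subcategory A S \<and>
    (\<forall>I X C \<iota>. small I \<and> (\<forall>i\<in>I. X i \<in> S) \<and> is_coproduct A I X C \<iota> \<longrightarrow> C \<in> S)"

definition colocalising_subcategory :: "'u ring \<Rightarrow> 'u cochain set \<Rightarrow> bool"
  where "colocalising_subcategory A S \<longleftrightarrow> triangulated_subcategory A S \<and>
    (\<forall>I X P \<pi>. small I \<and> (\<forall>i\<in>I. X i \<in> S) \<and> is_product A I X P \<pi> \<longrightarrow> P \<in> S)"

definition injectives_generate :: "'u ring \<Rightarrow> bool"
  where "injectives_generate A \<longleftrightarrow>
    \<Inter>{S. localising_subcategory A S \<and> stalk ` {J. injective_module A J} \<subseteq> S} = complexes A"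

definition projectives_cogenerate :: "'u ring \<Rightarrow> bool"
  where "projectives_cogenerate A \<longleftrightarrow>
    \<Inter>{S. colocalising_subcategory A S \<and> stalk ` {P. projective_module A P} \<subseteq> S} = complexes A"

end

theory Submission
  imports Defs
begin

text \<open>
  For an \<open>(L, R)\<close>-bimodule \<open>Q\<close> that is finitely generated projective over \<open>R\<close>, the functor \<open>Hom\<^sub>R(Q, -)\<close> is exact and
  commutes with products and coproducts, so preimages of (co)localising subcategories under it are again
  (co)localising. Since \<open>N \<otimes>\<^sub>A M\<close> has \<open>B\<close> as a bimodule summand, every complex \<open>X\<close> over \<open>B\<close> is a retract of
  \<open>Hom\<^sub>A(N, Hom\<^sub>B(M, X))\<close>, and (co)localising subcategories are closed under retracts. As \<open>Hom\<^sub>A(N, -)\<close> has an exact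
  left adjoint, it preserves injectives, which transfers generation from \<open>A\<close> to \<open>B\<close>. For projectives
  the same argument applies to the left adjoints: they are again Hom functors, namely those of the dual
  bimodules, and the retraction passes to them by taking mates.
\<close>

section \<open>Coding of functions in the universe\<close>

text \<open>All functors used are of the form Hom out of a bimodule. Their values consist of
  functions, which the coding of small functions turns into elements of \<open>'u\<close>. The
  tensor product, whose elements are sets of formal sums, enters only through the hypothesis, to
  provide a pairing and a central element. Tensoring with a finitely generated projective left
  module is replaced by Hom out of its dual, so that left adjoints are Hom functors as well. Finite
  dual bases make these functors exact and compatible with infinite direct sums already for
  complexes, and no resolutions occur. The obstacle is that triangles, products and coproducts are
  given in the derived category by roofs and universal properties: a calculus of fractions has to
  show that cones and termwise sums and products compute them. Closure under retracts is not part of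
  the definition of a (co)localising subcategory; it comes from a countable swindle that is the same
  for sums and products. Each implication of the theorem comes from one separable division, and
  exchanging the two rings gives its converse.\<close>

lemma small_lepoll: "(X :: 'u set) \<lesssim> (Y :: 'u set) \<Longrightarrow> small Y \<Longrightarrow> small X"
  unfolding small_def by (rule lesspoll_trans1)

lemma small_mono: "small (Y :: 'u set) \<Longrightarrow> X \<subseteq> Y \<Longrightarrow> small X"
  by (rule small_lepoll[OF subset_imp_lepoll])

lemma small_image: "small (X :: 'u set) \<Longrightarrow> small (f ` X :: 'u set)"
  by (rule small_lepoll[OF image_lepoll])

locale universe =
  fixes u :: "'u itself"
  assumes universe: "grothendieck_universe TYPE('u)"
begin

lemma small_UN: "small I \<Longrightarrow> (\<And>i. i \<in> I \<Longrightarrow> small (X i)) \<Longrightarrow> small (\<Union>i\<in>(I :: 'u set). (X i :: 'u set))"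
  using universe unfolding grothendieck_universe_def by blast

lemma Pow_lesspoll: "small (X :: 'u set) \<Longrightarrow> Pow X \<prec> (UNIV :: 'u set)"
  using universe unfolding grothendieck_universe_def by blast

lemma infinite_UNIV: "infinite (UNIV :: 'u set)"
  using universe by (auto simp: grothendieck_universe_def lesspoll_def infinite_le_lepoll)

lemma small_finite: "finite (X :: 'u set) \<Longrightarrow> small X"
  unfolding small_def using infinite_UNIV finite_lesspoll_infinite by blast

lemma small_Un:
  assumes "small X" "small (Y :: 'u set)"
  shows "small (X \<union> Y)"
proof -
  \<comment> \<open>\<open>small_UN\<close> takes index sets inside \<open>'u\<close>, so the binary
    union is indexed by two distinct points of the infinite type.\<close>
  obtain a b :: 'u where ab: "a \<noteq> b"
    using ex_new_if_finite[OF infinite_UNIV, of "{undefined}"] by auto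
  have "small (\<Union>i\<in>{a, b}. if i = a then X else Y)"
    by (rule small_UN) (auto simp: assms small_finite)
  moreover have "(\<Union>i\<in>{a, b}. if i = a then X else Y) = X \<union> Y" using ab by auto
  ultimately show ?thesis by simp
qed

text \<open>Uncountability of the universe makes countable index sets small. The countable power in
  \<open>locsub_retract\<close> is indexed by such a range.\<close>

lemma small_nat_image: "small (range (\<nu> :: nat \<Rightarrow> 'u))"
proof -
  have "(UNIV :: nat set) \<prec> (UNIV :: 'u set)"
    using universe unfolding grothendieck_universe_def by blast
  then show ?thesis unfolding small_def by (rule lesspoll_trans1[OF image_lepoll])
qed

lemma dec_enc [simp]: "dec (enc p) = (p :: 'u \<times> 'u)"
  unfolding dec_def by (rule inv_into_f_f) (use inj_enc[OF universe] in auto)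

lemma small_enc_Times: "small X \<Longrightarrow> small Y \<Longrightarrow> small (enc ` (X \<times> Y) :: 'u set)"
proof -
  assume "small X" "small Y"
  moreover have "enc ` (X \<times> Y) = (\<Union>x\<in>X. (\<lambda>y. enc (x, y)) ` Y)" by auto
  ultimately show ?thesis by (auto intro!: small_UN small_image)
qed

text \<open>A small set is bounded for a well-order of minimal type by regularity, and there are as many
  bounded sets as points because the universe is a strong limit.\<close>

lemma ex_small_set_code: "\<exists>c :: 'u set \<Rightarrow> 'u. inj_on c {X. small X}"
proof -
  define r where "r = |UNIV :: 'u set|"
  have C: "Card_order r" unfolding r_def by (rule card_of_Card_order)
  have wo: "Well_order r" and F: "Field r = UNIV"
    using C unfolding r_def by (auto simp: card_order_on_well_order_on)
  have total: "(a, b) \<in> r \<or> (b, a) \<in> r" for a b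
    using wo_rel.TOTALS[of r] wo F by (simp add: wo_rel_def)
  have under_small: "small (underS r a)" for a
  proof -
    have "|underS r a| <o r" by (rule card_of_underS[OF C]) (simp add: F)
    then have "|underS r a| <o |UNIV :: 'u set|" by (simp add: r_def)
    then show ?thesis unfolding small_def lesspoll_def eqpoll_iff_card_of_ordIso
      by (auto intro: subset_imp_lepoll dest: not_ordLess_ordIso)
  qed
  have bounded: "\<exists>a. X \<subseteq> underS r a" if "small X" for X
  proof (rule ccontr)
    assume *: "\<nexists>a. X \<subseteq> underS r a"
    \<comment> \<open>If X has no bound, the initial segments up to its points cover the universe.
      They are small and indexed by a small set, so regularity would make the universe itself
      small.\<close>
    have "UNIV \<subseteq> (\<Union>x\<in>X. insert x (underS r x))"
    proof
      fix a :: 'u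
      obtain x where x: "x \<in> X" "x \<notin> underS r a" using * by blast
      then have "(a, x) \<in> r" using total[of a x] by (auto simp: underS_def)
      then show "a \<in> (\<Union>x\<in>X. insert x (underS r x))" using x by (auto simp: underS_def)
    qed
    moreover have "small (\<Union>x\<in>X. insert x (underS r x))"
    proof (rule small_UN[OF that])
      fix x
      show "small (insert x (underS r x))"
        using small_Un[OF small_finite[of "{x}"] under_small[of x]] by simp
    qed
    ultimately have "small (UNIV :: 'u set)" by (rule small_mono[rotated])
    then show False by (simp add: small_def)
  qed
  define b where "b X = (SOME a. X \<subseteq> underS r a)" for X
  have b: "X \<subseteq> underS r (b X)" if "small X" for X
    unfolding b_def by (rule someI_ex) (rule bounded[OF that])
  have "\<exists>g :: 'u set \<Rightarrow> 'u. inj_on g (Pow (underS r a))" for a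
    using Pow_lesspoll[OF under_small[of a]] unfolding lesspoll_def lepoll_def by blast
  then obtain g :: "'u \<Rightarrow> 'u set \<Rightarrow> 'u" where g: "inj_on (g a) (Pow (underS r a))" for a by metis
  \<comment> \<open>A small set is coded by a bound together with its code among the subsets of the
    initial segment below that bound. The first component tells which of the codings
    \<open>g a\<close> was used.\<close>
  have "inj_on (\<lambda>X. enc (b X, g (b X) X)) {X. small X}"
  proof (rule inj_onI, goal_cases)
    case (1 X Y)
    then have "(b X, g (b X) X) = (b Y, g (b Y) Y)"
      using inj_enc[OF universe] by (auto dest: injD)
    then show ?case using b[of X] b[of Y] g[of "b X"] 1 by (auto dest: inj_onD)
  qed
  then show ?thesis by blast
qed

end

text \<open>Products and Hom modules consist of functions, but a module has to be carried by a
  subset of \<open>'u\<close>. \<open>pk\<close> packs a function into one element of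
  \<open>'u\<close>. The value \<open>undefined\<close> stands for absence from the domain, so every
  extensional function on a small set can be packed and recovered.\<close>

definition pk :: "('u \<Rightarrow> 'u) \<Rightarrow> 'u"
  where "pk = (SOME p. inj_on p {f. small {i. f i \<noteq> undefined}})"

definition up :: "'u \<Rightarrow> 'u \<Rightarrow> 'u"
  where "up = inv_into {f. small {i. f i \<noteq> undefined}} pk"

context universe begin

text \<open>A function is recovered from its graph over the points where it differs from
  \<open>undefined\<close>. This graph is a small set, and small sets have codes by
  \<open>ex_small_set_code\<close>.\<close>

lemma inj_pk: "inj_on pk {f :: 'u \<Rightarrow> 'u. small {i. f i \<noteq> undefined}}"
proof -
  obtain c :: "'u set \<Rightarrow> 'u" where c: "inj_on c {X. small X}" using ex_small_set_code by blast
  define gr :: "('u \<Rightarrow> 'u) \<Rightarrow> 'u set" where "gr f = (\<lambda>i. enc (i, f i)) ` {i. f i \<noteq> undefined}" for f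
  have "inj_on (\<lambda>f. c (gr f)) {f. small {i. f i \<noteq> undefined}}"
  proof (rule inj_onI, goal_cases)
    case (1 f f')
    then have "gr f = gr f'" using c by (auto simp: gr_def intro: small_image dest!: inj_onD)
    have *: "h' i = h i" if "gr h = gr h'" "h i \<noteq> undefined" for h h' i
    proof -
      have "enc (i, h i) \<in> gr h'" using that unfolding gr_def by blast
      then obtain j where "enc (i, h i) = enc (j, h' j)" unfolding gr_def by blast
      then have "(i, h i) = (j, h' j)" by (metis dec_enc)
      then show ?thesis by auto
    qed
    show ?case by (rule ext) (metis * \<open>gr f = gr f'\<close>)
  qed
  then show ?thesis unfolding pk_def by (rule someI[where P = "\<lambda>p. inj_on p _"])
qed

lemma up_pk_ext: "small I \<Longrightarrow> f \<in> extensional I \<Longrightarrow> up (pk f) = (f :: 'u \<Rightarrow> 'u)"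
  unfolding up_def by (rule inv_into_f_f[OF inj_pk])
    (auto simp: extensional_def intro: small_mono)

lemma up_pk [simp]: "small I \<Longrightarrow> up (pk (restrict f I)) = (restrict f I :: 'u \<Rightarrow> 'u)"
  by (rule up_pk_ext) auto

text \<open>A member of the product is determined by its graph, a subset of one small set of pairs;
  the strong limit property bounds the number of such subsets.\<close>

lemma small_pk_PiE:
  fixes I :: "'u set"
  assumes "small I" "\<And>i. i \<in> I \<Longrightarrow> small (X i :: 'u set)"
  shows "small (pk ` PiE I X)"
proof -
  have s: "small (enc ` (I \<times> (\<Union>i\<in>I. X i)))"
    by (intro small_enc_Times small_UN assms)
  have "inj_on (\<lambda>f. (\<lambda>i. enc (i, f i)) ` I) (PiE I X)"
  proof (rule inj_onI, goal_cases)
    case (1 f g)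
    have "f i = g i" if "i \<in> I" for i
    proof -
      have "enc (i, f i) \<in> (\<lambda>i. enc (i, g i)) ` I" using 1(3) that by blast
      then show ?thesis by (metis (no_types, lifting) Pair_inject dec_enc imageE)
    qed
    then show ?case using 1 by (auto intro: PiE_ext)
  qed
  moreover have "(\<lambda>f. (\<lambda>i. enc (i, f i)) ` I) ` PiE I X \<subseteq> Pow (enc ` (I \<times> (\<Union>i\<in>I. X i)))"
    by (auto simp: PiE_iff)
  ultimately have "PiE I X \<lesssim> Pow (enc ` (I \<times> (\<Union>i\<in>I. X i)))"
    unfolding lepoll_def by blast
  then have "PiE I X \<prec> (UNIV :: 'u set)"
    using Pow_lesspoll[OF s] lesspoll_trans1 by blast
  then show ?thesis unfolding small_def by (rule lesspoll_trans1[OF image_lepoll])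
qed

end

section \<open>Modules, sums and products\<close>

lemma (in abelian_group) a_inv_zero: "\<ominus> \<zero> = \<zero>"
  using l_neg[of \<zero>] by simp

lemmas (in abelian_group) abelian_group_simprules = a_closed zero_closed a_inv_closed minus_closed
  a_assoc l_zero l_neg a_comm minus_eq r_zero r_neg r_neg2 r_neg1 minus_add minus_minus a_inv_zero
  a_lcomm

text \<open>Sets up the method \<open>algebra\<close> for additive groups. Identities between sums,
  differences and negatives are then normalised from an \<open>abelian_group\<close> fact and the
  membership facts among the premises.\<close>

lemmas abelian_group_normalization
  [algebra abelian_group "ring.zero" "ring.add" "a_inv" "a_minus"] = abelian_group.abelian_group_simprules

text \<open>Jointly injective additive coordinates \<open>p i\<close> into abelian groups reflect
  all group laws. Binary sums, products, direct sums and Hom modules all arise this way, with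
  evaluation at a point as coordinate in the last case.\<close>

lemma abelian_groupI_coords:
  assumes X: "\<And>i. i \<in> I \<Longrightarrow> abelian_group (X i)"
    and add: "\<And>u v. u \<in> carrier M \<Longrightarrow> v \<in> carrier M \<Longrightarrow> u \<oplus>\<^bsub>M\<^esub> v \<in> carrier M"
    and zero: "\<zero>\<^bsub>M\<^esub> \<in> carrier M"
    and neg: "\<And>u. u \<in> carrier M \<Longrightarrow> \<exists>v\<in>carrier M. \<forall>i\<in>I. p i v = \<ominus>\<^bsub>X i\<^esub> p i u"
    and p: "\<And>u i. u \<in> carrier M \<Longrightarrow> i \<in> I \<Longrightarrow> p i u \<in> carrier (X i)"
    and p_add: "\<And>u v i. u \<in> carrier M \<Longrightarrow> v \<in> carrier M \<Longrightarrow> i \<in> I \<Longrightarrow>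
      p i (u \<oplus>\<^bsub>M\<^esub> v) = p i u \<oplus>\<^bsub>X i\<^esub> p i v"
    and p_zero: "\<And>i. i \<in> I \<Longrightarrow> p i \<zero>\<^bsub>M\<^esub> = \<zero>\<^bsub>X i\<^esub>"
    and ext: "\<And>u v. u \<in> carrier M \<Longrightarrow> v \<in> carrier M \<Longrightarrow> (\<And>i. i \<in> I \<Longrightarrow> p i u = p i v) \<Longrightarrow> u = v"
  shows "abelian_group M"
proof (rule abelian_groupI)
  fix x assume x: "x \<in> carrier M"
  then obtain v where "v \<in> carrier M" "\<forall>i\<in>I. p i v = \<ominus>\<^bsub>X i\<^esub> p i x" using neg by blast
  then show "\<exists>y\<in>carrier M. y \<oplus>\<^bsub>M\<^esub> x = \<zero>\<^bsub>M\<^esub>"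
    using x by (intro bexI[of _ v] ext) (simp_all add: add zero p_add p_zero p X abelian_group.l_neg)
  show "\<zero>\<^bsub>M\<^esub> \<oplus>\<^bsub>M\<^esub> x = x"
    using x by (intro ext) (simp_all add: add zero p_add p_zero p X abelian_group.abelian_group_simprules)
next
  fix x y assume "x \<in> carrier M" "y \<in> carrier M"
  then show "x \<oplus>\<^bsub>M\<^esub> y = y \<oplus>\<^bsub>M\<^esub> x"
    by (intro ext) (simp_all add: add zero p_add p X abelian_group.abelian_group_simprules)
next
  fix x y z assume "x \<in> carrier M" "y \<in> carrier M" "z \<in> carrier M"
  then show "x \<oplus>\<^bsub>M\<^esub> y \<oplus>\<^bsub>M\<^esub> z = x \<oplus>\<^bsub>M\<^esub> (y \<oplus>\<^bsub>M\<^esub> z)"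
    by (intro ext) (simp_all add: add zero p_add p X abelian_group.abelian_group_simprules)
qed (use add zero in auto)

lemma (in abelian_group) a_inv_unique: "x \<in> carrier G \<Longrightarrow> y \<in> carrier G \<Longrightarrow> x \<oplus> y = \<zero> \<Longrightarrow> y = \<ominus> x"
  using minus_equality a_comm by metis

lemma rmod_homI:
  assumes "\<And>x. x \<in> carrier M \<Longrightarrow> f x \<in> carrier N"
    and "\<And>x y. x \<in> carrier M \<Longrightarrow> y \<in> carrier M \<Longrightarrow> f (x \<oplus>\<^bsub>M\<^esub> y) = f x \<oplus>\<^bsub>N\<^esub> f y"
    and "\<And>r x. r \<in> carrier R \<Longrightarrow> x \<in> carrier M \<Longrightarrow> f (r \<odot>\<^bsub>M\<^esub> x) = r \<odot>\<^bsub>N\<^esub> f x"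
  shows "f \<in> rmod_hom R M N"
  using assms by (auto simp: rmod_hom_def)

lemma
  assumes "f \<in> rmod_hom R M N"
  shows hom_closed: "x \<in> carrier M \<Longrightarrow> f x \<in> carrier N"
    and hom_add: "x \<in> carrier M \<Longrightarrow> y \<in> carrier M \<Longrightarrow> f (x \<oplus>\<^bsub>M\<^esub> y) = f x \<oplus>\<^bsub>N\<^esub> f y"
    and hom_smult: "r \<in> carrier R \<Longrightarrow> x \<in> carrier M \<Longrightarrow> f (r \<odot>\<^bsub>M\<^esub> x) = r \<odot>\<^bsub>N\<^esub> f x"
  using assms by (auto simp: rmod_hom_def)

lemma hom_id: "(\<lambda>x. x) \<in> rmod_hom R M M"
  by (rule rmod_homI) auto

lemma hom_comp: "f \<in> rmod_hom R L M \<Longrightarrow> g \<in> rmod_hom R M N \<Longrightarrow> (\<lambda>x. g (f x)) \<in> rmod_hom R L N"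
  by (rule rmod_homI) (simp_all add: hom_closed hom_add hom_smult)

lemma
  assumes f: "f \<in> rmod_hom R M N" and M: "abelian_group M" and N: "abelian_group N"
  shows hom_zero: "f \<zero>\<^bsub>M\<^esub> = \<zero>\<^bsub>N\<^esub>"
    and hom_a_inv: "x \<in> carrier M \<Longrightarrow> f (\<ominus>\<^bsub>M\<^esub> x) = \<ominus>\<^bsub>N\<^esub> f x"
    and hom_minus: "x \<in> carrier M \<Longrightarrow> y \<in> carrier M \<Longrightarrow> f (x \<ominus>\<^bsub>M\<^esub> y) = f x \<ominus>\<^bsub>N\<^esub> f y"
proof -
  interpret M: abelian_group M by fact
  interpret N: abelian_group N by fact
  have "f \<zero>\<^bsub>M\<^esub> \<oplus>\<^bsub>N\<^esub> f \<zero>\<^bsub>M\<^esub> = f \<zero>\<^bsub>M\<^esub>" using hom_add[OF f, of "\<zero>\<^bsub>M\<^esub>" "\<zero>\<^bsub>M\<^esub>"] by simp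
  moreover have "f \<zero>\<^bsub>M\<^esub> \<in> carrier N" by (rule hom_closed[OF f]) simp
  ultimately show z: "f \<zero>\<^bsub>M\<^esub> = \<zero>\<^bsub>N\<^esub>"
    by (metis N.add.l_cancel_one')
  show *: "f (\<ominus>\<^bsub>M\<^esub> x) = \<ominus>\<^bsub>N\<^esub> f x" if "x \<in> carrier M" for x
    using that by (intro N.a_inv_unique) (simp_all add: hom_closed[OF f] hom_add[OF f, symmetric] z M.r_neg)
  show "x \<in> carrier M \<Longrightarrow> y \<in> carrier M \<Longrightarrow> f (x \<ominus>\<^bsub>M\<^esub> y) = f x \<ominus>\<^bsub>N\<^esub> f y"
    by (simp add: M.minus_eq N.minus_eq hom_add[OF f] *)
qed

locale ring_universe = universe "TYPE('u)" for A :: "'u ring" +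
  assumes ring_A: "ring A" and small_A: "small (carrier A)"
begin

lemma
  assumes "M \<in> modules A"
  shows mod_group: "abelian_group M"
    and mod_small: "small (carrier M)"
    and mod_right: "right_module A M"
  using assms by (auto simp: modules_def right_module_def)

lemma
  assumes "M \<in> modules A"
  shows mod_smult: "r \<in> carrier A \<Longrightarrow> x \<in> carrier M \<Longrightarrow> r \<odot>\<^bsub>M\<^esub> x \<in> carrier M"
    and mod_add: "x \<in> carrier M \<Longrightarrow> y \<in> carrier M \<Longrightarrow> x \<oplus>\<^bsub>M\<^esub> y \<in> carrier M"
    and mod_minus: "x \<in> carrier M \<Longrightarrow> y \<in> carrier M \<Longrightarrow> x \<ominus>\<^bsub>M\<^esub> y \<in> carrier M"
    and mod_inv: "x \<in> carrier M \<Longrightarrow> \<ominus>\<^bsub>M\<^esub> x \<in> carrier M"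
    and mod_zero: "\<zero>\<^bsub>M\<^esub> \<in> carrier M"
    and mod_smult_l: "r \<in> carrier A \<Longrightarrow> s \<in> carrier A \<Longrightarrow> x \<in> carrier M \<Longrightarrow>
        (r \<oplus>\<^bsub>A\<^esub> s) \<odot>\<^bsub>M\<^esub> x = (r \<odot>\<^bsub>M\<^esub> x) \<oplus>\<^bsub>M\<^esub> (s \<odot>\<^bsub>M\<^esub> x)"
    and mod_smult_r: "r \<in> carrier A \<Longrightarrow> x \<in> carrier M \<Longrightarrow> y \<in> carrier M \<Longrightarrow>
        r \<odot>\<^bsub>M\<^esub> (x \<oplus>\<^bsub>M\<^esub> y) = (r \<odot>\<^bsub>M\<^esub> x) \<oplus>\<^bsub>M\<^esub> (r \<odot>\<^bsub>M\<^esub> y)"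
    and mod_smult_assoc: "r \<in> carrier A \<Longrightarrow> s \<in> carrier A \<Longrightarrow> x \<in> carrier M \<Longrightarrow>
        (r \<otimes>\<^bsub>A\<^esub> s) \<odot>\<^bsub>M\<^esub> x = s \<odot>\<^bsub>M\<^esub> (r \<odot>\<^bsub>M\<^esub> x)"
    and mod_one: "x \<in> carrier M \<Longrightarrow> \<one>\<^bsub>A\<^esub> \<odot>\<^bsub>M\<^esub> x = x"
proof -
  interpret right_module A M using mod_right[OF assms] .
  show "r \<in> carrier A \<Longrightarrow> x \<in> carrier M \<Longrightarrow> r \<odot>\<^bsub>M\<^esub> x \<in> carrier M"
    "x \<in> carrier M \<Longrightarrow> y \<in> carrier M \<Longrightarrow> x \<oplus>\<^bsub>M\<^esub> y \<in> carrier M"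
    "x \<in> carrier M \<Longrightarrow> y \<in> carrier M \<Longrightarrow> x \<ominus>\<^bsub>M\<^esub> y \<in> carrier M"
    "x \<in> carrier M \<Longrightarrow> \<ominus>\<^bsub>M\<^esub> x \<in> carrier M"
    "\<zero>\<^bsub>M\<^esub> \<in> carrier M"
    "x \<in> carrier M \<Longrightarrow> \<one>\<^bsub>A\<^esub> \<odot>\<^bsub>M\<^esub> x = x" by (auto intro: smult_closed smult_one)
qed (use mod_right[OF assms] in \<open>auto simp: right_module.smult_l_distr right_module.smult_r_distr right_module.smult_assoc\<close>)

lemma
  assumes "M \<in> modules A" "r \<in> carrier A"
  shows smult_zero: "r \<odot>\<^bsub>M\<^esub> \<zero>\<^bsub>M\<^esub> = \<zero>\<^bsub>M\<^esub>"
    and smult_a_inv: "x \<in> carrier M \<Longrightarrow> r \<odot>\<^bsub>M\<^esub> (\<ominus>\<^bsub>M\<^esub> x) = \<ominus>\<^bsub>M\<^esub> (r \<odot>\<^bsub>M\<^esub> x)"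
proof -
  \<comment> \<open>Over the ring with its carrier emptied, a homomorphism is just an additive map.
    Multiplication by r is additive, but over a noncommutative ring it need not commute with other
    scalars.\<close>
  have "(\<lambda>x. r \<odot>\<^bsub>M\<^esub> x) \<in> rmod_hom (A\<lparr>carrier := {}\<rparr>) M M"
    by (rule rmod_homI) (simp_all add: assms mod_smult mod_smult_r)
  from hom_zero[OF this] hom_a_inv[OF this]
  show "r \<odot>\<^bsub>M\<^esub> \<zero>\<^bsub>M\<^esub> = \<zero>\<^bsub>M\<^esub>" "x \<in> carrier M \<Longrightarrow> r \<odot>\<^bsub>M\<^esub> (\<ominus>\<^bsub>M\<^esub> x) = \<ominus>\<^bsub>M\<^esub> (r \<odot>\<^bsub>M\<^esub> x)"
    using mod_group[OF assms(1)] by auto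
qed

lemma modulesI:
  assumes "abelian_group M" "small (carrier M)"
    and "\<And>r x. r \<in> carrier A \<Longrightarrow> x \<in> carrier M \<Longrightarrow> r \<odot>\<^bsub>M\<^esub> x \<in> carrier M"
    and "\<And>r s x. r \<in> carrier A \<Longrightarrow> s \<in> carrier A \<Longrightarrow> x \<in> carrier M \<Longrightarrow>
        (r \<oplus>\<^bsub>A\<^esub> s) \<odot>\<^bsub>M\<^esub> x = (r \<odot>\<^bsub>M\<^esub> x) \<oplus>\<^bsub>M\<^esub> (s \<odot>\<^bsub>M\<^esub> x)"
    and "\<And>r x y. r \<in> carrier A \<Longrightarrow> x \<in> carrier M \<Longrightarrow> y \<in> carrier M \<Longrightarrow>
        r \<odot>\<^bsub>M\<^esub> (x \<oplus>\<^bsub>M\<^esub> y) = (r \<odot>\<^bsub>M\<^esub> x) \<oplus>\<^bsub>M\<^esub> (r \<odot>\<^bsub>M\<^esub> y)"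
    and "\<And>r s x. r \<in> carrier A \<Longrightarrow> s \<in> carrier A \<Longrightarrow> x \<in> carrier M \<Longrightarrow>
        (r \<otimes>\<^bsub>A\<^esub> s) \<odot>\<^bsub>M\<^esub> x = s \<odot>\<^bsub>M\<^esub> (r \<odot>\<^bsub>M\<^esub> x)"
    and "\<And>x. x \<in> carrier M \<Longrightarrow> \<one>\<^bsub>A\<^esub> \<odot>\<^bsub>M\<^esub> x = x"
  shows "M \<in> modules A"
  using assms ring_A by (simp add: modules_def right_module_def right_module_axioms_def)

text \<open>The counterpart of \<open>abelian_groupI_coords\<close> with scalars. It serves binary
  sums, with two coordinates, and products and direct sums, with coordinates in the index
  set.\<close>

lemma modulesI_coords:
  assumes X: "\<And>i. i \<in> I \<Longrightarrow> X i \<in> modules A" and "small (carrier M)"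
    and add: "\<And>u v. u \<in> carrier M \<Longrightarrow> v \<in> carrier M \<Longrightarrow> u \<oplus>\<^bsub>M\<^esub> v \<in> carrier M"
    and zero: "\<zero>\<^bsub>M\<^esub> \<in> carrier M"
    and neg: "\<And>u. u \<in> carrier M \<Longrightarrow> \<exists>v\<in>carrier M. \<forall>i\<in>I. p i v = \<ominus>\<^bsub>X i\<^esub> p i u"
    and smult: "\<And>r u. r \<in> carrier A \<Longrightarrow> u \<in> carrier M \<Longrightarrow> r \<odot>\<^bsub>M\<^esub> u \<in> carrier M"
    and p: "\<And>u i. u \<in> carrier M \<Longrightarrow> i \<in> I \<Longrightarrow> p i u \<in> carrier (X i)"
    and p_add: "\<And>u v i. u \<in> carrier M \<Longrightarrow> v \<in> carrier M \<Longrightarrow> i \<in> I \<Longrightarrow>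
      p i (u \<oplus>\<^bsub>M\<^esub> v) = p i u \<oplus>\<^bsub>X i\<^esub> p i v"
    and p_zero: "\<And>i. i \<in> I \<Longrightarrow> p i \<zero>\<^bsub>M\<^esub> = \<zero>\<^bsub>X i\<^esub>"
    and p_smult: "\<And>r u i. r \<in> carrier A \<Longrightarrow> u \<in> carrier M \<Longrightarrow> i \<in> I \<Longrightarrow> p i (r \<odot>\<^bsub>M\<^esub> u) = r \<odot>\<^bsub>X i\<^esub> p i u"
    and ext: "\<And>u v. u \<in> carrier M \<Longrightarrow> v \<in> carrier M \<Longrightarrow> (\<And>i. i \<in> I \<Longrightarrow> p i u = p i v) \<Longrightarrow> u = v"
  shows "M \<in> modules A"
proof (rule modulesI)
  interpret A: ring A by (rule ring_A)
  show "abelian_group M"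
    by (rule abelian_groupI_coords[where I = I and X = X and p = p])
      (use assms mod_group in auto)
qed (auto intro!: ext simp: assms mod_smult mod_smult_l mod_smult_r mod_smult_assoc mod_one
    ring.ring_simprules[OF ring_A])

lemma hom_const_zero:
  assumes "M \<in> modules A" "N \<in> modules A"
  shows "(\<lambda>x. \<zero>\<^bsub>N\<^esub>) \<in> rmod_hom A M N"
  by (rule rmod_homI)
    (use assms in \<open>auto simp: mod_zero smult_zero abelian_group.abelian_group_simprules[OF mod_group]\<close>)

lemma hom_sum:
  assumes "M \<in> modules A" "N \<in> modules A" "f \<in> rmod_hom A M N" "g \<in> rmod_hom A M N"
  shows "(\<lambda>x. f x \<oplus>\<^bsub>N\<^esub> g x) \<in> rmod_hom A M N"
proof (rule rmod_homI)
  fix x y assume "x \<in> carrier M" "y \<in> carrier M"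
  moreover note hom_closed[OF assms(3), OF this(1)] hom_closed[OF assms(3), OF this(2)]
    hom_closed[OF assms(4), OF this(1)] hom_closed[OF assms(4), OF this(2)] mod_group[OF assms(2)]
  ultimately show "f (x \<oplus>\<^bsub>M\<^esub> y) \<oplus>\<^bsub>N\<^esub> g (x \<oplus>\<^bsub>M\<^esub> y) = f x \<oplus>\<^bsub>N\<^esub> g x \<oplus>\<^bsub>N\<^esub> (f y \<oplus>\<^bsub>N\<^esub> g y)"
    unfolding hom_add[OF assms(3) \<open>x \<in> _\<close> \<open>y \<in> _\<close>] hom_add[OF assms(4) \<open>x \<in> _\<close> \<open>y \<in> _\<close>] by algebra
qed (use assms in \<open>auto simp: hom_closed mod_add hom_smult mod_smult_r\<close>)

lemma hom_neg:
  assumes "M \<in> modules A" "N \<in> modules A" "f \<in> rmod_hom A M N"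
  shows "(\<lambda>x. \<ominus>\<^bsub>N\<^esub> f x) \<in> rmod_hom A M N"
  by (rule rmod_homI)
    (use assms in \<open>auto simp: hom_closed[OF assms(3)] hom_add[OF assms(3)] hom_smult[OF assms(3)] mod_inv
      smult_a_inv abelian_group.minus_add[OF mod_group]\<close>)

lemma hom_diff:
  assumes "M \<in> modules A" "N \<in> modules A" "f \<in> rmod_hom A M N" "g \<in> rmod_hom A M N"
  shows "(\<lambda>x. f x \<ominus>\<^bsub>N\<^esub> g x) \<in> rmod_hom A M N"
  using hom_sum[OF assms(1-3) hom_neg[OF assms(1,2,4)]]
  by (simp add: abelian_group.minus_eq[OF mod_group[OF assms(2)]])

lemma dec_module_sum:
  shows "\<zero>\<^bsub>module_sum M N\<^esub> = enc (\<zero>\<^bsub>M\<^esub>, \<zero>\<^bsub>N\<^esub> :: 'u)"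
    and "u \<oplus>\<^bsub>module_sum M N\<^esub> v = enc (fst (dec u) \<oplus>\<^bsub>M\<^esub> fst (dec v), snd (dec u) \<oplus>\<^bsub>N\<^esub> snd (dec v))"
    and "r \<odot>\<^bsub>module_sum M N\<^esub> u = enc (r \<odot>\<^bsub>M\<^esub> fst (dec u), r \<odot>\<^bsub>N\<^esub> snd (dec u))"
    and "carrier (module_sum M N) = enc ` (carrier M \<times> carrier N)"
  by (simp_all add: module_sum_def)

lemma enc_in_module_sum: "enc (x, y) \<in> carrier (module_sum M N) \<longleftrightarrow> x \<in> carrier M \<and> (y :: 'u) \<in> carrier N"
  by (auto simp: dec_module_sum dest: injD[OF inj_enc[OF universe]])

lemma module_sum_cases:
  assumes "u \<in> carrier (module_sum M N)"
  obtains x y where "u = enc (x, y)" "x \<in> carrier M" "(y :: 'u) \<in> carrier N"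
  using assms by (auto simp: dec_module_sum)

lemma module_sum_modules:
  assumes M: "M \<in> modules A" and N: "N \<in> modules A"
  shows "module_sum M N \<in> modules A"
proof (rule modulesI_coords[where I = "UNIV :: bool set" and X = "\<lambda>b. if b then M else N"
      and p = "\<lambda>b u. if b then fst (dec u) else snd (dec u)"])
  show "small (carrier (module_sum M N))"
    using assms by (simp add: dec_module_sum small_enc_Times mod_small)
  fix u assume u: "u \<in> carrier (module_sum M N)"
  then obtain x y where [simp]: "u = enc (x, y)" and "x \<in> carrier M" "y \<in> carrier N"
    by (rule module_sum_cases)
  then show "\<exists>v\<in>carrier (module_sum M N). \<forall>b\<in>UNIV. (if b then fst (dec v) else snd (dec v)) =
     \<ominus>\<^bsub>if b then M else N\<^esub> (if b then fst (dec u) else snd (dec u))"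
    using assms by (intro bexI[of _ "enc (\<ominus>\<^bsub>M\<^esub> x, \<ominus>\<^bsub>N\<^esub> y)"]) (auto simp: enc_in_module_sum mod_inv)
next
  fix u v assume "u \<in> carrier (module_sum M N)" "v \<in> carrier (module_sum M N)"
    and *: "\<And>i. i \<in> UNIV \<Longrightarrow> (if i then fst (dec u) else snd (dec u)) = (if i then fst (dec v) else snd (dec v))"
  then show "u = v" using *[of True, simplified] *[of False, simplified]
    by (elim module_sum_cases) simp
qed (use assms in \<open>auto simp: enc_in_module_sum dec_module_sum(1-3) mod_add mod_zero mod_smult elim!: module_sum_cases\<close>)

lemma module_sum_fst: "(\<lambda>u. fst (dec u)) \<in> rmod_hom R (module_sum M N) M"
  and module_sum_snd: "(\<lambda>u. snd (dec u)) \<in> rmod_hom R (module_sum M N) (N :: ('u, 'u) module)"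
  by (auto intro!: rmod_homI simp: dec_module_sum)

lemma module_sum_pair: "f \<in> rmod_hom R L M \<Longrightarrow> g \<in> rmod_hom R L N \<Longrightarrow>
  (\<lambda>x. enc (f x, g x :: 'u)) \<in> rmod_hom R L (module_sum M N)"
  by (rule rmod_homI) (auto simp: enc_in_module_sum dec_module_sum(1-3) hom_closed hom_add hom_smult)

end

text \<open>\<open>pmod True\<close> is the product of the modules \<open>X i\<close> and \<open>pmod False\<close> their direct sum.\<close>

definition pmod :: "bool \<Rightarrow> 'u set \<Rightarrow> ('u \<Rightarrow> ('u, 'u) module) \<Rightarrow> ('u, 'u) module"
  where "pmod b I X = \<lparr>
    carrier = pk ` {x \<in> \<Pi>\<^sub>E i\<in>I. carrier (X i). b \<or> finite {i \<in> I. x i \<noteq> \<zero>\<^bsub>X i\<^esub>}},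
    monoid.mult = undefined, monoid.one = undefined,
    ring.zero = pk (\<lambda>i\<in>I. \<zero>\<^bsub>X i\<^esub>),
    ring.add = (\<lambda>u v. pk (\<lambda>i\<in>I. up u i \<oplus>\<^bsub>X i\<^esub> up v i)),
    smult = (\<lambda>r u. pk (\<lambda>i\<in>I. r \<odot>\<^bsub>X i\<^esub> up u i))\<rparr>"

lemma pmod_simps:
  shows "\<zero>\<^bsub>pmod b I X\<^esub> = pk (\<lambda>i\<in>I. \<zero>\<^bsub>X i\<^esub>)"
    and "u \<oplus>\<^bsub>pmod b I X\<^esub> v = pk (\<lambda>i\<in>I. up u i \<oplus>\<^bsub>X i\<^esub> up v i)"
    and "r \<odot>\<^bsub>pmod b I X\<^esub> u = pk (\<lambda>i\<in>I. r \<odot>\<^bsub>X i\<^esub> up u i)"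
  by (simp_all add: pmod_def)

definition pmap :: "'u set \<Rightarrow> ('u \<Rightarrow> 'u \<Rightarrow> 'u) \<Rightarrow> 'u \<Rightarrow> 'u"
  where "pmap I f u = pk (\<lambda>i\<in>I. f i (up u i))"

definition pin :: "'u set \<Rightarrow> ('u \<Rightarrow> ('u, 'u) module) \<Rightarrow> 'u \<Rightarrow> 'u \<Rightarrow> 'u"
  where "pin I X i x = pk (\<lambda>j\<in>I. if j = i then x else \<zero>\<^bsub>X j\<^esub>)"

section \<open>Products and direct sums of modules in the universe\<close>

context ring_universe
begin

context
  fixes I :: "'u set"
  assumes I: "small I"
begin

lemma pk_in_pmod:
  "pk (restrict x I) \<in> carrier (pmod b I X) \<longleftrightarrow>
    (\<forall>i\<in>I. x i \<in> carrier (X i)) \<and> (b \<or> finite {i \<in> I. x i \<noteq> \<zero>\<^bsub>X i\<^esub>})"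
proof
  assume "pk (restrict x I) \<in> carrier (pmod b I X)"
  then obtain y where y: "y \<in> (\<Pi>\<^sub>E i\<in>I. carrier (X i))" "b \<or> finite {i \<in> I. y i \<noteq> \<zero>\<^bsub>X i\<^esub>}"
    and eq: "pk (restrict x I) = pk y" by (auto simp: pmod_def)
  have "restrict x I = y"
    using arg_cong[OF eq, of up] up_pk_ext[OF I, of y] y(1) I by (simp add: PiE_iff)
  then have "x i = y i" if "i \<in> I" for i using that by (metis restrict_apply')
  then show "(\<forall>i\<in>I. x i \<in> carrier (X i)) \<and> (b \<or> finite {i \<in> I. x i \<noteq> \<zero>\<^bsub>X i\<^esub>})"
    using y by (auto simp: PiE_iff cong: conj_cong)
next
  assume "(\<forall>i\<in>I. x i \<in> carrier (X i)) \<and> (b \<or> finite {i \<in> I. x i \<noteq> \<zero>\<^bsub>X i\<^esub>})"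
  then show "pk (restrict x I) \<in> carrier (pmod b I X)"
    unfolding pmod_def by (auto simp: PiE_iff cong: conj_cong)
qed

lemma pmod_cases:
  assumes "u \<in> carrier (pmod b I X)"
  shows "pk (restrict (up u) I) = u"
    and "i \<in> I \<Longrightarrow> up u i \<in> carrier (X i)"
    and "b \<or> finite {i \<in> I. up u i \<noteq> \<zero>\<^bsub>X i\<^esub>}"
proof -
  obtain y where y: "y \<in> (\<Pi>\<^sub>E i\<in>I. carrier (X i))" "b \<or> finite {i \<in> I. y i \<noteq> \<zero>\<^bsub>X i\<^esub>}"
    and eq: "u = pk y" using assms by (auto simp: pmod_def)
  have [simp]: "up (pk y) = y" "restrict y I = y" using y(1) I
    by (auto simp: up_pk_ext PiE_iff extensional_restrict)
  show "pk (restrict (up u) I) = u" "i \<in> I \<Longrightarrow> up u i \<in> carrier (X i)"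
    "b \<or> finite {i \<in> I. up u i \<noteq> \<zero>\<^bsub>X i\<^esub>}"
    using y by (auto simp: eq)
qed

lemma pmod_ext:
  assumes "u \<in> carrier (pmod b I X)" "v \<in> carrier (pmod b I X)" "\<And>i. i \<in> I \<Longrightarrow> up u i = up v i"
  shows "u = v"
proof -
  have "u = pk (restrict (up u) I)" by (rule pmod_cases(1)[OF assms(1), symmetric])
  also have "restrict (up u) I = restrict (up v) I" using assms(3) by (rule restrict_ext)
  also have "pk \<dots> = v" by (rule pmod_cases(1)[OF assms(2)])
  finally show ?thesis .
qed

lemma up_pmod:
  assumes "i \<in> I"
  shows "up \<zero>\<^bsub>pmod b I X\<^esub> i = \<zero>\<^bsub>X i\<^esub>"
    and "up (u \<oplus>\<^bsub>pmod b I X\<^esub> v) i = up u i \<oplus>\<^bsub>X i\<^esub> up v i"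
    and "up (r \<odot>\<^bsub>pmod b I X\<^esub> u) i = r \<odot>\<^bsub>X i\<^esub> up u i"
    and "up (pmap I f u) i = f i (up u i)"
    and "up (pin I X j x) i = (if i = j then x else \<zero>\<^bsub>X i\<^esub>)"
  using assms I by (simp_all add: pmod_def pmap_def pin_def)

lemma pmod_modules:
  assumes X: "\<And>i. i \<in> I \<Longrightarrow> X i \<in> modules A"
  shows "pmod b I X \<in> modules A"
proof (rule modulesI_coords[where I = I and X = X and p = "\<lambda>i u. up u i"])
  have "small (pk ` (\<Pi>\<^sub>E i\<in>I. carrier (X i)))"
    by (rule small_pk_PiE[OF I]) (simp add: X mod_small)
  then show "small (carrier (pmod b I X))"
    by (rule small_mono) (auto simp: pmod_def)
  note ag = abelian_group.abelian_group_simprules[OF mod_group[OF X]]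
  \<comment> \<open>A pointwise operation that sends zeros to zero keeps supports finite;
    \<open>h\<close> stands for addition, negation and scalar multiplication at once.\<close>
  have fin: "b \<or> finite {i \<in> I. h (up u i) (up v i) i \<noteq> \<zero>\<^bsub>X i\<^esub>}"
    if "u \<in> carrier (pmod b I X)" "v \<in> carrier (pmod b I X)" "\<And>i. i \<in> I \<Longrightarrow> h \<zero>\<^bsub>X i\<^esub> \<zero>\<^bsub>X i\<^esub> i = \<zero>\<^bsub>X i\<^esub>" for h u v
  proof (cases b)
    case False
    have "{i \<in> I. h (up u i) (up v i) i \<noteq> \<zero>\<^bsub>X i\<^esub>} \<subseteq> {i \<in> I. up u i \<noteq> \<zero>\<^bsub>X i\<^esub>} \<union> {i \<in> I. up v i \<noteq> \<zero>\<^bsub>X i\<^esub>}"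
      using that(3) by auto
    then show ?thesis using pmod_cases(3)[OF that(1)] pmod_cases(3)[OF that(2)] False
      by (meson finite_UnI finite_subset)
  qed simp
  fix u assume u: "u \<in> carrier (pmod b I X)"
  show "r \<odot>\<^bsub>pmod b I X\<^esub> u \<in> carrier (pmod b I X)" if "r \<in> carrier A" for r
    using u fin[OF u u, of "\<lambda>a b i. r \<odot>\<^bsub>X i\<^esub> a"] that
    by (auto simp: pk_in_pmod pmod_cases X mod_smult smult_zero pmod_simps)
  show "u \<oplus>\<^bsub>pmod b I X\<^esub> v \<in> carrier (pmod b I X)" if v: "v \<in> carrier (pmod b I X)" for v
    using u v fin[OF u v, of "\<lambda>a b i. a \<oplus>\<^bsub>X i\<^esub> b"]
    by (auto simp: pk_in_pmod pmod_cases X mod_add ag pmod_simps)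
  have "pk (\<lambda>i\<in>I. \<ominus>\<^bsub>X i\<^esub> up u i) \<in> carrier (pmod b I X)"
    using u fin[OF u u, of "\<lambda>a b i. \<ominus>\<^bsub>X i\<^esub> a"] by (auto simp: pk_in_pmod pmod_cases ag)
  then show "\<exists>v\<in>carrier (pmod b I X). \<forall>i\<in>I. up v i = \<ominus>\<^bsub>X i\<^esub> up u i"
    by (rule bexI[rotated]) (simp add: I)
next
  show "\<zero>\<^bsub>pmod b I X\<^esub> \<in> carrier (pmod b I X)"
    by (simp add: pk_in_pmod X mod_zero pmod_simps)
qed (auto simp: X up_pmod pmod_cases intro: pmod_ext)

lemma pmap_in:
  assumes "u \<in> carrier (pmod b I X)"
    and "\<And>i x. i \<in> I \<Longrightarrow> x \<in> carrier (X i) \<Longrightarrow> f i x \<in> carrier (Y i)"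
    and "\<And>i. i \<in> I \<Longrightarrow> f i \<zero>\<^bsub>X i\<^esub> = \<zero>\<^bsub>Y i\<^esub>"
  shows "pmap I f u \<in> carrier (pmod b I Y)"
proof -
  have "{i \<in> I. f i (up u i) \<noteq> \<zero>\<^bsub>Y i\<^esub>} \<subseteq> {i \<in> I. up u i \<noteq> \<zero>\<^bsub>X i\<^esub>}" using assms(3) by auto
  then have "b \<or> finite {i \<in> I. f i (up u i) \<noteq> \<zero>\<^bsub>Y i\<^esub>}"
    using pmod_cases(3)[OF assms(1)] by (meson finite_subset)
  then show ?thesis unfolding pmap_def using assms by (auto simp: pk_in_pmod pmod_cases)
qed

lemma pmap_hom:
  assumes X: "\<And>i. i \<in> I \<Longrightarrow> X i \<in> modules A" and Y: "\<And>i. i \<in> I \<Longrightarrow> Y i \<in> modules A"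
    and f: "\<And>i. i \<in> I \<Longrightarrow> f i \<in> rmod_hom A (X i) (Y i)"
  shows "pmap I f \<in> rmod_hom A (pmod b I X) (pmod b I Y)"
proof (rule rmod_homI)
  note mods = pmod_modules[OF X] pmod_modules[OF Y]
  have f0: "i \<in> I \<Longrightarrow> f i \<zero>\<^bsub>X i\<^esub> = \<zero>\<^bsub>Y i\<^esub>" for i
    using hom_zero[OF f mod_group[OF X] mod_group[OF Y]] by blast
  show cl: "pmap I f x \<in> carrier (pmod b I Y)" if "x \<in> carrier (pmod b I X)" for x
    using that by (rule pmap_in) (auto simp: f0 hom_closed[OF f])
  fix x assume x: "x \<in> carrier (pmod b I X)"
  show "pmap I f (x \<oplus>\<^bsub>pmod b I X\<^esub> y) = pmap I f x \<oplus>\<^bsub>pmod b I Y\<^esub> pmap I f y" if y: "y \<in> carrier (pmod b I X)" for y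
    by (rule pmod_ext[where b = b and X = Y]) (use x y in \<open>auto simp: cl mod_add mods up_pmod pmod_cases hom_add[OF f]\<close>)
  show "pmap I f (r \<odot>\<^bsub>pmod b I X\<^esub> x) = r \<odot>\<^bsub>pmod b I Y\<^esub> pmap I f x" if "r \<in> carrier A" for r
    by (rule pmod_ext[where b = b and X = Y]) (use x that in \<open>auto simp: cl mod_smult mods up_pmod pmod_cases hom_smult[OF f]\<close>)
qed

lemma up_hom: "i \<in> I \<Longrightarrow> (\<lambda>u. up u i) \<in> rmod_hom A (pmod b I X) (X i)"
  by (rule rmod_homI) (auto simp: up_pmod pmod_cases)

lemma pin_hom:
  assumes X: "\<And>i. i \<in> I \<Longrightarrow> X i \<in> modules A" and i: "i \<in> I"
  shows "pin I X i \<in> rmod_hom A (X i) (pmod b I X)"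
proof (rule rmod_homI)
  show cl: "pin I X i x \<in> carrier (pmod b I X)" if "x \<in> carrier (X i)" for x
  proof -
    have "finite {j \<in> I. (if j = i then x else \<zero>\<^bsub>X j\<^esub>) \<noteq> \<zero>\<^bsub>X j\<^esub>}"
      by (rule finite_subset[of _ "{i}"]) auto
    then show ?thesis unfolding pin_def pk_in_pmod using that X mod_zero by auto
  qed
  note mods = pmod_modules[OF X]
  note ag = abelian_group.abelian_group_simprules[OF mod_group[OF X]]
  fix x assume x: "x \<in> carrier (X i)"
  show "pin I X i (x \<oplus>\<^bsub>X i\<^esub> y) = pin I X i x \<oplus>\<^bsub>pmod b I X\<^esub> pin I X i y" if y: "y \<in> carrier (X i)" for y
    by (rule pmod_ext[where b = b and X = X]) (use x y i in \<open>auto simp: cl mod_add mods up_pmod X mod_add ag\<close>)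
  show "pin I X i (r \<odot>\<^bsub>X i\<^esub> x) = r \<odot>\<^bsub>pmod b I X\<^esub> pin I X i x" if "r \<in> carrier A" for r
    by (rule pmod_ext[where b = b and X = X]) (use x i that in \<open>auto simp: cl mod_smult mods up_pmod X mod_smult smult_zero\<close>)
qed

text \<open>The target is the full product, since at one point infinitely many of the maps may have
  nonzero values.\<close>

lemma pairing_hom:
  assumes X: "\<And>i. i \<in> I \<Longrightarrow> X i \<in> modules A" and M: "M \<in> modules A"
    and f: "\<And>i. i \<in> I \<Longrightarrow> f i \<in> rmod_hom A M (X i)"
  shows "(\<lambda>x. pk (\<lambda>i\<in>I. f i x)) \<in> rmod_hom A M (pmod True I X)"
proof (rule rmod_homI)
  show cl: "pk (\<lambda>i\<in>I. f i x) \<in> carrier (pmod True I X)" if "x \<in> carrier M" for x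
    using that by (auto simp: pk_in_pmod hom_closed[OF f])
  note mods = pmod_modules[OF X]
  fix x assume x: "x \<in> carrier M"
  show "pk (\<lambda>i\<in>I. f i (x \<oplus>\<^bsub>M\<^esub> y)) = pk (\<lambda>i\<in>I. f i x) \<oplus>\<^bsub>pmod True I X\<^esub> pk (\<lambda>i\<in>I. f i y)" if y: "y \<in> carrier M" for y
    by (rule pmod_ext[where b = True and X = X]) (use x y M in \<open>auto simp: cl mod_add mods up_pmod I hom_add[OF f] mod_add\<close>)
  show "pk (\<lambda>i\<in>I. f i (r \<odot>\<^bsub>M\<^esub> x)) = r \<odot>\<^bsub>pmod True I X\<^esub> pk (\<lambda>i\<in>I. f i x)" if "r \<in> carrier A" for r
    by (rule pmod_ext[where b = True and X = X]) (use x that M in \<open>auto simp: cl mod_smult mods up_pmod I hom_smult[OF f] mod_smult\<close>)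
qed

end

end

section \<open>Complexes, quasi-isomorphisms and homotopies\<close>

text \<open>Injectivity in cohomology expressed by representatives. Together with
  \<open>cmap_homology_surj\<close> it replaces the bijections between sets of cosets in
  \<open>quasi_isos\<close> (see \<open>quasi_isos_iff\<close>), and the two halves can be composed
  and cancelled separately.\<close>

definition cmap_homology_inj :: "'u cochain \<Rightarrow> 'u cochain \<Rightarrow> 'u cmap \<Rightarrow> bool"
  where "cmap_homology_inj X Y f \<longleftrightarrow>
    (\<forall>n. \<forall>z\<in>cocycles X n. f n z \<in> coboundaries Y n \<longrightarrow> z \<in> coboundaries X n)"

definition cmap_homology_surj :: "'u cochain \<Rightarrow> 'u cochain \<Rightarrow> 'u cmap \<Rightarrow> bool"
  where "cmap_homology_surj X Y f \<longleftrightarrow>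
    (\<forall>n. \<forall>w\<in>cocycles Y n. \<exists>z\<in>cocycles X n. w \<ominus>\<^bsub>obj Y n\<^esub> f n z \<in> coboundaries Y n)"

lemma (in abelian_group) a_r_coset_eq_iff:
  assumes B: "B \<subseteq> carrier G" "\<zero> \<in> B" "\<And>x y. x \<in> B \<Longrightarrow> y \<in> B \<Longrightarrow> x \<ominus> y \<in> B"
    and xy: "x \<in> carrier G" "y \<in> carrier G"
  shows "B +> x = B +> y \<longleftrightarrow> x \<ominus> y \<in> B"
proof
  have coset: "B +> z = {b \<oplus> z | b. b \<in> B}" for z
    by (auto simp: a_r_coset_def r_coset_def)
  have neg: "\<ominus> b \<in> B" if "b \<in> B" for b
    using B(3)[OF B(2) that] B(1) that by (auto simp: minus_eq)
  have add: "b \<oplus> c \<in> B" if "b \<in> B" "c \<in> B" for b c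
    using B(3)[OF that(1) neg[OF that(2)]] B(1) that by (auto simp: minus_eq)
  { assume "B +> x = B +> y"
    moreover have "x \<in> B +> x" using B(2) xy unfolding coset by (auto intro!: exI[of _ \<zero>])
    ultimately obtain b where "b \<in> B" "x = b \<oplus> y" unfolding coset by auto
    then show "x \<ominus> y \<in> B" using B(1) xy by (auto simp: minus_eq a_assoc r_neg subset_iff) }
  { assume d: "x \<ominus> y \<in> B"
    have "b \<oplus> x = (b \<oplus> (x \<ominus> y)) \<oplus> y" "b \<oplus> y = (b \<ominus> (x \<ominus> y)) \<oplus> x" if "b \<in> B" for b
    proof -
      have "b \<in> carrier G" using that B(1) by auto
      note f = this xy abelian_group_axioms
      show "b \<oplus> x = (b \<oplus> (x \<ominus> y)) \<oplus> y" using f by algebra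
      show "b \<oplus> y = (b \<ominus> (x \<ominus> y)) \<oplus> x" using f by algebra
    qed
    then show "B +> x = B +> y" unfolding coset using d by (auto intro!: add B(3)) }
qed

context ring_universe
begin

lemma cpx_obj: "X \<in> complexes A \<Longrightarrow> obj X n \<in> modules A"
  by (simp add: complexes_def)

lemma cpx_group: "X \<in> complexes A \<Longrightarrow> abelian_group (obj X n)"
  by (simp add: cpx_obj mod_group)

lemma cpx_dif: "X \<in> complexes A \<Longrightarrow> m = n + 1 \<Longrightarrow> dif X n \<in> rmod_hom A (obj X n) (obj X m)"
  by (simp add: complexes_def)

lemma cpx_dif': "X \<in> complexes A \<Longrightarrow> dif X (n - 1) \<in> rmod_hom A (obj X (n - 1)) (obj X n)"
  by (rule cpx_dif) auto

lemma dif_closed: "X \<in> complexes A \<Longrightarrow> m = n + 1 \<Longrightarrow> x \<in> carrier (obj X n) \<Longrightarrow> dif X n x \<in> carrier (obj X m)"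
  by (rule hom_closed[OF cpx_dif])

lemma dif_dif: "X \<in> complexes A \<Longrightarrow> m = n + 1 \<Longrightarrow> x \<in> carrier (obj X n) \<Longrightarrow> dif X m (dif X n x) = \<zero>\<^bsub>obj X (m + 1)\<^esub>"
  by (simp add: complexes_def)

lemma dif_zero: "X \<in> complexes A \<Longrightarrow> dif X n \<zero>\<^bsub>obj X n\<^esub> = \<zero>\<^bsub>obj X (n + 1)\<^esub>"
  by (rule hom_zero[OF cpx_dif]) (auto intro: cpx_group)

lemma dif_add: "X \<in> complexes A \<Longrightarrow> x \<in> carrier (obj X n) \<Longrightarrow> y \<in> carrier (obj X n) \<Longrightarrow>
   dif X n (x \<oplus>\<^bsub>obj X n\<^esub> y) = dif X n x \<oplus>\<^bsub>obj X (n + 1)\<^esub> dif X n y"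
  by (rule hom_add[OF cpx_dif]) (auto intro: cpx_group)

lemma dif_a_inv: "X \<in> complexes A \<Longrightarrow> x \<in> carrier (obj X n) \<Longrightarrow>
   dif X n (\<ominus>\<^bsub>obj X n\<^esub> x) = \<ominus>\<^bsub>obj X (n + 1)\<^esub> dif X n x"
  by (rule hom_a_inv[OF cpx_dif]) (auto intro: cpx_group)

lemma dif_minus: "X \<in> complexes A \<Longrightarrow> x \<in> carrier (obj X n) \<Longrightarrow> y \<in> carrier (obj X n) \<Longrightarrow>
   dif X n (x \<ominus>\<^bsub>obj X n\<^esub> y) = dif X n x \<ominus>\<^bsub>obj X (n + 1)\<^esub> dif X n y"
  by (rule hom_minus[OF cpx_dif]) (auto intro: cpx_group)

lemma chain_mapsI:
  assumes "\<And>n. f n \<in> rmod_hom A (obj X n) (obj Y n)"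
    "\<And>n x. x \<in> carrier (obj X n) \<Longrightarrow> f (n + 1) (dif X n x) = dif Y n (f n x)"
  shows "f \<in> chain_maps A X Y"
  using assms by (simp add: chain_maps_def)

lemma cm_hom: "f \<in> chain_maps A X Y \<Longrightarrow> f n \<in> rmod_hom A (obj X n) (obj Y n)"
  by (simp add: chain_maps_def)

lemma cm_closed: "f \<in> chain_maps A X Y \<Longrightarrow> x \<in> carrier (obj X n) \<Longrightarrow> f n x \<in> carrier (obj Y n)"
  by (rule hom_closed[OF cm_hom])

lemma cm_dif: "f \<in> chain_maps A X Y \<Longrightarrow> m = n + 1 \<Longrightarrow> x \<in> carrier (obj X n) \<Longrightarrow> f m (dif X n x) = dif Y n (f n x)"
  by (simp add: chain_maps_def)

lemma cm_id: "cid \<in> chain_maps A X X"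
  by (rule chain_mapsI) (auto simp: cid_def hom_id)

lemma cm_comp: "f \<in> chain_maps A X Y \<Longrightarrow> g \<in> chain_maps A Y Z \<Longrightarrow> g \<circ>\<^sub>c f \<in> chain_maps A X Z"
  by (rule chain_mapsI) (auto simp: ccomp_def cm_dif cm_closed intro: hom_comp cm_hom)

lemma ccomp_assoc: "(h \<circ>\<^sub>c g) \<circ>\<^sub>c f = h \<circ>\<^sub>c (g \<circ>\<^sub>c f)"
  and ccomp_cid: "f \<circ>\<^sub>c cid = f" "cid \<circ>\<^sub>c f = f"
  by (simp_all add: ccomp_def cid_def)

lemma cocycles_closed: "z \<in> cocycles X n \<Longrightarrow> z \<in> carrier (obj X n)"
  by (simp add: cocycles_def)

lemma cocycles_dif: "z \<in> cocycles X n \<Longrightarrow> dif X n z = \<zero>\<^bsub>obj X (n + 1)\<^esub>"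
  by (simp add: cocycles_def)

lemma coboundaries_closed: "X \<in> complexes A \<Longrightarrow> z \<in> coboundaries X n \<Longrightarrow> z \<in> carrier (obj X n)"
  by (auto simp: coboundaries_def dif_closed)

lemma coboundariesI: "x \<in> carrier (obj X (n - 1)) \<Longrightarrow> z = dif X (n - 1) x \<Longrightarrow> z \<in> coboundaries X n"
  by (auto simp: coboundaries_def)

lemma coboundaries_zero: "X \<in> complexes A \<Longrightarrow> \<zero>\<^bsub>obj X n\<^esub> \<in> coboundaries X n"
  using dif_zero[of X "n - 1"] by (intro coboundariesI[of "\<zero>\<^bsub>obj X (n - 1)\<^esub>"]) (auto simp: mod_zero cpx_obj)

lemma coboundaries_minus:
  assumes "X \<in> complexes A" "z \<in> coboundaries X n" "w \<in> coboundaries X n"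
  shows "z \<ominus>\<^bsub>obj X n\<^esub> w \<in> coboundaries X n"
proof -
  obtain x y where "x \<in> carrier (obj X (n - 1))" "z = dif X (n - 1) x" "y \<in> carrier (obj X (n - 1))" "w = dif X (n - 1) y"
    using assms by (auto simp: coboundaries_def)
  then show ?thesis using assms(1) dif_minus[of X x "n - 1" y]
    by (intro coboundariesI[of "x \<ominus>\<^bsub>obj X (n - 1)\<^esub> y"]) (auto simp: mod_minus cpx_obj)
qed

lemma coboundaries_add:
  assumes "X \<in> complexes A" "z \<in> coboundaries X n" "w \<in> coboundaries X n"
  shows "z \<oplus>\<^bsub>obj X n\<^esub> w \<in> coboundaries X n"
proof -
  obtain x y where "x \<in> carrier (obj X (n - 1))" "z = dif X (n - 1) x" "y \<in> carrier (obj X (n - 1))" "w = dif X (n - 1) y"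
    using assms by (auto simp: coboundaries_def)
  then show ?thesis using assms(1) dif_add[of X x "n - 1" y]
    by (intro coboundariesI[of "x \<oplus>\<^bsub>obj X (n - 1)\<^esub> y"]) (auto simp: mod_add cpx_obj)
qed

lemma cocycles_minus:
  assumes "X \<in> complexes A" "z \<in> cocycles X n" "w \<in> cocycles X n"
  shows "z \<ominus>\<^bsub>obj X n\<^esub> w \<in> cocycles X n"
proof -
  have "\<zero>\<^bsub>obj X (n + 1)\<^esub> \<ominus>\<^bsub>obj X (n + 1)\<^esub> \<zero>\<^bsub>obj X (n + 1)\<^esub> = \<zero>\<^bsub>obj X (n + 1)\<^esub>"
    using cpx_group[OF assms(1), of "n + 1"] by algebra
  then show ?thesis using assms by (auto simp: cocycles_def dif_minus mod_minus cpx_obj)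
qed

lemma coboundaries_cocycles: "X \<in> complexes A \<Longrightarrow> z \<in> coboundaries X n \<Longrightarrow> z \<in> cocycles X n"
  by (auto simp: coboundaries_def cocycles_def dif_closed dif_dif)

lemma cm_cocycles:
  assumes f: "f \<in> chain_maps A X Y" and X: "X \<in> complexes A" and Y: "Y \<in> complexes A"
    and z: "z \<in> cocycles X n"
  shows "f n z \<in> cocycles Y n"
  using z hom_zero[OF cm_hom[OF f] cpx_group[OF X] cpx_group[OF Y]] cm_dif[OF f, of "n + 1" n z]
  by (auto simp: cocycles_def cm_closed[OF f])

lemma cm_coboundaries:
  assumes f: "f \<in> chain_maps A X Y" and z: "z \<in> coboundaries X n"
  shows "f n z \<in> coboundaries Y n"
  using z cm_dif[OF f, of n "n - 1"]
  by (auto simp: coboundaries_def cm_closed[OF f])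

lemma cm_minus:
  assumes f: "f \<in> chain_maps A X Y" and X: "X \<in> complexes A" and Y: "Y \<in> complexes A"
    and z: "x \<in> carrier (obj X n)" "y \<in> carrier (obj X n)"
  shows "f n (x \<ominus>\<^bsub>obj X n\<^esub> y) = f n x \<ominus>\<^bsub>obj Y n\<^esub> f n y"
  using assms by (intro hom_minus[OF cm_hom[OF f]]) (auto intro: cpx_group)

lemma cm_add:
  assumes f: "f \<in> chain_maps A X Y"
    and z: "x \<in> carrier (obj X n)" "y \<in> carrier (obj X n)"
  shows "f n (x \<oplus>\<^bsub>obj X n\<^esub> y) = f n x \<oplus>\<^bsub>obj Y n\<^esub> f n y"
  using assms by (intro hom_add[OF cm_hom[OF f]]) auto

lemma cm_zero:
  assumes f: "f \<in> chain_maps A X Y" and X: "X \<in> complexes A" and Y: "Y \<in> complexes A"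
  shows "f n \<zero>\<^bsub>obj X n\<^esub> = \<zero>\<^bsub>obj Y n\<^esub>"
  using assms by (intro hom_zero[OF cm_hom[OF f]]) (auto intro: cpx_group)

lemma coset_eq_iff:
  assumes "X \<in> complexes A" "x \<in> carrier (obj X n)" "y \<in> carrier (obj X n)"
  shows "coboundaries X n +>\<^bsub>obj X n\<^esub> x = coboundaries X n +>\<^bsub>obj X n\<^esub> y \<longleftrightarrow>
    x \<ominus>\<^bsub>obj X n\<^esub> y \<in> coboundaries X n"
  by (rule abelian_group.a_r_coset_eq_iff[OF cpx_group])
    (use assms in \<open>auto intro: coboundaries_zero coboundaries_minus dest: coboundaries_closed\<close>)

text \<open>\<open>cohomology_map\<close> is a union over all representatives of a class. They
  differ by coboundaries, which chain maps preserve, so every member of the union is the same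
  coset.\<close>

lemma cohomology_map_coset:
  assumes f: "f \<in> chain_maps A X Y" and X: "X \<in> complexes A" and Y: "Y \<in> complexes A"
    and z: "z \<in> carrier (obj X n)"
  shows "cohomology_map Y f n (coboundaries X n +>\<^bsub>obj X n\<^esub> z) = coboundaries Y n +>\<^bsub>obj Y n\<^esub> f n z"
proof -
  have eq: "coboundaries Y n +>\<^bsub>obj Y n\<^esub> f n w = coboundaries Y n +>\<^bsub>obj Y n\<^esub> f n z"
    if "w \<in> coboundaries X n +>\<^bsub>obj X n\<^esub> z" for w
  proof -
    obtain b where b: "b \<in> coboundaries X n" "w = b \<oplus>\<^bsub>obj X n\<^esub> z"
      using \<open>w \<in> _\<close> by (auto simp: a_r_coset_def r_coset_def)
    note c = coboundaries_closed[OF X b(1)]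
    have "f n w \<ominus>\<^bsub>obj Y n\<^esub> f n z = f n b"
      using cm_closed[OF f c] cm_closed[OF f z] cpx_group[OF Y, of n]
      unfolding b(2) cm_add[OF f c z] by algebra
    then show ?thesis
      using c z by (subst coset_eq_iff[OF Y])
        (auto intro: cm_coboundaries[OF f b(1)] cm_closed[OF f] simp: b(2) mod_add cpx_obj[OF X])
  qed
  moreover have "z \<in> coboundaries X n +>\<^bsub>obj X n\<^esub> z"
    using coboundaries_zero[OF X, of n] z abelian_group.abelian_group_simprules(6)[OF cpx_group[OF X] z]
    by (auto simp: a_r_coset_def r_coset_def intro!: bexI[of _ "\<zero>\<^bsub>obj X n\<^esub>"])
  ultimately show ?thesis unfolding cohomology_map_def by blast
qed

text \<open>Two cosets are equal exactly if the difference of their representatives is a coboundary;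
  by additivity injectivity then only has to be tested against the zero class.\<close>

lemma quasi_isos_iff:
  assumes X: "X \<in> complexes A" and Y: "Y \<in> complexes A"
  shows "f \<in> quasi_isos A X Y \<longleftrightarrow> f \<in> chain_maps A X Y \<and> cmap_homology_inj X Y f \<and> cmap_homology_surj X Y f"
proof (cases "f \<in> chain_maps A X Y")
  case f: True
  let ?B = "\<lambda>X n z. coboundaries X n +>\<^bsub>obj X n\<^esub> z"
  note map = cohomology_map_coset[OF f X Y cocycles_closed]
  note closed = cocycles_closed cm_closed[OF f cocycles_closed]
  have "inj_on (cohomology_map Y f n) (cohomology X n) \<longleftrightarrow>
      (\<forall>z\<in>cocycles X n. f n z \<in> coboundaries Y n \<longrightarrow> z \<in> coboundaries X n)" (is "?L = ?R") for n
  proof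
    assume L: ?L
    show ?R
    proof safe
      fix z assume z: "z \<in> cocycles X n" "f n z \<in> coboundaries Y n"
      have 0: "\<zero>\<^bsub>obj X n\<^esub> \<in> cocycles X n"
        by (simp add: cocycles_def dif_zero mod_zero cpx_obj X)
      note r = z(1)[THEN closed(1)] z(1)[THEN closed(2)] cpx_group[OF X, of n] cpx_group[OF Y, of n]
      have m: "z \<ominus>\<^bsub>obj X n\<^esub> \<zero>\<^bsub>obj X n\<^esub> = z" "f n z \<ominus>\<^bsub>obj Y n\<^esub> \<zero>\<^bsub>obj Y n\<^esub> = f n z" using r by algebra+
      have e: "?B Y n (f n z) = ?B Y n (f n \<zero>\<^bsub>obj X n\<^esub>)"
        using z 0 by (subst coset_eq_iff[OF Y]) (auto intro: closed simp: cm_zero[OF f X Y] m mod_zero cpx_obj Y)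
      have "?B X n z = ?B X n \<zero>\<^bsub>obj X n\<^esub>"
        by (rule inj_onD[OF L]) (use z 0 e in \<open>auto simp: map cohomology_def\<close>)
      then show "z \<in> coboundaries X n"
        using z 0 by (subst (asm) coset_eq_iff[OF X]) (auto intro: closed simp: m)
    qed
  next
    assume R: ?R
    show ?L
    proof (rule inj_onI)
      fix c c' assume "c \<in> cohomology X n" "c' \<in> cohomology X n"
        and eq: "cohomology_map Y f n c = cohomology_map Y f n c'"
      then obtain z z' where z: "z \<in> cocycles X n" "z' \<in> cocycles X n" "c = ?B X n z" "c' = ?B X n z'"
        by (auto simp: cohomology_def)
      have "f n z \<ominus>\<^bsub>obj Y n\<^esub> f n z' \<in> coboundaries Y n"
        using eq z by (simp add: map coset_eq_iff[OF Y] closed)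
      then have "z \<ominus>\<^bsub>obj X n\<^esub> z' \<in> coboundaries X n"
        using R z by (auto simp: cm_minus[OF f X Y] closed cocycles_minus[OF X])
      then show "c = c'" using z by (simp add: coset_eq_iff[OF X] closed)
    qed
  qed
  moreover have "cohomology_map Y f n ` cohomology X n = cohomology Y n \<longleftrightarrow>
      (\<forall>w\<in>cocycles Y n. \<exists>z\<in>cocycles X n. w \<ominus>\<^bsub>obj Y n\<^esub> f n z \<in> coboundaries Y n)" for n
  proof -
    have "cohomology_map Y f n ` cohomology X n = (\<lambda>z. ?B Y n (f n z)) ` cocycles X n"
      unfolding cohomology_def image_image by (rule image_cong) (auto simp: map)
    moreover have "(\<lambda>z. ?B Y n (f n z)) ` cocycles X n \<subseteq> cohomology Y n"
      by (auto simp: cohomology_def cm_cocycles[OF f X Y])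
    ultimately have "cohomology_map Y f n ` cohomology X n = cohomology Y n \<longleftrightarrow>
        (\<forall>w\<in>cocycles Y n. \<exists>z\<in>cocycles X n. ?B Y n w = ?B Y n (f n z))"
      unfolding cohomology_def by (simp only: set_eq_subset image_subset_iff image_iff Ball_image_comp o_def) auto
    also have "\<dots> \<longleftrightarrow> (\<forall>w\<in>cocycles Y n. \<exists>z\<in>cocycles X n. w \<ominus>\<^bsub>obj Y n\<^esub> f n z \<in> coboundaries Y n)"
      using coset_eq_iff[OF Y closed(1) closed(2)] by simp
    finally show ?thesis .
  qed
  ultimately show ?thesis
    using f by (simp add: quasi_isos_def bij_betw_def cmap_homology_inj_def cmap_homology_surj_def) blast
qed (simp add: quasi_isos_def)

lemma quasi_isos_cm: "f \<in> quasi_isos A X Y \<Longrightarrow> f \<in> chain_maps A X Y"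
  by (simp add: quasi_isos_def)

lemma quasi_isosI:
  assumes "X \<in> complexes A" "Y \<in> complexes A" "f \<in> chain_maps A X Y"
    and "\<And>n z y. z \<in> cocycles X n \<Longrightarrow> y \<in> carrier (obj Y (n - 1)) \<Longrightarrow> f n z = dif Y (n - 1) y \<Longrightarrow>
      \<exists>x\<in>carrier (obj X (n - 1)). z = dif X (n - 1) x"
    and "\<And>n w. w \<in> cocycles Y n \<Longrightarrow> \<exists>z\<in>cocycles X n. \<exists>y\<in>carrier (obj Y (n - 1)).
      w = f n z \<oplus>\<^bsub>obj Y n\<^esub> dif Y (n - 1) y"
  shows "f \<in> quasi_isos A X Y"
proof -
  have "\<exists>z\<in>cocycles X n. w \<ominus>\<^bsub>obj Y n\<^esub> f n z \<in> coboundaries Y n" if w: "w \<in> cocycles Y n" for n w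
  proof -
    obtain z y where z: "z \<in> cocycles X n" and y: "y \<in> carrier (obj Y (n - 1))"
      and eq: "w = f n z \<oplus>\<^bsub>obj Y n\<^esub> dif Y (n - 1) y" using assms(5)[OF w] by blast
    have "w \<ominus>\<^bsub>obj Y n\<^esub> f n z = dif Y (n - 1) y"
      using cm_closed[OF assms(3) cocycles_closed[OF z]] hom_closed[OF cpx_dif'[OF assms(2)] y] cpx_group[OF assms(2), of n]
      unfolding eq by algebra
    then show ?thesis using z y by (auto simp: coboundaries_def)
  qed
  moreover have "z \<in> coboundaries X n" if "z \<in> cocycles X n" "f n z \<in> coboundaries Y n" for n z
    using that assms(4)[of z n] by (auto simp: coboundaries_def)
  ultimately show ?thesis
    using assms(1-3) by (auto simp: quasi_isos_iff cmap_homology_inj_def cmap_homology_surj_def)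
qed

lemma quasi_isosE_inj:
  assumes "f \<in> quasi_isos A X Y" "X \<in> complexes A" "Y \<in> complexes A" "z \<in> cocycles X n"
    "y \<in> carrier (obj Y (n - 1))" "f n z = dif Y (n - 1) y"
  obtains x where "x \<in> carrier (obj X (n - 1))" "z = dif X (n - 1) x"
proof -
  have "f n z \<in> coboundaries Y n" using assms by (auto simp: coboundaries_def)
  then have "z \<in> coboundaries X n" using assms by (auto simp: quasi_isos_iff cmap_homology_inj_def)
  then show ?thesis using that by (auto simp: coboundaries_def)
qed

lemma quasi_isosE_surj:
  assumes "f \<in> quasi_isos A X Y" "X \<in> complexes A" "Y \<in> complexes A" "w \<in> cocycles Y n"
  obtains z y where "z \<in> cocycles X n" "y \<in> carrier (obj Y (n - 1))" "w = f n z \<oplus>\<^bsub>obj Y n\<^esub> dif Y (n - 1) y"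
proof -
  obtain z where z: "z \<in> cocycles X n" "w \<ominus>\<^bsub>obj Y n\<^esub> f n z \<in> coboundaries Y n"
    using assms by (auto simp: quasi_isos_iff cmap_homology_surj_def)
  then obtain y where y: "y \<in> carrier (obj Y (n - 1))" "w \<ominus>\<^bsub>obj Y n\<^esub> f n z = dif Y (n - 1) y"
    by (auto simp: coboundaries_def)
  have "w = f n z \<oplus>\<^bsub>obj Y n\<^esub> (w \<ominus>\<^bsub>obj Y n\<^esub> f n z)"
    using cm_closed[OF quasi_isos_cm[OF assms(1)] cocycles_closed[OF z(1)]] cocycles_closed[OF assms(4)] cpx_group[OF assms(3), of n] by algebra
  then show ?thesis using that z(1) y by auto
qed

lemma homology_inj_comp:
  assumes "cmap_homology_inj X Y f" "cmap_homology_inj Y Z g" "f \<in> chain_maps A X Y" "X \<in> complexes A" "Y \<in> complexes A"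
  shows "cmap_homology_inj X Z (g \<circ>\<^sub>c f)"
  using assms cm_cocycles[OF assms(3-5)] by (auto simp: cmap_homology_inj_def ccomp_def)

lemma homology_inj_cancel:
  assumes "cmap_homology_inj X Z (g \<circ>\<^sub>c f)" "g \<in> chain_maps A Y Z"
  shows "cmap_homology_inj X Y f"
  using assms cm_coboundaries[OF assms(2)] by (auto simp: cmap_homology_inj_def ccomp_def)

lemma homology_surj_comp:
  assumes f: "cmap_homology_surj X Y f" and g: "cmap_homology_surj Y Z g"
    and fc: "f \<in> chain_maps A X Y" and gc: "g \<in> chain_maps A Y Z" and X: "X \<in> complexes A" and Y: "Y \<in> complexes A" and Z: "Z \<in> complexes A"
  shows "cmap_homology_surj X Z (g \<circ>\<^sub>c f)"
  unfolding cmap_homology_surj_def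
proof safe
  fix n w assume w: "w \<in> cocycles Z n"
  obtain y where y: "y \<in> cocycles Y n" "w \<ominus>\<^bsub>obj Z n\<^esub> g n y \<in> coboundaries Z n"
    using g w by (auto simp: cmap_homology_surj_def)
  obtain x where x: "x \<in> cocycles X n" "y \<ominus>\<^bsub>obj Y n\<^esub> f n x \<in> coboundaries Y n"
    using f y by (auto simp: cmap_homology_surj_def)
  note cl = cocycles_closed[OF w] cocycles_closed[OF y(1)] cocycles_closed[OF x(1)]
  note cl2 = cl cm_closed[OF fc cl(3)] cm_closed[OF gc cl(2)] cm_closed[OF gc cm_closed[OF fc cl(3)]] cpx_group[OF Z, of n]
  have "w \<ominus>\<^bsub>obj Z n\<^esub> g n (f n x) = (w \<ominus>\<^bsub>obj Z n\<^esub> g n y) \<oplus>\<^bsub>obj Z n\<^esub> g n (y \<ominus>\<^bsub>obj Y n\<^esub> f n x)"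
    unfolding cm_minus[OF gc Y Z cl(2) cm_closed[OF fc cl(3)]] using cl2 by algebra
  then show "\<exists>z\<in>cocycles X n. w \<ominus>\<^bsub>obj Z n\<^esub> (g \<circ>\<^sub>c f) n z \<in> coboundaries Z n"
    using x y by (intro bexI[of _ x]) (auto simp: ccomp_def intro!: coboundaries_add[OF Z] cm_coboundaries[OF gc])
qed

lemma homology_surj_cancel:
  assumes "cmap_homology_surj X Z (g \<circ>\<^sub>c f)" "f \<in> chain_maps A X Y" "X \<in> complexes A" "Y \<in> complexes A"
  shows "cmap_homology_surj Y Z g"
  using assms cm_cocycles[OF assms(2-4)] by (auto simp: cmap_homology_surj_def ccomp_def) blast

text \<open>Modulo a coboundary every cocycle of Y has the form \<open>f n x\<close>, and to such a
  cocycle the injectivity of the composite applies.\<close>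

lemma homology_inj_cancel_surj:
  assumes gf: "cmap_homology_inj X Z (g \<circ>\<^sub>c f)" and f: "cmap_homology_surj X Y f"
    and fc: "f \<in> chain_maps A X Y" and gc: "g \<in> chain_maps A Y Z" and X: "X \<in> complexes A" and Y: "Y \<in> complexes A" and Z: "Z \<in> complexes A"
  shows "cmap_homology_inj Y Z g"
  unfolding cmap_homology_inj_def
proof safe
  fix n z assume z: "z \<in> cocycles Y n" "g n z \<in> coboundaries Z n"
  obtain x where x: "x \<in> cocycles X n" "z \<ominus>\<^bsub>obj Y n\<^esub> f n x \<in> coboundaries Y n"
    using f z by (auto simp: cmap_homology_surj_def)
  note cl = cocycles_closed[OF z(1)] cocycles_closed[OF x(1)]
  note cl2 = cl cm_closed[OF fc cl(2)] cm_closed[OF gc cl(1)] cm_closed[OF gc cm_closed[OF fc cl(2)]]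
  have "g n (f n x) = g n z \<ominus>\<^bsub>obj Z n\<^esub> g n (z \<ominus>\<^bsub>obj Y n\<^esub> f n x)"
    unfolding cm_minus[OF gc Y Z cl(1) cm_closed[OF fc cl(2)]] using cl2 cpx_group[OF Z, of n] by algebra
  then have "g n (f n x) \<in> coboundaries Z n"
    using z x by (auto intro!: coboundaries_minus[OF Z] cm_coboundaries[OF gc])
  then have "x \<in> coboundaries X n" using gf x by (auto simp: cmap_homology_inj_def ccomp_def)
  moreover have "z = f n x \<oplus>\<^bsub>obj Y n\<^esub> (z \<ominus>\<^bsub>obj Y n\<^esub> f n x)" using cl2 cpx_group[OF Y, of n] by algebra
  ultimately show "z \<in> coboundaries Y n"
    using x coboundaries_add[OF Y cm_coboundaries[OF fc], of x n] by metis
qed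

text \<open>A preimage under the composite of the class of \<open>g n w\<close> gives a candidate
  for w; injectivity of \<open>g\<close> shows that the candidate is right already in Y.\<close>

lemma homology_surj_cancel_inj:
  assumes gf: "cmap_homology_surj X Z (g \<circ>\<^sub>c f)" and g: "cmap_homology_inj Y Z g"
    and fc: "f \<in> chain_maps A X Y" and gc: "g \<in> chain_maps A Y Z" and X: "X \<in> complexes A" and Y: "Y \<in> complexes A" and Z: "Z \<in> complexes A"
  shows "cmap_homology_surj X Y f"
  unfolding cmap_homology_surj_def
proof safe
  fix n w assume w: "w \<in> cocycles Y n"
  obtain x where x: "x \<in> cocycles X n" "g n w \<ominus>\<^bsub>obj Z n\<^esub> g n (f n x) \<in> coboundaries Z n"
    using gf cm_cocycles[OF gc Y Z w] by (auto simp: cmap_homology_surj_def ccomp_def)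
  then have "g n (w \<ominus>\<^bsub>obj Y n\<^esub> f n x) \<in> coboundaries Z n"
    using w by (simp add: cm_minus[OF gc Y Z] cocycles_closed cm_closed[OF fc])
  moreover have "w \<ominus>\<^bsub>obj Y n\<^esub> f n x \<in> cocycles Y n"
    using w x by (auto intro: cocycles_minus[OF Y] cm_cocycles[OF fc X Y])
  ultimately show "\<exists>z\<in>cocycles X n. w \<ominus>\<^bsub>obj Y n\<^esub> f n z \<in> coboundaries Y n"
    using g x by (auto simp: cmap_homology_inj_def)
qed

lemma quasi_isos_comp:
  assumes "f \<in> quasi_isos A X Y" "g \<in> quasi_isos A Y Z" "X \<in> complexes A" "Y \<in> complexes A" "Z \<in> complexes A"
  shows "g \<circ>\<^sub>c f \<in> quasi_isos A X Z"
  using assms by (auto simp: quasi_isos_iff intro: cm_comp homology_inj_comp homology_surj_comp)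

lemma quasi_isos_cancel_left:
  assumes "g \<circ>\<^sub>c f \<in> quasi_isos A X Z" "g \<in> quasi_isos A Y Z" "f \<in> chain_maps A X Y" "X \<in> complexes A" "Y \<in> complexes A" "Z \<in> complexes A"
  shows "f \<in> quasi_isos A X Y"
  using assms by (auto simp: quasi_isos_iff intro: homology_inj_cancel homology_surj_cancel_inj)

lemma quasi_isos_cid: "X \<in> complexes A \<Longrightarrow> cid \<in> quasi_isos A X X"
  unfolding quasi_isos_iff
proof (intro conjI)
  assume X: "X \<in> complexes A"
  have "w \<ominus>\<^bsub>obj X n\<^esub> w = \<zero>\<^bsub>obj X n\<^esub>" if "w \<in> carrier (obj X n)" for w n
    using that cpx_group[OF X, of n] by algebra
  then show "cmap_homology_surj X X cid"
    by (auto simp: cmap_homology_surj_def cid_def intro!: bexI coboundaries_zero[OF X] dest: cocycles_closed)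
qed (auto simp: cm_id cmap_homology_inj_def, simp add: cid_def)

text \<open>Isomorphisms of complexes are quasi-isomorphisms. This serves the comparison maps of Hom
  functors with shifts, cones, products and stalks.\<close>

lemma quasi_isos_bij:
  assumes X: "X \<in> complexes A" and Y: "Y \<in> complexes A" and f: "f \<in> chain_maps A X Y"
    and bij: "\<And>n. bij_betw (f n) (carrier (obj X n)) (carrier (obj Y n))"
  shows "f \<in> quasi_isos A X Y"
proof (rule quasi_isosI[OF X Y f])
  have f': "\<exists>x\<in>carrier (obj X n). y = f n x" if "y \<in> carrier (obj Y n)" for y n
    using bij[of n] that by (auto simp: bij_betw_def)
  have inj: "x = y" if "f n x = f n y" "x \<in> carrier (obj X n)" "y \<in> carrier (obj X n)" for x y n
    using bij[of n] that by (auto simp: bij_betw_def dest: inj_onD)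
  fix n
  {
    fix z y assume z: "z \<in> cocycles X n" and y: "y \<in> carrier (obj Y (n - 1))" and eq: "f n z = dif Y (n - 1) y"
    obtain x where x: "x \<in> carrier (obj X (n - 1))" "y = f (n - 1) x" using f'[OF y] by blast
    have "f n z = f n (dif X (n - 1) x)" using x eq cm_dif[OF f, of n "n - 1" x] by simp
    then have "z = dif X (n - 1) x" by (rule inj) (use x z in \<open>auto simp: cocycles_closed dif_closed X\<close>)
    then show "\<exists>x\<in>carrier (obj X (n - 1)). z = dif X (n - 1) x" using x by blast
  next
    fix w assume w: "w \<in> cocycles Y n"
    obtain z where z: "z \<in> carrier (obj X n)" "w = f n z" using f'[OF cocycles_closed[OF w]] by blast
    have "f (n + 1) (dif X n z) = f (n + 1) \<zero>\<^bsub>obj X (n + 1)\<^esub>"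
      using cm_dif[OF f refl z(1)] cocycles_dif[OF w] by (simp add: cm_zero[OF f X Y] z(2))
    then have "dif X n z = \<zero>\<^bsub>obj X (n + 1)\<^esub>"
      by (rule inj) (use z X in \<open>auto simp: dif_closed mod_zero cpx_obj\<close>)
    then have "z \<in> cocycles X n" using z by (simp add: cocycles_def)
    moreover have "w = f n z \<oplus>\<^bsub>obj Y n\<^esub> dif Y (n - 1) \<zero>\<^bsub>obj Y (n - 1)\<^esub>"
      using dif_zero[OF Y, of "n - 1"] cocycles_closed[OF w] z
      by (simp add: abelian_group.abelian_group_simprules[OF cpx_group[OF Y]])
    ultimately show "\<exists>z\<in>cocycles X n. \<exists>y\<in>carrier (obj Y (n - 1)). w = f n z \<oplus>\<^bsub>obj Y n\<^esub> dif Y (n - 1) y"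
      using mod_zero[OF cpx_obj[OF Y]] by blast
  }
qed

lemma homotopicI:
  assumes "\<And>n. h n \<in> rmod_hom A (obj X n) (obj Y (n - 1))"
    and "\<And>n x. x \<in> carrier (obj X n) \<Longrightarrow>
         f n x = g n x \<oplus>\<^bsub>obj Y n\<^esub> (dif Y (n - 1) (h n x) \<oplus>\<^bsub>obj Y n\<^esub> h (n + 1) (dif X n x))"
  shows "homotopic A X Y f g"
  using assms unfolding homotopic_def by blast

lemma homotopicE [consumes 3, case_names homotopy]:
  assumes "homotopic A X Y f g" "X \<in> complexes A" "Y \<in> complexes A"
  obtains h where "\<And>n. h n \<in> rmod_hom A (obj X n) (obj Y (n - 1))"
    and "\<And>n x. x \<in> carrier (obj X n) \<Longrightarrow>
         f n x = g n x \<oplus>\<^bsub>obj Y n\<^esub> (dif Y (n - 1) (h n x) \<oplus>\<^bsub>obj Y n\<^esub> h (n + 1) (dif X n x))"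
    and "\<And>n x. x \<in> carrier (obj X n) \<Longrightarrow> h n x \<in> carrier (obj Y (n - 1))"
    and "\<And>n x. x \<in> carrier (obj X n) \<Longrightarrow> dif Y (n - 1) (h n x) \<in> carrier (obj Y n)"
    and "\<And>n x. x \<in> carrier (obj X n) \<Longrightarrow> h (n + 1) (dif X n x) \<in> carrier (obj Y n)"
proof -
  obtain h where h: "\<And>n. h n \<in> rmod_hom A (obj X n) (obj Y (n - 1))"
    and eq: "\<And>n x. x \<in> carrier (obj X n) \<Longrightarrow>
         f n x = g n x \<oplus>\<^bsub>obj Y n\<^esub> (dif Y (n - 1) (h n x) \<oplus>\<^bsub>obj Y n\<^esub> h (n + 1) (dif X n x))"
    using assms(1) unfolding homotopic_def by blast
  have 1: "h n x \<in> carrier (obj Y (n - 1))" if "x \<in> carrier (obj X n)" for n x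
    using hom_closed[OF h that] .
  have 2: "dif Y (n - 1) (h n x) \<in> carrier (obj Y n)" if "x \<in> carrier (obj X n)" for n x
    using 1[OF that] by (simp add: dif_closed assms)
  have 3: "h (n + 1) (dif X n x) \<in> carrier (obj Y n)" if "x \<in> carrier (obj X n)" for n x
    using 1[of "dif X n x" "n + 1"] that by (simp add: dif_closed assms)
  show thesis by (rule that[OF h eq 1 2 3])
qed

lemma homotopic_refl:
  assumes "f \<in> chain_maps A X Y" "X \<in> complexes A" "Y \<in> complexes A"
  shows "homotopic A X Y f f"
proof (rule homotopicI[where h = "\<lambda>n x. \<zero>\<^bsub>obj Y (n - 1)\<^esub>"])
  show "(\<lambda>x. \<zero>\<^bsub>obj Y (n - 1)\<^esub>) \<in> rmod_hom A (obj X n) (obj Y (n - 1))" for n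
    by (intro hom_const_zero cpx_obj assms)
  fix n x assume x: "x \<in> carrier (obj X n)"
  have "dif Y (n - 1) \<zero>\<^bsub>obj Y (n - 1)\<^esub> = \<zero>\<^bsub>obj Y n\<^esub>" using dif_zero[OF assms(3), of "n - 1"] by simp
  then show "f n x = f n x \<oplus>\<^bsub>obj Y n\<^esub> (dif Y (n - 1) \<zero>\<^bsub>obj Y (n - 1)\<^esub> \<oplus>\<^bsub>obj Y n\<^esub> \<zero>\<^bsub>obj Y (n + 1 - 1)\<^esub>)"
    using cm_closed[OF assms(1) x] abelian_group.abelian_group_simprules[OF cpx_group[OF assms(3)]] by simp
qed

lemma homotopic_sym:
  assumes fg: "homotopic A X Y f g" and f: "f \<in> chain_maps A X Y" and g: "g \<in> chain_maps A X Y"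
    and X: "X \<in> complexes A" and Y: "Y \<in> complexes A"
  shows "homotopic A X Y g f"
  using fg X Y
proof (cases rule: homotopicE)
  case (homotopy h)
  note h = homotopy(1) and eq = homotopy(2) and cl = homotopy(3-5)
  show ?thesis
  proof (rule homotopicI[where h = "\<lambda>n x. \<ominus>\<^bsub>obj Y (n - 1)\<^esub> h n x"])
    show "(\<lambda>x. \<ominus>\<^bsub>obj Y (n - 1)\<^esub> h n x) \<in> rmod_hom A (obj X n) (obj Y (n - 1))" for n
      by (intro hom_neg cpx_obj X Y h)
    fix n x assume x: "x \<in> carrier (obj X n)"
    have d: "dif Y (n - 1) (\<ominus>\<^bsub>obj Y (n - 1)\<^esub> h n x) = \<ominus>\<^bsub>obj Y n\<^esub> dif Y (n - 1) (h n x)"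
      using dif_a_inv[OF Y cl(1)[OF x]] by simp
    show "g n x = f n x \<oplus>\<^bsub>obj Y n\<^esub> (dif Y (n - 1) (\<ominus>\<^bsub>obj Y (n - 1)\<^esub> h n x) \<oplus>\<^bsub>obj Y n\<^esub>
        \<ominus>\<^bsub>obj Y (n + 1 - 1)\<^esub> h (n + 1) (dif X n x))"
      unfolding eq[OF x] d add_diff_cancel using cm_closed[OF g x] cl(2,3)[OF x] cpx_group[OF Y, of n] by algebra
  qed
qed

lemma homotopic_trans:
  assumes fg: "homotopic A X Y f g" and gk: "homotopic A X Y g k" and k: "k \<in> chain_maps A X Y"
    and X: "X \<in> complexes A" and Y: "Y \<in> complexes A"
  shows "homotopic A X Y f k"
  using fg X Y
proof (cases rule: homotopicE)
  case (homotopy h)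
  note h = homotopy(1) and eq = homotopy(2) and cl = homotopy(3-5)
  from gk X Y show ?thesis
  proof (cases rule: homotopicE)
    case (homotopy h')
    note h' = homotopy(1) and eq' = homotopy(2) and cl' = homotopy(3-5)
    show ?thesis
    proof (rule homotopicI[where h = "\<lambda>n x. h n x \<oplus>\<^bsub>obj Y (n - 1)\<^esub> h' n x"])
      show "(\<lambda>x. h n x \<oplus>\<^bsub>obj Y (n - 1)\<^esub> h' n x) \<in> rmod_hom A (obj X n) (obj Y (n - 1))" for n
        by (intro hom_sum cpx_obj X Y h h')
      fix n x assume x: "x \<in> carrier (obj X n)"
      have d: "dif Y (n - 1) (h n x \<oplus>\<^bsub>obj Y (n - 1)\<^esub> h' n x) = dif Y (n - 1) (h n x) \<oplus>\<^bsub>obj Y n\<^esub> dif Y (n - 1) (h' n x)"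
        using dif_add[OF Y cl(1)[OF x] cl'(1)[OF x]] by simp
      show "f n x = k n x \<oplus>\<^bsub>obj Y n\<^esub> (dif Y (n - 1) (h n x \<oplus>\<^bsub>obj Y (n - 1)\<^esub> h' n x) \<oplus>\<^bsub>obj Y n\<^esub>
          (h (n + 1) (dif X n x) \<oplus>\<^bsub>obj Y (n + 1 - 1)\<^esub> h' (n + 1) (dif X n x)))"
        unfolding eq[OF x] eq'[OF x] d add_diff_cancel
        using cm_closed[OF k x] cl(2,3)[OF x] cl'(2,3)[OF x] cpx_group[OF Y, of n] by algebra
    qed
  qed
qed

lemma homotopic_comp_right:
  assumes fg: "homotopic A X Y f g" and k: "k \<in> chain_maps A W X"
    and X: "X \<in> complexes A" and Y: "Y \<in> complexes A" and W: "W \<in> complexes A"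
  shows "homotopic A W Y (f \<circ>\<^sub>c k) (g \<circ>\<^sub>c k)"
  using fg X Y
proof (cases rule: homotopicE)
  case (homotopy h)
  note h = homotopy(1) and eq = homotopy(2)
  show ?thesis
    by (rule homotopicI[where h = "\<lambda>n x. h n (k n x)"])
      (use k in \<open>auto intro: hom_comp[OF cm_hom[OF k]] h simp: ccomp_def eq cm_closed cm_dif\<close>)
qed

lemma homotopic_comp_left:
  assumes fg: "homotopic A X Y f g" and k: "k \<in> chain_maps A Y Z" and g: "g \<in> chain_maps A X Y"
    and X: "X \<in> complexes A" and Y: "Y \<in> complexes A" and Z: "Z \<in> complexes A"
  shows "homotopic A X Z (k \<circ>\<^sub>c f) (k \<circ>\<^sub>c g)"
  using fg X Y
proof (cases rule: homotopicE)
  case (homotopy h)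
  note h = homotopy(1) and eq = homotopy(2) and cl = homotopy(3-5)
  show ?thesis
  proof (rule homotopicI[where h = "\<lambda>n x. k (n - 1) (h n x)"])
    show "(\<lambda>x. k (n - 1) (h n x)) \<in> rmod_hom A (obj X n) (obj Z (n - 1))" for n
      by (rule hom_comp[OF h cm_hom[OF k]])
    fix n x assume x: "x \<in> carrier (obj X n)"
    show "(k \<circ>\<^sub>c f) n x = (k \<circ>\<^sub>c g) n x \<oplus>\<^bsub>obj Z n\<^esub> (dif Z (n - 1) (k (n - 1) (h n x)) \<oplus>\<^bsub>obj Z n\<^esub>
        k (n + 1 - 1) (h (n + 1) (dif X n x)))"
      using x cm_closed[OF g x] cl[OF x] cm_dif[OF k, of n "n - 1" "h n x"]
      by (simp add: ccomp_def eq[OF x] cm_add[OF k] mod_add cpx_obj Y)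
  qed
qed

text \<open>On a cocycle the summand \<open>h (n + 1) (dif X n z)\<close> of a homotopy vanishes and
  only a coboundary remains; hence homotopic maps agree in cohomology.\<close>

lemma homotopic_cocycle:
  assumes fg: "homotopic A X Y f g" and f: "f \<in> chain_maps A X Y" and g: "g \<in> chain_maps A X Y"
    and X: "X \<in> complexes A" and Y: "Y \<in> complexes A" and z: "z \<in> cocycles X n"
  obtains b where "b \<in> coboundaries Y n" "f n z = g n z \<oplus>\<^bsub>obj Y n\<^esub> b"
  using fg X Y
proof (cases rule: homotopicE)
  case (homotopy h)
  note h = homotopy(1) and eq = homotopy(2) and cl = homotopy(3-5)
  note zc = cocycles_closed[OF z]
  have "h (n + 1) (dif X n z) = \<zero>\<^bsub>obj Y n\<^esub>"
    using hom_zero[OF h cpx_group[OF X] cpx_group[OF Y], of "n + 1"] by (simp add: cocycles_dif[OF z])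
  then have "f n z = g n z \<oplus>\<^bsub>obj Y n\<^esub> dif Y (n - 1) (h n z)"
    using eq[OF zc] cl(2)[OF zc] by (simp add: abelian_group.abelian_group_simprules[OF cpx_group[OF Y]])
  then show ?thesis using cl(1)[OF zc] that by (auto simp: coboundaries_def)
qed

lemma homology_inj_homotopic:
  assumes i: "cmap_homology_inj X Y f" and fg: "homotopic A X Y f g" and f: "f \<in> chain_maps A X Y" and g: "g \<in> chain_maps A X Y"
    and X: "X \<in> complexes A" and Y: "Y \<in> complexes A"
  shows "cmap_homology_inj X Y g"
  unfolding cmap_homology_inj_def
proof safe
  fix n z assume z: "z \<in> cocycles X n" "g n z \<in> coboundaries Y n"
  then show "z \<in> coboundaries X n"
    using homotopic_cocycle[OF fg f g X Y z(1)] i coboundaries_add[OF Y z(2)]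
    by (metis cmap_homology_inj_def)
qed

lemma homology_surj_homotopic:
  assumes s: "cmap_homology_surj X Y f" and fg: "homotopic A X Y f g" and f: "f \<in> chain_maps A X Y" and g: "g \<in> chain_maps A X Y"
    and X: "X \<in> complexes A" and Y: "Y \<in> complexes A"
  shows "cmap_homology_surj X Y g"
  unfolding cmap_homology_surj_def
proof safe
  fix n w assume w: "w \<in> cocycles Y n"
  obtain z where z: "z \<in> cocycles X n" "w \<ominus>\<^bsub>obj Y n\<^esub> f n z \<in> coboundaries Y n"
    using s w by (auto simp: cmap_homology_surj_def)
  obtain b where b: "b \<in> coboundaries Y n" "f n z = g n z \<oplus>\<^bsub>obj Y n\<^esub> b"
    using homotopic_cocycle[OF fg f g X Y z(1)] .
  have "w \<ominus>\<^bsub>obj Y n\<^esub> g n z = (w \<ominus>\<^bsub>obj Y n\<^esub> f n z) \<oplus>\<^bsub>obj Y n\<^esub> b"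
    unfolding b(2) using cocycles_closed[OF w] cm_closed[OF g cocycles_closed[OF z(1)]]
      coboundaries_closed[OF Y b(1)] cpx_group[OF Y, of n] by algebra
  then show "\<exists>z\<in>cocycles X n. w \<ominus>\<^bsub>obj Y n\<^esub> g n z \<in> coboundaries Y n"
    using z b coboundaries_add[OF Y] by (intro bexI[of _ z]) auto
qed

lemma quasi_isos_homotopic:
  assumes f: "f \<in> quasi_isos A X Y" and fg: "homotopic A X Y f g" and g: "g \<in> chain_maps A X Y"
    and X: "X \<in> complexes A" and Y: "Y \<in> complexes A"
  shows "g \<in> quasi_isos A X Y"
  using f homology_inj_homotopic[OF _ fg quasi_isos_cm[OF f] g X Y] homology_surj_homotopic[OF _ fg quasi_isos_cm[OF f] g X Y] g
  by (simp add: quasi_isos_iff X Y)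

end

text \<open>The homotopy pullback of \<open>f : X \<rightarrow> Y\<close> and \<open>t : W \<rightarrow> Y\<close>: the complex of triples \<open>(x, w, y)\<close> with \<open>y\<close>
  a homotopy from \<open>t w\<close> to \<open>f x\<close>.\<close>

definition hpullback :: "'u cochain \<Rightarrow> 'u cochain \<Rightarrow> 'u cochain \<Rightarrow> 'u cmap \<Rightarrow> 'u cmap \<Rightarrow> 'u cochain"
  where "hpullback X W Y f t = \<lparr>obj = (\<lambda>n. module_sum (module_sum (obj X n) (obj W n)) (obj Y (n - 1))),
    dif = (\<lambda>n u. enc (enc (dif X n (fst (dec (fst (dec u)))), dif W n (snd (dec (fst (dec u))))),
      f n (fst (dec (fst (dec u)))) \<ominus>\<^bsub>obj Y n\<^esub> t n (snd (dec (fst (dec u)))) \<ominus>\<^bsub>obj Y n\<^esub> dif Y (n - 1) (snd (dec u))))\<rparr>"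

lemma (in universe) enc_eq_iff [simp]: "enc p = enc q \<longleftrightarrow> p = (q :: 'u \<times> 'u)"
  by (metis dec_enc)

section \<open>Homotopy pullbacks, the Ore condition and cancellation\<close>

context ring_universe
begin

context
  fixes X W Y :: "'u cochain" and f t :: "'u cmap"
  assumes X: "X \<in> complexes A" and W: "W \<in> complexes A" and Y: "Y \<in> complexes A"
    and f: "f \<in> chain_maps A X Y" and t: "t \<in> chain_maps A W Y"
begin

abbreviation (input) "hpb \<equiv> hpullback X W Y f t"

lemma hpullback_cases:
  assumes "u \<in> carrier (obj hpb n)"
  obtains x w y where "u = enc (enc (x, w), y)" "x \<in> carrier (obj X n)" "w \<in> carrier (obj W n)" "y \<in> carrier (obj Y (n - 1))"
  using assms by (auto simp: hpullback_def elim!: module_sum_cases)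

lemma hpullback_dif:
  "dif hpb n (enc (enc (x, w), y)) = enc (enc (dif X n x, dif W n w), f n x \<ominus>\<^bsub>obj Y n\<^esub> t n w \<ominus>\<^bsub>obj Y n\<^esub> dif Y (n - 1) y)"
  by (simp add: hpullback_def)

lemma hpullback_in: "enc (enc (x, w), y) \<in> carrier (obj hpb n) \<longleftrightarrow>
   x \<in> carrier (obj X n) \<and> w \<in> carrier (obj W n) \<and> y \<in> carrier (obj Y (n - 1))"
  by (simp add: hpullback_def enc_in_module_sum)

lemma hpullback_zero: "\<zero>\<^bsub>obj hpb n\<^esub> = enc (enc (\<zero>\<^bsub>obj X n\<^esub>, \<zero>\<^bsub>obj W n\<^esub>), \<zero>\<^bsub>obj Y (n - 1)\<^esub>)"
  by (simp add: hpullback_def module_sum_def)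

lemma hpullback_proj_hom:
  "(\<lambda>u. fst (dec (fst (dec u)))) \<in> rmod_hom A (obj hpb n) (obj X n)"
  "(\<lambda>u. snd (dec (fst (dec u)))) \<in> rmod_hom A (obj hpb n) (obj W n)"
  "(\<lambda>u. snd (dec u)) \<in> rmod_hom A (obj hpb n) (obj Y (n - 1))"
  unfolding hpullback_def
  by (auto intro: module_sum_snd hom_comp[OF module_sum_fst module_sum_fst] hom_comp[OF module_sum_fst module_sum_snd])

text \<open>The minus sign before \<open>dif Y (n - 1) y\<close> makes the differential square to
  zero: the differentials of f x and t w cancel against f and t of the differentials of x and
  w.\<close>

lemma hpullback_complexes: "hpb \<in> complexes A"
proof -
  have o: "obj hpb n \<in> modules A" for n
    by (simp add: hpullback_def module_sum_modules cpx_obj X W Y)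
  have "(\<lambda>u. enc (enc (dif X n (fst (dec (fst (dec u)))), dif W n (snd (dec (fst (dec u))))),
      f n (fst (dec (fst (dec u)))) \<ominus>\<^bsub>obj Y n\<^esub> t n (snd (dec (fst (dec u)))) \<ominus>\<^bsub>obj Y n\<^esub> dif Y (n - 1) (snd (dec u))))
     \<in> rmod_hom A (obj hpb n) (module_sum (module_sum (obj X (n + 1)) (obj W (n + 1))) (obj Y n))" for n
    by (intro module_sum_pair hom_diff o cpx_obj[OF Y]
        hom_comp[OF hpullback_proj_hom(1) cpx_dif[OF X refl]] hom_comp[OF hpullback_proj_hom(2) cpx_dif[OF W refl]]
        hom_comp[OF hpullback_proj_hom(1) cm_hom[OF f]] hom_comp[OF hpullback_proj_hom(2) cm_hom[OF t]]
        hom_comp[OF hpullback_proj_hom(3) cpx_dif'[OF Y]])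
  then have d: "dif hpb n \<in> rmod_hom A (obj hpb n) (obj hpb (n + 1))" for n
    by (simp add: hpullback_def)
  have "dif hpb (n + 1) (dif hpb n u) = \<zero>\<^bsub>obj hpb (n + 1 + 1)\<^esub>" if u: "u \<in> carrier (obj hpb n)" for u n
  proof -
    obtain x w y where u: "u = enc (enc (x, w), y)" and
      xw: "x \<in> carrier (obj X n)" "w \<in> carrier (obj W n)" and y: "y \<in> carrier (obj Y (n - 1))"
      using u by (rule hpullback_cases)
    have cl: "f n x \<in> carrier (obj Y n)" "t n w \<in> carrier (obj Y n)" "dif Y (n - 1) y \<in> carrier (obj Y n)"
      using xw y by (auto intro: cm_closed f t dif_closed[OF Y])
    then have cl': "dif Y n (f n x) \<in> carrier (obj Y (n + 1))" "dif Y n (t n w) \<in> carrier (obj Y (n + 1))"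
      by (auto intro: dif_closed[OF Y])
    have "dif Y n (f n x \<ominus>\<^bsub>obj Y n\<^esub> t n w \<ominus>\<^bsub>obj Y n\<^esub> dif Y (n - 1) y) =
      dif Y n (f n x) \<ominus>\<^bsub>obj Y (n + 1)\<^esub> dif Y n (t n w) \<ominus>\<^bsub>obj Y (n + 1)\<^esub> \<zero>\<^bsub>obj Y (n + 1)\<^esub>"
      using cl dif_dif[OF Y, of n "n - 1" y] y by (simp add: dif_minus[OF Y] mod_minus cpx_obj[OF Y])
    then have "f (n + 1) (dif X n x) \<ominus>\<^bsub>obj Y (n + 1)\<^esub> t (n + 1) (dif W n w) \<ominus>\<^bsub>obj Y (n + 1)\<^esub>
      dif Y n (f n x \<ominus>\<^bsub>obj Y n\<^esub> t n w \<ominus>\<^bsub>obj Y n\<^esub> dif Y (n - 1) y) = \<zero>\<^bsub>obj Y (n + 1)\<^esub>"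
      unfolding cm_dif[OF f refl xw(1)] cm_dif[OF t refl xw(2)]
      using cl' cpx_group[OF Y, of "n + 1"] by algebra
    then show ?thesis
      using xw by (simp add: u hpullback_dif hpullback_zero dif_dif X W add.commute)
  qed
  with o d show ?thesis by (simp add: complexes_def)
qed

definition "hp1 = (\<lambda>(n::int) u. fst (dec (fst (dec u :: 'u \<times> 'u))) :: 'u)"
definition "hp2 = (\<lambda>(n::int) u. snd (dec (fst (dec u :: 'u \<times> 'u))) :: 'u)"

lemma hp_chain_maps: "hp1 \<in> chain_maps A hpb X" "hp2 \<in> chain_maps A hpb W"
  unfolding hp1_def hp2_def
  by (auto intro!: chain_mapsI hpullback_proj_hom elim!: hpullback_cases simp: hpullback_dif)

text \<open>The third component of a triple is itself the homotopy.\<close>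

lemma hp_homotopic: "homotopic A hpb Y (f \<circ>\<^sub>c hp1) (t \<circ>\<^sub>c hp2)"
proof (rule homotopicI[where h = "\<lambda>n u. snd (dec u)"])
  fix n u assume "u \<in> carrier (obj hpb n)"
  then obtain x w y where u: "u = enc (enc (x, w), y)" and
      xw: "x \<in> carrier (obj X n)" "w \<in> carrier (obj W n)" and y: "y \<in> carrier (obj Y (n - 1))"
    by (rule hpullback_cases)
  have "f n x = t n w \<oplus>\<^bsub>obj Y n\<^esub> (dif Y (n - 1) y \<oplus>\<^bsub>obj Y n\<^esub> (f n x \<ominus>\<^bsub>obj Y n\<^esub> t n w \<ominus>\<^bsub>obj Y n\<^esub> dif Y (n - 1) y))"
    using cm_closed[OF f xw(1)] cm_closed[OF t xw(2)] hom_closed[OF cpx_dif'[OF Y] y] cpx_group[OF Y, of n] by algebra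
  then show "(f \<circ>\<^sub>c hp1) n u = (t \<circ>\<^sub>c hp2) n u \<oplus>\<^bsub>obj Y n\<^esub> (dif Y (n - 1) (snd (dec u)) \<oplus>\<^bsub>obj Y n\<^esub> snd (dec (dif hpb n u)))"
    by (simp add: u hpullback_dif ccomp_def hp1_def hp2_def)
qed (rule hpullback_proj_hom)

text \<open>The universal property up to homotopy: the given homotopy serves as third component, and
  the chain map condition for the triple is the homotopy identity.\<close>

lemma hpullback_lift:
  assumes V: "V \<in> complexes A" and a: "a \<in> chain_maps A V X" and b: "b \<in> chain_maps A V W"
    and h: "homotopic A V Y (f \<circ>\<^sub>c a) (t \<circ>\<^sub>c b)"
  obtains c where "c \<in> chain_maps A V hpb" "hp1 \<circ>\<^sub>c c = a" "hp2 \<circ>\<^sub>c c = b"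
  using h V Y
proof (cases rule: homotopicE)
  case (homotopy h)
  note h = homotopy(1) and eq = homotopy(2) and cl = homotopy(3-5)
  define c where "c n x = enc (enc (a n x, b n x), h n x)" for n x
  have "c \<in> chain_maps A V hpb"
  proof (rule chain_mapsI)
    show "c n \<in> rmod_hom A (obj V n) (obj hpb n)" for n
      unfolding c_def hpullback_def by (simp, intro module_sum_pair cm_hom a b h)
    fix n x assume x: "x \<in> carrier (obj V n)"
    have "f n (a n x) \<ominus>\<^bsub>obj Y n\<^esub> t n (b n x) \<ominus>\<^bsub>obj Y n\<^esub> dif Y (n - 1) (h n x) = h (n + 1) (dif V n x)"
      unfolding eq[OF x, unfolded ccomp_def]
      using cm_closed[OF t cm_closed[OF b x]] cl(2,3)[OF x] cpx_group[OF Y, of n] by algebra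
    then show "c (n + 1) (dif V n x) = dif hpb n (c n x)"
      by (simp add: c_def hpullback_dif cm_dif[OF a refl x] cm_dif[OF b refl x])
  qed
  moreover have "hp1 \<circ>\<^sub>c c = a" "hp2 \<circ>\<^sub>c c = b" by (auto simp: hp1_def hp2_def c_def ccomp_def fun_eq_iff)
  ultimately show ?thesis by (rule that)
qed

text \<open>The kernel of \<open>hp1\<close> is the cone of \<open>t\<close> shifted by -1, which is
  acyclic. In elements, the injective half uses injectivity of \<open>t\<close> in degree n and its
  surjectivity in degree n - 1.\<close>

lemma hp1_quasi_iso:
  assumes tq: "t \<in> quasi_isos A W Y"
  shows "hp1 \<in> quasi_isos A hpb X"
proof (rule quasi_isosI[OF hpullback_complexes X hp_chain_maps(1)])
  fix n
  {
    fix u x' assume u: "u \<in> cocycles hpb n" and x': "x' \<in> carrier (obj X (n - 1))" and eq: "hp1 n u = dif X (n - 1) x'"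
    obtain x w y where ue: "u = enc (enc (x, w), y)" and
      xw: "x \<in> carrier (obj X n)" "w \<in> carrier (obj W n)" and y: "y \<in> carrier (obj Y (n - 1))"
      using cocycles_closed[OF u] by (rule hpullback_cases)
    have x: "x = dif X (n - 1) x'" using eq by (simp add: ue hp1_def)
    have "dec (dif hpb n u) = dec (\<zero>\<^bsub>obj hpb (n + 1)\<^esub>)" "dec (fst (dec (dif hpb n u))) = dec (fst (dec \<zero>\<^bsub>obj hpb (n + 1)\<^esub>))"
      using u by (simp_all add: cocycles_def)
    then have d: "dif W n w = \<zero>\<^bsub>obj W (n + 1)\<^esub>" and rel: "f n x \<ominus>\<^bsub>obj Y n\<^esub> t n w \<ominus>\<^bsub>obj Y n\<^esub> dif Y (n - 1) y = \<zero>\<^bsub>obj Y n\<^esub>"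
      by (auto simp: ue hpullback_dif hpullback_zero)
    have w: "w \<in> cocycles W n" using xw d by (simp add: cocycles_def)
    note G = cpx_group[OF Y, of n] cpx_group[OF Y, of "n - 1"]
    have fx: "f n x = dif Y (n - 1) (f (n - 1) x')" using cm_dif[OF f, of n "n - 1" x'] x' x by simp
    note cl = cm_closed[OF f x'] y
    note dcl = hom_closed[OF cpx_dif'[OF Y] cl(1)] hom_closed[OF cpx_dif'[OF Y] cl(2)] cm_closed[OF t xw(2)]
    \<comment> \<open>The third component of the cocycle condition exhibits t w as a coboundary, so
      w is a coboundary as well.\<close>
    have "t n w = f n x \<ominus>\<^bsub>obj Y n\<^esub> dif Y (n - 1) y \<ominus>\<^bsub>obj Y n\<^esub> (f n x \<ominus>\<^bsub>obj Y n\<^esub> t n w \<ominus>\<^bsub>obj Y n\<^esub> dif Y (n - 1) y)"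
      unfolding fx using dcl G by algebra
    also have "\<dots> = f n x \<ominus>\<^bsub>obj Y n\<^esub> dif Y (n - 1) y"
      unfolding rel unfolding fx using dcl G by algebra
    finally have "t n w = dif Y (n - 1) (f (n - 1) x' \<ominus>\<^bsub>obj Y (n - 1)\<^esub> y)"
      unfolding fx using dif_minus[OF Y cl] by simp
    then obtain w' where w': "w' \<in> carrier (obj W (n - 1))" "w = dif W (n - 1) w'"
      using quasi_isosE_inj[OF tq W Y w, of "f (n - 1) x' \<ominus>\<^bsub>obj Y (n - 1)\<^esub> y"] cl by (auto simp: mod_minus cpx_obj[OF Y])
    \<comment> \<open>The triple (x', w', 0) bounds u except in the third component, where the error
      is \<open>c\<close>. This \<open>c\<close> is a cocycle, so it has the form t v + d y', and
      replacing (w', 0) by (w' + v, y') removes the error.\<close>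
    define c where "c = f (n - 1) x' \<ominus>\<^bsub>obj Y (n - 1)\<^esub> t (n - 1) w' \<ominus>\<^bsub>obj Y (n - 1)\<^esub> y"
    have tw': "dif Y (n - 1) (t (n - 1) w') = t n w" using cm_dif[OF t, of n "n - 1" w'] w' by simp
    note tcl = cm_closed[OF t w'(1)]
    have cc: "c \<in> carrier (obj Y (n - 1))" using cl tcl by (simp add: c_def mod_minus cpx_obj[OF Y])
    have "dif Y (n - 1) c = dif Y (n - 1) (f (n - 1) x') \<ominus>\<^bsub>obj Y n\<^esub> t n w \<ominus>\<^bsub>obj Y n\<^esub> dif Y (n - 1) y"
      using cl tcl dif_minus[OF Y, of _ "n - 1"] by (simp add: c_def mod_minus cpx_obj[OF Y] tw')
    then have "c \<in> cocycles Y (n - 1)" using cc rel by (simp add: cocycles_def fx)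
    then obtain v y' where v: "v \<in> cocycles W (n - 1)" and y': "y' \<in> carrier (obj Y (n - 1 - 1))"
      and ceq: "c = t (n - 1) v \<oplus>\<^bsub>obj Y (n - 1)\<^esub> dif Y (n - 1 - 1) y'"
      by (rule quasi_isosE_surj[OF tq W Y])
    note vc = cocycles_closed[OF v]
    define u' where "u' = enc (enc (x', w' \<oplus>\<^bsub>obj W (n - 1)\<^esub> v), y')"
    have u': "u' \<in> carrier (obj hpb (n - 1))"
      using x' w' vc y' by (simp add: u'_def hpullback_in mod_add cpx_obj[OF W])
    have "dif W (n - 1) (w' \<oplus>\<^bsub>obj W (n - 1)\<^esub> v) = w"
      using dif_add[OF W w'(1) vc] cocycles_dif[OF v] w' xw by (simp add: abelian_group.abelian_group_simprules[OF cpx_group[OF W]])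
    moreover have "f (n - 1) x' \<ominus>\<^bsub>obj Y (n - 1)\<^esub> t (n - 1) (w' \<oplus>\<^bsub>obj W (n - 1)\<^esub> v) \<ominus>\<^bsub>obj Y (n - 1)\<^esub> dif Y (n - 1 - 1) y' = y"
    proof -
      note k = hom_closed[OF cpx_dif'[OF Y] y'] cm_closed[OF t vc] tcl cl G
      have "f (n - 1) x' \<ominus>\<^bsub>obj Y (n - 1)\<^esub> t (n - 1) (w' \<oplus>\<^bsub>obj W (n - 1)\<^esub> v) \<ominus>\<^bsub>obj Y (n - 1)\<^esub> dif Y (n - 1 - 1) y'
        = f (n - 1) x' \<ominus>\<^bsub>obj Y (n - 1)\<^esub> t (n - 1) w' \<ominus>\<^bsub>obj Y (n - 1)\<^esub> c"
        unfolding ceq cm_add[OF t w'(1) vc] using k by algebra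
      also have "\<dots> = y" unfolding c_def using k by algebra
      finally show ?thesis .
    qed
    ultimately have "dif hpb (n - 1) u' = u" by (simp add: u'_def hpullback_dif ue x)
    then show "\<exists>x\<in>carrier (obj hpb (n - 1)). u = dif hpb (n - 1) x" using u' by blast
  next
    fix x assume x: "x \<in> cocycles X n"
    note xc = cocycles_closed[OF x]
    obtain w y where w: "w \<in> cocycles W n" and y: "y \<in> carrier (obj Y (n - 1))"
      and eq: "f n x = t n w \<oplus>\<^bsub>obj Y n\<^esub> dif Y (n - 1) y"
      using quasi_isosE_surj[OF tq W Y cm_cocycles[OF f X Y x]] .
    have "f n x \<ominus>\<^bsub>obj Y n\<^esub> t n w \<ominus>\<^bsub>obj Y n\<^esub> dif Y (n - 1) y = \<zero>\<^bsub>obj Y n\<^esub>"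
      unfolding eq using cm_closed[OF t cocycles_closed[OF w]] hom_closed[OF cpx_dif'[OF Y] y] cpx_group[OF Y, of n] by algebra
    then have "enc (enc (x, w), y) \<in> cocycles hpb n"
      using cocycles_closed[OF x] cocycles_closed[OF w] y
      by (simp add: cocycles_def hpullback_in hpullback_dif hpullback_zero cocycles_dif[OF x] cocycles_dif[OF w])
    moreover have "x = hp1 n (enc (enc (x, w), y)) \<oplus>\<^bsub>obj X n\<^esub> dif X (n - 1) \<zero>\<^bsub>obj X (n - 1)\<^esub>"
      using dif_zero[OF X, of "n - 1"] xc by (simp add: hp1_def abelian_group.abelian_group_simprules[OF cpx_group[OF X]])
    ultimately show "\<exists>z\<in>cocycles hpb n. \<exists>y\<in>carrier (obj X (n - 1)). x = hp1 n z \<oplus>\<^bsub>obj X n\<^esub> dif X (n - 1) y"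
      using mod_zero[OF cpx_obj[OF X]] by blast
  }
qed

end

text \<open>Homotopy bundled with all typing facts, so that chains of homotopies are composed by
  rules alone and carried along compositions.\<close>

definition heq :: "'u cochain \<Rightarrow> 'u cochain \<Rightarrow> 'u cmap \<Rightarrow> 'u cmap \<Rightarrow> bool"
  where "heq X Y f g \<longleftrightarrow> X \<in> complexes A \<and> Y \<in> complexes A \<and>
    f \<in> chain_maps A X Y \<and> g \<in> chain_maps A X Y \<and> homotopic A X Y f g"

lemma heq_refl: "X \<in> complexes A \<Longrightarrow> Y \<in> complexes A \<Longrightarrow> f \<in> chain_maps A X Y \<Longrightarrow> heq X Y f f"
  by (simp add: heq_def homotopic_refl)

lemma heq_sym: "heq X Y f g \<Longrightarrow> heq X Y g f"
  by (simp add: heq_def homotopic_sym)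

lemma heq_trans [trans]: "heq X Y f g \<Longrightarrow> heq X Y g k \<Longrightarrow> heq X Y f k"
  using homotopic_trans[of X Y f g k] by (simp add: heq_def)

lemma heq_right: "heq X Y f g \<Longrightarrow> k \<in> chain_maps A W X \<Longrightarrow> W \<in> complexes A \<Longrightarrow> heq W Y (f \<circ>\<^sub>c k) (g \<circ>\<^sub>c k)"
  using homotopic_comp_right[of X Y f g k W] by (simp add: heq_def cm_comp)

lemma heq_left: "heq X Y f g \<Longrightarrow> k \<in> chain_maps A Y Z \<Longrightarrow> Z \<in> complexes A \<Longrightarrow> heq X Z (k \<circ>\<^sub>c f) (k \<circ>\<^sub>c g)"
  using homotopic_comp_left[of X Y f g k Z] by (auto simp: heq_def intro: cm_comp)

lemma heq_qis: "heq X Y f g \<Longrightarrow> f \<in> quasi_isos A X Y \<longleftrightarrow> g \<in> quasi_isos A X Y"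
  using quasi_isos_homotopic heq_sym unfolding heq_def by blast

text \<open>The completion of X -> Y <- W is the homotopy pullback: its projection to X inherits
  from \<open>t\<close> the property of being a quasi-isomorphism.\<close>

lemma ore:
  assumes "X \<in> complexes A" "W \<in> complexes A" "Y \<in> complexes A" "f \<in> chain_maps A X Y" "t \<in> quasi_isos A W Y"
  obtains P p q where "P \<in> complexes A" "p \<in> quasi_isos A P X" "q \<in> chain_maps A P W" "heq P Y (f \<circ>\<^sub>c p) (t \<circ>\<^sub>c q)"
proof -
  note t = quasi_isos_cm[OF assms(5)]
  note P = hpullback_complexes[OF assms(1-4) t]
  note m = hp_chain_maps[OF assms(1-4) t]
  show ?thesis
    by (rule that[OF P hp1_quasi_iso[OF assms(1-4) t assms(5)] m(2)])
      (simp add: heq_def P assms m cm_comp[OF m(1)] cm_comp[OF m(2)] t hp_homotopic)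
qed

text \<open>Cancellation: a homotopy \<open>t f \<sim> t g\<close> is a map to the homotopy pullback of \<open>t\<close> along itself, whose
  diagonal is a quasi-isomorphism.\<close>

lemma cancel:
  assumes X: "X \<in> complexes A" and Y: "Y \<in> complexes A" and Z: "Z \<in> complexes A"
    and f: "f \<in> chain_maps A X Y" and g: "g \<in> chain_maps A X Y" and t: "t \<in> quasi_isos A Y Z"
    and fg: "heq X Z (t \<circ>\<^sub>c f) (t \<circ>\<^sub>c g)"
  obtains P p where "P \<in> complexes A" "p \<in> quasi_isos A P X" "heq P Y (f \<circ>\<^sub>c p) (g \<circ>\<^sub>c p)"
proof -
  note tc = quasi_isos_cm[OF t]
  let ?E = "hpullback Y Y Z t t"
  note E = hpullback_complexes[OF Y Y Z tc tc]
  note m = hp_chain_maps[OF Y Y Z tc tc]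
  note q = hp1_quasi_iso[OF Y Y Z tc tc t]
  have "homotopic A X Z (t \<circ>\<^sub>c f) (t \<circ>\<^sub>c g)" using fg by (simp add: heq_def)
  then obtain c where c: "c \<in> chain_maps A X ?E" "hp1 \<circ>\<^sub>c c = f" "hp2 \<circ>\<^sub>c c = g"
    by (rule hpullback_lift[OF Y Y Z tc tc X f g])
  \<comment> \<open>The constant homotopy defines the diagonal. It splits the quasi-isomorphism
    \<open>hp1\<close>, hence is one too.\<close>
  have "homotopic A Y Z (t \<circ>\<^sub>c cid) (t \<circ>\<^sub>c cid)" by (rule homotopic_refl) (simp_all add: ccomp_cid tc Y Z)
  then obtain d where d: "d \<in> chain_maps A Y ?E" "hp1 \<circ>\<^sub>c d = cid" "hp2 \<circ>\<^sub>c d = cid"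
    by (rule hpullback_lift[OF Y Y Z tc tc Y cm_id cm_id])
  have "hp1 \<circ>\<^sub>c d \<in> quasi_isos A Y Y" by (simp add: d quasi_isos_cid Y)
  from quasi_isos_cancel_left[OF this q d(1) Y E Y] have dq: "d \<in> quasi_isos A Y ?E" .
  \<comment> \<open>After pulling back along the diagonal, the map \<open>c\<close> factors through
    it up to homotopy. Applying the two projections makes f p and g p homotopic to the same map
    k.\<close>
  obtain P p k where P: "P \<in> complexes A" "p \<in> quasi_isos A P X" "k \<in> chain_maps A P Y" "heq P ?E (c \<circ>\<^sub>c p) (d \<circ>\<^sub>c k)"
    by (rule ore[OF X Y E c(1) dq])
  have "heq P Y (f \<circ>\<^sub>c p) k" using heq_left[OF P(4) m(1) Y] by (simp add: ccomp_assoc[symmetric] c d ccomp_cid)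
  moreover have "heq P Y (g \<circ>\<^sub>c p) k" using heq_left[OF P(4) m(2) Y] by (simp add: ccomp_assoc[symmetric] c d ccomp_cid)
  ultimately have "heq P Y (f \<circ>\<^sub>c p) (g \<circ>\<^sub>c p)" using heq_trans heq_sym by blast
  then show ?thesis using that P by blast
qed

end

section \<open>Calculus of fractions\<close>

context ring_universe
begin

definition roof_class :: "'u cochain \<Rightarrow> 'u cochain \<Rightarrow> 'u roof \<Rightarrow> 'u dmor"
  where "roof_class X Y r = roof_rel A X Y `` {r}"

lemma in_roofs: "(Z, s, f) \<in> roofs A X Y \<longleftrightarrow> Z \<in> complexes A \<and> s \<in> quasi_isos A Z X \<and> f \<in> chain_maps A Z Y"
  by (simp add: roofs_def)

text \<open>The definition only requires s a to be a quasi-isomorphism. Since the left legs are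
  quasi-isomorphisms and s' b is homotopic to s a, cancellation shows that both a and b are
  quasi-isomorphisms, which makes the relation symmetric in form.\<close>

lemma roof_rel_iff:
  assumes "X \<in> complexes A" "Y \<in> complexes A"
  shows "((Z, s, f), (Z', s', f')) \<in> roof_rel A X Y \<longleftrightarrow> (Z, s, f) \<in> roofs A X Y \<and> (Z', s', f') \<in> roofs A X Y \<and>
    (\<exists>W\<in>complexes A. \<exists>a\<in>quasi_isos A W Z. \<exists>b\<in>quasi_isos A W Z'. heq W X (s \<circ>\<^sub>c a) (s' \<circ>\<^sub>c b) \<and> heq W Y (f \<circ>\<^sub>c a) (f' \<circ>\<^sub>c b))"
    (is "?L \<longleftrightarrow> ?R")
proof
  assume ?L
  then obtain W a b where r: "(Z, s, f) \<in> roofs A X Y" "(Z', s', f') \<in> roofs A X Y" and W: "W \<in> complexes A"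
    and ab: "a \<in> chain_maps A W Z" "b \<in> chain_maps A W Z'" "s \<circ>\<^sub>c a \<in> quasi_isos A W X"
    and h: "homotopic A W X (s \<circ>\<^sub>c a) (s' \<circ>\<^sub>c b)" "homotopic A W Y (f \<circ>\<^sub>c a) (f' \<circ>\<^sub>c b)"
    by (auto simp: roof_rel_def)
  have q: "s \<in> quasi_isos A Z X" "s' \<in> quasi_isos A Z' X" and c: "f \<in> chain_maps A Z Y" "f' \<in> chain_maps A Z' Y"
    and Z: "Z \<in> complexes A" "Z' \<in> complexes A"
    using r by (auto simp: in_roofs)
  have e: "heq W X (s \<circ>\<^sub>c a) (s' \<circ>\<^sub>c b)" "heq W Y (f \<circ>\<^sub>c a) (f' \<circ>\<^sub>c b)"
    using h ab q c W assms by (auto simp: heq_def intro: cm_comp quasi_isos_cm)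
  have "a \<in> quasi_isos A W Z" by (rule quasi_isos_cancel_left[OF ab(3) q(1) ab(1) W Z(1) assms(1)])
  moreover have "s' \<circ>\<^sub>c b \<in> quasi_isos A W X" using heq_qis[OF e(1)] ab(3) by simp
  from quasi_isos_cancel_left[OF this q(2) ab(2) W Z(2) assms(1)] have "b \<in> quasi_isos A W Z'" .
  ultimately show ?R using r W e by blast
next
  assume ?R
  then obtain W a b where W: "W \<in> complexes A" "a \<in> quasi_isos A W Z" "b \<in> quasi_isos A W Z'"
    "heq W X (s \<circ>\<^sub>c a) (s' \<circ>\<^sub>c b)" "heq W Y (f \<circ>\<^sub>c a) (f' \<circ>\<^sub>c b)"
    and r: "(Z, s, f) \<in> roofs A X Y" "(Z', s', f') \<in> roofs A X Y" by blast
  have "s \<circ>\<^sub>c a \<in> quasi_isos A W X" using W r assms by (auto simp: in_roofs intro: quasi_isos_comp)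
  then show ?L using W r quasi_isos_cm[OF W(2)] quasi_isos_cm[OF W(3)] unfolding roof_rel_def heq_def by blast
qed

lemma roof_relI:
  assumes "X \<in> complexes A" "Y \<in> complexes A" "(Z, s, f) \<in> roofs A X Y" "(Z', s', f') \<in> roofs A X Y"
    "W \<in> complexes A" "a \<in> quasi_isos A W Z" "b \<in> quasi_isos A W Z'"
    "heq W X (s \<circ>\<^sub>c a) (s' \<circ>\<^sub>c b)" "heq W Y (f \<circ>\<^sub>c a) (f' \<circ>\<^sub>c b)"
  shows "((Z, s, f), (Z', s', f')) \<in> roof_rel A X Y"
  using assms by (auto simp: roof_rel_iff)

lemma roof_rel_equiv:
  assumes X: "X \<in> complexes A" and Y: "Y \<in> complexes A"
  shows "equiv (roofs A X Y) (roof_rel A X Y)"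
proof (rule equivI)
  show "roof_rel A X Y \<subseteq> roofs A X Y \<times> roofs A X Y" by (auto simp: roof_rel_def)
  show "refl_on (roofs A X Y) (roof_rel A X Y)"
  proof (rule refl_onI)
    fix r assume r: "r \<in> roofs A X Y"
    obtain Z s f where e: "r = (Z, s, f)" by (cases r) auto
    then have "Z \<in> complexes A" "s \<in> quasi_isos A Z X" "f \<in> chain_maps A Z Y" using r by (auto simp: in_roofs)
    then show "(r, r) \<in> roof_rel A X Y"
      unfolding e using r[unfolded e] X Y
      by (intro roof_relI[of X Y Z s f Z s f Z cid cid]) (auto simp: quasi_isos_cid ccomp_cid intro: heq_refl quasi_isos_cm)
  qed
  show "sym (roof_rel A X Y)"
  proof (rule symI)
    fix r r' assume "(r, r') \<in> roof_rel A X Y"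
    then show "(r', r) \<in> roof_rel A X Y"
      by (cases r, cases r') (auto simp: roof_rel_iff X Y intro: heq_sym)
  qed
  show "trans (roof_rel A X Y)"
  proof (rule transI)
    fix r1 r2 r3 assume *: "(r1, r2) \<in> roof_rel A X Y" "(r2, r3) \<in> roof_rel A X Y"
    obtain Z1 s1 f1 Z2 s2 f2 Z3 s3 f3 where e: "r1 = (Z1, s1, f1)" "r2 = (Z2, s2, f2)" "r3 = (Z3, s3, f3)"
      by (cases r1, cases r2, cases r3) auto
    obtain W a b where W: "W \<in> complexes A" "a \<in> quasi_isos A W Z1" "b \<in> quasi_isos A W Z2"
      and h: "heq W X (s1 \<circ>\<^sub>c a) (s2 \<circ>\<^sub>c b)" "heq W Y (f1 \<circ>\<^sub>c a) (f2 \<circ>\<^sub>c b)"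
      and r: "r1 \<in> roofs A X Y" "r2 \<in> roofs A X Y"
      using *(1) unfolding e roof_rel_iff[OF X Y] by blast
    obtain W' a' b' where W': "W' \<in> complexes A" "a' \<in> quasi_isos A W' Z2" "b' \<in> quasi_isos A W' Z3"
      and h': "heq W' X (s2 \<circ>\<^sub>c a') (s3 \<circ>\<^sub>c b')" "heq W' Y (f2 \<circ>\<^sub>c a') (f3 \<circ>\<^sub>c b')"
      and r3: "r3 \<in> roofs A X Y"
      using *(2) unfolding e roof_rel_iff[OF X Y] by blast
    have Z: "Z1 \<in> complexes A" "Z2 \<in> complexes A" "Z3 \<in> complexes A"
      and sf: "s2 \<in> chain_maps A Z2 X" "f2 \<in> chain_maps A Z2 Y"
      using r r3 by (auto simp: e in_roofs intro: quasi_isos_cm)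
    \<comment> \<open>The two witnesses W and W' both lie over the middle complex Z2; an Ore square
      over Z2 is the witness for transitivity.\<close>
    obtain P p q where P: "P \<in> complexes A" and p: "p \<in> quasi_isos A P W" and q: "q \<in> chain_maps A P W'"
      and pq: "heq P Z2 (b \<circ>\<^sub>c p) (a' \<circ>\<^sub>c q)"
      by (rule ore[OF W(1) W'(1) Z(2) quasi_isos_cm[OF W(3)] W'(2)])
    have "a' \<circ>\<^sub>c q \<in> quasi_isos A P Z2" using heq_qis[OF pq] quasi_isos_comp[OF p W(3) P W(1) Z(2)] by simp
    from quasi_isos_cancel_left[OF this W'(2) q P W'(1) Z(2)] have qq: "q \<in> quasi_isos A P W'" .
    have chain: "heq P V (k1 \<circ>\<^sub>c (a \<circ>\<^sub>c p)) (k3 \<circ>\<^sub>c (b' \<circ>\<^sub>c q))"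
      if "heq W V (k1 \<circ>\<^sub>c a) (k2 \<circ>\<^sub>c b)" "heq W' V (k2 \<circ>\<^sub>c a') (k3 \<circ>\<^sub>c b')" "k2 \<in> chain_maps A Z2 V" "V \<in> complexes A" for V k1 k2 k3
      using heq_trans[OF heq_trans[OF heq_right[OF that(1) quasi_isos_cm[OF p] P, unfolded ccomp_assoc]
            heq_left[OF pq that(3,4), unfolded ccomp_assoc]] heq_right[OF that(2) q P, unfolded ccomp_assoc]] .
    show "(r1, r3) \<in> roof_rel A X Y"
      unfolding e using r(1) r3 unfolding e
      by (intro roof_relI[of X Y Z1 s1 f1 Z3 s3 f3 P "a \<circ>\<^sub>c p" "b' \<circ>\<^sub>c q"] X Y P quasi_isos_comp[OF p W(2) P W(1) Z(1)]
          quasi_isos_comp[OF qq W'(3) P W'(1) Z(3)] chain[OF h(1) h'(1) sf(1) X] chain[OF h(2) h'(2) sf(2) Y])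
  qed
qed

lemma roof_class_eq_iff:
  assumes "X \<in> complexes A" "Y \<in> complexes A" "r \<in> roofs A X Y" "r' \<in> roofs A X Y"
  shows "roof_class X Y r = roof_class X Y r' \<longleftrightarrow> (r, r') \<in> roof_rel A X Y"
  unfolding roof_class_def by (rule eq_equiv_class_iff[OF roof_rel_equiv assms(3,4)]) (rule assms)+

lemma roof_class_D_hom:
  assumes "r \<in> roofs A X Y"
  shows "roof_class X Y r \<in> D_hom A X Y"
  unfolding roof_class_def D_hom_def by (rule quotientI[OF assms])

lemma D_hom_cases:
  assumes "\<alpha> \<in> D_hom A X Y"
  obtains Z s f where "(Z, s, f) \<in> roofs A X Y" "\<alpha> = roof_class X Y (Z, s, f)"
  using assms unfolding D_hom_def roof_class_def quotient_def by auto

lemma in_roof_class: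
  assumes "X \<in> complexes A" "Y \<in> complexes A" "r \<in> roofs A X Y"
  shows "r' \<in> roof_class X Y r \<longleftrightarrow> r' \<in> roofs A X Y \<and> roof_class X Y r = roof_class X Y r'"
proof -
  have "(r, r') \<in> roof_rel A X Y \<Longrightarrow> r' \<in> roofs A X Y" by (auto simp: roof_rel_def)
  moreover have "r' \<in> roof_class X Y r \<longleftrightarrow> (r, r') \<in> roof_rel A X Y" by (simp add: roof_class_def)
  ultimately show ?thesis using roof_class_eq_iff[OF assms, of r'] by blast
qed

section \<open>Composition of roofs\<close>

definition completion :: "'u cochain \<Rightarrow> 'u cochain \<Rightarrow> 'u cochain \<Rightarrow> 'u cmap \<Rightarrow> 'u cmap \<Rightarrow> 'u cochain \<Rightarrow> 'u cmap \<Rightarrow> 'u cmap \<Rightarrow> bool"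
  where "completion Z Y W f t P p q \<longleftrightarrow> P \<in> complexes A \<and> p \<in> quasi_isos A P Z \<and> q \<in> chain_maps A P W \<and>
    heq P Y (f \<circ>\<^sub>c p) (t \<circ>\<^sub>c q)"

lemma ex_completion:
  assumes "(Z, s, f) \<in> roofs A X Y" "(W, t, g) \<in> roofs A Y V" "Y \<in> complexes A"
  obtains P p q where "completion Z Y W f t P p q"
proof -
  have "Z \<in> complexes A" "W \<in> complexes A" "f \<in> chain_maps A Z Y" "t \<in> quasi_isos A W Y"
    using assms by (auto simp: in_roofs)
  then show ?thesis using ore[of Z W Y f t] that assms(3) unfolding completion_def by metis
qed

context
  fixes X Y V :: "'u cochain"
  assumes XYV: "X \<in> complexes A" "Y \<in> complexes A" "V \<in> complexes A"
begin

lemma completion_roof: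
  assumes "(Z, s, f) \<in> roofs A X Y" "(W, t, g) \<in> roofs A Y V" "completion Z Y W f t P p q"
  shows "(P, s \<circ>\<^sub>c p, g \<circ>\<^sub>c q) \<in> roofs A X V"
  using assms XYV by (auto simp: in_roofs completion_def intro: quasi_isos_comp cm_comp quasi_isos_cm)

text \<open>Two completions are first compared over Z by \<open>ore\<close>. The legs to W then
  agree only after composition with \<open>t\<close>, and \<open>cancel\<close> removes
  \<open>t\<close> at the price of one more refinement.\<close>

lemma completion_unique:
  assumes Z: "(Z, s, f) \<in> roofs A X Y" and W: "(W, t, g) \<in> roofs A Y V"
    and c: "completion Z Y W f t P p q" and c': "completion Z Y W f t P' p' q'"
  shows "((P, s \<circ>\<^sub>c p, g \<circ>\<^sub>c q), (P', s \<circ>\<^sub>c p', g \<circ>\<^sub>c q')) \<in> roof_rel A X V"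
proof -
  have Zc: "Z \<in> complexes A" "s \<in> quasi_isos A Z X" "s \<in> chain_maps A Z X" "f \<in> chain_maps A Z Y"
    and Wc: "W \<in> complexes A" "t \<in> quasi_isos A W Y" "t \<in> chain_maps A W Y" "g \<in> chain_maps A W V"
    and P: "P \<in> complexes A" "p \<in> quasi_isos A P Z" "p \<in> chain_maps A P Z" "q \<in> chain_maps A P W" "heq P Y (f \<circ>\<^sub>c p) (t \<circ>\<^sub>c q)"
    and P': "P' \<in> complexes A" "p' \<in> quasi_isos A P' Z" "p' \<in> chain_maps A P' Z" "q' \<in> chain_maps A P' W" "heq P' Y (f \<circ>\<^sub>c p') (t \<circ>\<^sub>c q')"
    using assms by (auto simp: in_roofs completion_def quasi_isos_cm)
  obtain R u u' where R: "R \<in> complexes A" and u: "u \<in> quasi_isos A R P" and u': "u' \<in> chain_maps A R P'"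
    and uu: "heq R Z (p \<circ>\<^sub>c u) (p' \<circ>\<^sub>c u')"
    by (rule ore[OF P(1) P'(1) Zc(1) P(3) P'(2)])
  note uc = quasi_isos_cm[OF u]
  have "p' \<circ>\<^sub>c u' \<in> quasi_isos A R Z" using heq_qis[OF uu] quasi_isos_comp[OF u P(2) R P(1) Zc(1)] by simp
  from quasi_isos_cancel_left[OF this P'(2) u' R P'(1) Zc(1)] have u'q: "u' \<in> quasi_isos A R P'" .
  have "heq R Y (t \<circ>\<^sub>c (q \<circ>\<^sub>c u)) (t \<circ>\<^sub>c (q' \<circ>\<^sub>c u'))"
    using heq_trans[OF heq_trans[OF heq_sym[OF heq_right[OF P(5) uc R, unfolded ccomp_assoc]]
          heq_left[OF uu Zc(4) XYV(2), unfolded ccomp_assoc]] heq_right[OF P'(5) u' R, unfolded ccomp_assoc]] .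
  then obtain R' v where R': "R' \<in> complexes A" and v: "v \<in> quasi_isos A R' R"
    and qq: "heq R' W ((q \<circ>\<^sub>c u) \<circ>\<^sub>c v) ((q' \<circ>\<^sub>c u') \<circ>\<^sub>c v)"
    by (rule cancel[OF R Wc(1) XYV(2) cm_comp[OF uc P(4)] cm_comp[OF u' P'(4)] Wc(2)])
  show ?thesis
  proof (rule roof_relI[where a = "u \<circ>\<^sub>c v" and b = "u' \<circ>\<^sub>c v" and W = R'])
    show "heq R' X ((s \<circ>\<^sub>c p) \<circ>\<^sub>c (u \<circ>\<^sub>c v)) ((s \<circ>\<^sub>c p') \<circ>\<^sub>c (u' \<circ>\<^sub>c v))"
      using heq_left[OF heq_right[OF uu quasi_isos_cm[OF v] R'] Zc(3) XYV(1)] by (simp add: ccomp_assoc)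
    show "heq R' V ((g \<circ>\<^sub>c q) \<circ>\<^sub>c (u \<circ>\<^sub>c v)) ((g \<circ>\<^sub>c q') \<circ>\<^sub>c (u' \<circ>\<^sub>c v))"
      using heq_left[OF qq Wc(4) XYV(3)] by (simp add: ccomp_assoc)
  qed (use XYV assms R' in \<open>auto intro: completion_roof quasi_isos_comp[OF v u R' R P(1)] quasi_isos_comp[OF v u'q R' R P'(1)]\<close>)
qed

text \<open>Independence of the representative of the first morphism: one Ore square over the common
  refinement U completes both roofs.\<close>

lemma completion_left:
  assumes Z: "((Z, s, f), (Z', s', f')) \<in> roof_rel A X Y" and W: "(W, t, g) \<in> roofs A Y V"
  obtains P p q P' p' q' where "completion Z Y W f t P p q" "completion Z' Y W f' t P' p' q'"
    "((P, s \<circ>\<^sub>c p, g \<circ>\<^sub>c q), (P', s' \<circ>\<^sub>c p', g \<circ>\<^sub>c q')) \<in> roof_rel A X V"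
proof -
  obtain U a b where r: "(Z, s, f) \<in> roofs A X Y" "(Z', s', f') \<in> roofs A X Y" and U: "U \<in> complexes A"
    and a: "a \<in> quasi_isos A U Z" and b: "b \<in> quasi_isos A U Z'"
    and h: "heq U X (s \<circ>\<^sub>c a) (s' \<circ>\<^sub>c b)" "heq U Y (f \<circ>\<^sub>c a) (f' \<circ>\<^sub>c b)"
    using Z unfolding roof_rel_iff[OF XYV(1,2)] by blast
  have Zc: "Z \<in> complexes A" "Z' \<in> complexes A" "f \<in> chain_maps A Z Y" "f' \<in> chain_maps A Z' Y"
    and Wc: "W \<in> complexes A" "t \<in> quasi_isos A W Y" "g \<in> chain_maps A W V"
    using r W by (auto simp: in_roofs)
  obtain P p q where P: "P \<in> complexes A" and p: "p \<in> quasi_isos A P U" and q: "q \<in> chain_maps A P W"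
    and pq: "heq P Y ((f \<circ>\<^sub>c a) \<circ>\<^sub>c p) (t \<circ>\<^sub>c q)"
    by (rule ore[OF U Wc(1) XYV(2) cm_comp[OF quasi_isos_cm[OF a] Zc(3)] Wc(2)])
  note pc = quasi_isos_cm[OF p]
  have c: "completion Z Y W f t P (a \<circ>\<^sub>c p) q"
    using P q pq quasi_isos_comp[OF p a P U Zc(1)] by (simp add: completion_def ccomp_assoc)
  have c': "completion Z' Y W f' t P (b \<circ>\<^sub>c p) q"
    using P q heq_trans[OF heq_sym[OF heq_right[OF h(2) pc P]] pq] quasi_isos_comp[OF p b P U Zc(2)] by (simp add: completion_def ccomp_assoc)
  show ?thesis
  proof (rule that[OF c c'], rule roof_relI[where W = P and a = cid and b = cid])
    show "heq P X ((s \<circ>\<^sub>c (a \<circ>\<^sub>c p)) \<circ>\<^sub>c cid) ((s' \<circ>\<^sub>c (b \<circ>\<^sub>c p)) \<circ>\<^sub>c cid)"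
      using heq_right[OF h(1) pc P] by (simp add: ccomp_cid ccomp_assoc)
    show "heq P V ((g \<circ>\<^sub>c q) \<circ>\<^sub>c cid) ((g \<circ>\<^sub>c q) \<circ>\<^sub>c cid)"
      by (simp add: ccomp_cid heq_refl P XYV cm_comp[OF q Wc(3)])
  qed (use XYV P r W c c' in \<open>auto intro: completion_roof quasi_isos_cid\<close>)
qed

text \<open>Independence of the representative of the second morphism, again by an Ore square
  against a common refinement, here of W and W'.\<close>

lemma completion_right:
  assumes Z: "(Z, s, f) \<in> roofs A X Y" and W: "((W, t, g), (W', t', g')) \<in> roof_rel A Y V"
  obtains P p q P' p' q' where "completion Z Y W f t P p q" "completion Z Y W' f t' P' p' q'"
    "((P, s \<circ>\<^sub>c p, g \<circ>\<^sub>c q), (P', s \<circ>\<^sub>c p', g' \<circ>\<^sub>c q')) \<in> roof_rel A X V"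
proof -
  obtain U a b where r: "(W, t, g) \<in> roofs A Y V" "(W', t', g') \<in> roofs A Y V" and U: "U \<in> complexes A"
    and a: "a \<in> quasi_isos A U W" and b: "b \<in> quasi_isos A U W'"
    and h: "heq U Y (t \<circ>\<^sub>c a) (t' \<circ>\<^sub>c b)" "heq U V (g \<circ>\<^sub>c a) (g' \<circ>\<^sub>c b)"
    using W unfolding roof_rel_iff[OF XYV(2,3)] by blast
  have Zc: "Z \<in> complexes A" "f \<in> chain_maps A Z Y" "s \<in> chain_maps A Z X"
    and Wc: "W \<in> complexes A" "t \<in> quasi_isos A W Y"
    using r Z by (auto simp: in_roofs quasi_isos_cm)
  obtain P p q where P: "P \<in> complexes A" and p: "p \<in> quasi_isos A P Z" and q: "q \<in> chain_maps A P U"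
    and pq: "heq P Y (f \<circ>\<^sub>c p) ((t \<circ>\<^sub>c a) \<circ>\<^sub>c q)"
    by (rule ore[OF Zc(1) U XYV(2) Zc(2) quasi_isos_comp[OF a Wc(2) U Wc(1) XYV(2)]])
  have c: "completion Z Y W f t P p (a \<circ>\<^sub>c q)"
    using P p pq cm_comp[OF q quasi_isos_cm[OF a]] by (simp add: completion_def ccomp_assoc)
  have c': "completion Z Y W' f t' P p (b \<circ>\<^sub>c q)"
    using P p heq_trans[OF pq heq_right[OF h(1) q P]] cm_comp[OF q quasi_isos_cm[OF b]] by (simp add: completion_def ccomp_assoc)
  show ?thesis
  proof (rule that[OF c c'], rule roof_relI[where W = P and a = cid and b = cid])
    show "heq P V ((g \<circ>\<^sub>c (a \<circ>\<^sub>c q)) \<circ>\<^sub>c cid) ((g' \<circ>\<^sub>c (b \<circ>\<^sub>c q)) \<circ>\<^sub>c cid)"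
      using heq_right[OF h(2) q P] by (simp add: ccomp_cid ccomp_assoc)
    show "heq P X ((s \<circ>\<^sub>c p) \<circ>\<^sub>c cid) ((s \<circ>\<^sub>c p) \<circ>\<^sub>c cid)"
      by (simp add: ccomp_cid heq_refl P XYV cm_comp[OF quasi_isos_cm[OF p] Zc(3)])
  qed (use XYV P r Z c c' in \<open>auto intro: completion_roof quasi_isos_cid\<close>)
qed

text \<open>\<open>D_comp\<close> collects the results of all choices of representatives and
  completions. The three comparison lemmas show that all choices give one class, so a composite may
  be computed from any single completion.\<close>

lemma D_comp_roofs:
  assumes Z: "(Z, s, f) \<in> roofs A X Y" and W: "(W, t, g) \<in> roofs A Y V" and c: "completion Z Y W f t P p q"
  shows "D_comp A X Y V (roof_class Y V (W, t, g)) (roof_class X Y (Z, s, f)) = roof_class X V (P, s \<circ>\<^sub>c p, g \<circ>\<^sub>c q)"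
proof -
  let ?C = "roof_class X V"
  note eqC = roof_class_eq_iff[OF XYV(1,3)]
  have main: "?C (P', s' \<circ>\<^sub>c p', g' \<circ>\<^sub>c q') = ?C (P, s \<circ>\<^sub>c p, g \<circ>\<^sub>c q)"
    if Z': "(Z', s', f') \<in> roof_class X Y (Z, s, f)" and W': "(W', t', g') \<in> roof_class Y V (W, t, g)"
      and c': "completion Z' Y W' f' t' P' p' q'" for Z' s' f' W' t' g' P' p' q'
  proof -
    have ZZ: "((Z, s, f), (Z', s', f')) \<in> roof_rel A X Y" and WW: "((W, t, g), (W', t', g')) \<in> roof_rel A Y V"
      using Z' W' by (auto simp: roof_class_def)
    have Z'r: "(Z', s', f') \<in> roofs A X Y" and W'r: "(W', t', g') \<in> roofs A Y V"
      using ZZ WW by (auto simp: roof_rel_def)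
    obtain P1 p1 q1 P2 p2 q2 where 1: "completion Z Y W f t P1 p1 q1" "completion Z' Y W f' t P2 p2 q2"
      "((P1, s \<circ>\<^sub>c p1, g \<circ>\<^sub>c q1), (P2, s' \<circ>\<^sub>c p2, g \<circ>\<^sub>c q2)) \<in> roof_rel A X V"
      by (rule completion_left[OF ZZ W])
    obtain P3 p3 q3 P4 p4 q4 where 2: "completion Z' Y W f' t P3 p3 q3" "completion Z' Y W' f' t' P4 p4 q4"
      "((P3, s' \<circ>\<^sub>c p3, g \<circ>\<^sub>c q3), (P4, s' \<circ>\<^sub>c p4, g' \<circ>\<^sub>c q4)) \<in> roof_rel A X V"
      by (rule completion_right[OF Z'r WW])
    have rC: "?C (Q, a, b) = ?C (Q', a', b')" if "((Q, a, b), (Q', a', b')) \<in> roof_rel A X V" for Q a b Q' a' b'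
      using that equiv_class_eq[OF roof_rel_equiv[OF XYV(1,3)]] by (simp add: roof_class_def)
    \<comment> \<open>The first roof is exchanged, then the second; between the exchanges
      \<open>completion_unique\<close> passes from one completion to another.\<close>
    have "?C (P, s \<circ>\<^sub>c p, g \<circ>\<^sub>c q) = ?C (P1, s \<circ>\<^sub>c p1, g \<circ>\<^sub>c q1)" by (rule rC[OF completion_unique[OF Z W c 1(1)]])
    also have "\<dots> = ?C (P2, s' \<circ>\<^sub>c p2, g \<circ>\<^sub>c q2)" by (rule rC[OF 1(3)])
    also have "\<dots> = ?C (P3, s' \<circ>\<^sub>c p3, g \<circ>\<^sub>c q3)" by (rule rC[OF completion_unique[OF Z'r W 1(2) 2(1)]])
    also have "\<dots> = ?C (P4, s' \<circ>\<^sub>c p4, g' \<circ>\<^sub>c q4)" by (rule rC[OF 2(3)])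
    also have "\<dots> = ?C (P', s' \<circ>\<^sub>c p', g' \<circ>\<^sub>c q')" by (rule rC[OF completion_unique[OF Z'r W'r 2(2) c']])
    finally show ?thesis by simp
  qed
  have compl: "completion Z' Y W' f' t' P' p' q'"
    if "(Z', s', f') \<in> roof_class X Y (Z, s, f)" "(W', t', g') \<in> roof_class Y V (W, t, g)"
      "P' \<in> complexes A" "p' \<in> quasi_isos A P' Z'" "q' \<in> chain_maps A P' W'" "homotopic A P' Y (f' \<circ>\<^sub>c p') (t' \<circ>\<^sub>c q')"
    for Z' s' f' W' t' g' P' p' q'
  proof -
    have "(Z', s', f') \<in> roofs A X Y" "(W', t', g') \<in> roofs A Y V"
      using that in_roof_class[OF XYV(1,2) Z] in_roof_class[OF XYV(2,3) W] by auto
    then show ?thesis using that XYV by (auto simp: completion_def heq_def in_roofs intro: cm_comp quasi_isos_cm)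
  qed
  have self: "(Z, s, f) \<in> roof_class X Y (Z, s, f)" "(W, t, g) \<in> roof_class Y V (W, t, g)"
    using Z W by (simp_all add: in_roof_class XYV)
  show ?thesis
  proof (intro equalityI subsetI)
    fix r assume "r \<in> D_comp A X Y V (roof_class Y V (W, t, g)) (roof_class X Y (Z, s, f))"
    then obtain Z' s' f' W' t' g' P' p' q' where
      *: "(Z', s', f') \<in> roof_class X Y (Z, s, f)" "(W', t', g') \<in> roof_class Y V (W, t, g)"
      "P' \<in> complexes A" "p' \<in> quasi_isos A P' Z'" "q' \<in> chain_maps A P' W'" "homotopic A P' Y (f' \<circ>\<^sub>c p') (t' \<circ>\<^sub>c q')"
      and r: "r \<in> ?C (P', s' \<circ>\<^sub>c p', g' \<circ>\<^sub>c q')"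
      unfolding D_comp_def roof_class_def by blast
    then show "r \<in> ?C (P, s \<circ>\<^sub>c p, g \<circ>\<^sub>c q)" using main[OF *(1,2) compl[OF *]] by simp
  next
    fix r assume "r \<in> ?C (P, s \<circ>\<^sub>c p, g \<circ>\<^sub>c q)"
    then show "r \<in> D_comp A X Y V (roof_class Y V (W, t, g)) (roof_class X Y (Z, s, f))"
      using self c unfolding D_comp_def completion_def heq_def roof_class_def Image_singleton_iff mem_Collect_eq by blast
  qed
qed

end

lemma D_comp_closed:
  assumes "X \<in> complexes A" "Y \<in> complexes A" "V \<in> complexes A" "\<alpha> \<in> D_hom A X Y" "\<beta> \<in> D_hom A Y V"
  shows "D_comp A X Y V \<beta> \<alpha> \<in> D_hom A X V"
proof -
  obtain Z s f where Z: "(Z, s, f) \<in> roofs A X Y" "\<alpha> = roof_class X Y (Z, s, f)" using assms(4) by (rule D_hom_cases)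
  obtain W t g where W: "(W, t, g) \<in> roofs A Y V" "\<beta> = roof_class Y V (W, t, g)" using assms(5) by (rule D_hom_cases)
  obtain P p q where c: "completion Z Y W f t P p q" by (rule ex_completion[OF Z(1) W(1) assms(2)])
  show ?thesis unfolding Z W D_comp_roofs[OF assms(1-3) Z(1) W(1) c]
    by (rule roof_class_D_hom[OF completion_roof[OF assms(1-3) Z(1) W(1) c]])
qed

text \<open>One further Ore square R over P -> W <- Q completes both bracketings, and the two
  resulting roofs coincide.\<close>

lemma D_comp_assoc:
  assumes X: "X \<in> complexes A" and Y: "Y \<in> complexes A" and V: "V \<in> complexes A" and U: "U \<in> complexes A"
    and "\<alpha> \<in> D_hom A X Y" "\<beta> \<in> D_hom A Y V" "\<gamma> \<in> D_hom A V U"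
  shows "D_comp A X V U \<gamma> (D_comp A X Y V \<beta> \<alpha>) = D_comp A X Y U (D_comp A Y V U \<gamma> \<beta>) \<alpha>"
proof -
  obtain Z s f where Z: "(Z, s, f) \<in> roofs A X Y" "\<alpha> = roof_class X Y (Z, s, f)" using assms(5) by (rule D_hom_cases)
  obtain W t g where W: "(W, t, g) \<in> roofs A Y V" "\<beta> = roof_class Y V (W, t, g)" using assms(6) by (rule D_hom_cases)
  obtain S v h where S: "(S, v, h) \<in> roofs A V U" "\<gamma> = roof_class V U (S, v, h)" using assms(7) by (rule D_hom_cases)
  obtain P p q where c: "completion Z Y W f t P p q" by (rule ex_completion[OF Z(1) W(1) Y])
  obtain Q p' q' where c': "completion W V S g v Q p' q'" by (rule ex_completion[OF W(1) S(1) V])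
  have P: "P \<in> complexes A" "q \<in> chain_maps A P W" "heq P Y (f \<circ>\<^sub>c p) (t \<circ>\<^sub>c q)" "p \<in> quasi_isos A P Z"
    and Q: "Q \<in> complexes A" "p' \<in> quasi_isos A Q W" "q' \<in> chain_maps A Q S" "heq Q V (g \<circ>\<^sub>c p') (v \<circ>\<^sub>c q')"
    and Wc: "W \<in> complexes A" "t \<in> chain_maps A W Y" "g \<in> chain_maps A W V" and Zc: "Z \<in> complexes A"
    using c c' W Z by (auto simp: completion_def in_roofs quasi_isos_cm)
  obtain R r r' where R: "R \<in> complexes A" and r: "r \<in> quasi_isos A R P" and r': "r' \<in> chain_maps A R Q"
    and rr: "heq R W (q \<circ>\<^sub>c r) (p' \<circ>\<^sub>c r')"
    by (rule ore[OF P(1) Q(1) Wc(1) P(2) Q(2)])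
  note rc = quasi_isos_cm[OF r]
  note PR = completion_roof[OF X Y V Z(1) W(1) c]
  note QR = completion_roof[OF Y V U W(1) S(1) c']
  have 1: "completion P V S (g \<circ>\<^sub>c q) v R r (q' \<circ>\<^sub>c r')"
    unfolding completion_def
    using R r cm_comp[OF r' Q(3)] heq_trans[OF heq_left[OF rr Wc(3) V] heq_right[OF Q(4) r' R, unfolded ccomp_assoc]]
    by (simp add: ccomp_assoc)
  have 2: "completion Z Y Q f (t \<circ>\<^sub>c p') R (p \<circ>\<^sub>c r) r'"
    unfolding completion_def
    using R quasi_isos_comp[OF r P(4) R P(1) Zc] r' heq_trans[OF heq_right[OF P(3) rc R] heq_left[OF rr Wc(2) Y, folded ccomp_assoc]]
    by (simp add: ccomp_assoc)
  show ?thesis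
    unfolding Z(2) W(2) S(2) D_comp_roofs[OF X Y V Z(1) W(1) c] D_comp_roofs[OF Y V U W(1) S(1) c']
      D_comp_roofs[OF X V U PR S(1) 1] D_comp_roofs[OF X Y U Z(1) QR 2]
    by (simp add: ccomp_assoc)
qed

lemma cid_roof: "X \<in> complexes A \<Longrightarrow> f \<in> chain_maps A X Y \<Longrightarrow> (X, cid, f) \<in> roofs A X Y"
  by (simp add: in_roofs quasi_isos_cid)

lemma D_map_class: "D_map A X Y f = roof_class X Y (X, cid, f)"
  by (simp add: D_map_def roof_class_def)

lemma D_map_D_hom: "X \<in> complexes A \<Longrightarrow> f \<in> chain_maps A X Y \<Longrightarrow> D_map A X Y f \<in> D_hom A X Y"
  unfolding D_map_class by (rule roof_class_D_hom[OF cid_roof])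

lemma D_id_D_hom: "X \<in> complexes A \<Longrightarrow> D_id A X \<in> D_hom A X X"
  unfolding D_id_def by (rule D_map_D_hom[OF _ cm_id])

lemma D_comp_map_left:
  assumes "X \<in> complexes A" "Y \<in> complexes A" "V \<in> complexes A" "(Z, s, f) \<in> roofs A X Y" "g \<in> chain_maps A Y V"
  shows "D_comp A X Y V (D_map A Y V g) (roof_class X Y (Z, s, f)) = roof_class X V (Z, s, g \<circ>\<^sub>c f)"
proof -
  have "completion Z Y Y f cid Z cid f"
    using assms by (auto simp: completion_def in_roofs quasi_isos_cid ccomp_cid intro: heq_refl)
  from D_comp_roofs[OF assms(1-4) cid_roof[OF assms(2,5)] this] show ?thesis by (simp add: D_map_class ccomp_cid)
qed

lemma D_comp_id_left: "X \<in> complexes A \<Longrightarrow> Y \<in> complexes A \<Longrightarrow> \<alpha> \<in> D_hom A X Y \<Longrightarrow> D_comp A X Y Y (D_id A Y) \<alpha> = \<alpha>"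
  using D_comp_map_left[OF _ _ _ _ cm_id] by (metis D_hom_cases D_id_def ccomp_cid(2))

lemma D_comp_map_right:
  assumes "X \<in> complexes A" "Y \<in> complexes A" "V \<in> complexes A" "f \<in> chain_maps A X Y" "(W, t, g) \<in> roofs A Y V"
    "P \<in> complexes A" "p \<in> quasi_isos A P X" "q \<in> chain_maps A P W" "heq P Y (f \<circ>\<^sub>c p) (t \<circ>\<^sub>c q)"
  shows "D_comp A X Y V (roof_class Y V (W, t, g)) (D_map A X Y f) = roof_class X V (P, p, g \<circ>\<^sub>c q)"
proof -
  have "completion X Y W f t P p q"
    using assms by (auto simp: completion_def)
  from D_comp_roofs[OF assms(1-3) cid_roof[OF assms(1,4)] assms(5) this] show ?thesis by (simp add: D_map_class ccomp_cid)
qed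

lemma D_comp_id_right:
  assumes X: "X \<in> complexes A" and Y: "Y \<in> complexes A" and "\<alpha> \<in> D_hom A X Y"
  shows "D_comp A X X Y \<alpha> (D_id A X) = \<alpha>"
proof -
  obtain Z s f where Z: "(Z, s, f) \<in> roofs A X Y" "\<alpha> = roof_class X Y (Z, s, f)" using assms(3) by (rule D_hom_cases)
  then have "Z \<in> complexes A" "s \<in> quasi_isos A Z X" by (auto simp: in_roofs)
  then show ?thesis unfolding Z(2) D_id_def
    by (subst D_comp_map_right[OF X X Y cm_id Z(1), of Z s cid]) (auto simp: ccomp_cid cm_id quasi_isos_cm X intro: heq_refl)
qed

text \<open>The inverse of the class of \<open>s\<close> is the roof with left leg \<open>s\<close>
  and the identity as right leg.\<close>

lemma quasi_iso_D_isos: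
  assumes Z: "Z \<in> complexes A" and X: "X \<in> complexes A" and s: "s \<in> quasi_isos A Z X"
  shows "D_isos A Z X \<noteq> {}" "D_isos A X Z \<noteq> {}"
proof -
  note sc = quasi_isos_cm[OF s]
  let ?b = "roof_class X Z (Z, s, cid)"
  have r: "(Z, s, cid) \<in> roofs A X Z" using Z s cm_id by (simp add: in_roofs)
  have m: "D_map A Z X s \<in> D_hom A Z X" by (rule D_map_D_hom[OF Z sc])
  have b: "?b \<in> D_hom A X Z" by (rule roof_class_D_hom[OF r])
  have 1: "D_comp A Z X Z ?b (D_map A Z X s) = D_id A Z"
    by (subst D_comp_map_right[OF Z X Z sc r Z quasi_isos_cid[OF Z] cm_id])
      (auto simp: ccomp_cid D_id_def D_map_class intro: heq_refl Z X sc)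
  have "((Z, s, s), (X, cid, cid)) \<in> roof_rel A X X"
    by (rule roof_relI[of X X Z s s X cid cid Z cid s])
      (auto simp: in_roofs Z X s sc quasi_isos_cid cm_id ccomp_cid intro: heq_refl)
  then have "roof_class X X (Z, s, s) = roof_class X X (X, cid, cid)"
    by (subst roof_class_eq_iff) (auto simp: in_roofs Z X s sc quasi_isos_cid cm_id)
  then have 2: "D_comp A X Z X (D_map A Z X s) ?b = D_id A X"
    by (subst D_comp_map_left[OF X Z X r sc]) (auto simp: ccomp_cid D_id_def D_map_class)
  show "D_isos A Z X \<noteq> {}" "D_isos A X Z \<noteq> {}"
    unfolding D_isos_def using m b 1 2 by blast+
qed

lemma D_isos_id: "X \<in> complexes A \<Longrightarrow> D_id A X \<in> D_isos A X X"
  unfolding D_isos_def using D_id_D_hom D_comp_id_left by blast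

text \<open>An isomorphism of the derived category induces isomorphisms in cohomology, so its right leg is a quasi-isomorphism.\<close>

lemma D_isos_quasi_isos:
  assumes "D_isos A X Y \<noteq> {}" and X: "X \<in> complexes A" and Y: "Y \<in> complexes A"
  obtains Z s f where "Z \<in> complexes A" "s \<in> quasi_isos A Z X" "f \<in> quasi_isos A Z Y"
proof -
  obtain \<alpha> \<beta> where \<alpha>: "\<alpha> \<in> D_hom A X Y" and \<beta>: "\<beta> \<in> D_hom A Y X"
    and c: "D_comp A X Y X \<beta> \<alpha> = D_id A X" "D_comp A Y X Y \<alpha> \<beta> = D_id A Y"
    using assms(1) by (auto simp: D_isos_def)
  obtain Z s f where Z: "(Z, s, f) \<in> roofs A X Y" "\<alpha> = roof_class X Y (Z, s, f)" using \<alpha> by (rule D_hom_cases)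
  obtain W t g where W: "(W, t, g) \<in> roofs A Y X" "\<beta> = roof_class Y X (W, t, g)" using \<beta> by (rule D_hom_cases)
  have Zc: "Z \<in> complexes A" "s \<in> quasi_isos A Z X" "f \<in> chain_maps A Z Y"
    and Wc: "W \<in> complexes A" "t \<in> quasi_isos A W Y" "g \<in> chain_maps A W X"
    using Z W by (auto simp: in_roofs)
  \<comment> \<open>Stated for arbitrary roofs so that it applies to both composites: a composite
    equal to the identity is homotopic to a quasi-isomorphism after refinement, hence its right leg
    is a quasi-isomorphism.\<close>
  have half: "\<exists>P p q. completion Z Y W f t P p q \<and> g \<circ>\<^sub>c q \<in> quasi_isos A P X"
    if "D_comp A X Y X (roof_class Y X (W, t, g)) (roof_class X Y (Z, s, f)) = D_id A X"
      and Z: "(Z, s, f) \<in> roofs A X Y" and W: "(W, t, g) \<in> roofs A Y X" and X: "X \<in> complexes A" and Y: "Y \<in> complexes A"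
    for X Y Z s f W t g
  proof -
    obtain P p q where c: "completion Z Y W f t P p q" by (rule ex_completion[OF Z W Y])
    note r = completion_roof[OF X Y X Z W c]
    have "roof_class X X (P, s \<circ>\<^sub>c p, g \<circ>\<^sub>c q) = roof_class X X (X, cid, cid)"
      using that(1) D_comp_roofs[OF X Y X Z W c] by (simp add: D_id_def D_map_class)
    then have "((P, s \<circ>\<^sub>c p, g \<circ>\<^sub>c q), (X, cid, cid)) \<in> roof_rel A X X"
      using r by (subst (asm) roof_class_eq_iff) (auto simp: cid_roof X cm_id)
    then obtain U a b where U: "U \<in> complexes A" "a \<in> quasi_isos A U P" "b \<in> quasi_isos A U X" "heq U X ((g \<circ>\<^sub>c q) \<circ>\<^sub>c a) b"
      unfolding roof_rel_iff[OF X X] ccomp_cid by blast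
    have "(g \<circ>\<^sub>c q) \<circ>\<^sub>c a \<in> quasi_isos A U X" using heq_qis[OF U(4)] U(3) by simp
    moreover have "P \<in> complexes A" "g \<circ>\<^sub>c q \<in> chain_maps A P X" using r by (auto simp: in_roofs)
    ultimately have "g \<circ>\<^sub>c q \<in> quasi_isos A P X"
      using U(1,2) X homology_inj_cancel_surj[of U X "g \<circ>\<^sub>c q" a P] homology_surj_cancel[of U X "g \<circ>\<^sub>c q" a P]
      by (auto simp: quasi_isos_iff)
    then show ?thesis using c by blast
  qed
  obtain P p q where P: "completion Z Y W f t P p q" "g \<circ>\<^sub>c q \<in> quasi_isos A P X"
    using half[OF c(1)[unfolded Z(2) W(2)] Z(1) W(1) X Y] by blast
  obtain P' p' q' where P': "completion W X Z g s P' p' q'" "f \<circ>\<^sub>c q' \<in> quasi_isos A P' Y"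
    using half[OF c(2)[unfolded Z(2) W(2)] W(1) Z(1) Y X] by blast
  have Pc: "P \<in> complexes A" "p \<in> quasi_isos A P Z" "q \<in> chain_maps A P W" "heq P Y (f \<circ>\<^sub>c p) (t \<circ>\<^sub>c q)"
    and P'c: "P' \<in> complexes A" "q' \<in> chain_maps A P' Z"
    using P(1) P'(1) by (auto simp: completion_def)
  \<comment> \<open>Since \<open>g\<close> after \<open>q\<close> is a quasi-isomorphism,
    \<open>q\<close> is injective in cohomology, and so is \<open>t\<close> after \<open>q\<close>,
    which is homotopic to \<open>f\<close> after \<open>p\<close>. As \<open>p\<close> is surjective
    in cohomology, \<open>f\<close> is injective. Surjectivity of \<open>f\<close> comes from the
    other composite.\<close>
  have "cmap_homology_inj P W q" using P(2) Wc Pc X by (auto simp: quasi_isos_iff intro: homology_inj_cancel)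
  then have "cmap_homology_inj P Y (t \<circ>\<^sub>c q)" using Wc Pc Y by (auto simp: quasi_isos_iff intro: homology_inj_comp)
  then have "cmap_homology_inj P Y (f \<circ>\<^sub>c p)"
    using heq_sym[OF Pc(4)] by (auto simp: heq_def intro: homology_inj_homotopic)
  then have "cmap_homology_inj Z Y f"
    using Pc Zc Y homology_inj_cancel_surj[of P Y f p Z] by (auto simp: quasi_isos_iff)
  moreover have "cmap_homology_surj Z Y f"
    using P'(2) P'c Zc Y homology_surj_cancel[of P' Y f q' Z] by (auto simp: quasi_isos_iff)
  ultimately have "f \<in> quasi_isos A Z Y" using Zc Y by (simp add: quasi_isos_iff)
  then show ?thesis using that Zc by blast
qed

end

section \<open>Direct sums and products of complexes\<close>

definition copairing :: "'u set \<Rightarrow> ('u \<Rightarrow> ('u, 'u) module) \<Rightarrow> ('u, 'u) module \<Rightarrow> ('u \<Rightarrow> 'u \<Rightarrow> 'u) \<Rightarrow> 'u \<Rightarrow> 'u"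
  where "copairing I X N f u = (\<Oplus>\<^bsub>N\<^esub>i\<in>{i \<in> I. up u i \<noteq> \<zero>\<^bsub>X i\<^esub>}. f i (up u i))"

definition cprod :: "bool \<Rightarrow> 'u set \<Rightarrow> ('u \<Rightarrow> 'u cochain) \<Rightarrow> 'u cochain"
  where "cprod b I X = \<lparr>obj = (\<lambda>n. pmod b I (\<lambda>i. obj (X i) n)), dif = (\<lambda>n. pmap I (\<lambda>i. dif (X i) n))\<rparr>"

definition cprod_map :: "'u set \<Rightarrow> ('u \<Rightarrow> 'u cmap) \<Rightarrow> 'u cmap"
  where "cprod_map I f = (\<lambda>n. pmap I (\<lambda>i. f i n))"

definition cprod_in :: "'u set \<Rightarrow> ('u \<Rightarrow> 'u cochain) \<Rightarrow> 'u \<Rightarrow> 'u cmap"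
  where "cprod_in I X i = (\<lambda>n. pin I (\<lambda>i. obj (X i) n) i)"

definition cprod_proj :: "'u \<Rightarrow> 'u cmap"
  where "cprod_proj i = (\<lambda>n u. up u i)"

definition cprod_pair :: "'u set \<Rightarrow> ('u \<Rightarrow> 'u cmap) \<Rightarrow> 'u cmap"
  where "cprod_pair I f = (\<lambda>n x. pk (\<lambda>i\<in>I. f i n x))"

definition cprod_copair :: "'u set \<Rightarrow> ('u \<Rightarrow> 'u cochain) \<Rightarrow> 'u cochain \<Rightarrow> ('u \<Rightarrow> 'u cmap) \<Rightarrow> 'u cmap"
  where "cprod_copair I X Y f = (\<lambda>n. copairing I (\<lambda>i. obj (X i) n) (obj Y n) (\<lambda>i. f i n))"

context ring_universe
begin

lemma hom_finsum:
  assumes f: "f \<in> rmod_hom R M N" and M: "abelian_group M" and N: "abelian_group N"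
    and "finite T" "x \<in> T \<rightarrow> carrier M"
  shows "f (\<Oplus>\<^bsub>M\<^esub>i\<in>T. x i) = (\<Oplus>\<^bsub>N\<^esub>i\<in>T. f (x i))"
proof -
  interpret M: abelian_group M by fact
  interpret N: abelian_group N by fact
  show ?thesis
    using assms(4,5)
    by (induction T rule: finite_induct)
      (auto simp: hom_zero[OF f M N] hom_add[OF f] hom_closed[OF f] Pi_iff M.finsum_closed)
qed

context
  fixes I :: "'u set"
  assumes I: "small I"
begin

context
  fixes X :: "'u \<Rightarrow> ('u, 'u) module" and N :: "('u, 'u) module" and f :: "'u \<Rightarrow> 'u \<Rightarrow> 'u"
  assumes X: "\<And>i. i \<in> I \<Longrightarrow> X i \<in> modules A" and N: "N \<in> modules A"
    and f: "\<And>i. i \<in> I \<Longrightarrow> f i \<in> rmod_hom A (X i) N"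
begin

text \<open>The support changes under addition and scalar multiplication. Linearity is therefore
  checked over a finite set that contains all supports involved; the extra terms are images of
  zero.\<close>

lemma copairing_superset:
  assumes u: "u \<in> carrier (pmod False I X)" and T: "finite T" "T \<subseteq> I" "{i \<in> I. up u i \<noteq> \<zero>\<^bsub>X i\<^esub>} \<subseteq> T"
  shows "copairing I X N f u = (\<Oplus>\<^bsub>N\<^esub>i\<in>T. f i (up u i))"
proof -
  interpret N: abelian_group N using mod_group[OF N] .
  show ?thesis
    unfolding copairing_def
    by (rule N.add.finprod_mono_neutral_cong_left)
      (use T u in \<open>auto simp: hom_zero[OF f mod_group[OF X] mod_group[OF N]] hom_closed[OF f] pmod_cases[OF I] subset_iff\<close>)
qed

lemma copairing_hom: "copairing I X N f \<in> rmod_hom A (pmod False I X) N"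
proof (rule rmod_homI)
  interpret N: abelian_group N using mod_group[OF N] .
  let ?P = "pmod False I X"
  have P: "?P \<in> modules A" by (rule pmod_modules[OF I X])
  define S where "S u = {i \<in> I. up u i \<noteq> \<zero>\<^bsub>X i\<^esub>}" for u
  have fin: "finite (S u)" if "u \<in> carrier ?P" for u
    using pmod_cases(3)[OF I that] by (simp add: S_def)
  have SI: "S u \<subseteq> I" for u by (auto simp: S_def)
  have sup: "copairing I X N f u = (\<Oplus>\<^bsub>N\<^esub>i\<in>T. f i (up u i))" if "u \<in> carrier ?P" "finite T" "T \<subseteq> I" "S u \<subseteq> T" for u T
    using copairing_superset[OF that(1-3)] that(4) by (simp add: S_def)
  have cl: "f i (up u i) \<in> carrier N" if "u \<in> carrier ?P" "i \<in> I" for u i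
    using that by (auto simp: hom_closed[OF f] pmod_cases[OF I])
  show "copairing I X N f u \<in> carrier N" if u: "u \<in> carrier ?P" for u
    unfolding sup[OF u fin[OF u] SI subset_refl] using u SI by (auto intro!: N.finsum_closed cl)
  fix u assume u: "u \<in> carrier ?P"
  {
    fix v assume v: "v \<in> carrier ?P"
    have w: "u \<oplus>\<^bsub>?P\<^esub> v \<in> carrier ?P" using mod_add[OF P u v] .
    define T where "T = S u \<union> S v \<union> S (u \<oplus>\<^bsub>?P\<^esub> v)"
    have T: "finite T" "T \<subseteq> I" using fin u v w SI by (auto simp: T_def)
    have "(\<Oplus>\<^bsub>N\<^esub>i\<in>T. f i (up (u \<oplus>\<^bsub>?P\<^esub> v) i)) = (\<Oplus>\<^bsub>N\<^esub>i\<in>T. f i (up u i) \<oplus>\<^bsub>N\<^esub> f i (up v i))"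
      using T u v by (intro N.finsum_cong') (auto simp: up_pmod[OF I] hom_add[OF f] pmod_cases[OF I] subset_iff intro!: N.a_closed cl)
    also have "\<dots> = (\<Oplus>\<^bsub>N\<^esub>i\<in>T. f i (up u i)) \<oplus>\<^bsub>N\<^esub> (\<Oplus>\<^bsub>N\<^esub>i\<in>T. f i (up v i))"
      using T u v by (intro N.finsum_addf) (auto intro!: cl)
    moreover have "S u \<subseteq> T" "S v \<subseteq> T" "S (u \<oplus>\<^bsub>?P\<^esub> v) \<subseteq> T" by (auto simp: T_def)
    ultimately show "copairing I X N f (u \<oplus>\<^bsub>?P\<^esub> v) = copairing I X N f u \<oplus>\<^bsub>N\<^esub> copairing I X N f v"
      using sup[OF u T] sup[OF v T] sup[OF w T] by simp
  next
    fix r assume r: "r \<in> carrier A"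
    have w: "r \<odot>\<^bsub>?P\<^esub> u \<in> carrier ?P" using mod_smult[OF P r u] .
    define T where "T = S u \<union> S (r \<odot>\<^bsub>?P\<^esub> u)"
    have T: "finite T" "T \<subseteq> I" using fin u w SI by (auto simp: T_def)
    have h: "(\<lambda>x. r \<odot>\<^bsub>N\<^esub> x) \<in> rmod_hom (A\<lparr>carrier := {}\<rparr>) N N"
      by (rule rmod_homI) (auto simp: r N mod_smult mod_smult_r)
    have "(\<Oplus>\<^bsub>N\<^esub>i\<in>T. f i (up (r \<odot>\<^bsub>?P\<^esub> u) i)) = (\<Oplus>\<^bsub>N\<^esub>i\<in>T. r \<odot>\<^bsub>N\<^esub> f i (up u i))"
      using T u r N by (intro N.finsum_cong') (auto simp: up_pmod[OF I] hom_smult[OF f] pmod_cases[OF I] subset_iff intro!: mod_smult cl)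
    also have "\<dots> = r \<odot>\<^bsub>N\<^esub> (\<Oplus>\<^bsub>N\<^esub>i\<in>T. f i (up u i))"
      using T u by (intro hom_finsum[OF h, symmetric] mod_group N) (auto intro!: cl)
    moreover have "S u \<subseteq> T" "S (r \<odot>\<^bsub>?P\<^esub> u) \<subseteq> T" by (auto simp: T_def)
    ultimately show "copairing I X N f (r \<odot>\<^bsub>?P\<^esub> u) = r \<odot>\<^bsub>N\<^esub> copairing I X N f u"
      using sup[OF u T] sup[OF w T] by simp
  }
qed

lemma copairing_pin:
  assumes i: "i \<in> I" and x: "x \<in> carrier (X i)"
  shows "copairing I X N f (pin I X i x) = f i x"
proof -
  interpret N: abelian_group N using mod_group[OF N] .
  have "copairing I X N f (pin I X i x) = (\<Oplus>\<^bsub>N\<^esub>j\<in>{i}. f j (up (pin I X i x) j))"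
    by (rule copairing_superset) (use i x in \<open>auto simp: up_pmod[OF I] intro: hom_closed[OF pin_hom[OF I X]] split: if_splits\<close>)
  also have "\<dots> = f i x" using i x by (simp add: up_pmod[OF I] hom_closed[OF f])
  finally show ?thesis .
qed

end

text \<open>A direct sum is generated by its summands. The induction runs over a finite set
  containing the support and splits off one coordinate by subtracting its image under
  \<open>pin\<close>.\<close>

lemma pmod_False_hom_ext:
  assumes X: "\<And>i. i \<in> I \<Longrightarrow> X i \<in> modules A" and N: "N \<in> modules A"
    and f: "f \<in> rmod_hom A (pmod False I X) N" and g: "g \<in> rmod_hom A (pmod False I X) N"
    and eq: "\<And>i x. i \<in> I \<Longrightarrow> x \<in> carrier (X i) \<Longrightarrow> f (pin I X i x) = g (pin I X i x)"
    and u: "u \<in> carrier (pmod False I X)"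
  shows "f u = g u"
proof -
  let ?P = "pmod False I X"
  have P: "?P \<in> modules A" by (rule pmod_modules[OF I X])
  have "\<forall>u\<in>carrier ?P. {i \<in> I. up u i \<noteq> \<zero>\<^bsub>X i\<^esub>} \<subseteq> F \<longrightarrow> f u = g u" if "finite F" for F
    using that
  proof (induction F rule: finite_induct)
    case empty
    show ?case
    proof safe
      fix u assume u: "u \<in> carrier ?P" "{i \<in> I. up u i \<noteq> \<zero>\<^bsub>X i\<^esub>} \<subseteq> {}"
      have "u = \<zero>\<^bsub>?P\<^esub>" by (rule pmod_ext[OF I u(1) mod_zero[OF P]]) (use u in \<open>auto simp: up_pmod[OF I]\<close>)
      then show "f u = g u" using hom_zero[OF f mod_group[OF P] mod_group[OF N]] hom_zero[OF g mod_group[OF P] mod_group[OF N]] by simp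
    qed
  next
    case (insert j F)
    show ?case
    proof safe
      fix u assume u: "u \<in> carrier ?P" "{i \<in> I. up u i \<noteq> \<zero>\<^bsub>X i\<^esub>} \<subseteq> insert j F"
      show "f u = g u"
      proof (cases "j \<in> I")
        case j: True
        note x = pmod_cases(2)[OF I u(1) j]
        note p = hom_closed[OF pin_hom[where X = X and b = False, OF I X j] x]
        define v where "v = u \<ominus>\<^bsub>?P\<^esub> pin I X j (up u j)"
        have v: "v \<in> carrier ?P" unfolding v_def by (rule mod_minus[OF P u(1) p])
        have upv: "up v i = up u i \<ominus>\<^bsub>X i\<^esub> (if i = j then up u j else \<zero>\<^bsub>X i\<^esub>)" if i: "i \<in> I" for i
          using hom_minus[OF up_hom[OF I i, where b = False] mod_group[OF P] mod_group[OF X[OF i]] u(1) p]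
          by (simp add: v_def up_pmod[OF I i])
        have m: "x \<ominus>\<^bsub>X i\<^esub> x = \<zero>\<^bsub>X i\<^esub>" "x \<ominus>\<^bsub>X i\<^esub> \<zero>\<^bsub>X i\<^esub> = x" if "i \<in> I" "x \<in> carrier (X i)" for i x
          using mod_group[OF X[OF that(1)]] that(2) by algebra+
        have "{i \<in> I. up v i \<noteq> \<zero>\<^bsub>X i\<^esub>} \<subseteq> F"
          using u(2) pmod_cases(2)[OF I u(1)] by (auto simp: upv m split: if_splits)
        then have "f v = g v" using insert.IH v by blast
        moreover have "u = v \<oplus>\<^bsub>?P\<^esub> pin I X j (up u j)"
          unfolding v_def using u(1) p mod_group[OF P] by algebra
        ultimately show ?thesis using hom_add[OF f v p] hom_add[OF g v p] eq[OF j x] by simp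
      qed (use u insert in auto)
    qed
  qed
  then show ?thesis using u pmod_cases(3)[OF I u] by blast
qed

end

context
  fixes I :: "'u set"
  assumes I: "small I"
begin

lemma cprod_obj: "obj (cprod b I X) n = pmod b I (\<lambda>i. obj (X i) n)"
  by (simp add: cprod_def)

lemma up_cprod:
  assumes "i \<in> I"
  shows "up \<zero>\<^bsub>obj (cprod b I X) n\<^esub> i = \<zero>\<^bsub>obj (X i) n\<^esub>"
    and "up (u \<oplus>\<^bsub>obj (cprod b I X) n\<^esub> v) i = up u i \<oplus>\<^bsub>obj (X i) n\<^esub> up v i"
    and "up (dif (cprod b I X) n u) i = dif (X i) n (up u i)"
    and "up (cprod_map I f n u) i = f i n (up u i)"
    and "up (cprod_in I X j n x) i = (if i = j then x else \<zero>\<^bsub>obj (X i) n\<^esub>)"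
    and "up (cprod_pair I f n x) i = f i n x"
  using assms by (simp_all add: cprod_def cprod_map_def cprod_in_def cprod_pair_def up_pmod[OF I] I)

lemma cprod_ext:
  assumes "u \<in> carrier (obj (cprod b I X) n)" "v \<in> carrier (obj (cprod b I X) n)" "\<And>i. i \<in> I \<Longrightarrow> up u i = up v i"
  shows "u = v"
  using assms unfolding cprod_obj by (rule pmod_ext[OF I])

lemma cprod_up_closed: "u \<in> carrier (obj (cprod b I X) n) \<Longrightarrow> i \<in> I \<Longrightarrow> up u i \<in> carrier (obj (X i) n)"
  unfolding cprod_obj by (rule pmod_cases[OF I])

context
  fixes X :: "'u \<Rightarrow> 'u cochain"
  assumes X: "\<And>i. i \<in> I \<Longrightarrow> X i \<in> complexes A"
begin

lemma cprod_modules: "pmod b I (\<lambda>i. obj (X i) n) \<in> modules A"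
  by (rule pmod_modules[OF I]) (simp add: cpx_obj X)

lemma cprod_complexes: "cprod b I X \<in> complexes A"
proof -
  have o: "obj (cprod b I X) n \<in> modules A" for n
    unfolding cprod_obj by (rule cprod_modules)
  have d: "dif (cprod b I X) n \<in> rmod_hom A (obj (cprod b I X) n) (obj (cprod b I X) (n + 1))" for n
    by (simp add: cprod_def, rule pmap_hom[OF I]) (auto simp: cpx_obj X cpx_dif)
  have "dif (cprod b I X) (n + 1) (dif (cprod b I X) n x) = \<zero>\<^bsub>obj (cprod b I X) (n + 1 + 1)\<^esub>"
    if x: "x \<in> carrier (obj (cprod b I X) n)" for n x
    by (rule cprod_ext[OF hom_closed[OF d hom_closed[OF d x]] mod_zero[OF o]])
      (simp add: up_cprod dif_dif X cprod_up_closed[OF x])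
  then show ?thesis using o d by (simp add: complexes_def)
qed

lemma cprod_proj_cm: "i \<in> I \<Longrightarrow> cprod_proj i \<in> chain_maps A (cprod b I X) (X i)"
  by (rule chain_mapsI) (auto simp: cprod_proj_def cprod_obj up_cprod intro: up_hom[OF I])

lemma cprod_in_cm:
  assumes i: "i \<in> I"
  shows "cprod_in I X i \<in> chain_maps A (X i) (cprod b I X)"
proof (rule chain_mapsI)
  show h: "cprod_in I X i n \<in> rmod_hom A (obj (X i) n) (obj (cprod b I X) n)" for n
    unfolding cprod_in_def cprod_obj by (rule pin_hom[OF I]) (auto simp: cpx_obj X i)
  fix n x assume x: "x \<in> carrier (obj (X i) n)"
  show "cprod_in I X i (n + 1) (dif (X i) n x) = dif (cprod b I X) n (cprod_in I X i n x)"
    by (rule cprod_ext[where b = b and X = X and n = "n + 1"])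
      (use x i in \<open>auto simp: up_cprod X dif_zero intro!: hom_closed[OF h] dif_closed[OF cprod_complexes] dif_closed[OF X]\<close>)
qed

lemma cprod_pair_cm:
  assumes Y: "Y \<in> complexes A" and f: "\<And>i. i \<in> I \<Longrightarrow> f i \<in> chain_maps A Y (X i)"
  shows "cprod_pair I f \<in> chain_maps A Y (cprod True I X)"
proof (rule chain_mapsI)
  show h: "cprod_pair I f n \<in> rmod_hom A (obj Y n) (obj (cprod True I X) n)" for n
    unfolding cprod_pair_def cprod_obj by (rule pairing_hom[OF I]) (auto simp: cpx_obj X Y f cm_hom)
  fix n x assume x: "x \<in> carrier (obj Y n)"
  show "cprod_pair I f (n + 1) (dif Y n x) = dif (cprod True I X) n (cprod_pair I f n x)"
    by (rule cprod_ext[where b = True and X = X and n = "n + 1"])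
      (use x in \<open>auto simp: up_cprod cm_dif[OF f] intro!: hom_closed[OF h] dif_closed[OF cprod_complexes] dif_closed[OF Y]\<close>)
qed

lemma cprod_copair_cm:
  assumes Y: "Y \<in> complexes A" and f: "\<And>i. i \<in> I \<Longrightarrow> f i \<in> chain_maps A (X i) Y"
  shows "cprod_copair I X Y f \<in> chain_maps A (cprod False I X) Y"
proof (rule chain_mapsI)
  show h: "cprod_copair I X Y f n \<in> rmod_hom A (obj (cprod False I X) n) (obj Y n)" for n
    unfolding cprod_copair_def cprod_obj by (rule copairing_hom[OF I]) (auto simp: cpx_obj X Y f cm_hom)
  have p: "cprod_copair I X Y f n (cprod_in I X i n x) = f i n x" if "i \<in> I" "x \<in> carrier (obj (X i) n)" for i n x
    unfolding cprod_copair_def cprod_in_def by (rule copairing_pin[OF I]) (auto simp: that cpx_obj X Y f cm_hom)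
  fix n x assume x: "x \<in> carrier (obj (cprod False I X) n)"
  show "cprod_copair I X Y f (n + 1) (dif (cprod False I X) n x) = dif Y n (cprod_copair I X Y f n x)"
  proof (rule pmod_False_hom_ext[OF I, where X = "\<lambda>i. obj (X i) n" and N = "obj Y (n + 1)" and u = x
        and f = "\<lambda>x. cprod_copair I X Y f (n + 1) (dif (cprod False I X) n x)" and g = "\<lambda>x. dif Y n (cprod_copair I X Y f n x)"])
    show "(\<lambda>x. cprod_copair I X Y f (n + 1) (dif (cprod False I X) n x)) \<in> rmod_hom A (pmod False I (\<lambda>i. obj (X i) n)) (obj Y (n + 1))"
      using hom_comp[OF cpx_dif[OF cprod_complexes refl] h] by (simp add: cprod_obj)
    show "(\<lambda>x. dif Y n (cprod_copair I X Y f n x)) \<in> rmod_hom A (pmod False I (\<lambda>i. obj (X i) n)) (obj Y (n + 1))"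
      using hom_comp[OF h cpx_dif[OF Y refl]] by (simp add: cprod_obj)
    fix i x assume ix: "i \<in> I" "x \<in> carrier (obj (X i) n)"
    have "pin I (\<lambda>i. obj (X i) n) i x = cprod_in I X i n x" by (simp add: cprod_in_def)
    then show "cprod_copair I X Y f (n + 1) (dif (cprod False I X) n (pin I (\<lambda>i. obj (X i) n) i x)) =
       dif Y n (cprod_copair I X Y f n (pin I (\<lambda>i. obj (X i) n) i x))"
      using ix by (simp add: cm_dif[OF cprod_in_cm[where b = False, OF ix(1)], symmetric] p dif_closed X cm_dif[OF f])
  qed (use x X Y in \<open>auto simp: cprod_obj cpx_obj\<close>)
qed

lemma cprod_copair_in:
  assumes Y: "Y \<in> complexes A" and f: "\<And>i. i \<in> I \<Longrightarrow> f i \<in> chain_maps A (X i) Y"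
    and "i \<in> I" "x \<in> carrier (obj (X i) n)"
  shows "cprod_copair I X Y f n (cprod_in I X i n x) = f i n x"
  unfolding cprod_copair_def cprod_in_def by (rule copairing_pin[OF I]) (auto simp: assms cpx_obj X Y f cm_hom)

end

lemma cprod_map_cm:
  assumes X: "\<And>i. i \<in> I \<Longrightarrow> X i \<in> complexes A" and Y: "\<And>i. i \<in> I \<Longrightarrow> Y i \<in> complexes A"
    and f: "\<And>i. i \<in> I \<Longrightarrow> f i \<in> chain_maps A (X i) (Y i)"
  shows "cprod_map I f \<in> chain_maps A (cprod b I X) (cprod b I Y)"
proof (rule chain_mapsI)
  show h: "cprod_map I f n \<in> rmod_hom A (obj (cprod b I X) n) (obj (cprod b I Y) n)" for n
    unfolding cprod_map_def cprod_obj by (rule pmap_hom[OF I]) (auto simp: cpx_obj X Y f cm_hom)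
  fix n x assume x: "x \<in> carrier (obj (cprod b I X) n)"
  show "cprod_map I f (n + 1) (dif (cprod b I X) n x) = dif (cprod b I Y) n (cprod_map I f n x)"
    by (rule cprod_ext[where b = b and X = Y and n = "n + 1"])
      (use x in \<open>auto simp: up_cprod cprod_up_closed cm_dif[OF f] X Y intro!: hom_closed[OF h] dif_closed[OF cprod_complexes]\<close>)
qed

text \<open>Products and direct sums are exact: primitives and preimages are chosen coordinate by
  coordinate. Choosing zero wherever the given coordinate is zero keeps supports finite, so one
  argument covers both values of \<open>b\<close>.\<close>

lemma cprod_map_quasi_iso:
  assumes X: "\<And>i. i \<in> I \<Longrightarrow> X i \<in> complexes A" and Y: "\<And>i. i \<in> I \<Longrightarrow> Y i \<in> complexes A"
    and f: "\<And>i. i \<in> I \<Longrightarrow> f i \<in> quasi_isos A (X i) (Y i)"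
  shows "cprod_map I f \<in> quasi_isos A (cprod b I X) (cprod b I Y)"
proof (rule quasi_isosI[OF cprod_complexes[OF X] cprod_complexes[OF Y] cprod_map_cm[OF X Y quasi_isos_cm[OF f]]])
  note PX = cprod_complexes[OF X, where b = b]
  note PY = cprod_complexes[OF Y, where b = b]
  have dif0: "dif (X i) (n - 1) \<zero>\<^bsub>obj (X i) (n - 1)\<^esub> = \<zero>\<^bsub>obj (X i) n\<^esub>"
    "dif (Y i) (n - 1) \<zero>\<^bsub>obj (Y i) (n - 1)\<^esub> = \<zero>\<^bsub>obj (Y i) n\<^esub>" if "i \<in> I" for i n
    using dif_zero[OF X[OF that], of "n - 1"] dif_zero[OF Y[OF that], of "n - 1"] by simp_all
  have cocyc: "u \<in> carrier (obj (cprod b I V) n) \<Longrightarrow> u \<in> cocycles (cprod b I V) n \<longleftrightarrow> (\<forall>i\<in>I. up u i \<in> cocycles (V i) n)"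
    if V: "\<And>i. i \<in> I \<Longrightarrow> V i \<in> complexes A" for u n V
  proof -
    assume u: "u \<in> carrier (obj (cprod b I V) n)"
    have "dif (cprod b I V) n u = \<zero>\<^bsub>obj (cprod b I V) (n + 1)\<^esub> \<longleftrightarrow> (\<forall>i\<in>I. dif (V i) n (up u i) = \<zero>\<^bsub>obj (V i) (n + 1)\<^esub>)"
      using cprod_ext[OF dif_closed[OF cprod_complexes[OF V] refl u] mod_zero[OF cpx_obj[OF cprod_complexes[OF V]]]]
      by (auto simp: up_cprod dest: arg_cong[of "dif (cprod b I V) n u" _ up])
        (metis up_cprod(1,3))+
    then show ?thesis using u by (auto simp: cocycles_def cprod_up_closed)
  qed
  have fin: "pk (\<lambda>i\<in>I. x i) \<in> carrier (obj (cprod b I V) m)"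
    if "\<And>i. i \<in> I \<Longrightarrow> x i \<in> carrier (obj (V i) m)" and u: "u \<in> carrier (obj (cprod b I U) n)"
      and "\<And>i. i \<in> I \<Longrightarrow> up u i = \<zero>\<^bsub>obj (U i) n\<^esub> \<Longrightarrow> x i = \<zero>\<^bsub>obj (V i) m\<^esub>" for x V m u U n
  proof -
    have "{i \<in> I. x i \<noteq> \<zero>\<^bsub>obj (V i) m\<^esub>} \<subseteq> {i \<in> I. up u i \<noteq> \<zero>\<^bsub>obj (U i) n\<^esub>}" using that(3) by auto
    then have "b \<or> finite {i \<in> I. x i \<noteq> \<zero>\<^bsub>obj (V i) m\<^esub>}"
      using pmod_cases(3)[OF I u[unfolded cprod_obj]] by (meson finite_subset)
    then show ?thesis unfolding cprod_obj pk_in_pmod[OF I] using that(1) by blast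
  qed
  fix n
  {
    fix u w assume u: "u \<in> cocycles (cprod b I X) n" and w: "w \<in> carrier (obj (cprod b I Y) (n - 1))"
      and eq: "cprod_map I f n u = dif (cprod b I Y) (n - 1) w"
    note uc = cocycles_closed[OF u]
    have "\<exists>x\<in>carrier (obj (X i) (n - 1)). up u i = dif (X i) (n - 1) x \<and> (up u i = \<zero>\<^bsub>obj (X i) n\<^esub> \<longrightarrow> x = \<zero>\<^bsub>obj (X i) (n - 1)\<^esub>)" if i: "i \<in> I" for i
    proof (cases "up u i = \<zero>\<^bsub>obj (X i) n\<^esub>")
      case True
      then show ?thesis using dif0[OF i] mod_zero[OF cpx_obj[OF X[OF i]]] by force
    next
      case False
      have "f i n (up u i) = dif (Y i) (n - 1) (up w i)"
        using arg_cong[OF eq, of "\<lambda>u. up u i"] i by (simp add: up_cprod)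
      moreover have "up u i \<in> cocycles (X i) n" using cocyc[OF X uc] u i by blast
      ultimately show ?thesis
        using False quasi_isosE_inj[OF f[OF i] X[OF i] Y[OF i]] cprod_up_closed[OF w i] by metis
    qed
    then obtain x where x: "\<And>i. i \<in> I \<Longrightarrow> x i \<in> carrier (obj (X i) (n - 1))" "\<And>i. i \<in> I \<Longrightarrow> up u i = dif (X i) (n - 1) (x i)"
      "\<And>i. i \<in> I \<Longrightarrow> up u i = \<zero>\<^bsub>obj (X i) n\<^esub> \<Longrightarrow> x i = \<zero>\<^bsub>obj (X i) (n - 1)\<^esub>" by metis
    have p: "pk (\<lambda>i\<in>I. x i) \<in> carrier (obj (cprod b I X) (n - 1))" by (rule fin[OF x(1) uc x(3)])
    have "u = dif (cprod b I X) (n - 1) (pk (\<lambda>i\<in>I. x i))"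
    proof (rule cprod_ext[OF uc hom_closed[OF cpx_dif'[OF PX] p]])
      fix i assume i: "i \<in> I"
      show "up u i = up (dif (cprod b I X) (n - 1) (pk (\<lambda>i\<in>I. x i))) i"
        unfolding up_cprod(3)[OF i] x(2)[OF i] up_pk[OF I] by (simp add: i)
    qed
    then show "\<exists>x\<in>carrier (obj (cprod b I X) (n - 1)). u = dif (cprod b I X) (n - 1) x" using p by blast
  next
    fix w assume w: "w \<in> cocycles (cprod b I Y) n"
    note wc = cocycles_closed[OF w]
    define Q where "Q i z y \<longleftrightarrow> z \<in> cocycles (X i) n \<and> y \<in> carrier (obj (Y i) (n - 1)) \<and>
      up w i = f i n z \<oplus>\<^bsub>obj (Y i) n\<^esub> dif (Y i) (n - 1) y \<and>
      (up w i = \<zero>\<^bsub>obj (Y i) n\<^esub> \<longrightarrow> z = \<zero>\<^bsub>obj (X i) n\<^esub> \<and> y = \<zero>\<^bsub>obj (Y i) (n - 1)\<^esub>)" for i z y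
    have "\<exists>z y. Q i z y" if i: "i \<in> I" for i
    proof (cases "up w i = \<zero>\<^bsub>obj (Y i) n\<^esub>")
      case True
      have "\<zero>\<^bsub>obj (X i) n\<^esub> \<in> cocycles (X i) n" using coboundaries_cocycles[OF X[OF i] coboundaries_zero[OF X[OF i]]] .
      moreover have "f i n \<zero>\<^bsub>obj (X i) n\<^esub> \<oplus>\<^bsub>obj (Y i) n\<^esub> dif (Y i) (n - 1) \<zero>\<^bsub>obj (Y i) (n - 1)\<^esub> = \<zero>\<^bsub>obj (Y i) n\<^esub>"
        using cpx_group[OF Y[OF i], of n] unfolding dif0(2)[OF i] cm_zero[OF quasi_isos_cm[OF f[OF i]] X[OF i] Y[OF i]] by algebra
      ultimately show ?thesis using True mod_zero[OF cpx_obj[OF Y[OF i]]] unfolding Q_def by metis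
    next
      case False
      have "up w i \<in> cocycles (Y i) n" using cocyc[OF Y wc] w i by blast
      then obtain z y where "z \<in> cocycles (X i) n" "y \<in> carrier (obj (Y i) (n - 1))"
          "up w i = f i n z \<oplus>\<^bsub>obj (Y i) n\<^esub> dif (Y i) (n - 1) y"
        by (rule quasi_isosE_surj[OF f[OF i] X[OF i] Y[OF i]])
      then show ?thesis using False unfolding Q_def by blast
    qed
    then obtain z y where "\<And>i. i \<in> I \<Longrightarrow> Q i (z i) (y i)" by metis
    then have z: "\<And>i. i \<in> I \<Longrightarrow> z i \<in> cocycles (X i) n" and y: "\<And>i. i \<in> I \<Longrightarrow> y i \<in> carrier (obj (Y i) (n - 1))"
      and e: "\<And>i. i \<in> I \<Longrightarrow> up w i = f i n (z i) \<oplus>\<^bsub>obj (Y i) n\<^esub> dif (Y i) (n - 1) (y i)"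
      and zz: "\<And>i. i \<in> I \<Longrightarrow> up w i = \<zero>\<^bsub>obj (Y i) n\<^esub> \<Longrightarrow> z i = \<zero>\<^bsub>obj (X i) n\<^esub>"
      and yz: "\<And>i. i \<in> I \<Longrightarrow> up w i = \<zero>\<^bsub>obj (Y i) n\<^esub> \<Longrightarrow> y i = \<zero>\<^bsub>obj (Y i) (n - 1)\<^esub>"
      unfolding Q_def by blast+
    have pz: "pk (\<lambda>i\<in>I. z i) \<in> carrier (obj (cprod b I X) n)" by (rule fin[OF cocycles_closed[OF z] wc zz])
    have py: "pk (\<lambda>i\<in>I. y i) \<in> carrier (obj (cprod b I Y) (n - 1))" by (rule fin[OF y wc yz])
    have "pk (\<lambda>i\<in>I. z i) \<in> cocycles (cprod b I X) n" using cocyc[where V = X, OF X pz] by (simp add: I z)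
    moreover have "w = cprod_map I f n (pk (\<lambda>i\<in>I. z i)) \<oplus>\<^bsub>obj (cprod b I Y) n\<^esub> dif (cprod b I Y) (n - 1) (pk (\<lambda>i\<in>I. y i))"
      by (rule cprod_ext[OF wc mod_add[OF cpx_obj[OF PY] cm_closed[OF cprod_map_cm[OF X Y quasi_isos_cm[OF f]] pz] hom_closed[OF cpx_dif'[OF PY] py]]])
        (simp_all add: up_cprod e I)
    ultimately show "\<exists>z\<in>cocycles (cprod b I X) n. \<exists>y\<in>carrier (obj (cprod b I Y) (n - 1)).
      w = cprod_map I f n z \<oplus>\<^bsub>obj (cprod b I Y) n\<^esub> dif (cprod b I Y) (n - 1) y" using py by blast
  }
qed

text \<open>Homotopies chosen for the individual factors are the components of one homotopy into the
  product. Together with \<open>cprod_copair_homotopic\<close> this drives the uniqueness halves of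
  the universal properties.\<close>

lemma cprod_pair_homotopic:
  assumes X: "\<And>i. i \<in> I \<Longrightarrow> X i \<in> complexes A" and Y: "Y \<in> complexes A"
    and f: "f \<in> chain_maps A Y (cprod True I X)" and g: "g \<in> chain_maps A Y (cprod True I X)"
    and fg: "\<And>i. i \<in> I \<Longrightarrow> heq Y (X i) (cprod_proj i \<circ>\<^sub>c f) (cprod_proj i \<circ>\<^sub>c g)"
  shows "heq Y (cprod True I X) f g"
proof -
  note P = cprod_complexes[OF X, where b = True]
  have "\<exists>h. (\<forall>n. h n \<in> rmod_hom A (obj Y n) (obj (X i) (n - 1))) \<and> (\<forall>n. \<forall>x\<in>carrier (obj Y n).
      up (f n x) i = up (g n x) i \<oplus>\<^bsub>obj (X i) n\<^esub> (dif (X i) (n - 1) (h n x) \<oplus>\<^bsub>obj (X i) n\<^esub> h (n + 1) (dif Y n x)))" if "i \<in> I" for i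
    using fg[OF that] unfolding heq_def homotopic_def cprod_proj_def ccomp_def by blast
  then obtain h where h: "\<And>i n. i \<in> I \<Longrightarrow> h i n \<in> rmod_hom A (obj Y n) (obj (X i) (n - 1))"
    and e: "\<And>i n x. i \<in> I \<Longrightarrow> x \<in> carrier (obj Y n) \<Longrightarrow>
      up (f n x) i = up (g n x) i \<oplus>\<^bsub>obj (X i) n\<^esub> (dif (X i) (n - 1) (h i n x) \<oplus>\<^bsub>obj (X i) n\<^esub> h i (n + 1) (dif Y n x))" by metis
  have hom: "cprod_pair I h n \<in> rmod_hom A (obj Y n) (obj (cprod True I X) (n - 1))" for n
    unfolding cprod_pair_def cprod_obj by (rule pairing_hom[OF I]) (auto simp: cpx_obj X Y h)
  have "homotopic A Y (cprod True I X) f g"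
  proof (rule homotopicI[OF hom])
    fix n x assume x: "x \<in> carrier (obj Y n)"
    have 1: "dif (cprod True I X) (n - 1) (cprod_pair I h n x) \<in> carrier (obj (cprod True I X) n)"
      by (rule hom_closed[OF cpx_dif'[OF P] hom_closed[OF hom x]])
    have 2: "cprod_pair I h (n + 1) (dif Y n x) \<in> carrier (obj (cprod True I X) n)"
      using hom_closed[OF hom dif_closed[OF Y refl x]] by simp
    show "f n x = g n x \<oplus>\<^bsub>obj (cprod True I X) n\<^esub> (dif (cprod True I X) (n - 1) (cprod_pair I h n x)
        \<oplus>\<^bsub>obj (cprod True I X) n\<^esub> cprod_pair I h (n + 1) (dif Y n x))"
      by (rule cprod_ext[OF cm_closed[OF f x]]) (use 1 2 cm_closed[OF g x] in \<open>auto simp: up_cprod e[OF _ x] intro!: mod_add cpx_obj[OF P]\<close>)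
  qed
  then show ?thesis using f g P Y by (simp add: heq_def)
qed

lemma cprod_copair_homotopic:
  assumes X: "\<And>i. i \<in> I \<Longrightarrow> X i \<in> complexes A" and Y: "Y \<in> complexes A"
    and f: "f \<in> chain_maps A (cprod False I X) Y" and g: "g \<in> chain_maps A (cprod False I X) Y"
    and fg: "\<And>i. i \<in> I \<Longrightarrow> heq (X i) Y (f \<circ>\<^sub>c cprod_in I X i) (g \<circ>\<^sub>c cprod_in I X i)"
  shows "heq (cprod False I X) Y f g"
proof -
  let ?P = "cprod False I X"
  note P = cprod_complexes[OF X, where b = False]
  have "\<exists>h. (\<forall>n. h n \<in> rmod_hom A (obj (X i) n) (obj Y (n - 1))) \<and> (\<forall>n. \<forall>x\<in>carrier (obj (X i) n).
      f n (cprod_in I X i n x) = g n (cprod_in I X i n x) \<oplus>\<^bsub>obj Y n\<^esub> (dif Y (n - 1) (h n x) \<oplus>\<^bsub>obj Y n\<^esub> h (n + 1) (dif (X i) n x)))" if "i \<in> I" for i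
    using fg[OF that] unfolding heq_def homotopic_def ccomp_def by blast
  then obtain h where h: "\<And>i n. i \<in> I \<Longrightarrow> h i n \<in> rmod_hom A (obj (X i) n) (obj Y (n - 1))"
    and e: "\<And>i n x. i \<in> I \<Longrightarrow> x \<in> carrier (obj (X i) n) \<Longrightarrow>
      f n (cprod_in I X i n x) = g n (cprod_in I X i n x) \<oplus>\<^bsub>obj Y n\<^esub> (dif Y (n - 1) (h i n x) \<oplus>\<^bsub>obj Y n\<^esub> h i (n + 1) (dif (X i) n x))" by metis
  define H where "H n = copairing I (\<lambda>i. obj (X i) n) (obj Y (n - 1)) (\<lambda>i. h i n)" for n
  have hom: "H n \<in> rmod_hom A (obj ?P n) (obj Y (n - 1))" for n
    unfolding H_def cprod_obj by (rule copairing_hom[OF I]) (auto simp: cpx_obj X Y h)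
  have Hin: "H n (cprod_in I X i n x) = h i n x" if "i \<in> I" "x \<in> carrier (obj (X i) n)" for i n x
    unfolding H_def cprod_in_def by (rule copairing_pin[OF I]) (auto simp: that cpx_obj X Y h)
  have "homotopic A ?P Y f g"
  proof (rule homotopicI[OF hom])
    fix n x assume x: "x \<in> carrier (obj ?P n)"
    let ?R = "\<lambda>x. g n x \<oplus>\<^bsub>obj Y n\<^esub> (dif Y (n - 1) (H n x) \<oplus>\<^bsub>obj Y n\<^esub> H (n + 1) (dif ?P n x))"
    show "f n x = g n x \<oplus>\<^bsub>obj Y n\<^esub> (dif Y (n - 1) (H n x) \<oplus>\<^bsub>obj Y n\<^esub> H (n + 1) (dif ?P n x))"
    proof (rule pmod_False_hom_ext[OF I, where X = "\<lambda>i. obj (X i) n" and N = "obj Y n" and u = x and f = "f n"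
        and g = "?R"])
      show "f n \<in> rmod_hom A (pmod False I (\<lambda>i. obj (X i) n)) (obj Y n)" using cm_hom[OF f] by (simp add: cprod_obj)
      have "H (n + 1) \<in> rmod_hom A (obj ?P (n + 1)) (obj Y n)" using hom[of "n + 1"] by simp
      then have "?R \<in> rmod_hom A (obj ?P n) (obj Y n)"
        by (intro hom_sum cpx_obj Y P cm_hom[OF g] hom_comp[OF hom cpx_dif'[OF Y]] hom_comp[OF cpx_dif[OF P refl]])
      then show "?R \<in> rmod_hom A (pmod False I (\<lambda>i. obj (X i) n)) (obj Y n)"
        by (simp add: cprod_obj)
      fix i x assume ix: "i \<in> I" "x \<in> carrier (obj (X i) n)"
      let ?i = "pin I (\<lambda>i. obj (X i) n) i x"
      have p: "?i = cprod_in I X i n x" by (simp add: cprod_in_def)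
      have d: "dif ?P n (cprod_in I X i n x) = cprod_in I X i (n + 1) (dif (X i) n x)"
        using cm_dif[OF cprod_in_cm[where X = X and b = False, OF X ix(1)] refl ix(2)] by simp
      show "f n ?i = g n ?i \<oplus>\<^bsub>obj Y n\<^esub>
         (dif Y (n - 1) (H n ?i) \<oplus>\<^bsub>obj Y n\<^esub> H (n + 1) (dif ?P n ?i))"
        unfolding p e[OF ix] d Hin[OF ix] Hin[OF ix(1) dif_closed[OF X[OF ix(1)] refl ix(2)]] by (rule refl)
    qed (use x X Y in \<open>auto simp: cprod_obj cpx_obj\<close>)
  qed
  then show ?thesis using f g P Y by (simp add: heq_def)
qed

end

end

section \<open>Triangles, coproducts and products in the derived category\<close>

context ring_universe
begin

lemma shift_simps: "obj (shift X) n = obj X (n + 1)" "dif (shift X) n x = \<ominus>\<^bsub>obj X (n + 1 + 1)\<^esub> dif X (n + 1) x"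
  by (simp_all add: shift_def)

lemma shift_complexes:
  assumes X: "X \<in> complexes A"
  shows "shift X \<in> complexes A"
proof -
  have "(\<lambda>x. \<ominus>\<^bsub>obj X (n + 1 + 1)\<^esub> dif X (n + 1) x) \<in> rmod_hom A (obj X (n + 1)) (obj X (n + 1 + 1))" for n
    by (intro hom_neg cpx_obj X cpx_dif refl)
  then have "dif (shift X) n \<in> rmod_hom A (obj (shift X) n) (obj (shift X) (n + 1))" for n
    by (simp add: shift_def)
  moreover have "dif (shift X) (n + 1) (dif (shift X) n x) = \<zero>\<^bsub>obj (shift X) (n + 1 + 1)\<^esub>" if x: "x \<in> carrier (obj (shift X) n)" for n x
  proof -
    have x: "x \<in> carrier (obj X (n + 1))" using x by (simp add: shift_simps)
    note d = dif_closed[OF X refl x]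
    have "dif X (n + 1 + 1) (\<ominus>\<^bsub>obj X (n + 1 + 1)\<^esub> dif X (n + 1) x) = \<ominus>\<^bsub>obj X (n + 1 + 1 + 1)\<^esub> \<zero>\<^bsub>obj X (n + 1 + 1 + 1)\<^esub>"
      unfolding dif_a_inv[OF X d] dif_dif[OF X refl x] ..
    moreover have "\<ominus>\<^bsub>obj X m\<^esub> (\<ominus>\<^bsub>obj X m\<^esub> \<zero>\<^bsub>obj X m\<^esub>) = \<zero>\<^bsub>obj X m\<^esub>" for m
      using cpx_group[OF X, of m] by algebra
    ultimately show ?thesis unfolding shift_simps by simp
  qed
  ultimately show ?thesis using X by (auto simp: complexes_def shift_simps)
qed

lemma shift_map_cm:
  assumes X: "X \<in> complexes A" and Y: "Y \<in> complexes A" and f: "f \<in> chain_maps A X Y"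
  shows "shift_map f \<in> chain_maps A (shift X) (shift Y)"
  by (rule chain_mapsI)
    (auto simp: shift_simps shift_map_def cm_hom[OF f] hom_a_inv[OF cm_hom[OF f] cpx_group[OF X] cpx_group[OF Y]]
      dif_closed X cm_dif[OF f])

lemma shift_cocycles:
  assumes X: "X \<in> complexes A"
  shows "cocycles (shift X) n = cocycles X (n + 1)"
proof -
  have "\<ominus>\<^bsub>obj X m\<^esub> x = \<zero>\<^bsub>obj X m\<^esub> \<longleftrightarrow> x = \<zero>\<^bsub>obj X m\<^esub>" if "x \<in> carrier (obj X m)" for x m
    using abelian_group.minus_minus[OF cpx_group[OF X] that] abelian_group.a_inv_zero[OF cpx_group[OF X], of m] by metis
  then show ?thesis by (auto simp: cocycles_def shift_simps dif_closed[OF X] abelian_group.a_inv_zero[OF cpx_group[OF X]])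
qed

lemma shift_coboundaries:
  assumes X: "X \<in> complexes A"
  shows "coboundaries (shift X) n = coboundaries X (n + 1)"
proof -
  have d: "dif X n (\<ominus>\<^bsub>obj X n\<^esub> x) = \<ominus>\<^bsub>obj X (n + 1)\<^esub> dif X n x" if "x \<in> carrier (obj X n)" for x
    by (rule dif_a_inv[OF X that])
  have m: "dif X n x = \<ominus>\<^bsub>obj X (n + 1)\<^esub> dif X n (\<ominus>\<^bsub>obj X n\<^esub> x)" if "x \<in> carrier (obj X n)" for x
    using that abelian_group.minus_minus[OF cpx_group[OF X]] by (simp add: d dif_closed[OF X])
  have "(\<lambda>x. \<ominus>\<^bsub>obj X (n + 1)\<^esub> dif X n x) ` carrier (obj X n) = dif X n ` carrier (obj X n)"
  proof (intro equalityI subsetI; elim imageE)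
    fix y x assume "y = \<ominus>\<^bsub>obj X (n + 1)\<^esub> dif X n x" "x \<in> carrier (obj X n)"
    then show "y \<in> dif X n ` carrier (obj X n)"
      using d mod_inv[OF cpx_obj[OF X]] by (metis imageI)
  next
    fix y x assume "y = dif X n x" "x \<in> carrier (obj X n)"
    then show "y \<in> (\<lambda>x. \<ominus>\<^bsub>obj X (n + 1)\<^esub> dif X n x) ` carrier (obj X n)"
      using m mod_inv[OF cpx_obj[OF X]] by blast
  qed
  then show ?thesis by (simp add: coboundaries_def shift_def add.commute)
qed

lemma shift_map_quasi_iso:
  assumes X: "X \<in> complexes A" and Y: "Y \<in> complexes A" and f: "f \<in> quasi_isos A X Y"
  shows "shift_map f \<in> quasi_isos A (shift X) (shift Y)"
  using f shift_map_cm[OF X Y quasi_isos_cm[OF f]]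
  by (simp add: quasi_isos_iff X Y shift_complexes cmap_homology_inj_def cmap_homology_surj_def
      shift_cocycles shift_coboundaries shift_map_def shift_simps)

lemma shift_heq:
  assumes fg: "heq X Y f g"
  shows "heq (shift X) (shift Y) (shift_map f) (shift_map g)"
proof -
  have X: "X \<in> complexes A" and Y: "Y \<in> complexes A" and f: "f \<in> chain_maps A X Y" and g: "g \<in> chain_maps A X Y"
    and h: "homotopic A X Y f g" using fg by (auto simp: heq_def)
  from h X Y show ?thesis
  proof (cases rule: homotopicE)
    case (homotopy h)
    note h = homotopy(1) and eq = homotopy(2) and cl = homotopy(3-5)
    have "homotopic A (shift X) (shift Y) (shift_map f) (shift_map g)"
    \<comment> \<open>The homotopy changes sign together with the differential of the shift.\<close>
    proof (rule homotopicI[where h = "\<lambda>n x. \<ominus>\<^bsub>obj Y n\<^esub> h (n + 1) x"])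
      have "h (n + 1) \<in> rmod_hom A (obj X (n + 1)) (obj Y n)" for n using h[of "n + 1"] by simp
      then have "(\<lambda>x. \<ominus>\<^bsub>obj Y n\<^esub> h (n + 1) x) \<in> rmod_hom A (obj X (n + 1)) (obj Y n)" for n
        by (intro hom_neg cpx_obj X Y)
      then show "(\<lambda>x. \<ominus>\<^bsub>obj Y n\<^esub> h (n + 1) x) \<in> rmod_hom A (obj (shift X) n) (obj (shift Y) (n - 1))" for n
        by (simp add: shift_simps)
      fix n x assume "x \<in> carrier (obj (shift X) n)"
      then have x: "x \<in> carrier (obj X (n + 1))" by (simp add: shift_simps)
      note G = cpx_group[OF Y, of "n + 1"]
      have hx: "h (n + 1) x \<in> carrier (obj Y n)" using cl(1)[OF x] by simp
      have dh: "dif Y n (h (n + 1) x) \<in> carrier (obj Y (n + 1))" using cl(2)[OF x] by simp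
      have 1: "\<ominus>\<^bsub>obj Y (n + 1)\<^esub> dif Y n (\<ominus>\<^bsub>obj Y n\<^esub> h (n + 1) x) = dif Y n (h (n + 1) x)"
        unfolding dif_a_inv[OF Y hx] using dh G by algebra
      have 2: "\<ominus>\<^bsub>obj Y (n + 1)\<^esub> h (n + 1 + 1) (\<ominus>\<^bsub>obj X (n + 1 + 1)\<^esub> dif X (n + 1) x) = h (n + 1 + 1) (dif X (n + 1) x)"
      proof -
        have "h (n + 1 + 1) (\<ominus>\<^bsub>obj X (n + 1 + 1)\<^esub> dif X (n + 1) x) = \<ominus>\<^bsub>obj Y (n + 1)\<^esub> h (n + 1 + 1) (dif X (n + 1) x)"
          using hom_a_inv[OF h cpx_group[OF X] cpx_group[OF Y] dif_closed[OF X refl x]] by (simp add: add.commute)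
        moreover have "h (n + 1 + 1) (dif X (n + 1) x) \<in> carrier (obj Y (n + 1))" using cl(3)[OF x] .
        ultimately show ?thesis using G abelian_group.minus_minus by metis
      qed
      show "shift_map f n x = shift_map g n x \<oplus>\<^bsub>obj (shift Y) n\<^esub>
        (dif (shift Y) (n - 1) (\<ominus>\<^bsub>obj Y n\<^esub> h (n + 1) x) \<oplus>\<^bsub>obj (shift Y) n\<^esub> \<ominus>\<^bsub>obj Y (n + 1)\<^esub> h (n + 1 + 1) (dif (shift X) n x))"
        using eq[OF x] by (simp only: shift_map_def shift_simps diff_add_cancel 1 2 add_diff_cancel)
    qed
    then show ?thesis using X Y f g by (simp add: heq_def shift_complexes shift_map_cm)
  qed
qed

lemma shift_map_comp: "shift_map (g \<circ>\<^sub>c f) = shift_map g \<circ>\<^sub>c shift_map f"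
  and shift_map_cid: "shift_map cid = cid"
  by (simp_all add: shift_map_def ccomp_def cid_def)

text \<open>Used in \<open>cone_distinguished\<close>, where comparing a standard triangle with
  itself involves the shift of an identity. As \<open>D_shift\<close> collects the shifts of all
  representatives, each of these has to be compared with the identity roof.\<close>

lemma D_shift_id:
  assumes X: "X \<in> complexes A"
  shows "D_shift A X X (D_id A X) = D_id A (shift X)"
proof -
  note SX = shift_complexes[OF X]
  have rX: "(X, cid, cid) \<in> roofs A X X" and rS: "(shift X, cid, cid) \<in> roofs A (shift X) (shift X)"
    using X SX by (auto intro: cid_roof cm_id)
  have *: "((shift Z, shift_map s, shift_map f), (shift X, cid, cid)) \<in> roof_rel A (shift X) (shift X)"
    if zsf: "((X, cid, cid), (Z, s, f)) \<in> roof_rel A X X" for Z s f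
  proof -
    obtain W a b where W: "W \<in> complexes A" "a \<in> quasi_isos A W X" "b \<in> quasi_isos A W Z"
      and e: "heq W X (cid \<circ>\<^sub>c a) (s \<circ>\<^sub>c b)" "heq W X (cid \<circ>\<^sub>c a) (f \<circ>\<^sub>c b)" and r: "(Z, s, f) \<in> roofs A X X"
      using zsf unfolding roof_rel_iff[OF X X] by blast
    show ?thesis
      using r X W rS shift_heq[OF heq_sym[OF e(1)]] shift_heq[OF heq_sym[OF e(2)]]
      by (intro roof_relI[OF SX SX _ rS shift_complexes[OF W(1)], where a = "shift_map b" and b = "shift_map a"])
       (auto simp: in_roofs shift_complexes shift_map_quasi_iso shift_map_cm shift_map_comp shift_map_cid ccomp_cid)
  qed
  note eqv = roof_rel_equiv[OF SX SX]
  show ?thesis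
  proof (intro equalityI subsetI)
    fix r assume "r \<in> D_shift A X X (D_id A X)"
    then obtain Z s f where "((X, cid, cid), (Z, s, f)) \<in> roof_rel A X X"
      "((shift Z, shift_map s, shift_map f), r) \<in> roof_rel A (shift X) (shift X)"
      by (auto simp: D_shift_def D_id_def D_map_def)
    then show "r \<in> D_id A (shift X)"
      using *[of Z s f] eqv unfolding D_id_def D_map_def equiv_def by (auto dest: symD transD)
  next
    fix r assume "r \<in> D_id A (shift X)"
    moreover have "((X, cid, cid), (X, cid, cid)) \<in> roof_rel A X X"
      using roof_rel_equiv[OF X X] rX by (auto simp: equiv_def refl_on_def)
    ultimately show "r \<in> D_shift A X X (D_id A X)"
      unfolding D_shift_def D_id_def D_map_def by (auto simp: shift_map_cid intro!: exI[of _ X] exI[of _ cid])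
  qed
qed

context
  fixes X Y :: "'u cochain" and f :: "'u cmap"
  assumes X: "X \<in> complexes A" and Y: "Y \<in> complexes A" and f: "f \<in> chain_maps A X Y"
begin

lemma cone_obj: "obj (cone X Y f) n = module_sum (obj X (n + 1)) (obj Y n)"
  and cone_dif: "dif (cone X Y f) n (enc (x, y)) =
    enc (\<ominus>\<^bsub>obj X (n + 1 + 1)\<^esub> dif X (n + 1) x, f (n + 1) x \<oplus>\<^bsub>obj Y (n + 1)\<^esub> dif Y n y)"
  by (simp_all add: cone_def)

lemma cone_in_carrier: "enc (x, y) \<in> carrier (obj (cone X Y f) n) \<longleftrightarrow> x \<in> carrier (obj X (n + 1)) \<and> y \<in> carrier (obj Y n)"
  by (simp add: cone_obj enc_in_module_sum)

lemma cone_cases: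
  assumes "u \<in> carrier (obj (cone X Y f) n)"
  obtains x y where "u = enc (x, y)" "x \<in> carrier (obj X (n + 1))" "y \<in> carrier (obj Y n)"
  using assms unfolding cone_obj by (rule module_sum_cases)

lemma cone_complexes: "cone X Y f \<in> complexes A"
proof -
  have o: "obj (cone X Y f) n \<in> modules A" for n
    by (simp add: cone_obj module_sum_modules cpx_obj X Y)
  have "(\<lambda>u. enc (\<ominus>\<^bsub>obj X (n + 1 + 1)\<^esub> dif X (n + 1) (fst (dec u)),
                      f (n + 1) (fst (dec u)) \<oplus>\<^bsub>obj Y (n + 1)\<^esub> dif Y n (snd (dec u))))
      \<in> rmod_hom A (obj (cone X Y f) n) (module_sum (obj X (n + 1 + 1)) (obj Y (n + 1)))" for n
    by (intro module_sum_pair hom_neg hom_sum o cpx_obj X Y; unfold cone_obj)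
     (intro hom_comp[OF module_sum_fst] hom_comp[OF module_sum_snd] cpx_dif X Y refl cm_hom f)+
  then have d: "dif (cone X Y f) n \<in> rmod_hom A (obj (cone X Y f) n) (obj (cone X Y f) (n + 1))" for n
    by (simp add: cone_def)
  have "dif (cone X Y f) (n + 1) (dif (cone X Y f) n u) = \<zero>\<^bsub>obj (cone X Y f) (n + 1 + 1)\<^esub>"
    if u: "u \<in> carrier (obj (cone X Y f) n)" for u n
  proof -
    obtain x y where u: "u = enc (x, y)" and x: "x \<in> carrier (obj X (n + 1))" and y: "y \<in> carrier (obj Y n)"
      using u by (rule cone_cases)
    define m where "m = n + 1 + 1"
    have dx: "dif X (n + 1) x \<in> carrier (obj X m)" using dif_closed[OF X _ x] by (simp add: m_def)
    have dd: "dif X m (dif X (n + 1) x) = \<zero>\<^bsub>obj X (m + 1)\<^esub>" by (rule dif_dif[OF X _ x]) (simp add: m_def)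
    have "dif X m (\<ominus>\<^bsub>obj X m\<^esub> dif X (n + 1) x) = \<ominus>\<^bsub>obj X (m + 1)\<^esub> \<zero>\<^bsub>obj X (m + 1)\<^esub>"
      unfolding dif_a_inv[OF X dx] dd ..
    then have 1: "\<ominus>\<^bsub>obj X (m + 1)\<^esub> dif X m (\<ominus>\<^bsub>obj X m\<^esub> dif X (n + 1) x) = \<zero>\<^bsub>obj X (m + 1)\<^esub>"
      using cpx_group[OF X, of "m + 1"] by (simp add: abelian_group.abelian_group_simprules)
    have fx: "f (n + 1) x \<in> carrier (obj Y (n + 1))" "dif Y n y \<in> carrier (obj Y (n + 1))" "f m (dif X (n + 1) x) \<in> carrier (obj Y m)"
      using x y dx by (auto intro: cm_closed f dif_closed[OF Y])
    have 2: "f m (\<ominus>\<^bsub>obj X m\<^esub> dif X (n + 1) x) \<oplus>\<^bsub>obj Y m\<^esub> dif Y (n + 1) (f (n + 1) x \<oplus>\<^bsub>obj Y (n + 1)\<^esub> dif Y n y) = \<zero>\<^bsub>obj Y m\<^esub>"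
    proof -
      have "dif Y (n + 1) (f (n + 1) x \<oplus>\<^bsub>obj Y (n + 1)\<^esub> dif Y n y) = f m (dif X (n + 1) x) \<oplus>\<^bsub>obj Y m\<^esub> \<zero>\<^bsub>obj Y m\<^esub>"
        unfolding dif_add[OF Y fx(1,2)] m_def dif_dif[OF Y refl y] cm_dif[OF f refl x] ..
      then show ?thesis
        unfolding hom_a_inv[OF cm_hom[OF f] cpx_group[OF X] cpx_group[OF Y] dx] using fx(3) cpx_group[OF Y, of m] by algebra
    qed
    show ?thesis
      using 1 2 unfolding u cone_dif m_def cone_obj dec_module_sum by simp
  qed
  with o d show ?thesis by (simp add: complexes_def)
qed

lemma cone_in_cm: "cone_in X \<in> chain_maps A Y (cone X Y f)"
proof (rule chain_mapsI)
  show "cone_in X n \<in> rmod_hom A (obj Y n) (obj (cone X Y f) n)" for n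
    unfolding cone_in_def cone_obj by (intro module_sum_pair hom_const_zero hom_id cpx_obj X Y)
  fix n y assume y: "y \<in> carrier (obj Y n)"
  have "\<ominus>\<^bsub>obj X (n + 1 + 1)\<^esub> dif X (n + 1) \<zero>\<^bsub>obj X (n + 1)\<^esub> = \<zero>\<^bsub>obj X (n + 1 + 1)\<^esub>"
    unfolding dif_zero[OF X] using cpx_group[OF X, of "n + 1 + 1"] by algebra
  moreover have "\<zero>\<^bsub>obj Y (n + 1)\<^esub> \<oplus>\<^bsub>obj Y (n + 1)\<^esub> dif Y n y = dif Y n y"
    using dif_closed[OF Y refl y] cpx_group[OF Y, of "n + 1"] by algebra
  ultimately show "cone_in X (n + 1) (dif Y n y) = dif (cone X Y f) n (cone_in X n y)"
    unfolding cone_in_def cone_dif cm_zero[OF f X Y] by simp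
qed

lemma cone_out_cm: "cone_out \<in> chain_maps A (cone X Y f) (shift X)"
  by (rule chain_mapsI)
    (auto simp: cone_out_def cone_obj shift_simps cone_dif[simplified] intro: module_sum_fst elim!: cone_cases module_sum_cases)

lemma cone_distinguished:
  "distinguished_triangle A X Y (cone X Y f) (D_map A X Y f) (D_map A Y (cone X Y f) (cone_in X))
    (D_map A (cone X Y f) (shift X) cone_out)"
proof -
  note C = cone_complexes and S = shift_complexes[OF X]
  have m: "D_map A X Y f \<in> D_hom A X Y" "D_map A Y (cone X Y f) (cone_in X) \<in> D_hom A Y (cone X Y f)"
    "D_map A (cone X Y f) (shift X) cone_out \<in> D_hom A (cone X Y f) (shift X)"
    by (intro D_map_D_hom X Y C f cone_in_cm cone_out_cm)+
  show ?thesis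
    unfolding distinguished_triangle_def
    using X Y C S m
    by (intro conjI bexI[of _ X] bexI[of _ Y] bexI[of _ f] bexI[of _ "D_id A X"] bexI[of _ "D_id A Y"] bexI[of _ "D_id A (cone X Y f)"])
     (auto simp: D_isos_id f D_comp_id_left D_comp_id_right D_shift_id)
qed

end

text \<open>Chain maps are functions on all of \<open>'u\<close>. Maps that agree on the carriers
  may differ elsewhere, and \<open>heq\<close> identifies them.\<close>

lemma heq_ext:
  assumes "X \<in> complexes A" "Y \<in> complexes A" "f \<in> chain_maps A X Y" "g \<in> chain_maps A X Y"
    "\<And>n x. x \<in> carrier (obj X n) \<Longrightarrow> f n x = g n x"
  shows "heq X Y f g"
proof -
  have "homotopic A X Y f f" using assms by (simp add: homotopic_refl)
  then have "homotopic A X Y f g" unfolding homotopic_def using assms(5) by (metis)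
  then show ?thesis using assms by (simp add: heq_def)
qed

lemma roof_class_eqI:
  assumes "X \<in> complexes A" "Y \<in> complexes A" "(Z, s, f) \<in> roofs A X Y" "(Z', s', f') \<in> roofs A X Y"
    "b \<in> quasi_isos A Z Z'" "heq Z X s (s' \<circ>\<^sub>c b)" "heq Z Y f (f' \<circ>\<^sub>c b)"
  shows "roof_class X Y (Z, s, f) = roof_class X Y (Z', s', f')"
proof -
  have "Z \<in> complexes A" using assms by (simp add: in_roofs)
  then show ?thesis
    using assms by (subst roof_class_eq_iff) (auto intro!: roof_relI[where W = Z and a = cid and b = b] simp: ccomp_cid quasi_isos_cid)
qed

text \<open>As with fractions, both roofs are refined to the Ore square of their left legs.\<close>

lemma D_hom_common_denominator:
  assumes X: "X \<in> complexes A" and Y: "Y \<in> complexes A" and "\<alpha> \<in> D_hom A X Y" "\<beta> \<in> D_hom A X Y"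
  obtains Z s f g where "(Z, s, f) \<in> roofs A X Y" "(Z, s, g) \<in> roofs A X Y" "\<alpha> = roof_class X Y (Z, s, f)" "\<beta> = roof_class X Y (Z, s, g)"
proof -
  obtain Z s f where Z: "(Z, s, f) \<in> roofs A X Y" "\<alpha> = roof_class X Y (Z, s, f)" using assms(3) by (rule D_hom_cases)
  obtain W t g where W: "(W, t, g) \<in> roofs A X Y" "\<beta> = roof_class X Y (W, t, g)" using assms(4) by (rule D_hom_cases)
  have Zc: "Z \<in> complexes A" "s \<in> quasi_isos A Z X" "f \<in> chain_maps A Z Y"
    and Wc: "W \<in> complexes A" "t \<in> quasi_isos A W X" "g \<in> chain_maps A W Y"
    using Z W by (auto simp: in_roofs)
  obtain P p q where P: "P \<in> complexes A" "p \<in> quasi_isos A P Z" "q \<in> chain_maps A P W" "heq P X (s \<circ>\<^sub>c p) (t \<circ>\<^sub>c q)"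
    by (rule ore[OF Zc(1) Wc(1) X quasi_isos_cm[OF Zc(2)] Wc(2)])
  have sp: "s \<circ>\<^sub>c p \<in> quasi_isos A P X" by (rule quasi_isos_comp[OF P(2) Zc(2) P(1) Zc(1) X])
  then have "t \<circ>\<^sub>c q \<in> quasi_isos A P X" using heq_qis[OF P(4)] by simp
  from quasi_isos_cancel_left[OF this Wc(2) P(3) P(1) Wc(1) X] have q: "q \<in> quasi_isos A P W" .
  have r: "(P, s \<circ>\<^sub>c p, f \<circ>\<^sub>c p) \<in> roofs A X Y" "(P, s \<circ>\<^sub>c p, g \<circ>\<^sub>c q) \<in> roofs A X Y"
    using P sp Zc Wc by (auto simp: in_roofs intro: cm_comp quasi_isos_cm)
  show ?thesis
  proof (rule that[OF r])
    have h: "heq P X (s \<circ>\<^sub>c p) (s \<circ>\<^sub>c p)" "heq P Y (f \<circ>\<^sub>c p) (f \<circ>\<^sub>c p)" "heq P Y (g \<circ>\<^sub>c q) (g \<circ>\<^sub>c q)"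
      using r P X Y by (auto simp: in_roofs intro: heq_refl quasi_isos_cm)
    show "\<alpha> = roof_class X Y (P, s \<circ>\<^sub>c p, f \<circ>\<^sub>c p)"
      using roof_class_eqI[OF X Y r(1) Z(1) P(2) h(1,2)] Z(2) by simp
    show "\<beta> = roof_class X Y (P, s \<circ>\<^sub>c p, g \<circ>\<^sub>c q)"
      using roof_class_eqI[OF X Y r(2) W(1) q P(4) h(3)] W(2) by simp
  qed
qed

text \<open>Equality of the classes gives two refinements a and b with s a homotopic to s b.
  Cancelling \<open>s\<close> makes a and b homotopic after a further refinement, so a single one
  suffices.\<close>

lemma roof_class_same_denominator:
  assumes X: "X \<in> complexes A" and Y: "Y \<in> complexes A" and r: "(Z, s, f) \<in> roofs A X Y" "(Z, s, g) \<in> roofs A X Y"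
  shows "roof_class X Y (Z, s, f) = roof_class X Y (Z, s, g) \<longleftrightarrow>
    (\<exists>W\<in>complexes A. \<exists>a\<in>quasi_isos A W Z. heq W Y (f \<circ>\<^sub>c a) (g \<circ>\<^sub>c a))" (is "?L \<longleftrightarrow> ?R")
proof
  have Zc: "Z \<in> complexes A" "s \<in> quasi_isos A Z X" "f \<in> chain_maps A Z Y" "g \<in> chain_maps A Z Y"
    using r by (auto simp: in_roofs)
  {
    assume ?L
    then have "((Z, s, f), (Z, s, g)) \<in> roof_rel A X Y" using roof_class_eq_iff[OF X Y r] by simp
    then obtain W a b where W: "W \<in> complexes A" and a: "a \<in> quasi_isos A W Z" and b: "b \<in> quasi_isos A W Z"
      and e: "heq W X (s \<circ>\<^sub>c a) (s \<circ>\<^sub>c b)" "heq W Y (f \<circ>\<^sub>c a) (g \<circ>\<^sub>c b)"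
      unfolding roof_rel_iff[OF X Y] by blast
    obtain V v where V: "V \<in> complexes A" "v \<in> quasi_isos A V W" "heq V Z (a \<circ>\<^sub>c v) (b \<circ>\<^sub>c v)"
      by (rule cancel[OF W Zc(1) X quasi_isos_cm[OF a] quasi_isos_cm[OF b] Zc(2) e(1)])
    have "heq V Y (f \<circ>\<^sub>c (a \<circ>\<^sub>c v)) (g \<circ>\<^sub>c (a \<circ>\<^sub>c v))"
      using heq_trans[OF heq_right[OF e(2) quasi_isos_cm[OF V(2)] V(1), unfolded ccomp_assoc]
          heq_sym[OF heq_left[OF V(3) Zc(4) Y]]] .
    moreover have "a \<circ>\<^sub>c v \<in> quasi_isos A V Z" by (rule quasi_isos_comp[OF V(2) a V(1) W Zc(1)])
    ultimately show ?R using V(1) by blast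
  next
    assume ?R
    then obtain W a where W: "W \<in> complexes A" "a \<in> quasi_isos A W Z" "heq W Y (f \<circ>\<^sub>c a) (g \<circ>\<^sub>c a)" by blast
    moreover have "heq W X (s \<circ>\<^sub>c a) (s \<circ>\<^sub>c a)"
      using W Zc X by (intro heq_refl) (auto intro: cm_comp quasi_isos_cm)
    ultimately show ?L using r X Y by (auto simp: roof_class_eq_iff intro!: roof_relI)
  }
qed

lemma cprod_in_natural:
  assumes I: "small I" and Z: "\<And>i. i \<in> I \<Longrightarrow> Z i \<in> complexes A" and X: "\<And>i. i \<in> I \<Longrightarrow> X i \<in> complexes A"
    and s: "\<And>i. i \<in> I \<Longrightarrow> s i \<in> chain_maps A (Z i) (X i)" and i: "i \<in> I"
  shows "heq (Z i) (cprod False I X) (cprod_in I X i \<circ>\<^sub>c s i) (cprod_map I s \<circ>\<^sub>c cprod_in I Z i)"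
proof -
  have inX: "cprod_in I X i \<in> chain_maps A (X i) (cprod False I X)" by (rule cprod_in_cm[OF I X i])
  have inZ: "cprod_in I Z i \<in> chain_maps A (Z i) (cprod False I Z)" by (rule cprod_in_cm[OF I Z i])
  have C: "cprod False I X \<in> complexes A" by (rule cprod_complexes[OF I X])
  have 1: "cprod_in I X i \<circ>\<^sub>c s i \<in> chain_maps A (Z i) (cprod False I X)" by (rule cm_comp[OF s[OF i] inX])
  have m: "cprod_map I s \<in> chain_maps A (cprod False I Z) (cprod False I X)" by (rule cprod_map_cm[OF I Z X s])
  have 2: "cprod_map I s \<circ>\<^sub>c cprod_in I Z i \<in> chain_maps A (Z i) (cprod False I X)" by (rule cm_comp[OF inZ m])
  have "(cprod_in I X i \<circ>\<^sub>c s i) n x = (cprod_map I s \<circ>\<^sub>c cprod_in I Z i) n x" if x: "x \<in> carrier (obj (Z i) n)" for n x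
    by (rule cprod_ext[OF I cm_closed[OF 1 x] cm_closed[OF 2 x]])
      (auto simp: up_cprod[OF I] ccomp_def cm_zero[OF s Z X] intro: cm_zero[OF s Z X, symmetric] cm_zero[OF s Z X])
  then show ?thesis by (rule heq_ext[OF Z[OF i] C 1 2])
qed

text \<open>Existence: roofs for the \<open>\<phi> i\<close> are added up, and the left leg of the
  sum is a quasi-isomorphism because direct sums are exact. Uniqueness: two candidates with a common
  denominator agree on each summand after some refinement, and the direct sum of these refinements
  serves for the whole.\<close>

lemma cprod_coproduct:
  assumes I: "small I" and X: "\<And>i. i \<in> I \<Longrightarrow> X i \<in> complexes A"
  shows "is_coproduct A I X (cprod False I X) (\<lambda>i. D_map A (X i) (cprod False I X) (cprod_in I X i))"
  unfolding is_coproduct_def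
proof (intro conjI ballI allI impI)
  let ?C = "cprod False I X"
  have C: "?C \<in> complexes A" by (rule cprod_complexes[OF I X])
  have inc: "cprod_in I X i \<in> chain_maps A (X i) ?C" if "i \<in> I" for i by (rule cprod_in_cm[OF I X that])
  show "?C \<in> complexes A" by (rule C)
  show "i \<in> I \<Longrightarrow> D_map A (X i) ?C (cprod_in I X i) \<in> D_hom A (X i) ?C" for i
    by (intro D_map_D_hom X inc)
  let ?\<iota> = "\<lambda>i. D_map A (X i) ?C (cprod_in I X i)"
  fix Y \<phi> assume Y: "Y \<in> complexes A" and \<phi>: "\<forall>i\<in>I. \<phi> i \<in> D_hom A (X i) Y"
  show "\<exists>!\<psi>. \<psi> \<in> D_hom A ?C Y \<and> (\<forall>i\<in>I. D_comp A (X i) ?C Y \<psi> (?\<iota> i) = \<phi> i)"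
  proof (rule ex_ex1I)
    have "\<exists>Z s f. (Z, s, f) \<in> roofs A (X i) Y \<and> \<phi> i = roof_class (X i) Y (Z, s, f)" if "i \<in> I" for i
      using \<phi> that by (metis D_hom_cases)
    then obtain Z s f where r: "\<And>i. i \<in> I \<Longrightarrow> (Z i, s i, f i) \<in> roofs A (X i) Y"
      and \<phi>r: "\<And>i. i \<in> I \<Longrightarrow> \<phi> i = roof_class (X i) Y (Z i, s i, f i)" by metis
    have Z: "i \<in> I \<Longrightarrow> Z i \<in> complexes A" and s: "i \<in> I \<Longrightarrow> s i \<in> quasi_isos A (Z i) (X i)"
      and f: "i \<in> I \<Longrightarrow> f i \<in> chain_maps A (Z i) Y" for i using r by (auto simp: in_roofs)
    let ?Z = "cprod False I Z"
    have ZC: "?Z \<in> complexes A" by (rule cprod_complexes[OF I Z])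
    have inZ: "cprod_in I Z i \<in> chain_maps A (Z i) ?Z" if "i \<in> I" for i by (rule cprod_in_cm[OF I Z that])
    have copZ: "cprod_copair I Z Y f \<in> chain_maps A ?Z Y" by (rule cprod_copair_cm[OF I Z Y f])
    have mapZ: "cprod_map I s \<in> quasi_isos A ?Z ?C" by (rule cprod_map_quasi_iso[OF I Z X s])
    have copin: "cprod_copair I Z Y f n (cprod_in I Z i n x) = f i n x" if "i \<in> I" "x \<in> carrier (obj (Z i) n)" for i n x
      by (rule cprod_copair_in[OF I Z Y f]) (auto simp: that)
    have R: "(?Z, cprod_map I s, cprod_copair I Z Y f) \<in> roofs A ?C Y"
      using mapZ copZ ZC by (simp add: in_roofs)
    have "D_comp A (X i) ?C Y (roof_class ?C Y (?Z, cprod_map I s, cprod_copair I Z Y f)) (?\<iota> i) = \<phi> i"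
      if i: "i \<in> I" for i
    proof -
      have "heq (Z i) ?C (cprod_in I X i \<circ>\<^sub>c s i) (cprod_map I s \<circ>\<^sub>c cprod_in I Z i)"
        by (rule cprod_in_natural[OF I Z X quasi_isos_cm[OF s] i])
      then have "D_comp A (X i) ?C Y (roof_class ?C Y (?Z, cprod_map I s, cprod_copair I Z Y f)) (?\<iota> i) =
          roof_class (X i) Y (Z i, s i, cprod_copair I Z Y f \<circ>\<^sub>c cprod_in I Z i)"
        by (rule D_comp_map_right[OF X[OF i] C Y inc[OF i] R Z[OF i] s[OF i] inZ[OF i]])
      also have "\<dots> = \<phi> i"
        unfolding \<phi>r[OF i]
      proof (rule roof_class_eqI[where b = cid, OF X[OF i] Y _ r[OF i] quasi_isos_cid[OF Z[OF i]]])
        show k: "(Z i, s i, cprod_copair I Z Y f \<circ>\<^sub>c cprod_in I Z i) \<in> roofs A (X i) Y"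
          using i by (auto simp: in_roofs Z s intro: cm_comp[OF inZ copZ])
        show "heq (Z i) (X i) (s i) (s i \<circ>\<^sub>c cid)" using i by (simp add: ccomp_cid heq_refl Z X quasi_isos_cm[OF s])
        show "heq (Z i) Y (cprod_copair I Z Y f \<circ>\<^sub>c cprod_in I Z i) (f i \<circ>\<^sub>c cid)"
          unfolding ccomp_cid using k i by (intro heq_ext) (auto simp: in_roofs Z Y f ccomp_def copin)
      qed
      finally show ?thesis .
    qed
    then show "\<exists>\<psi>. \<psi> \<in> D_hom A ?C Y \<and> (\<forall>i\<in>I. D_comp A (X i) ?C Y \<psi> (?\<iota> i) = \<phi> i)"
      using roof_class_D_hom[OF R] by blast
  next
    fix \<psi> \<psi>' assume
      \<psi>: "\<psi> \<in> D_hom A ?C Y \<and> (\<forall>i\<in>I. D_comp A (X i) ?C Y \<psi> (?\<iota> i) = \<phi> i)"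
      and \<psi>': "\<psi>' \<in> D_hom A ?C Y \<and> (\<forall>i\<in>I. D_comp A (X i) ?C Y \<psi>' (?\<iota> i) = \<phi> i)"
    obtain Z s f g where r: "(Z, s, f) \<in> roofs A ?C Y" "(Z, s, g) \<in> roofs A ?C Y"
      and e: "\<psi> = roof_class ?C Y (Z, s, f)" "\<psi>' = roof_class ?C Y (Z, s, g)"
      using D_hom_common_denominator[OF C Y] \<psi> \<psi>' by metis
    have Z: "Z \<in> complexes A" and s: "s \<in> quasi_isos A Z ?C" and f: "f \<in> chain_maps A Z Y" and g: "g \<in> chain_maps A Z Y"
      using r by (auto simp: in_roofs)
    \<comment> \<open>\<open>Q\<close> records a refinement over the summand X i: an Ore square
      lifts the inclusion of X i to the denominator Z, and after passing to W the two numerators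
      agree.\<close>
    define Q where "Q i W p q \<longleftrightarrow> W \<in> complexes A \<and> p \<in> quasi_isos A W (X i) \<and> q \<in> chain_maps A W Z \<and>
      heq W ?C (cprod_in I X i \<circ>\<^sub>c p) (s \<circ>\<^sub>c q) \<and> heq W Y (f \<circ>\<^sub>c q) (g \<circ>\<^sub>c q)" for i W p q
    have "\<exists>W p q. Q i W p q" if i: "i \<in> I" for i
    proof -
      obtain P p q where P: "P \<in> complexes A" "p \<in> quasi_isos A P (X i)" "q \<in> chain_maps A P Z" "heq P ?C (cprod_in I X i \<circ>\<^sub>c p) (s \<circ>\<^sub>c q)"
        by (rule ore[OF X[OF i] Z C inc[OF i] s])
      have "roof_class (X i) Y (P, p, f \<circ>\<^sub>c q) = roof_class (X i) Y (P, p, g \<circ>\<^sub>c q)"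
        using \<psi> \<psi>' i unfolding e D_comp_map_right[OF X[OF i] C Y inc[OF i] r(1) P, symmetric] D_comp_map_right[OF X[OF i] C Y inc[OF i] r(2) P, symmetric]
        by simp
      then obtain W a where W: "W \<in> complexes A" "a \<in> quasi_isos A W P" "heq W Y ((f \<circ>\<^sub>c q) \<circ>\<^sub>c a) ((g \<circ>\<^sub>c q) \<circ>\<^sub>c a)"
        by (subst (asm) roof_class_same_denominator[OF X[OF i] Y]) (use P f g in \<open>auto simp: in_roofs intro: cm_comp\<close>)
      have "Q i W (p \<circ>\<^sub>c a) (q \<circ>\<^sub>c a)"
        using W P heq_right[OF P(4) quasi_isos_cm[OF W(2)] W(1)] quasi_isos_comp[OF W(2) P(2) W(1) P(1) X[OF i]] cm_comp[OF quasi_isos_cm[OF W(2)] P(3)]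
        by (simp add: Q_def ccomp_assoc)
      then show ?thesis by blast
    qed
    then obtain W p q where Q: "\<And>i. i \<in> I \<Longrightarrow> Q i (W i) (p i) (q i)" by metis
    have W: "i \<in> I \<Longrightarrow> W i \<in> complexes A" and p: "i \<in> I \<Longrightarrow> p i \<in> quasi_isos A (W i) (X i)" and q: "i \<in> I \<Longrightarrow> q i \<in> chain_maps A (W i) Z"
      and pq: "i \<in> I \<Longrightarrow> heq (W i) ?C (cprod_in I X i \<circ>\<^sub>c p i) (s \<circ>\<^sub>c q i)" and fg: "i \<in> I \<Longrightarrow> heq (W i) Y (f \<circ>\<^sub>c q i) (g \<circ>\<^sub>c q i)" for i
      using Q by (auto simp: Q_def)
    let ?W = "cprod False I W"
    let ?q = "cprod_copair I W Z q"
    have WC: "?W \<in> complexes A" by (rule cprod_complexes[OF I W])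
    have qc: "?q \<in> chain_maps A ?W Z" by (rule cprod_copair_cm[OF I W Z q])
    have inW: "cprod_in I W i \<in> chain_maps A (W i) ?W" if "i \<in> I" for i by (rule cprod_in_cm[OF I W that])
    have pm: "cprod_map I p \<in> quasi_isos A ?W ?C" by (rule cprod_map_quasi_iso[OF I W X p])
    have qin: "?q n (cprod_in I W i n x) = q i n x" if "i \<in> I" "x \<in> carrier (obj (W i) n)" for i n x
      by (rule cprod_copair_in[OF I W Z q]) (auto simp: that)
    note scm = quasi_isos_cm[OF s]
    have q_in: "heq (W i) Z (?q \<circ>\<^sub>c cprod_in I W i) (q i)" if "i \<in> I" for i
      by (rule heq_ext[OF W Z cm_comp[OF inW qc] q]) (use that in \<open>auto simp: ccomp_def qin\<close>)
    have in_nat: "heq (W i) ?C (cprod_map I p \<circ>\<^sub>c cprod_in I W i) (cprod_in I X i \<circ>\<^sub>c p i)" if i: "i \<in> I" for i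
      by (rule heq_sym[OF cprod_in_natural[OF I W X quasi_isos_cm[OF p] i]])
    \<comment> \<open>The assembled map to Z, followed by \<open>s\<close>, is homotopic to the sum
      of the quasi-isomorphisms \<open>p i\<close>. Hence it is a quasi-isomorphism itself and may
      be used as a refinement.\<close>
    have "heq ?W ?C (cprod_map I p) (s \<circ>\<^sub>c ?q)"
    proof (rule cprod_copair_homotopic[OF I W C quasi_isos_cm[OF pm] cm_comp[OF qc scm]])
      fix i assume i: "i \<in> I"
      show "heq (W i) ?C (cprod_map I p \<circ>\<^sub>c cprod_in I W i) ((s \<circ>\<^sub>c ?q) \<circ>\<^sub>c cprod_in I W i)"
        unfolding ccomp_assoc
        using heq_trans[OF in_nat[OF i] heq_trans[OF pq[OF i] heq_sym[OF heq_left[OF q_in[OF i] scm C]]]] .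
    qed
    then have "s \<circ>\<^sub>c ?q \<in> quasi_isos A ?W ?C" using heq_qis pm by blast
    from quasi_isos_cancel_left[OF this s qc WC Z C] have "?q \<in> quasi_isos A ?W Z" .
    moreover have "heq ?W Y (f \<circ>\<^sub>c ?q) (g \<circ>\<^sub>c ?q)"
    proof (rule cprod_copair_homotopic[OF I W Y cm_comp[OF qc f] cm_comp[OF qc g]])
      fix i assume i: "i \<in> I"
      show "heq (W i) Y ((f \<circ>\<^sub>c ?q) \<circ>\<^sub>c cprod_in I W i) ((g \<circ>\<^sub>c ?q) \<circ>\<^sub>c cprod_in I W i)"
        unfolding ccomp_assoc
        using heq_trans[OF heq_left[OF q_in[OF i] f Y] heq_trans[OF fg[OF i] heq_sym[OF heq_left[OF q_in[OF i] g Y]]]] .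
    qed
    ultimately show "\<psi> = \<psi>'"
      unfolding e roof_class_same_denominator[OF C Y r] using WC by blast
  qed
qed

text \<open>Pulling the product of the \<open>a i\<close> back along the diagonal of Y gives a
  common refinement of all of them. For morphisms into a product, infinitely many left legs over Y
  have to be unified at once.\<close>

lemma wide_ore:
  fixes I :: "'u set"
  assumes I: "small I" and Y: "Y \<in> complexes A" and W: "\<And>i. i \<in> I \<Longrightarrow> W i \<in> complexes A"
    and a: "\<And>i. i \<in> I \<Longrightarrow> a i \<in> quasi_isos A (W i) Y"
  shows "\<exists>P p q. P \<in> complexes A \<and> p \<in> quasi_isos A P Y \<and>
    (\<forall>i\<in>I. q i \<in> chain_maps A P (W i) \<and> heq P Y p (a i \<circ>\<^sub>c q i))"
proof -
  let ?Y = "cprod True I (\<lambda>_. Y)" and ?W = "cprod True I W"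
  have YC: "?Y \<in> complexes A" by (rule cprod_complexes[OF I]) (rule Y)
  have WC: "?W \<in> complexes A" by (rule cprod_complexes[OF I]) (rule W)
  have d: "cprod_pair I (\<lambda>_. cid) \<in> chain_maps A Y ?Y" by (rule cprod_pair_cm[OF I Y Y cm_id])
  have m: "cprod_map I a \<in> quasi_isos A ?W ?Y" by (rule cprod_map_quasi_iso[OF I W Y a])
  obtain P p q where P: "P \<in> complexes A" "p \<in> quasi_isos A P Y" "q \<in> chain_maps A P ?W"
    and pq: "heq P ?Y (cprod_pair I (\<lambda>_. cid) \<circ>\<^sub>c p) (cprod_map I a \<circ>\<^sub>c q)"
    by (rule ore[OF Y WC YC d m])
  have qi: "cprod_proj i \<circ>\<^sub>c q \<in> chain_maps A P (W i)" if "i \<in> I" for i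
    by (rule cm_comp[OF P(3) cprod_proj_cm[OF I W that]])
  have "heq P Y p (a i \<circ>\<^sub>c (cprod_proj i \<circ>\<^sub>c q))" if i: "i \<in> I" for i
  proof -
    have pr: "cprod_proj i \<in> chain_maps A ?Y Y" by (rule cprod_proj_cm[OF I Y i])
    have "cprod_proj i \<circ>\<^sub>c (cprod_pair I (\<lambda>_. cid) \<circ>\<^sub>c p) = p"
      using i by (simp add: fun_eq_iff ccomp_def cprod_proj_def up_cprod[OF I] cid_def)
    moreover have "cprod_proj i \<circ>\<^sub>c (cprod_map I a \<circ>\<^sub>c q) = a i \<circ>\<^sub>c (cprod_proj i \<circ>\<^sub>c q)"
      using i by (simp add: fun_eq_iff ccomp_def cprod_proj_def up_cprod[OF I])
    ultimately show ?thesis using heq_left[OF pq pr Y] by simp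
  qed
  then show ?thesis using P qi
    by (intro exI[of _ P] exI[of _ p] exI[of _ "\<lambda>i. cprod_proj i \<circ>\<^sub>c q"]) auto
qed

text \<open>Dual to \<open>cprod_coproduct\<close>, except that the roofs for the
  \<open>\<phi> i\<close> have different left legs over the same Y. \<open>wide_ore\<close> replaces
  them by one, and does the same for the refinements in the uniqueness part.\<close>

lemma cprod_product:
  assumes I: "small I" and X: "\<And>i. i \<in> I \<Longrightarrow> X i \<in> complexes A"
  shows "is_product A I X (cprod True I X) (\<lambda>i. D_map A (cprod True I X) (X i) (cprod_proj i))"
  unfolding is_product_def
proof (intro conjI ballI allI impI)
  let ?C = "cprod True I X"
  have C: "?C \<in> complexes A" by (rule cprod_complexes[OF I X])
  have pr: "cprod_proj i \<in> chain_maps A ?C (X i)" if "i \<in> I" for i by (rule cprod_proj_cm[OF I X that])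
  show "?C \<in> complexes A" by (rule C)
  show "i \<in> I \<Longrightarrow> D_map A ?C (X i) (cprod_proj i) \<in> D_hom A ?C (X i)" for i
    by (intro D_map_D_hom C pr)
  let ?\<pi> = "\<lambda>i. D_map A ?C (X i) (cprod_proj i)"
  fix Y \<phi> assume Y: "Y \<in> complexes A" and \<phi>: "\<forall>i\<in>I. \<phi> i \<in> D_hom A Y (X i)"
  show "\<exists>!\<psi>. \<psi> \<in> D_hom A Y ?C \<and> (\<forall>i\<in>I. D_comp A Y ?C (X i) (?\<pi> i) \<psi> = \<phi> i)"
  proof (rule ex_ex1I)
    have "\<exists>Z s f. (Z, s, f) \<in> roofs A Y (X i) \<and> \<phi> i = roof_class Y (X i) (Z, s, f)" if "i \<in> I" for i
      using \<phi> that by (metis D_hom_cases)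
    then obtain Z s f where r: "\<And>i. i \<in> I \<Longrightarrow> (Z i, s i, f i) \<in> roofs A Y (X i)"
      and \<phi>r: "\<And>i. i \<in> I \<Longrightarrow> \<phi> i = roof_class Y (X i) (Z i, s i, f i)" by metis
    have Z: "i \<in> I \<Longrightarrow> Z i \<in> complexes A" and s: "i \<in> I \<Longrightarrow> s i \<in> quasi_isos A (Z i) Y"
      and f: "i \<in> I \<Longrightarrow> f i \<in> chain_maps A (Z i) (X i)" for i using r by (auto simp: in_roofs)
    obtain P p q where P: "P \<in> complexes A" and p: "p \<in> quasi_isos A P Y" and q: "\<And>i. i \<in> I \<Longrightarrow> q i \<in> chain_maps A P (Z i)"
      and pq: "\<And>i. i \<in> I \<Longrightarrow> heq P Y p (s i \<circ>\<^sub>c q i)"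
      using wide_ore[OF I Y, of Z s] Z s by blast
    let ?f = "cprod_pair I (\<lambda>i. f i \<circ>\<^sub>c q i)"
    have fq: "i \<in> I \<Longrightarrow> f i \<circ>\<^sub>c q i \<in> chain_maps A P (X i)" for i by (rule cm_comp[OF q f])
    have R: "(P, p, ?f) \<in> roofs A Y ?C" using P p cprod_pair_cm[OF I X P fq] by (simp add: in_roofs)
    have "D_comp A Y ?C (X i) (?\<pi> i) (roof_class Y ?C (P, p, ?f)) = \<phi> i" if i: "i \<in> I" for i
    proof -
      have "cprod_proj i \<circ>\<^sub>c ?f = f i \<circ>\<^sub>c q i" using i by (simp add: fun_eq_iff ccomp_def cprod_proj_def up_cprod[OF I])
      then have "D_comp A Y ?C (X i) (?\<pi> i) (roof_class Y ?C (P, p, ?f)) = roof_class Y (X i) (P, p, f i \<circ>\<^sub>c q i)"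
        using D_comp_map_left[OF Y C X[OF i] R pr[OF i]] by simp
      also have "\<dots> = \<phi> i"
        unfolding \<phi>r[OF i]
      proof (rule roof_class_eqI[OF Y X[OF i] _ r[OF i] _ pq[OF i]])
        show "(P, p, f i \<circ>\<^sub>c q i) \<in> roofs A Y (X i)" using P p fq[OF i] by (simp add: in_roofs)
        show "heq P (X i) (f i \<circ>\<^sub>c q i) (f i \<circ>\<^sub>c q i)" by (rule heq_refl[OF P X[OF i] fq[OF i]])
        have "s i \<circ>\<^sub>c q i \<in> quasi_isos A P Y" using heq_qis[OF pq[OF i]] p by simp
        then show "q i \<in> quasi_isos A P (Z i)" by (rule quasi_isos_cancel_left[OF _ s[OF i] q[OF i] P Z[OF i] Y])
      qed
      finally show ?thesis .
    qed
    then show "\<exists>\<psi>. \<psi> \<in> D_hom A Y ?C \<and> (\<forall>i\<in>I. D_comp A Y ?C (X i) (?\<pi> i) \<psi> = \<phi> i)"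
      using roof_class_D_hom[OF R] by blast
  next
    fix \<psi> \<psi>' assume
      \<psi>: "\<psi> \<in> D_hom A Y ?C \<and> (\<forall>i\<in>I. D_comp A Y ?C (X i) (?\<pi> i) \<psi> = \<phi> i)"
      and \<psi>': "\<psi>' \<in> D_hom A Y ?C \<and> (\<forall>i\<in>I. D_comp A Y ?C (X i) (?\<pi> i) \<psi>' = \<phi> i)"
    obtain Z s f g where r: "(Z, s, f) \<in> roofs A Y ?C" "(Z, s, g) \<in> roofs A Y ?C"
      and e: "\<psi> = roof_class Y ?C (Z, s, f)" "\<psi>' = roof_class Y ?C (Z, s, g)"
      using D_hom_common_denominator[OF Y C] \<psi> \<psi>' by metis
    have Z: "Z \<in> complexes A" and s: "s \<in> quasi_isos A Z Y" and f: "f \<in> chain_maps A Z ?C" and g: "g \<in> chain_maps A Z ?C"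
      using r by (auto simp: in_roofs)
    have "\<exists>W a. W \<in> complexes A \<and> a \<in> quasi_isos A W Z \<and> heq W (X i) ((cprod_proj i \<circ>\<^sub>c f) \<circ>\<^sub>c a) ((cprod_proj i \<circ>\<^sub>c g) \<circ>\<^sub>c a)" if i: "i \<in> I" for i
    proof -
      have "roof_class Y (X i) (Z, s, cprod_proj i \<circ>\<^sub>c f) = roof_class Y (X i) (Z, s, cprod_proj i \<circ>\<^sub>c g)"
        using \<psi> \<psi>' i unfolding e D_comp_map_left[OF Y C X[OF i] r(1) pr[OF i], symmetric] D_comp_map_left[OF Y C X[OF i] r(2) pr[OF i], symmetric]
        by simp
      then show ?thesis
        by (subst (asm) roof_class_same_denominator[OF Y X[OF i]])
          (use Z s cm_comp[OF f pr[OF i]] cm_comp[OF g pr[OF i]] in \<open>auto simp: in_roofs\<close>)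
    qed
    then obtain W a where W: "\<And>i. i \<in> I \<Longrightarrow> W i \<in> complexes A" and a: "\<And>i. i \<in> I \<Longrightarrow> a i \<in> quasi_isos A (W i) Z"
      and fg: "\<And>i. i \<in> I \<Longrightarrow> heq (W i) (X i) ((cprod_proj i \<circ>\<^sub>c f) \<circ>\<^sub>c a i) ((cprod_proj i \<circ>\<^sub>c g) \<circ>\<^sub>c a i)" by metis
    obtain P p q where P: "P \<in> complexes A" and p: "p \<in> quasi_isos A P Z" and q: "\<And>i. i \<in> I \<Longrightarrow> q i \<in> chain_maps A P (W i)"
      and pq: "\<And>i. i \<in> I \<Longrightarrow> heq P Z p (a i \<circ>\<^sub>c q i)"
      using wide_ore[OF I Z, of W a] W a by blast
    have "heq P ?C (f \<circ>\<^sub>c p) (g \<circ>\<^sub>c p)"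
    proof (rule cprod_pair_homotopic[OF I X P cm_comp[OF quasi_isos_cm[OF p] f] cm_comp[OF quasi_isos_cm[OF p] g]])
      fix i assume i: "i \<in> I"
      show "heq P (X i) (cprod_proj i \<circ>\<^sub>c (f \<circ>\<^sub>c p)) (cprod_proj i \<circ>\<^sub>c (g \<circ>\<^sub>c p))"
        using heq_trans[OF heq_left[OF pq[OF i] cm_comp[OF f pr[OF i]] X[OF i]]
            heq_trans[OF heq_right[OF fg[OF i] q[OF i] P, unfolded ccomp_assoc[of _ "a i"]]
              heq_sym[OF heq_left[OF pq[OF i] cm_comp[OF g pr[OF i]] X[OF i]]]]]
        by (simp only: ccomp_assoc)
    qed
    then show "\<psi> = \<psi>'" unfolding e roof_class_same_denominator[OF Y C r] using P p by blast
  qed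
qed

text \<open>In \<open>locsubI\<close> this passes from the termwise direct sum to an arbitrary
  coproduct of the derived category.\<close>

lemma coproduct_unique:
  assumes X: "\<And>i. i \<in> I \<Longrightarrow> X i \<in> complexes A" and C: "is_coproduct A I X C \<iota>" and C': "is_coproduct A I X C' \<iota>'"
  shows "D_isos A C C' \<noteq> {}"
proof -
  have cC: "C \<in> complexes A" "C' \<in> complexes A" and \<iota>: "\<And>i. i \<in> I \<Longrightarrow> \<iota> i \<in> D_hom A (X i) C" "\<And>i. i \<in> I \<Longrightarrow> \<iota>' i \<in> D_hom A (X i) C'"
    using C C' by (auto simp: is_coproduct_def)
  have u: "\<exists>!\<psi>. \<psi> \<in> D_hom A C Y \<and> (\<forall>i\<in>I. D_comp A (X i) C Y \<psi> (\<iota> i) = \<phi> i)"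
    if "is_coproduct A I X C \<iota>" "Y \<in> complexes A" "\<And>i. i \<in> I \<Longrightarrow> \<phi> i \<in> D_hom A (X i) Y" for C \<iota> Y \<phi>
    using that unfolding is_coproduct_def by blast
  have eq: "a = b" if "\<exists>!x. P x" "P a" "P b" for a b :: "'u dmor" and P using that by blast
  obtain \<psi> where \<psi>: "\<psi> \<in> D_hom A C C'" "\<And>i. i \<in> I \<Longrightarrow> D_comp A (X i) C C' \<psi> (\<iota> i) = \<iota>' i"
    using u[OF C cC(2) \<iota>(2)] by blast
  obtain \<chi> where \<chi>: "\<chi> \<in> D_hom A C' C" "\<And>i. i \<in> I \<Longrightarrow> D_comp A (X i) C' C \<chi> (\<iota>' i) = \<iota> i"
    using u[OF C' cC(1) \<iota>(1)] by blast
  have "D_comp A C C' C \<chi> \<psi> = D_id A C"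
    by (rule eq[OF u[OF C cC(1) \<iota>(1)]])
      (simp_all add: D_comp_closed[OF cC(1,2,1) \<psi>(1) \<chi>(1)] D_id_D_hom D_comp_assoc[OF X cC(1,2,1) \<iota>(1) \<psi>(1) \<chi>(1), symmetric] \<psi> \<chi> D_comp_id_left X cC \<iota>)
  moreover have "D_comp A C' C C' \<psi> \<chi> = D_id A C'"
    by (rule eq[OF u[OF C' cC(2) \<iota>(2)]])
      (simp_all add: D_comp_closed[OF cC(2,1,2) \<chi>(1) \<psi>(1)] D_id_D_hom D_comp_assoc[OF X cC(2,1,2) \<iota>(2) \<chi>(1) \<psi>(1), symmetric] \<psi> \<chi> D_comp_id_left X cC \<iota>)
  ultimately show ?thesis unfolding D_isos_def using \<psi>(1) \<chi>(1) by blast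
qed

lemma product_unique:
  assumes X: "\<And>i. i \<in> I \<Longrightarrow> X i \<in> complexes A" and C: "is_product A I X C \<iota>" and C': "is_product A I X C' \<iota>'"
  shows "D_isos A C C' \<noteq> {}"
proof -
  have cC: "C \<in> complexes A" "C' \<in> complexes A" and \<iota>: "\<And>i. i \<in> I \<Longrightarrow> \<iota> i \<in> D_hom A C (X i)" "\<And>i. i \<in> I \<Longrightarrow> \<iota>' i \<in> D_hom A C' (X i)"
    using C C' by (auto simp: is_product_def)
  have u: "\<exists>!\<psi>. \<psi> \<in> D_hom A Y C \<and> (\<forall>i\<in>I. D_comp A Y C (X i) (\<iota> i) \<psi> = \<phi> i)"
    if "is_product A I X C \<iota>" "Y \<in> complexes A" "\<And>i. i \<in> I \<Longrightarrow> \<phi> i \<in> D_hom A Y (X i)" for C \<iota> Y \<phi>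
    using that unfolding is_product_def by blast
  have eq: "a = b" if "\<exists>!x. P x" "P a" "P b" for a b :: "'u dmor" and P using that by blast
  obtain \<psi> where \<psi>: "\<psi> \<in> D_hom A C' C" "\<And>i. i \<in> I \<Longrightarrow> D_comp A C' C (X i) (\<iota> i) \<psi> = \<iota>' i"
    using u[OF C cC(2) \<iota>(2)] by blast
  obtain \<chi> where \<chi>: "\<chi> \<in> D_hom A C C'" "\<And>i. i \<in> I \<Longrightarrow> D_comp A C C' (X i) (\<iota>' i) \<chi> = \<iota> i"
    using u[OF C' cC(1) \<iota>(1)] by blast
  have "D_comp A C C' C \<psi> \<chi> = D_id A C"
    by (rule eq[OF u[OF C cC(1) \<iota>(1)]])
      (simp_all add: D_comp_closed[OF cC(1,2,1) \<chi>(1) \<psi>(1)] D_id_D_hom D_comp_assoc[OF cC(1,2,1) X \<chi>(1) \<psi>(1) \<iota>(1)] \<psi> \<chi> D_comp_id_right X cC \<iota>)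
  moreover have "D_comp A C' C C' \<chi> \<psi> = D_id A C'"
    by (rule eq[OF u[OF C' cC(2) \<iota>(2)]])
      (simp_all add: D_comp_closed[OF cC(2,1,2) \<psi>(1) \<chi>(1)] D_id_D_hom D_comp_assoc[OF cC(2,1,2) X \<psi>(1) \<chi>(1) \<iota>(2)] \<psi> \<chi> D_comp_id_right X cC \<iota>)
  ultimately show ?thesis unfolding D_isos_def using \<psi>(1) \<chi>(1) by blast
qed

end

section \<open>Localising and colocalising subcategories\<close>

text \<open>\<open>locsub False\<close> and \<open>locsub True\<close> are the localising and the colocalising subcategories.\<close>

definition locsub :: "bool \<Rightarrow> 'u ring \<Rightarrow> 'u cochain set \<Rightarrow> bool"
  where "locsub b A S \<longleftrightarrow> (if b then colocalising_subcategory A S else localising_subcategory A S)"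

lemma locsub_triangulated: "locsub b A S \<Longrightarrow> triangulated_subcategory A S"
  by (simp add: locsub_def localising_subcategory_def colocalising_subcategory_def split: if_splits)

context ring_universe
begin

lemma locsub_complexes: "locsub b A S \<Longrightarrow> X \<in> S \<Longrightarrow> X \<in> complexes A"
  by (drule locsub_triangulated) (unfold triangulated_subcategory_def, blast)

lemma locsub_iso:
  assumes "locsub b A S" "X \<in> S" "Y \<in> complexes A" "D_isos A X Y \<noteq> {}"
  shows "Y \<in> S"
  using locsub_triangulated[OF assms(1)] assms(2-4) unfolding triangulated_subcategory_def by blast

lemma locsub_quasi_iso:
  assumes S: "locsub b A S" and X: "X \<in> complexes A" and Y: "Y \<in> complexes A" and f: "f \<in> quasi_isos A X Y"
  shows "X \<in> S \<longleftrightarrow> Y \<in> S"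
  using locsub_iso[OF S _ Y quasi_iso_D_isos(1)[OF X Y f]] locsub_iso[OF S _ X quasi_iso_D_isos(2)[OF X Y f]] by blast

lemma locsub_shift: "locsub b A S \<Longrightarrow> X \<in> complexes A \<Longrightarrow> X \<in> S \<longleftrightarrow> shift X \<in> S"
  by (drule locsub_triangulated) (unfold triangulated_subcategory_def, blast)

lemma locsub_cone:
  assumes S: "locsub b A S" and "X \<in> S" "Y \<in> S" "f \<in> chain_maps A X Y"
  shows "cone X Y f \<in> S"
proof -
  have "distinguished_triangle A X Y (cone X Y f) (D_map A X Y f) (D_map A Y (cone X Y f) (cone_in X))
    (D_map A (cone X Y f) (shift X) cone_out)"
    using assms locsub_complexes[OF S] by (intro cone_distinguished) auto
  then show ?thesis using locsub_triangulated[OF S] assms(2,3) unfolding triangulated_subcategory_def by blast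
qed

lemma locsub_cprod:
  assumes S: "locsub b A S" and I: "small I" and X: "\<And>i. i \<in> I \<Longrightarrow> X i \<in> S"
  shows "cprod b I X \<in> S"
proof -
  have Xc: "X i \<in> complexes A" if "i \<in> I" for i using locsub_complexes[OF S X[OF that]] .
  show ?thesis
  proof (cases b)
    case True
    have "is_product A I X (cprod True I X) (\<lambda>i. D_map A (cprod True I X) (X i) (cprod_proj i))"
      by (rule cprod_product[OF I Xc])
    then show ?thesis using S I X True unfolding locsub_def colocalising_subcategory_def by (simp only: if_True) blast
  next
    case False
    have "is_coproduct A I X (cprod False I X) (\<lambda>i. D_map A (X i) (cprod False I X) (cprod_in I X i))"
      by (rule cprod_coproduct[OF I Xc])
    then show ?thesis using S I X False unfolding locsub_def localising_subcategory_def by (simp only: if_False) blast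
  qed
qed

text \<open>The definition speaks of isomorphisms, triangles and (co)products in the derived
  category. Each has a model on the level of complexes, namely chains of quasi-isomorphisms, cones
  and \<open>cprod\<close>, so closure under the models suffices.\<close>

lemma locsubI:
  assumes sub: "S \<subseteq> complexes A" "S \<noteq> {}"
    and qis: "\<And>X Y f. X \<in> complexes A \<Longrightarrow> Y \<in> complexes A \<Longrightarrow> f \<in> quasi_isos A X Y \<Longrightarrow> X \<in> S \<longleftrightarrow> Y \<in> S"
    and shift: "\<And>X. X \<in> complexes A \<Longrightarrow> X \<in> S \<longleftrightarrow> shift X \<in> S"
    and cone: "\<And>X Y f. X \<in> S \<Longrightarrow> Y \<in> S \<Longrightarrow> f \<in> chain_maps A X Y \<Longrightarrow> cone X Y f \<in> S"
    and cprod: "\<And>I X. small I \<Longrightarrow> (\<And>i. i \<in> I \<Longrightarrow> X i \<in> S) \<Longrightarrow> cprod b I X \<in> S"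
  shows "locsub b A S"
proof -
  have iso: "Y \<in> S" if XY: "X \<in> complexes A" "Y \<in> complexes A" and "D_isos A X Y \<noteq> {}" "X \<in> S" for X Y
  proof -
    note d = that(3)
    obtain Z s f where "Z \<in> complexes A" "s \<in> quasi_isos A Z X" "f \<in> quasi_isos A Z Y"
      by (rule D_isos_quasi_isos[OF d XY])
    then show ?thesis using qis XY \<open>X \<in> S\<close> by blast
  qed
  have iso_sym: "D_isos A Y X \<noteq> {}" if "D_isos A X Y \<noteq> {}" for X Y
    using that unfolding D_isos_def by blast
  have tri: "triangulated_subcategory A S"
    unfolding triangulated_subcategory_def
  proof (intro conjI allI impI ballI)
    fix X Y Z u v w assume "distinguished_triangle A X Y Z u v w \<and> X \<in> S \<and> Y \<in> S"
    then have S: "X \<in> S" "Y \<in> S" and Z: "Z \<in> complexes A"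
      and "\<exists>X'\<in>complexes A. \<exists>Y'\<in>complexes A. \<exists>f\<in>chain_maps A X' Y'. D_isos A X X' \<noteq> {} \<and> D_isos A Y Y' \<noteq> {} \<and> D_isos A Z (cone X' Y' f) \<noteq> {}"
      unfolding distinguished_triangle_def by blast+
    then obtain X' Y' f where XY: "X' \<in> complexes A" "Y' \<in> complexes A" "f \<in> chain_maps A X' Y'"
      and i: "D_isos A X X' \<noteq> {}" "D_isos A Y Y' \<noteq> {}" "D_isos A Z (cone X' Y' f) \<noteq> {}" by blast
    have "X' \<in> S" "Y' \<in> S" using iso[OF _ XY(1) i(1)] iso[OF _ XY(2) i(2)] S sub by auto
    then have "cone X' Y' f \<in> S" using cone XY by blast
    then show "Z \<in> S" using iso[OF cone_complexes[OF XY] Z iso_sym[OF i(3)]] by blast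
  next
    fix X Y assume "X \<in> S" "Y \<in> complexes A" "D_isos A X Y \<noteq> {}"
    then show "Y \<in> S" using iso sub(1) by blast
  next
    fix X assume "X \<in> complexes A"
    then show "X \<in> S \<longleftrightarrow> shift X \<in> S" by (rule shift)
  qed (rule sub)+
  show ?thesis
  proof (cases b)
    case True
    have "C \<in> S" if "small I" "\<forall>i\<in>I. X i \<in> S" "is_product A I X C \<pi>" for I X C \<pi>
    proof -
      have Xc: "X i \<in> complexes A" if "i \<in> I" for i using sub \<open>\<forall>i\<in>I. X i \<in> S\<close> that by auto
      have "is_product A I X (cprod True I X) (\<lambda>i. D_map A (cprod True I X) (X i) (cprod_proj i))"
        by (rule cprod_product[OF that(1) Xc])
      from product_unique[OF Xc this that(3)] have "D_isos A (cprod True I X) C \<noteq> {}" by simp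
      moreover have "C \<in> complexes A" using that(3) by (simp add: is_product_def)
      moreover have "cprod True I X \<in> S" using cprod[of I X] that True by auto
      ultimately show ?thesis using iso sub by blast
    qed
    then show ?thesis using True tri unfolding locsub_def colocalising_subcategory_def by auto
  next
    case False
    have "C \<in> S" if "small I" "\<forall>i\<in>I. X i \<in> S" "is_coproduct A I X C \<pi>" for I X C \<pi>
    proof -
      have Xc: "X i \<in> complexes A" if "i \<in> I" for i using sub \<open>\<forall>i\<in>I. X i \<in> S\<close> that by auto
      have "is_coproduct A I X (cprod False I X) (\<lambda>i. D_map A (X i) (cprod False I X) (cprod_in I X i))"
        by (rule cprod_coproduct[OF that(1) Xc])
      from coproduct_unique[OF Xc this that(3)] have "D_isos A (cprod False I X) C \<noteq> {}" by simp
      moreover have "C \<in> complexes A" using that(3) by (simp add: is_coproduct_def)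
      moreover have "cprod False I X \<in> S" using cprod[of I X] that False by auto
      ultimately show ?thesis using iso sub by blast
    qed
    then show ?thesis using False tri unfolding locsub_def localising_subcategory_def by auto
  qed
qed

section \<open>Closure under retracts\<close>

lemma cm_sum:
  assumes X: "X \<in> complexes A" and Y: "Y \<in> complexes A" and f: "f \<in> chain_maps A X Y" and g: "g \<in> chain_maps A X Y"
  shows "(\<lambda>n x. f n x \<oplus>\<^bsub>obj Y n\<^esub> g n x) \<in> chain_maps A X Y"
  by (rule chain_mapsI)
    (auto intro!: hom_sum cpx_obj X Y cm_hom[OF f] cm_hom[OF g] simp: cm_dif[OF f] cm_dif[OF g] dif_add[OF Y] cm_closed[OF f] cm_closed[OF g])

lemma cm_diff:
  assumes X: "X \<in> complexes A" and Y: "Y \<in> complexes A" and f: "f \<in> chain_maps A X Y" and g: "g \<in> chain_maps A X Y"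
  shows "(\<lambda>n x. f n x \<ominus>\<^bsub>obj Y n\<^esub> g n x) \<in> chain_maps A X Y"
  by (rule chain_mapsI)
    (auto intro!: hom_diff cpx_obj X Y cm_hom[OF f] cm_hom[OF g] simp: cm_dif[OF f] cm_dif[OF g] dif_minus[OF Y] cm_closed[OF f] cm_closed[OF g])

text \<open>Coordinate k of the result is coordinate g k of the argument where P holds and zero
  elsewhere. The instances in \<open>locsub_retract\<close> are the right and left shifts of a
  countable power.\<close>

definition reindex :: "'u set \<Rightarrow> 'u cochain \<Rightarrow> ('u \<Rightarrow> bool) \<Rightarrow> ('u \<Rightarrow> 'u) \<Rightarrow> 'u cmap"
  where "reindex I Z P g n u = pk (\<lambda>k\<in>I. if P k then up u (g k) else \<zero>\<^bsub>obj Z n\<^esub>)"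

text \<open>For direct sums the support must stay finite: the injective \<open>g\<close> maps the
  new support into the old one.\<close>

lemma reindex_cm:
  assumes I: "small I" and Z: "Z \<in> complexes A" and g: "\<And>k. k \<in> I \<Longrightarrow> P k \<Longrightarrow> g k \<in> I" and inj: "inj_on g {k \<in> I. P k}"
  shows "reindex I Z P g \<in> chain_maps A (cprod b I (\<lambda>_. Z)) (cprod b I (\<lambda>_. Z))"
proof -
  let ?W = "cprod b I (\<lambda>_. Z)"
  have W: "?W \<in> complexes A" by (rule cprod_complexes[OF I Z])
  have up: "up (reindex I Z P g n u) k = (if P k then up u (g k) else \<zero>\<^bsub>obj Z n\<^esub>)" if "k \<in> I" for k n u
    using that I by (simp add: reindex_def)
  have cl: "reindex I Z P g n u \<in> carrier (obj ?W n)" if u: "u \<in> carrier (obj ?W n)" for n u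
  proof -
    have "finite {k \<in> I. (if P k then up u (g k) else \<zero>\<^bsub>obj Z n\<^esub>) \<noteq> \<zero>\<^bsub>obj Z n\<^esub>}" if "\<not> b"
    proof (rule inj_on_finite)
      show "inj_on g {k \<in> I. (if P k then up u (g k) else \<zero>\<^bsub>obj Z n\<^esub>) \<noteq> \<zero>\<^bsub>obj Z n\<^esub>}"
        by (rule inj_on_subset[OF inj]) auto
      show "g ` {k \<in> I. (if P k then up u (g k) else \<zero>\<^bsub>obj Z n\<^esub>) \<noteq> \<zero>\<^bsub>obj Z n\<^esub>} \<subseteq> {k \<in> I. up u k \<noteq> \<zero>\<^bsub>obj Z n\<^esub>}"
        using g by auto
      show "finite {k \<in> I. up u k \<noteq> \<zero>\<^bsub>obj Z n\<^esub>}" using pmod_cases(3)[OF I u[unfolded cprod_obj[OF I]]] that by simp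
    qed
    then have "b \<or> finite {k \<in> I. (if P k then up u (g k) else \<zero>\<^bsub>obj Z n\<^esub>) \<noteq> \<zero>\<^bsub>obj Z n\<^esub>}" by blast
    then show ?thesis
      unfolding reindex_def cprod_obj[OF I] pk_in_pmod[OF I]
      by (rule conjI[rotated]) (use g cprod_up_closed[OF I u] mod_zero[OF cpx_obj[OF Z]] in auto)
  qed
  show ?thesis
  proof (rule chain_mapsI)
    fix n
    show "reindex I Z P g n \<in> rmod_hom A (obj ?W n) (obj ?W n)"
    proof (rule rmod_homI)
      fix u v assume uv: "u \<in> carrier (obj ?W n)" "v \<in> carrier (obj ?W n)"
      show "reindex I Z P g n (u \<oplus>\<^bsub>obj ?W n\<^esub> v) = reindex I Z P g n u \<oplus>\<^bsub>obj ?W n\<^esub> reindex I Z P g n v"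
      proof (rule cprod_ext[OF I])
        show "reindex I Z P g n (u \<oplus>\<^bsub>obj ?W n\<^esub> v) \<in> carrier (obj ?W n)"
          "reindex I Z P g n u \<oplus>\<^bsub>obj ?W n\<^esub> reindex I Z P g n v \<in> carrier (obj ?W n)"
          using uv by (auto intro!: cl mod_add cpx_obj W)
        fix k assume "k \<in> I"
        then show "up (reindex I Z P g n (u \<oplus>\<^bsub>obj ?W n\<^esub> v)) k = up (reindex I Z P g n u \<oplus>\<^bsub>obj ?W n\<^esub> reindex I Z P g n v) k"
          using g by (simp add: up up_cprod[OF I] abelian_group.abelian_group_simprules[OF cpx_group[OF Z]])
      qed
    next
      fix r u assume ru: "r \<in> carrier A" "u \<in> carrier (obj ?W n)"
      show "reindex I Z P g n (r \<odot>\<^bsub>obj ?W n\<^esub> u) = r \<odot>\<^bsub>obj ?W n\<^esub> reindex I Z P g n u"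
      proof (rule cprod_ext[OF I])
        show "reindex I Z P g n (r \<odot>\<^bsub>obj ?W n\<^esub> u) \<in> carrier (obj ?W n)"
          "r \<odot>\<^bsub>obj ?W n\<^esub> reindex I Z P g n u \<in> carrier (obj ?W n)"
          using ru by (auto intro!: cl mod_smult cpx_obj W)
        fix k assume "k \<in> I"
        then show "up (reindex I Z P g n (r \<odot>\<^bsub>obj ?W n\<^esub> u)) k = up (r \<odot>\<^bsub>obj ?W n\<^esub> reindex I Z P g n u) k"
          using g ru by (simp add: up cprod_obj[OF I] up_pmod[OF I] smult_zero[OF cpx_obj[OF Z]])
      qed
    qed (rule cl)
    fix u assume u: "u \<in> carrier (obj ?W n)"
    show "reindex I Z P g (n + 1) (dif ?W n u) = dif ?W n (reindex I Z P g n u)"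
      by (rule cprod_ext[OF I cl[OF dif_closed[OF W refl u]] dif_closed[OF W refl cl[OF u]]])
        (use g in \<open>simp add: up up_cprod[OF I] dif_zero[OF Z]\<close>)
  qed
qed

text \<open>The Eilenberg swindle: if \<open>e = i r\<close> is the idempotent of a retract \<open>X\<close> of \<open>Z\<close>, then
  \<open>(z\<^sub>0, z\<^sub>1, \<dots>) \<mapsto> ((1 - e) z\<^sub>0, e z\<^sub>0 + (1 - e) z\<^sub>1, e z\<^sub>1 + (1 - e) z\<^sub>2, \<dots>)\<close> is a split
  monomorphism between countable powers of \<open>Z\<close> with cokernel \<open>X\<close>, so \<open>X\<close> is its cone up to quasi-isomorphism.\<close>

lemma locsub_retract:
  assumes S: "locsub b A S" and Z: "Z \<in> S" and X: "X \<in> complexes A"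
    and i: "i \<in> chain_maps A X Z" and r: "r \<in> chain_maps A Z X"
    and ri: "\<And>n x. x \<in> carrier (obj X n) \<Longrightarrow> r n (i n x) = x"
  shows "X \<in> S"
proof -
  have Zc: "Z \<in> complexes A" by (rule locsub_complexes[OF S Z])
  obtain \<nu> :: "nat \<Rightarrow> 'u" where \<nu>: "inj \<nu>" using infinite_UNIV infinite_countable_subset by blast
  define I where "I = range \<nu>"
  have I: "small I" unfolding I_def by (rule small_nat_image)
  let ?W = "cprod b I (\<lambda>_. Z)"
  have W: "?W \<in> S" by (rule locsub_cprod[OF S I Z])
  have Wc: "?W \<in> complexes A" by (rule locsub_complexes[OF S W])
  define idx where "idx = inv_into UNIV \<nu>"
  have idx: "idx (\<nu> m) = m" for m by (simp add: idx_def inv_into_f_f[OF \<nu>])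
  have \<nu>I: "\<nu> m \<in> I" for m by (simp add: I_def)
  have extI: "u = v" if "u \<in> carrier (obj ?W n)" "v \<in> carrier (obj ?W n)" "\<And>m. up u (\<nu> m) = up v (\<nu> m)" for u v n
    by (rule cprod_ext[OF I that(1,2)]) (use that(3) in \<open>auto simp: I_def\<close>)
  \<comment> \<open>\<open>E\<close> is the idempotent onto the image of X in Z, and
    \<open>F\<close> is its complement. The relations between them computed below carry the whole
    swindle.\<close>
  define E where "E n x = i n (r n x)" for n x
  define F where "F n x = x \<ominus>\<^bsub>obj Z n\<^esub> E n x" for n x
  have Ecm: "E \<in> chain_maps A Z Z" using cm_comp[OF r i] unfolding E_def[abs_def] ccomp_def .
  have Fcm: "F \<in> chain_maps A Z Z" using cm_diff[OF Zc Zc cm_id Ecm] unfolding F_def[abs_def] cid_def .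
  note G = cpx_group[OF Zc]
  note Ecl = cm_closed[OF Ecm] and Fcl = cm_closed[OF Fcm]
  have EE: "E n (E n x) = E n x" if "x \<in> carrier (obj Z n)" for n x
    using that by (simp add: E_def ri cm_closed[OF r])
  have EF: "E n (F n x) = \<zero>\<^bsub>obj Z n\<^esub>" if "x \<in> carrier (obj Z n)" for n x
    using that Ecl[OF that] G[of n] unfolding F_def cm_minus[OF Ecm Zc Zc that Ecl[OF that]] EE[OF that] by algebra
  have FE: "F n (E n x) = \<zero>\<^bsub>obj Z n\<^esub>" if "x \<in> carrier (obj Z n)" for n x
    using Ecl[OF that] G[of n] unfolding F_def EE[OF that] by algebra
  have FF: "F n (F n x) = F n x" if "x \<in> carrier (obj Z n)" for n x
  proof -
    have "F n (F n x) = F n x \<ominus>\<^bsub>obj Z n\<^esub> \<zero>\<^bsub>obj Z n\<^esub>" using EF[OF that] by (simp add: F_def[of n "F n x"])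
    then show ?thesis using Fcl[OF that] G[of n] by (simp add: abelian_group.abelian_group_simprules)
  qed
  have sum: "F n x \<oplus>\<^bsub>obj Z n\<^esub> E n x = x" if "x \<in> carrier (obj Z n)" for n x
    unfolding F_def using that Ecl[OF that] G[of n] by algebra
  have rF: "r n (F n x) = \<zero>\<^bsub>obj X n\<^esub>" if "x \<in> carrier (obj Z n)" for n x
  proof -
    have "r n (F n x) = r n x \<ominus>\<^bsub>obj X n\<^esub> r n x"
      unfolding F_def cm_minus[OF r Zc X that Ecl[OF that]] by (simp add: E_def ri cm_closed[OF r that])
    then show ?thesis using cm_closed[OF r that] cpx_group[OF X, of n] by (simp add: abelian_group.abelian_group_simprules)
  qed
  let ?EW = "cprod_map I (\<lambda>_. E)" and ?FW = "cprod_map I (\<lambda>_. F)"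
  \<comment> \<open>\<open>\<sigma>\<close> shifts coordinates to the right and puts zero into
    coordinate 0, so that the truncated subtraction is used only for positive indices;
    \<open>\<tau>\<close> shifts to the left.\<close>
  define \<sigma> where "\<sigma> = reindex I Z (\<lambda>k. k \<noteq> \<nu> 0) (\<lambda>k. \<nu> (idx k - 1))"
  define \<tau> where "\<tau> = reindex I Z (\<lambda>k. True) (\<lambda>k. \<nu> (idx k + 1))"
  define j where "j n u = ?FW n u \<oplus>\<^bsub>obj ?W n\<^esub> (?EW \<circ>\<^sub>c \<sigma>) n u" for n u
  \<comment> \<open>A left inverse of \<open>j\<close>: coordinate m receives the F part of
    coordinate m and the E part of coordinate m + 1, which undoes the displacement made by
    \<open>j\<close>.\<close>
  define \<kappa> where "\<kappa> n u = ?FW n u \<oplus>\<^bsub>obj ?W n\<^esub> (?EW \<circ>\<^sub>c \<tau>) n u" for n u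
  have \<sigma>: "\<sigma> \<in> chain_maps A ?W ?W" unfolding \<sigma>_def
  proof (rule reindex_cm[OF I Zc])
    show "inj_on (\<lambda>k. \<nu> (idx k - 1)) {k \<in> I. k \<noteq> \<nu> 0}"
      by (rule inj_onI) (use \<nu> in \<open>auto simp: I_def idx dest!: injD, metis Suc_pred neq0_conv\<close>)
  qed (rule \<nu>I)
  have \<tau>: "\<tau> \<in> chain_maps A ?W ?W" unfolding \<tau>_def
    by (rule reindex_cm[OF I Zc \<nu>I]) (use \<nu> in \<open>auto simp: I_def idx inj_on_def dest!: injD\<close>)
  have EW: "?EW \<in> chain_maps A ?W ?W" and FW: "?FW \<in> chain_maps A ?W ?W"
    by (rule cprod_map_cm[OF I]; rule Zc Ecm Fcm)+
  have jcm: "j \<in> chain_maps A ?W ?W" unfolding j_def by (rule cm_sum[OF Wc Wc FW cm_comp[OF \<sigma> EW]])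
  have \<kappa>cm: "\<kappa> \<in> chain_maps A ?W ?W" unfolding \<kappa>_def by (rule cm_sum[OF Wc Wc FW cm_comp[OF \<tau> EW]])
  have j0: "up (j n u) (\<nu> 0) = F n (up u (\<nu> 0))" if "u \<in> carrier (obj ?W n)" for n u
    using Fcl[OF cprod_up_closed[OF I that \<nu>I]] G[of n] cm_zero[OF Ecm Zc Zc, of n]
    by (simp add: j_def up_cprod[OF I \<nu>I] ccomp_def \<sigma>_def reindex_def I \<nu>I abelian_group.abelian_group_simprules)
  have jS: "up (j n u) (\<nu> (Suc m)) = F n (up u (\<nu> (Suc m))) \<oplus>\<^bsub>obj Z n\<^esub> E n (up u (\<nu> m))" for n u m
    using \<nu> by (auto simp: j_def up_cprod[OF I \<nu>I] ccomp_def \<sigma>_def reindex_def I \<nu>I idx dest: injD)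
  have \<kappa>m: "up (\<kappa> n u) (\<nu> m) = F n (up u (\<nu> m)) \<oplus>\<^bsub>obj Z n\<^esub> E n (up u (\<nu> (Suc m)))" for n u m
    by (simp add: \<kappa>_def up_cprod[OF I \<nu>I] ccomp_def \<tau>_def reindex_def I \<nu>I idx)
  note upc = cprod_up_closed[OF I _ \<nu>I]
  have zr: "x \<oplus>\<^bsub>obj Z n\<^esub> \<zero>\<^bsub>obj Z n\<^esub> = x" "\<zero>\<^bsub>obj Z n\<^esub> \<oplus>\<^bsub>obj Z n\<^esub> x = x" if "x \<in> carrier (obj Z n)" for x n
    using that G[of n] by (simp_all add: abelian_group.abelian_group_simprules)
  have \<kappa>j: "\<kappa> n (j n u) = u" if u: "u \<in> carrier (obj ?W n)" for n u
  proof (rule extI)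
    show "\<kappa> n (j n u) \<in> carrier (obj ?W n)" by (rule cm_closed[OF \<kappa>cm cm_closed[OF jcm u]])
    show "u \<in> carrier (obj ?W n)" by fact
    fix m
    have "E n (up (j n u) (\<nu> (Suc m))) = E n (up u (\<nu> m))"
      unfolding jS by (simp add: cm_add[OF Ecm] Fcl Ecl upc[OF u] EF EE zr)
    moreover have "F n (up (j n u) (\<nu> m)) = F n (up u (\<nu> m))"
    proof (cases m)
      case 0
      then show ?thesis by (simp add: j0[OF u] FF upc[OF u])
    next
      case (Suc k)
      then show ?thesis by (simp add: jS cm_add[OF Fcm] Fcl Ecl upc[OF u] FF FE zr)
    qed
    ultimately show "up (\<kappa> n (j n u)) (\<nu> m) = up u (\<nu> m)" by (simp add: \<kappa>m sum upc[OF u])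
  qed
  have E\<kappa>: "E n (up (\<kappa> n w) (\<nu> m)) = E n (up w (\<nu> (Suc m)))" "F n (up (\<kappa> n w) (\<nu> m)) = F n (up w (\<nu> m))"
    if w: "w \<in> carrier (obj ?W n)" for n w m
    unfolding \<kappa>m by (simp_all add: cm_add[OF Ecm] cm_add[OF Fcm] Fcl Ecl upc[OF w] EF EE FF FE zr)
  let ?C = "cone ?W ?W j"
  \<comment> \<open>Coordinate 0 of the image of \<open>j\<close> lies in the image of
    \<open>F\<close>, which \<open>r\<close> kills. So \<open>r\<close> of coordinate 0 vanishes on
    the image of \<open>j\<close> and gives the map from the cone to X.\<close>
  define q where "q n u = r n (up (snd (dec u)) (\<nu> 0))" for n u
  have C: "?C \<in> S" by (rule locsub_cone[OF S W W jcm])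
  have Cc: "?C \<in> complexes A" by (rule locsub_complexes[OF S C])
  note cc = cone_in_carrier[OF Wc Wc jcm] and cd = cone_dif[OF Wc Wc jcm] and co = cone_obj[OF Wc Wc jcm]
  have qcm: "q \<in> chain_maps A ?C X"
  proof (rule chain_mapsI)
    show "q n \<in> rmod_hom A (obj ?C n) (obj X n)" for n
      unfolding q_def co
      using hom_comp[OF hom_comp[OF module_sum_snd cm_hom[OF cprod_proj_cm[OF I Zc \<nu>I, unfolded cprod_proj_def]]] cm_hom[OF r]] .
    fix n u assume "u \<in> carrier (obj ?C n)"
    then obtain z w where u: "u = enc (z, w)" and z: "z \<in> carrier (obj ?W (n + 1))" and w: "w \<in> carrier (obj ?W n)"
      by (rule cone_cases[OF Wc Wc jcm])
    have c: "F (n + 1) (up z (\<nu> 0)) \<in> carrier (obj Z (n + 1))" "dif Z n (up w (\<nu> 0)) \<in> carrier (obj Z (n + 1))"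
      using upc[OF z] upc[OF w] by (auto intro: Fcl dif_closed[OF Zc])
    have "r (n + 1) (F (n + 1) (up z (\<nu> 0)) \<oplus>\<^bsub>obj Z (n + 1)\<^esub> dif Z n (up w (\<nu> 0))) = dif X n (r n (up w (\<nu> 0)))"
      using cpx_group[OF X, of "n + 1"] dif_closed[OF X refl cm_closed[OF r upc[OF w]]]
      by (simp add: cm_add[OF r c] rF[OF upc[OF z]] cm_dif[OF r refl upc[OF w]] abelian_group.abelian_group_simprules)
    then show "q (n + 1) (dif ?C n u) = dif X n (q n u)"
      by (simp add: u q_def cd up_cprod[OF I \<nu>I] j0[OF z])
  qed
  have in0: "cprod_in I (\<lambda>_. Z) (\<nu> 0) \<in> chain_maps A Z ?W" by (rule cprod_in_cm[OF I Zc \<nu>I])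
  have "q \<in> quasi_isos A ?C X"
  proof (rule quasi_isosI[OF Cc X qcm])
    fix n
    {
      fix u x assume u: "u \<in> cocycles ?C n" and x: "x \<in> carrier (obj X (n - 1))" and eq: "q n u = dif X (n - 1) x"
      obtain z w where ue: "u = enc (z, w)" and z: "z \<in> carrier (obj ?W (n + 1))" and w: "w \<in> carrier (obj ?W n)"
        using cocycles_closed[OF u] by (rule cone_cases[OF Wc Wc jcm])
      have jz: "j (n + 1) z \<oplus>\<^bsub>obj ?W (n + 1)\<^esub> dif ?W n w = \<zero>\<^bsub>obj ?W (n + 1)\<^esub>"
        using cocycles_dif[OF u] by (simp add: ue cd co dec_module_sum)
      have "dif ?W n w = \<ominus>\<^bsub>obj ?W (n + 1)\<^esub> j (n + 1) z"
        using abelian_group.a_inv_unique[OF cpx_group[OF Wc] cm_closed[OF jcm z] dif_closed[OF Wc refl w] jz] .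
      then have "\<kappa> (n + 1) (dif ?W n w) = \<ominus>\<^bsub>obj ?W (n + 1)\<^esub> z"
        using hom_a_inv[OF cm_hom[OF \<kappa>cm] cpx_group[OF Wc] cpx_group[OF Wc] cm_closed[OF jcm z]] by (simp add: \<kappa>j[OF z])
      \<comment> \<open>Applying \<open>\<kappa>\<close> to the cocycle condition j z + d w = 0
        shows that z is minus the differential of \<open>\<kappa>\<close> w, which settles the first
        component of the cone.\<close>
      then have dz: "\<ominus>\<^bsub>obj ?W (n + 1)\<^esub> dif ?W n (\<kappa> n w) = z"
        using z cpx_group[OF Wc, of "n + 1"] by (simp add: cm_dif[OF \<kappa>cm refl w, symmetric] abelian_group.abelian_group_simprules)
      \<comment> \<open>The difference of w and j (\<open>\<kappa>\<close> w) is concentrated in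
        coordinate 0, where it is E of the coordinate of w, that is i (d x) = d (i x). So w' is i x
        placed in coordinate 0.\<close>
      define w' where "w' = cprod_in I (\<lambda>_. Z) (\<nu> 0) (n - 1) (i (n - 1) x)"
      have w': "w' \<in> carrier (obj ?W (n - 1))" unfolding w'_def by (rule cm_closed[OF in0 cm_closed[OF i x]])
      have kw: "\<kappa> n w \<in> carrier (obj ?W n)" by (rule cm_closed[OF \<kappa>cm w])
      have dw': "dif ?W (n - 1) w' \<in> carrier (obj ?W n)" by (rule hom_closed[OF cpx_dif'[OF Wc] w'])
      have "j n (\<kappa> n w) \<oplus>\<^bsub>obj ?W n\<^esub> dif ?W (n - 1) w' = w"
      proof (rule extI[OF mod_add[OF cpx_obj[OF Wc] cm_closed[OF jcm kw] dw'] w])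
        fix m
        show "up (j n (\<kappa> n w) \<oplus>\<^bsub>obj ?W n\<^esub> dif ?W (n - 1) w') (\<nu> m) = up w (\<nu> m)"
        proof (cases m)
          case 0
          have "dif Z (n - 1) (i (n - 1) x) = E n (up w (\<nu> 0))"
            using cm_dif[OF i _ x, of n] eq by (simp add: q_def ue E_def)
          then show ?thesis
            by (simp add: 0 up_cprod[OF I \<nu>I] j0[OF kw] E\<kappa>[OF w] w'_def sum upc[OF w])
        next
          case (Suc k)
          have "\<nu> (Suc k) \<noteq> \<nu> 0" using \<nu> by (auto dest: injD)
          then show ?thesis
            using dif_zero[OF Zc, of "n - 1"]
            by (simp add: Suc up_cprod[OF I \<nu>I] jS E\<kappa>[OF w] w'_def sum upc[OF w] zr)
        qed
      qed
      then have "u = dif ?C (n - 1) (enc (\<kappa> n w, w'))"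
        using dz cd[of "n - 1"] by (simp add: ue)
      moreover have "enc (\<kappa> n w, w') \<in> carrier (obj ?C (n - 1))" using kw w' by (simp add: cc)
      ultimately show "\<exists>x\<in>carrier (obj ?C (n - 1)). u = dif ?C (n - 1) x" by blast
    next
      fix x assume x: "x \<in> cocycles X n"
      note xc = cocycles_closed[OF x]
      \<comment> \<open>A cocycle of X is hit by its image under \<open>i\<close> placed in
        coordinate 0, because \<open>r\<close> after \<open>i\<close> is the identity.\<close>
      define w where "w = cprod_in I (\<lambda>_. Z) (\<nu> 0) n (i n x)"
      have w: "w \<in> carrier (obj ?W n)" unfolding w_def by (rule cm_closed[OF in0 cm_closed[OF i xc]])
      have "dif ?W n w = \<zero>\<^bsub>obj ?W (n + 1)\<^esub>"
        unfolding w_def cm_dif[OF in0 refl cm_closed[OF i xc], symmetric] cm_dif[OF i refl xc, symmetric] cocycles_dif[OF x]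
          cm_zero[OF i X Zc] cm_zero[OF in0 Zc Wc] ..
      then have "enc (\<zero>\<^bsub>obj ?W (n + 1)\<^esub>, w) \<in> cocycles ?C n"
        using w dif_zero[OF Wc, of "n + 1"] cpx_group[OF Wc]
        by (simp add: cocycles_def cc cd co dec_module_sum mod_zero cpx_obj Wc cm_zero[OF jcm Wc Wc] abelian_group.abelian_group_simprules)
      moreover have "x = q n (enc (\<zero>\<^bsub>obj ?W (n + 1)\<^esub>, w)) \<oplus>\<^bsub>obj X n\<^esub> dif X (n - 1) \<zero>\<^bsub>obj X (n - 1)\<^esub>"
        using dif_zero[OF X, of "n - 1"] xc cpx_group[OF X, of n]
        by (simp add: q_def w_def up_cprod[OF I \<nu>I] ri abelian_group.abelian_group_simprules)
      ultimately show "\<exists>z\<in>cocycles ?C n. \<exists>y\<in>carrier (obj X (n - 1)). x = q n z \<oplus>\<^bsub>obj X n\<^esub> dif X (n - 1) y"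
        using mod_zero[OF cpx_obj[OF X]] by blast
    }
  qed
  then show ?thesis using locsub_quasi_iso[OF S Cc X] C by blast
qed

end

section \<open>Hom functors of bimodules\<close>

text \<open>\<open>homf R Q X\<close> is \<open>Hom\<^sub>R(Q, X)\<close> for an \<open>(L, R)\<close>-bimodule \<open>Q\<close>, with the right action \<open>(\<phi> l) q = \<phi> (l q)\<close> of \<open>L\<close>.\<close>

definition homf :: "'u ring \<Rightarrow> ('u, 'u, 'u) bimodule \<Rightarrow> ('u, 'u) module \<Rightarrow> ('u, 'u) module"
  where "homf R Q X = \<lparr>
    carrier = {pk (restrict \<phi> (carrier Q)) | \<phi>. \<phi> \<in> rmod_hom R Q X},
    monoid.mult = undefined, monoid.one = undefined,
    ring.zero = pk (\<lambda>q\<in>carrier Q. \<zero>\<^bsub>X\<^esub>),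
    ring.add = (\<lambda>u v. pk (\<lambda>q\<in>carrier Q. up u q \<oplus>\<^bsub>X\<^esub> up v q)),
    smult = (\<lambda>l u. pk (\<lambda>q\<in>carrier Q. up u (lsmult Q l q)))\<rparr>"

definition homf_map :: "('u, 'u, 'u) bimodule \<Rightarrow> ('u \<Rightarrow> 'u) \<Rightarrow> 'u \<Rightarrow> 'u"
  where "homf_map Q f u = pk (\<lambda>q\<in>carrier Q. f (up u q))"

definition homc :: "'u ring \<Rightarrow> ('u, 'u, 'u) bimodule \<Rightarrow> 'u cochain \<Rightarrow> 'u cochain"
  where "homc R Q X = \<lparr>obj = (\<lambda>n. homf R Q (obj X n)), dif = (\<lambda>n. homf_map Q (dif X n))\<rparr>"

definition homc_map :: "('u, 'u, 'u) bimodule \<Rightarrow> 'u cmap \<Rightarrow> 'u cmap"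
  where "homc_map Q f = (\<lambda>n. homf_map Q (f n))"

lemma part_simps [simp]:
  "carrier (right_part M) = carrier M" "\<zero>\<^bsub>right_part M\<^esub> = \<zero>\<^bsub>M\<^esub>" "ring.add (right_part M) = ring.add M" "r \<odot>\<^bsub>right_part M\<^esub> x = r \<odot>\<^bsub>M\<^esub> x"
  "carrier (left_part M) = carrier M" "\<zero>\<^bsub>left_part M\<^esub> = \<zero>\<^bsub>M\<^esub>" "ring.add (left_part M) = ring.add M" "l \<odot>\<^bsub>left_part M\<^esub> x = lsmult M l x"
  by (simp_all add: right_part_def left_part_def)

lemma finsum_part [simp]: "finsum (right_part M) f T = finsum M f T" "finsum (left_part M) f T = finsum M f T"
  by (simp_all add: finsum_def finprod_def)

lemma opposite_simps [simp]:
  "carrier (opposite R) = carrier R" "\<zero>\<^bsub>opposite R\<^esub> = \<zero>\<^bsub>R\<^esub>" "\<one>\<^bsub>opposite R\<^esub> = \<one>\<^bsub>R\<^esub>" "x \<oplus>\<^bsub>opposite R\<^esub> y = x \<oplus>\<^bsub>R\<^esub> y" "x \<otimes>\<^bsub>opposite R\<^esub> y = y \<otimes>\<^bsub>R\<^esub> x"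
  by (simp_all add: opposite_def)

lemma abelian_group_right_part: "abelian_group (right_part M) \<Longrightarrow> abelian_group M"
  using abelian_groupE[of "right_part M"] by (intro abelian_groupI) simp_all

lemma rmod_hom_right_part [simp]: "rmod_hom R (right_part M) N = rmod_hom R M N" "rmod_hom R N (right_part M) = rmod_hom R N M"
  by (simp_all add: rmod_hom_def)

locale bimod = L: ring_universe L + R: ring_universe R
  for L R :: "'u ring" +
  fixes Q :: "('u, 'u, 'u) bimodule"
  assumes bimodule: "is_bimodule L R Q" and small_Q: "small (carrier Q)"
begin

lemma Q_modules: "right_part Q \<in> modules R"
  using bimodule small_Q by (simp add: is_bimodule_def modules_def)

lemma Q_group: "abelian_group Q"
  by (rule abelian_group_right_part[OF R.mod_group[OF Q_modules]])

lemma
  shows lsmult_closed: "l \<in> carrier L \<Longrightarrow> q \<in> carrier Q \<Longrightarrow> lsmult Q l q \<in> carrier Q"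
    and lsmult_add: "l \<in> carrier L \<Longrightarrow> q \<in> carrier Q \<Longrightarrow> q' \<in> carrier Q \<Longrightarrow> lsmult Q l (q \<oplus>\<^bsub>Q\<^esub> q') = lsmult Q l q \<oplus>\<^bsub>Q\<^esub> lsmult Q l q'"
    and add_lsmult: "l \<in> carrier L \<Longrightarrow> l' \<in> carrier L \<Longrightarrow> q \<in> carrier Q \<Longrightarrow> lsmult Q (l \<oplus>\<^bsub>L\<^esub> l') q = lsmult Q l q \<oplus>\<^bsub>Q\<^esub> lsmult Q l' q"
    and lsmult_assoc: "l \<in> carrier L \<Longrightarrow> l' \<in> carrier L \<Longrightarrow> q \<in> carrier Q \<Longrightarrow> lsmult Q (l \<otimes>\<^bsub>L\<^esub> l') q = lsmult Q l (lsmult Q l' q)"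
    and lsmult_one: "q \<in> carrier Q \<Longrightarrow> lsmult Q \<one>\<^bsub>L\<^esub> q = q"
    and lsmult_rsmult: "l \<in> carrier L \<Longrightarrow> r \<in> carrier R \<Longrightarrow> q \<in> carrier Q \<Longrightarrow> r \<odot>\<^bsub>Q\<^esub> lsmult Q l q = lsmult Q l (r \<odot>\<^bsub>Q\<^esub> q)"
proof -
  interpret l: right_module "opposite L" "left_part Q" using bimodule by (simp add: is_bimodule_def)
  show "l \<in> carrier L \<Longrightarrow> q \<in> carrier Q \<Longrightarrow> lsmult Q l q \<in> carrier Q"
    using l.smult_closed[of l q] by simp
  show "l \<in> carrier L \<Longrightarrow> q \<in> carrier Q \<Longrightarrow> q' \<in> carrier Q \<Longrightarrow> lsmult Q l (q \<oplus>\<^bsub>Q\<^esub> q') = lsmult Q l q \<oplus>\<^bsub>Q\<^esub> lsmult Q l q'"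
    using l.smult_r_distr[of l q q'] by simp
  show "l \<in> carrier L \<Longrightarrow> l' \<in> carrier L \<Longrightarrow> q \<in> carrier Q \<Longrightarrow> lsmult Q (l \<oplus>\<^bsub>L\<^esub> l') q = lsmult Q l q \<oplus>\<^bsub>Q\<^esub> lsmult Q l' q"
    using l.smult_l_distr[of l l' q] by simp
  show "l \<in> carrier L \<Longrightarrow> l' \<in> carrier L \<Longrightarrow> q \<in> carrier Q \<Longrightarrow> lsmult Q (l \<otimes>\<^bsub>L\<^esub> l') q = lsmult Q l (lsmult Q l' q)"
    using l.smult_assoc[of l' l q] by simp
  show "q \<in> carrier Q \<Longrightarrow> lsmult Q \<one>\<^bsub>L\<^esub> q = q"
    using l.smult_one[of q] by simp
  show "l \<in> carrier L \<Longrightarrow> r \<in> carrier R \<Longrightarrow> q \<in> carrier Q \<Longrightarrow> r \<odot>\<^bsub>Q\<^esub> lsmult Q l q = lsmult Q l (r \<odot>\<^bsub>Q\<^esub> q)"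
    using bimodule by (simp add: is_bimodule_def)
qed

lemma rsmult_closed: "r \<in> carrier R \<Longrightarrow> q \<in> carrier Q \<Longrightarrow> r \<odot>\<^bsub>Q\<^esub> q \<in> carrier Q"
  using R.mod_smult[OF Q_modules] by simp

lemma Q_add: "q \<in> carrier Q \<Longrightarrow> q' \<in> carrier Q \<Longrightarrow> q \<oplus>\<^bsub>Q\<^esub> q' \<in> carrier Q"
  using R.mod_add[OF Q_modules] by simp

lemma lsmult_hom: "l \<in> carrier L \<Longrightarrow> lsmult Q l \<in> rmod_hom R Q Q"
  by (rule rmod_homI) (simp_all add: lsmult_closed lsmult_add lsmult_rsmult)

lemma restrict_hom_iff: "restrict \<phi> (carrier Q) \<in> rmod_hom R Q X \<longleftrightarrow> \<phi> \<in> rmod_hom R Q X"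
  by (auto simp: rmod_hom_def Q_add rsmult_closed Pi_iff)

lemma homf_in: "pk (restrict \<phi> (carrier Q)) \<in> carrier (homf R Q X) \<longleftrightarrow> \<phi> \<in> rmod_hom R Q X"
proof
  assume "pk (restrict \<phi> (carrier Q)) \<in> carrier (homf R Q X)"
  then obtain \<psi> where \<psi>: "\<psi> \<in> rmod_hom R Q X" and eq: "pk (restrict \<phi> (carrier Q)) = pk (restrict \<psi> (carrier Q))"
    by (auto simp: homf_def)
  have "restrict \<phi> (carrier Q) = restrict \<psi> (carrier Q)" using arg_cong[OF eq, of up] unfolding L.up_pk[OF small_Q] .
  then show "\<phi> \<in> rmod_hom R Q X" using \<psi> by (metis restrict_hom_iff)
qed (auto simp: homf_def)

lemma homf_cases:
  assumes "u \<in> carrier (homf R Q X)"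
  shows "up u \<in> rmod_hom R Q X" "pk (restrict (up u) (carrier Q)) = u"
proof -
  obtain \<psi> where \<psi>: "\<psi> \<in> rmod_hom R Q X" and eq: "u = pk (restrict \<psi> (carrier Q))" using assms by (auto simp: homf_def)
  then show "up u \<in> rmod_hom R Q X" "pk (restrict (up u) (carrier Q)) = u"
    using small_Q by (simp_all add: restrict_hom_iff)
qed

lemma homf_ext:
  assumes "u \<in> carrier (homf R Q X)" "v \<in> carrier (homf R Q X)" "\<And>q. q \<in> carrier Q \<Longrightarrow> up u q = up v q"
  shows "u = v"
proof -
  have "u = pk (restrict (up u) (carrier Q))" by (rule homf_cases(2)[OF assms(1), symmetric])
  also have "restrict (up u) (carrier Q) = restrict (up v) (carrier Q)" using assms(3) by (rule restrict_ext)
  also have "pk \<dots> = v" by (rule homf_cases(2)[OF assms(2)])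
  finally show ?thesis .
qed

lemma up_homf:
  assumes "q \<in> carrier Q"
  shows "up \<zero>\<^bsub>homf R Q X\<^esub> q = \<zero>\<^bsub>X\<^esub>"
    and "up (u \<oplus>\<^bsub>homf R Q X\<^esub> v) q = up u q \<oplus>\<^bsub>X\<^esub> up v q"
    and "up (l \<odot>\<^bsub>homf R Q X\<^esub> u) q = up u (lsmult Q l q)"
    and "up (homf_map Q f u) q = f (up u q)"
    and "up (pk (restrict \<phi> (carrier Q))) q = \<phi> q"
  using assms small_Q by (simp_all add: homf_def homf_map_def)

lemma homf_closed: "u \<in> carrier (homf R Q X) \<Longrightarrow> q \<in> carrier Q \<Longrightarrow> up u q \<in> carrier X"
  by (rule hom_closed[OF homf_cases(1)])

lemma Q_hom_sum: "X \<in> modules R \<Longrightarrow> f \<in> rmod_hom R Q X \<Longrightarrow> g \<in> rmod_hom R Q X \<Longrightarrow> (\<lambda>q. f q \<oplus>\<^bsub>X\<^esub> g q) \<in> rmod_hom R Q X"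
  using R.hom_sum[OF Q_modules] by simp

lemma Q_hom_neg: "X \<in> modules R \<Longrightarrow> f \<in> rmod_hom R Q X \<Longrightarrow> (\<lambda>q. \<ominus>\<^bsub>X\<^esub> f q) \<in> rmod_hom R Q X"
  using R.hom_neg[OF Q_modules] by simp

lemma Q_hom_zero: "X \<in> modules R \<Longrightarrow> (\<lambda>q. \<zero>\<^bsub>X\<^esub>) \<in> rmod_hom R Q X"
  using R.hom_const_zero[OF Q_modules] by simp

lemma homf_modules:
  assumes X: "X \<in> modules R"
  shows "homf R Q X \<in> modules L"
proof -
  note add = Q_hom_sum[OF X] and neg = Q_hom_neg[OF X]
  have cl: "u \<oplus>\<^bsub>homf R Q X\<^esub> v \<in> carrier (homf R Q X)" if "u \<in> carrier (homf R Q X)" "v \<in> carrier (homf R Q X)" for u v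
  proof -
    have "u \<oplus>\<^bsub>homf R Q X\<^esub> v = pk (\<lambda>q\<in>carrier Q. up u q \<oplus>\<^bsub>X\<^esub> up v q)" by (simp add: homf_def)
    then show ?thesis using add homf_cases(1) that by (simp add: homf_in)
  qed
  have cs: "l \<odot>\<^bsub>homf R Q X\<^esub> u \<in> carrier (homf R Q X)" if "u \<in> carrier (homf R Q X)" "l \<in> carrier L" for u l
  proof -
    have "l \<odot>\<^bsub>homf R Q X\<^esub> u = pk (\<lambda>q\<in>carrier Q. up u (lsmult Q l q))" by (simp add: homf_def)
    then show ?thesis using hom_comp[OF lsmult_hom homf_cases(1)] that by (simp add: homf_in)
  qed
  have z: "\<zero>\<^bsub>homf R Q X\<^esub> \<in> carrier (homf R Q X)"
  proof -
    have "\<zero>\<^bsub>homf R Q X\<^esub> = pk (\<lambda>q\<in>carrier Q. \<zero>\<^bsub>X\<^esub>)" by (simp add: homf_def)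
    then show ?thesis using Q_hom_zero[OF X] by (simp add: homf_in)
  qed
  show ?thesis
  proof (rule L.modulesI)
    show "abelian_group (homf R Q X)"
    proof (rule abelian_groupI_coords[where I = "carrier Q" and X = "\<lambda>_. X" and p = "\<lambda>q u. up u q"])
      fix u assume "u \<in> carrier (homf R Q X)"
      then show "\<exists>v\<in>carrier (homf R Q X). \<forall>i\<in>carrier Q. up v i = \<ominus>\<^bsub>X\<^esub> up u i"
        using neg[OF homf_cases(1)] small_Q by (intro bexI[of _ "pk (\<lambda>q\<in>carrier Q. \<ominus>\<^bsub>X\<^esub> up u q)"]) (auto simp: homf_in)
    qed (use cl z X in \<open>auto simp: up_homf homf_closed R.mod_group intro: homf_ext\<close>)
    have "carrier (homf R Q X) \<subseteq> pk ` (\<Pi>\<^sub>E q\<in>carrier Q. carrier X)"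
      by (auto simp: homf_def hom_closed)
    then show "small (carrier (homf R Q X))"
      using small_mono L.small_pk_PiE[OF small_Q, of "\<lambda>_. carrier X"] R.mod_small[OF X] by blast
  next
    fix r s x assume rsx: "r \<in> carrier L" "s \<in> carrier L" "x \<in> carrier (homf R Q X)"
    interpret ring L by (rule L.ring_A)
    note h = hom_add[OF homf_cases(1)[OF rsx(3)]]
    show "(r \<oplus>\<^bsub>L\<^esub> s) \<odot>\<^bsub>homf R Q X\<^esub> x = r \<odot>\<^bsub>homf R Q X\<^esub> x \<oplus>\<^bsub>homf R Q X\<^esub> s \<odot>\<^bsub>homf R Q X\<^esub> x"
      by (rule homf_ext[where X = X]) (use rsx in \<open>auto simp: up_homf lsmult_closed add_lsmult h intro!: cl cs\<close>)
    show "(r \<otimes>\<^bsub>L\<^esub> s) \<odot>\<^bsub>homf R Q X\<^esub> x = s \<odot>\<^bsub>homf R Q X\<^esub> (r \<odot>\<^bsub>homf R Q X\<^esub> x)"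
      by (rule homf_ext[where X = X]) (use rsx in \<open>auto simp: up_homf lsmult_closed lsmult_assoc intro!: cl cs\<close>)
  next
    fix r x y assume rxy: "r \<in> carrier L" "x \<in> carrier (homf R Q X)" "y \<in> carrier (homf R Q X)"
    show "r \<odot>\<^bsub>homf R Q X\<^esub> (x \<oplus>\<^bsub>homf R Q X\<^esub> y) = r \<odot>\<^bsub>homf R Q X\<^esub> x \<oplus>\<^bsub>homf R Q X\<^esub> r \<odot>\<^bsub>homf R Q X\<^esub> y"
      by (rule homf_ext[where X = X]) (use rxy in \<open>auto simp: up_homf lsmult_closed intro!: cl cs\<close>)
    show "r \<odot>\<^bsub>homf R Q X\<^esub> x \<in> carrier (homf R Q X)" using rxy cs by blast
  next
    fix x assume x: "x \<in> carrier (homf R Q X)"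
    interpret ring L by (rule L.ring_A)
    show "\<one>\<^bsub>L\<^esub> \<odot>\<^bsub>homf R Q X\<^esub> x = x"
      by (rule homf_ext[where X = X]) (use x in \<open>auto simp: up_homf lsmult_one intro!: cl cs\<close>)
  qed
qed

lemma homf_map_in:
  assumes "f \<in> rmod_hom R X Y" "u \<in> carrier (homf R Q X)"
  shows "homf_map Q f u \<in> carrier (homf R Q Y)"
  unfolding homf_map_def homf_in by (rule hom_comp[OF homf_cases(1)[OF assms(2)] assms(1)])

lemma homf_map_hom:
  assumes X: "X \<in> modules R" and Y: "Y \<in> modules R" and f: "f \<in> rmod_hom R X Y"
  shows "homf_map Q f \<in> rmod_hom L (homf R Q X) (homf R Q Y)"
proof (rule rmod_homI)
  fix u assume u: "u \<in> carrier (homf R Q X)"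
  show "homf_map Q f u \<in> carrier (homf R Q Y)" by (rule homf_map_in[OF f u])
  show "homf_map Q f (u \<oplus>\<^bsub>homf R Q X\<^esub> v) = homf_map Q f u \<oplus>\<^bsub>homf R Q Y\<^esub> homf_map Q f v" if v: "v \<in> carrier (homf R Q X)" for v
    by (rule homf_ext[OF homf_map_in[OF f L.mod_add[OF homf_modules[OF X] u v]] L.mod_add[OF homf_modules[OF Y] homf_map_in[OF f u] homf_map_in[OF f v]]])
      (simp add: up_homf hom_add[OF f] homf_closed u v)
  show "homf_map Q f (l \<odot>\<^bsub>homf R Q X\<^esub> u) = l \<odot>\<^bsub>homf R Q Y\<^esub> homf_map Q f u" if l: "l \<in> carrier L" for l
    by (rule homf_ext[OF homf_map_in[OF f L.mod_smult[OF homf_modules[OF X] l u]] L.mod_smult[OF homf_modules[OF Y] l homf_map_in[OF f u]]])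
      (simp add: up_homf lsmult_closed l)
qed

lemma homc_obj: "obj (homc R Q X) n = homf R Q (obj X n)"
  and homc_dif: "dif (homc R Q X) n = homf_map Q (dif X n)"
  by (simp_all add: homc_def)

lemma homc_complexes:
  assumes X: "X \<in> complexes R"
  shows "homc R Q X \<in> complexes L"
proof -
  have "homf_map Q (dif X (n + 1)) (homf_map Q (dif X n) u) = \<zero>\<^bsub>homf R Q (obj X (n + 1 + 1))\<^esub>" if u: "u \<in> carrier (homf R Q (obj X n))" for n u
    by (rule homf_ext[OF homf_map_in[OF R.cpx_dif[OF X refl] homf_map_in[OF R.cpx_dif[OF X refl] u]] L.mod_zero[OF homf_modules[OF R.cpx_obj[OF X]]]])
      (simp add: up_homf R.dif_dif[OF X] homf_closed[OF u])
  then show ?thesis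
    using X by (simp add: complexes_def[of L] homc_obj homc_dif homf_modules R.cpx_obj homf_map_hom R.cpx_dif)
qed

lemma homc_map_cm:
  assumes X: "X \<in> complexes R" and Y: "Y \<in> complexes R" and f: "f \<in> chain_maps R X Y"
  shows "homc_map Q f \<in> chain_maps L (homc R Q X) (homc R Q Y)"
proof (rule L.chain_mapsI)
  show "homc_map Q f n \<in> rmod_hom L (obj (homc R Q X) n) (obj (homc R Q Y) n)" for n
    unfolding homc_map_def homc_obj by (rule homf_map_hom) (auto simp: X Y R.cpx_obj R.cm_hom[OF f])
  fix n u assume u: "u \<in> carrier (obj (homc R Q X) n)"
  then have u: "u \<in> carrier (homf R Q (obj X n))" by (simp add: homc_obj)
  show "homc_map Q f (n + 1) (dif (homc R Q X) n u) = dif (homc R Q Y) n (homc_map Q f n u)"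
    unfolding homc_map_def homc_dif
    by (rule homf_ext[OF homf_map_in[OF R.cm_hom[OF f] homf_map_in[OF R.cpx_dif[OF X refl] u]] homf_map_in[OF R.cpx_dif[OF Y refl] homf_map_in[OF R.cm_hom[OF f] u]]])
      (simp add: up_homf R.cm_dif[OF f] homf_closed[OF u])
qed

text \<open>The objects of both complexes are equal and the differentials are compared on the
  carriers. The result is therefore a quasi-isomorphism given by the identity and not an equation of
  complexes.\<close>

lemma homc_shift:
  assumes X: "X \<in> complexes R"
  shows "cid \<in> quasi_isos L (homc R Q (shift X)) (shift (homc R Q X))"
proof (rule L.quasi_isos_bij)
  show 1: "homc R Q (shift X) \<in> complexes L" by (rule homc_complexes[OF R.shift_complexes[OF X]])
  note H = homc_complexes[OF X]
  show 2: "shift (homc R Q X) \<in> complexes L" by (rule L.shift_complexes[OF H])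
  have o: "obj (shift (homc R Q X)) n = obj (homc R Q (shift X)) n" for n by (simp add: L.shift_simps R.shift_simps homc_obj)
  show "bij_betw (cid n) (carrier (obj (homc R Q (shift X)) n)) (carrier (obj (shift (homc R Q X)) n))" for n
    by (simp add: o cid_def bij_betw_def)
  show "cid \<in> chain_maps L (homc R Q (shift X)) (shift (homc R Q X))"
  proof (rule L.chain_mapsI)
    show "cid n \<in> rmod_hom L (obj (homc R Q (shift X)) n) (obj (shift (homc R Q X)) n)" for n
      unfolding o cid_def by (rule hom_id)
    fix n u assume u: "u \<in> carrier (obj (homc R Q (shift X)) n)"
    then have u': "u \<in> carrier (homf R Q (obj X (n + 1)))" by (simp add: homc_obj R.shift_simps)
    have d: "homf_map Q (dif X (n + 1)) u \<in> carrier (homf R Q (obj X (n + 1 + 1)))" by (rule homf_map_in[OF R.cpx_dif[OF X refl] u'])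
    have up_neg: "up (\<ominus>\<^bsub>homf R Q Y\<^esub> v) q = \<ominus>\<^bsub>Y\<^esub> up v q" if "v \<in> carrier (homf R Q Y)" "q \<in> carrier Q" "Y \<in> modules R" for Y v q
    proof (rule abelian_group.a_inv_unique[OF R.mod_group[OF that(3)]])
      note g = L.mod_group[OF homf_modules[OF that(3)]]
      show "up v q \<in> carrier Y" "up (\<ominus>\<^bsub>homf R Q Y\<^esub> v) q \<in> carrier Y"
        using that by (auto intro!: homf_closed L.mod_inv[OF homf_modules])
      show "up v q \<oplus>\<^bsub>Y\<^esub> up (\<ominus>\<^bsub>homf R Q Y\<^esub> v) q = \<zero>\<^bsub>Y\<^esub>"
        using up_homf(1)[OF that(2), of Y] abelian_group.r_neg[OF g that(1)] up_homf(2)[OF that(2), of Y v "\<ominus>\<^bsub>homf R Q Y\<^esub> v"] by simp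
    qed
    have "dif (homc R Q (shift X)) n u = dif (shift (homc R Q X)) n u"
    proof (rule homf_ext)
      show "dif (homc R Q (shift X)) n u \<in> carrier (homf R Q (obj X (n + 1 + 1)))"
        using L.dif_closed[OF 1 refl u] by (simp add: homc_obj R.shift_simps)
      show "dif (shift (homc R Q X)) n u \<in> carrier (homf R Q (obj X (n + 1 + 1)))"
        using L.dif_closed[OF 2 refl, of u n] u by (simp add: homc_obj R.shift_simps o)
      show "up (dif (homc R Q (shift X)) n u) q = up (dif (shift (homc R Q X)) n u) q" if q: "q \<in> carrier Q" for q
        unfolding L.shift_simps homc_dif homc_obj up_neg[OF d q R.cpx_obj[OF X]] up_homf(4)[OF q] R.shift_simps ..
    qed
    then show "cid (n + 1) (dif (homc R Q (shift X)) n u) = dif (shift (homc R Q X)) n (cid n u)" by (simp add: cid_def)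
  qed
qed

text \<open>A homomorphism into a direct sum is split into its two components. This is bijective in
  each degree and matches the two differentials exactly.\<close>

lemma homc_cone:
  assumes X: "X \<in> complexes R" and Y: "Y \<in> complexes R" and f: "f \<in> chain_maps R X Y"
  shows "(\<lambda>n u. enc (homf_map Q (\<lambda>v. fst (dec v)) u, homf_map Q (\<lambda>v. snd (dec v)) u))
    \<in> quasi_isos L (homc R Q (cone X Y f)) (cone (homc R Q X) (homc R Q Y) (homc_map Q f))" (is "?\<theta> \<in> _")
proof (rule L.quasi_isos_bij)
  let ?p = "homf_map Q (\<lambda>v. fst (dec v))" and ?q = "homf_map Q (\<lambda>v. snd (dec v))"
  let ?C = "homc R Q (cone X Y f)" and ?D = "cone (homc R Q X) (homc R Q Y) (homc_map Q f)"
  note C = R.cone_complexes[OF X Y f]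
  note HX = homc_complexes[OF X] and HY = homc_complexes[OF Y] and Hf = homc_map_cm[OF X Y f]
  note co = R.cone_obj[OF X Y f] and co' = L.cone_obj[OF HX HY Hf]
  note ms = R.module_sum_fst R.module_sum_snd
  show HC: "?C \<in> complexes L" by (rule homc_complexes[OF C])
  show CH: "?D \<in> complexes L" by (rule L.cone_complexes[OF HX HY Hf])
  have hom: "?\<theta> n \<in> rmod_hom L (obj ?C n) (obj ?D n)" for n
    unfolding co' homc_obj co
    by (intro L.module_sum_pair homf_map_hom R.module_sum_modules R.cpx_obj X Y ms)
  show "?\<theta> \<in> chain_maps L ?C ?D"
  proof (rule L.chain_mapsI[OF hom])
    fix n u assume "u \<in> carrier (obj ?C n)"
    then have u: "u \<in> carrier (homf R Q (module_sum (obj X (n + 1)) (obj Y n)))" by (simp add: homc_obj co)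
    have uf: "?p u \<in> carrier (homf R Q (obj X (n + 1)))"
      and us: "?q u \<in> carrier (homf R Q (obj Y n))"
      by (rule homf_map_in[OF ms(1) u], rule homf_map_in[OF ms(2) u])
    have uq: "up u q = enc (fst (dec (up u q)), snd (dec (up u q)))" if "q \<in> carrier Q" for q
      using homf_closed[OF u that] by (rule R.module_sum_cases) simp
    have du: "homf_map Q (dif (cone X Y f) n) u \<in> carrier (homf R Q (module_sum (obj X (n + 1 + 1)) (obj Y (n + 1))))"
      using homf_map_in[OF R.cpx_dif[OF C refl]] u unfolding co by blast
    note ob = L.cpx_obj[OF HX, unfolded homc_obj] L.cpx_obj[OF HY, unfolded homc_obj]
    have dq: "up (homf_map Q (dif (cone X Y f) n) u) q =
      enc (\<ominus>\<^bsub>obj X (n + 1 + 1)\<^esub> dif X (n + 1) (fst (dec (up u q))), f (n + 1) (fst (dec (up u q))) \<oplus>\<^bsub>obj Y (n + 1)\<^esub> dif Y n (snd (dec (up u q))))"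
      if q: "q \<in> carrier Q" for q
      unfolding up_homf(4)[OF q] by (subst uq[OF q]) (rule R.cone_dif[OF X Y f])
    have dX: "homf_map Q (dif X (n + 1)) (?p u) \<in> carrier (homf R Q (obj X (n + 1 + 1)))"
      by (rule homf_map_in[OF R.cpx_dif[OF X refl] uf])
    have dY: "homf_map Q (dif Y n) (?q u) \<in> carrier (homf R Q (obj Y (n + 1)))"
      by (rule homf_map_in[OF R.cpx_dif[OF Y refl] us])
    have fu: "homf_map Q (f (n + 1)) (?p u) \<in> carrier (homf R Q (obj Y (n + 1)))"
      by (rule homf_map_in[OF R.cm_hom[OF f] uf])
    have "?p (homf_map Q (dif (cone X Y f) n) u) =
       \<ominus>\<^bsub>homf R Q (obj X (n + 1 + 1))\<^esub> homf_map Q (dif X (n + 1)) (?p u)"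
    proof (rule abelian_group.a_inv_unique[OF L.mod_group[OF ob(1)] dX homf_map_in[OF ms(1) du]])
      show "homf_map Q (dif X (n + 1)) (?p u) \<oplus>\<^bsub>homf R Q (obj X (n + 1 + 1))\<^esub>
        ?p (homf_map Q (dif (cone X Y f) n) u) = \<zero>\<^bsub>homf R Q (obj X (n + 1 + 1))\<^esub>"
      proof (rule homf_ext[OF L.mod_add[OF ob(1) dX homf_map_in[OF ms(1) du]] L.mod_zero[OF ob(1)]])
        fix q assume q: "q \<in> carrier Q"
        have "dif X (n + 1) (fst (dec (up u q))) \<in> carrier (obj X (n + 1 + 1))"
          using hom_closed[OF ms(1) homf_closed[OF u q]] by (rule R.dif_closed[OF X refl])
        then show "up (homf_map Q (dif X (n + 1)) (?p u) \<oplus>\<^bsub>homf R Q (obj X (n + 1 + 1))\<^esub>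
          ?p (homf_map Q (dif (cone X Y f) n) u)) q = up \<zero>\<^bsub>homf R Q (obj X (n + 1 + 1))\<^esub> q"
          unfolding up_homf(1,2)[OF q] up_homf(4)[OF q, of "\<lambda>v. fst (dec v)"] dq[OF q] up_homf(4)[OF q, of "dif X (n + 1)"] L.dec_enc fst_conv
          by (rule abelian_group.r_neg[OF R.cpx_group[OF X]])
      qed
    qed
    moreover have "?q (homf_map Q (dif (cone X Y f) n) u) =
       homf_map Q (f (n + 1)) (?p u) \<oplus>\<^bsub>homf R Q (obj Y (n + 1))\<^esub> homf_map Q (dif Y n) (?q u)"
      by (rule homf_ext[OF homf_map_in[OF ms(2) du] L.mod_add[OF ob(2) fu dY]])
        (simp only: up_homf(2) up_homf(4)[where f = "\<lambda>v. snd (dec v)"] up_homf(4)[where f = "\<lambda>v. fst (dec v)"] up_homf(4)[where f = "f (n + 1)"] up_homf(4)[where f = "dif Y n"] dq L.dec_enc snd_conv)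
    ultimately show "?\<theta> (n + 1) (dif ?C n u) = dif ?D n (?\<theta> n u)"
      unfolding L.cone_dif[OF HX HY Hf] unfolding homc_dif homc_obj homc_map_def by simp
  qed
  show "bij_betw (?\<theta> n) (carrier (obj ?C n)) (carrier (obj ?D n))" for n
  proof (rule bij_betwI[where g = "\<lambda>w. pk (\<lambda>q\<in>carrier Q. enc (up (fst (dec w)) q, up (snd (dec w)) q))"])
    show "?\<theta> n \<in> carrier (obj ?C n) \<rightarrow> carrier (obj ?D n)"
      using hom_closed[OF hom] by blast
    show "(\<lambda>w. pk (\<lambda>q\<in>carrier Q. enc (up (fst (dec w)) q, up (snd (dec w)) q))) \<in>
      carrier (obj ?D n) \<rightarrow> carrier (obj ?C n)"
      unfolding co' homc_obj co
      by (auto elim!: L.module_sum_cases simp: homf_in intro!: R.module_sum_pair homf_cases)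
    fix u assume "u \<in> carrier (obj ?C n)"
    then have u: "u \<in> carrier (homf R Q (module_sum (obj X (n + 1)) (obj Y n)))" by (simp add: homc_obj co)
    have h: "(\<lambda>q. enc (up (?p u) q, up (?q u) q)) \<in> rmod_hom R Q (module_sum (obj X (n + 1)) (obj Y n))"
      by (intro R.module_sum_pair homf_cases(1)[OF homf_map_in[OF _ u]] ms)
    let ?r = "pk (\<lambda>q\<in>carrier Q. enc (up (?p u) q, up (?q u) q))"
    have "?r = u"
    proof (rule homf_ext[OF _ u])
      show "?r \<in> carrier (homf R Q (module_sum (obj X (n + 1)) (obj Y n)))"
        using h by (simp add: homf_in)
      fix q assume q: "q \<in> carrier Q"
      have "up u q = enc (fst (dec (up u q)), snd (dec (up u q)))"
        using homf_closed[OF u q] by (rule R.module_sum_cases) simp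
      then show "up (?r) q = up u q"
        using q by (simp add: up_homf)
    qed
    then show "pk (\<lambda>q\<in>carrier Q. enc (up (fst (dec (?\<theta> n u))) q, up (snd (dec (?\<theta> n u))) q)) = u" by simp
  next
    fix w assume "w \<in> carrier (obj ?D n)"
    then obtain a c where w: "w = enc (a, c)" and a: "a \<in> carrier (homf R Q (obj X (n + 1)))" and c: "c \<in> carrier (homf R Q (obj Y n))"
      unfolding co' homc_obj by (rule L.module_sum_cases)
    let ?w = "pk (\<lambda>q\<in>carrier Q. enc (up a q, up c q))"
    have p: "?w \<in> carrier (homf R Q (module_sum (obj X (n + 1)) (obj Y n)))"
      unfolding homf_in by (intro R.module_sum_pair homf_cases(1)[OF a] homf_cases(1)[OF c])
    have "?p ?w = a" by (rule homf_ext[OF homf_map_in[OF ms(1) p] a]) (simp add: up_homf)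
    moreover have "?q ?w = c" by (rule homf_ext[OF homf_map_in[OF ms(2) p] c]) (simp add: up_homf)
    ultimately show "?\<theta> n (pk (\<lambda>q\<in>carrier Q. enc (up (fst (dec w)) q, up (snd (dec w)) q))) = w" by (simp add: w)
  qed
qed

end

text \<open>The form in which finite generation and projectivity are used (see
  \<open>dual_basis_exists\<close>): the functionals \<open>c j\<close> are coordinates for the
  elements \<open>e j\<close>. The index set is kept apart from the elements so that the dual module
  gets a dual basis over the same \<open>J\<close>.\<close>

definition dual_basis :: "'u ring \<Rightarrow> ('u, 'u, 's) module_scheme \<Rightarrow> 'u set \<Rightarrow> ('u \<Rightarrow> 'u) \<Rightarrow> ('u \<Rightarrow> 'u \<Rightarrow> 'u) \<Rightarrow> bool"
  where "dual_basis R Q J e c \<longleftrightarrow> finite J \<and>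
    (\<forall>j\<in>J. e j \<in> carrier Q \<and> c j \<in> rmod_hom R Q (right_part (regular_bimodule R))) \<and>
    (\<forall>q\<in>carrier Q. q = (\<Oplus>\<^bsub>Q\<^esub>j\<in>J. c j q \<odot>\<^bsub>Q\<^esub> e j))"

lemma regular_simps [simp]:
  "carrier (regular_bimodule R) = carrier R" "\<zero>\<^bsub>regular_bimodule R\<^esub> = \<zero>\<^bsub>R\<^esub>" "ring.add (regular_bimodule R) = ring.add R"
  "r \<odot>\<^bsub>regular_bimodule R\<^esub> x = x \<otimes>\<^bsub>R\<^esub> r" "lsmult (regular_bimodule R) l x = l \<otimes>\<^bsub>R\<^esub> x"
  by (simp_all add: regular_bimodule_def)

context ring_universe
begin

lemma zero_submodule_modules:
  assumes M: "M \<in> modules A"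
  shows "M\<lparr>carrier := {\<zero>\<^bsub>M\<^esub>}\<rparr> \<in> modules A"
proof (rule modulesI)
  note z = mod_zero[OF M]
  have 0: "\<zero>\<^bsub>M\<^esub> \<oplus>\<^bsub>M\<^esub> \<zero>\<^bsub>M\<^esub> = \<zero>\<^bsub>M\<^esub>"
    using z by (simp add: abelian_group.abelian_group_simprules[OF mod_group[OF M]])
  show "abelian_group (M\<lparr>carrier := {\<zero>\<^bsub>M\<^esub>}\<rparr>)"
    by (rule abelian_groupI) (auto simp: 0)
  show "small (carrier (M\<lparr>carrier := {\<zero>\<^bsub>M\<^esub>}\<rparr>))" by (simp add: small_finite)
  interpret ring A by (rule ring_A)
  show "r \<in> carrier A \<Longrightarrow> x \<in> carrier (M\<lparr>carrier := {\<zero>\<^bsub>M\<^esub>}\<rparr>) \<Longrightarrow> r \<odot>\<^bsub>M\<lparr>carrier := {\<zero>\<^bsub>M\<^esub>}\<rparr>\<^esub> x \<in> carrier (M\<lparr>carrier := {\<zero>\<^bsub>M\<^esub>}\<rparr>)" for r x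
    by (simp add: smult_zero[OF M])
qed (auto simp: smult_zero[OF M] mod_one[OF M] abelian_group.abelian_group_simprules[OF mod_group[OF M]] mod_zero[OF M] ring.ring_simprules[OF ring_A])

lemma stalk_complexes:
  assumes M: "M \<in> modules A"
  shows "stalk M \<in> complexes A"
proof -
  have o: "obj (stalk M) n \<in> modules A" for n by (simp add: stalk_def M zero_submodule_modules)
  have z: "\<zero>\<^bsub>obj (stalk M) n\<^esub> = \<zero>\<^bsub>M\<^esub>" for n by (simp add: stalk_def)
  have "(\<lambda>x. \<zero>\<^bsub>obj (stalk M) (n + 1)\<^esub>) \<in> rmod_hom A (obj (stalk M) n) (obj (stalk M) (n + 1))" for n
    by (rule hom_const_zero[OF o o])
  then have "dif (stalk M) n \<in> rmod_hom A (obj (stalk M) n) (obj (stalk M) (n + 1))" for n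
    unfolding z by (simp add: stalk_def)
  moreover have "dif (stalk M) (n + 1) (dif (stalk M) n x) = \<zero>\<^bsub>obj (stalk M) (n + 1 + 1)\<^esub>" for n x
    unfolding z by (simp add: stalk_def)
  ultimately show ?thesis using o by (simp add: complexes_def)
qed

end

section \<open>Exactness of Hom out of a finitely generated projective bimodule\<close>

locale fgp_bimod = bimod L R Q for L R :: "'u ring" and Q +
  fixes J :: "'u set" and e :: "'u \<Rightarrow> 'u" and c :: "'u \<Rightarrow> 'u \<Rightarrow> 'u"
  assumes dual_basis: "dual_basis R Q J e c"
begin

lemma finite_J: "finite J"
  using dual_basis by (simp add: dual_basis_def)

lemma e_closed: "j \<in> J \<Longrightarrow> e j \<in> carrier Q"
  using dual_basis by (simp add: dual_basis_def)

lemma c_hom: "j \<in> J \<Longrightarrow> c j \<in> rmod_hom R Q (regular_bimodule R)"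
  using dual_basis by (simp add: dual_basis_def)

lemma dual_basis_expand: "q \<in> carrier Q \<Longrightarrow> q = (\<Oplus>\<^bsub>Q\<^esub>j\<in>J. c j q \<odot>\<^bsub>Q\<^esub> e j)"
  using dual_basis by (simp add: dual_basis_def)

lemma c_closed: "j \<in> J \<Longrightarrow> q \<in> carrier Q \<Longrightarrow> c j q \<in> carrier R"
  using hom_closed[OF c_hom] by simp

text \<open>Turns values attached to the indices into a homomorphism on Q. As Q is only a direct
  summand of a free module, \<open>bext X x (e j)\<close> need not be \<open>x j\<close>; it is if
  the values are those of a homomorphism (\<open>hom_expand\<close>).\<close>

definition bext :: "('u, 'u) module \<Rightarrow> ('u \<Rightarrow> 'u) \<Rightarrow> 'u \<Rightarrow> 'u"
  where "bext X x q = (\<Oplus>\<^bsub>X\<^esub>j\<in>J. c j q \<odot>\<^bsub>X\<^esub> x j)"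

lemma bext_hom:
  assumes X: "X \<in> modules R" and x: "\<And>j. j \<in> J \<Longrightarrow> x j \<in> carrier X"
  shows "bext X x \<in> rmod_hom R Q X"
proof (rule rmod_homI)
  interpret X: abelian_group X by (rule R.mod_group[OF X])
  have cl: "c j q \<odot>\<^bsub>X\<^esub> x j \<in> carrier X" if "j \<in> J" "q \<in> carrier Q" for j q
    using that by (auto intro: R.mod_smult[OF X] c_closed x)
  fix q assume q: "q \<in> carrier Q"
  show "bext X x q \<in> carrier X" unfolding bext_def using cl q by (intro X.finsum_closed) auto
  show "bext X x (q \<oplus>\<^bsub>Q\<^esub> q') = bext X x q \<oplus>\<^bsub>X\<^esub> bext X x q'" if q': "q' \<in> carrier Q" for q'
  proof -
    have "bext X x (q \<oplus>\<^bsub>Q\<^esub> q') = (\<Oplus>\<^bsub>X\<^esub>j\<in>J. c j q \<odot>\<^bsub>X\<^esub> x j \<oplus>\<^bsub>X\<^esub> c j q' \<odot>\<^bsub>X\<^esub> x j)"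
      unfolding bext_def
      by (rule X.finsum_cong') (use q q' in \<open>auto simp: hom_add[OF c_hom] R.mod_smult_l[OF X] c_closed x intro!: X.a_closed cl\<close>)
    also have "\<dots> = bext X x q \<oplus>\<^bsub>X\<^esub> bext X x q'"
      unfolding bext_def by (rule X.finsum_addf) (use q q' cl in auto)
    finally show ?thesis .
  qed
  show "bext X x (r \<odot>\<^bsub>Q\<^esub> q) = r \<odot>\<^bsub>X\<^esub> bext X x q" if r: "r \<in> carrier R" for r
  proof -
    have h: "(\<lambda>y. r \<odot>\<^bsub>X\<^esub> y) \<in> rmod_hom (R\<lparr>carrier := {}\<rparr>) X X"
      by (rule rmod_homI) (auto simp: r X R.mod_smult R.mod_smult_r)
    have "bext X x (r \<odot>\<^bsub>Q\<^esub> q) = (\<Oplus>\<^bsub>X\<^esub>j\<in>J. r \<odot>\<^bsub>X\<^esub> (c j q \<odot>\<^bsub>X\<^esub> x j))"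
      unfolding bext_def
      by (rule X.finsum_cong') (use q r in \<open>auto simp: hom_smult[OF c_hom] R.mod_smult_assoc[OF X] c_closed x intro!: R.mod_smult[OF X] cl\<close>)
    also have "\<dots> = r \<odot>\<^bsub>X\<^esub> bext X x q"
      unfolding bext_def by (rule R.hom_finsum[OF h X.abelian_group_axioms X.abelian_group_axioms finite_J, symmetric]) (use q cl in auto)
    finally show ?thesis .
  qed
qed

lemma hom_bext:
  assumes X: "X \<in> modules R" and Y: "Y \<in> modules R" and g: "g \<in> rmod_hom R X Y"
    and x: "\<And>j. j \<in> J \<Longrightarrow> x j \<in> carrier X" and q: "q \<in> carrier Q"
  shows "g (bext X x q) = bext Y (\<lambda>j. g (x j)) q"
proof -
  interpret Y: abelian_group Y by (rule R.mod_group[OF Y])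
  have "g (bext X x q) = (\<Oplus>\<^bsub>Y\<^esub>j\<in>J. g (c j q \<odot>\<^bsub>X\<^esub> x j))"
    unfolding bext_def by (rule R.hom_finsum[OF g R.mod_group[OF X] R.mod_group[OF Y] finite_J]) (use q in \<open>auto intro: R.mod_smult[OF X] c_closed x\<close>)
  also have "\<dots> = bext Y (\<lambda>j. g (x j)) q"
    unfolding bext_def by (rule Y.finsum_cong') (use q in \<open>auto simp: hom_smult[OF g] c_closed x intro!: R.mod_smult[OF Y] hom_closed[OF g]\<close>)
  finally show ?thesis .
qed

lemma hom_expand:
  assumes X: "X \<in> modules R" and \<phi>: "\<phi> \<in> rmod_hom R Q X" and q: "q \<in> carrier Q"
  shows "\<phi> q = bext X (\<lambda>j. \<phi> (e j)) q"
proof -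
  have "\<phi> (bext (right_part Q) e q) = bext X (\<lambda>j. \<phi> (e j)) q"
    by (rule hom_bext[OF Q_modules X _ _ q]) (use \<phi> e_closed in auto)
  moreover have "bext (right_part Q) e q = q" using dual_basis_expand[OF q] by (simp add: bext_def)
  ultimately show ?thesis by simp
qed

lemma bext_cong:
  assumes "X \<in> modules R" "\<And>j. j \<in> J \<Longrightarrow> x j = y j" "\<And>j. j \<in> J \<Longrightarrow> y j \<in> carrier X" "q \<in> carrier Q"
  shows "bext X x q = bext X y q"
proof -
  interpret X: abelian_group X by (rule R.mod_group[OF assms(1)])
  show ?thesis unfolding bext_def
    by (rule X.finsum_cong') (use assms in \<open>auto intro!: R.mod_smult c_closed\<close>)
qed

lemma bext_zero:
  assumes X: "X \<in> modules R" and "\<And>j. j \<in> J \<Longrightarrow> x j = \<zero>\<^bsub>X\<^esub>" and q: "q \<in> carrier Q"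
  shows "bext X x q = \<zero>\<^bsub>X\<^esub>"
proof -
  interpret X: abelian_group X by (rule R.mod_group[OF X])
  show ?thesis unfolding bext_def
    by (rule X.add.finprod_one_eqI) (use assms in \<open>auto simp: R.smult_zero c_closed\<close>)
qed

lemma hom_ext_basis:
  assumes X: "X \<in> modules R" and "\<phi> \<in> rmod_hom R Q X" "\<psi> \<in> rmod_hom R Q X"
    and "\<And>j. j \<in> J \<Longrightarrow> \<phi> (e j) = \<psi> (e j)" and q: "q \<in> carrier Q"
  shows "\<phi> q = \<psi> q"
proof -
  have "bext X (\<lambda>j. \<phi> (e j)) q = bext X (\<lambda>j. \<psi> (e j)) q"
    by (rule bext_cong[OF X assms(4) _ q]) (auto intro: hom_closed[OF assms(3)] e_closed)
  then show ?thesis using hom_expand[OF X assms(2) q] hom_expand[OF X assms(3) q] by simp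
qed

text \<open>Exactness of Hom out of Q, done on elements: the lifting problem is solved at the
  finitely many \<open>e j\<close> and extended by \<open>bext\<close>. This is consistent because
  \<open>bext\<close> commutes with homomorphisms (\<open>hom_bext\<close>) and reproduces a
  homomorphism from its values (\<open>hom_expand\<close>).\<close>

lemma homc_map_quasi_iso:
  assumes X: "X \<in> complexes R" and Y: "Y \<in> complexes R" and f: "f \<in> quasi_isos R X Y"
  shows "homc_map Q f \<in> quasi_isos L (homc R Q X) (homc R Q Y)"
proof -
  have fc: "f \<in> chain_maps R X Y" by (rule R.quasi_isos_cm[OF f])
  note HX = homc_complexes[OF X] and HY = homc_complexes[OF Y]
  have cocyc: "up u q \<in> cocycles V n" if "u \<in> cocycles (homc R Q V) n" "q \<in> carrier Q" "V \<in> complexes R" for u q V n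
  proof -
    have u: "u \<in> carrier (homf R Q (obj V n))" using that by (simp add: cocycles_def homc_obj)
    have "up (dif (homc R Q V) n u) q = up \<zero>\<^bsub>obj (homc R Q V) (n + 1)\<^esub> q" using that by (simp add: cocycles_def)
    then show ?thesis using homf_closed[OF u that(2)] that(2) by (simp add: cocycles_def homc_obj homc_dif up_homf)
  qed
  show ?thesis
  proof (rule L.quasi_isosI[OF HX HY homc_map_cm[OF X Y fc]])
    fix n
    {
      fix u w assume u: "u \<in> cocycles (homc R Q X) n" and "w \<in> carrier (obj (homc R Q Y) (n - 1))"
        and eq: "homc_map Q f n u = dif (homc R Q Y) (n - 1) w"
      then have w: "w \<in> carrier (homf R Q (obj Y (n - 1)))" by (simp add: homc_obj)
      have uc: "u \<in> carrier (homf R Q (obj X n))" using u by (simp add: cocycles_def homc_obj)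
      have "\<exists>x\<in>carrier (obj X (n - 1)). up u (e j) = dif X (n - 1) x" if j: "j \<in> J" for j
      proof -
        have "f n (up u (e j)) = dif Y (n - 1) (up w (e j))"
          using arg_cong[OF eq, of "\<lambda>u. up u (e j)"] e_closed[OF j] by (simp add: homc_map_def homc_dif up_homf)
        then show ?thesis
          using R.quasi_isosE_inj[OF f X Y cocyc[OF u e_closed[OF j] X] homf_closed[OF w e_closed[OF j]]] by metis
      qed
      then obtain x where x: "\<And>j. j \<in> J \<Longrightarrow> x j \<in> carrier (obj X (n - 1))" "\<And>j. j \<in> J \<Longrightarrow> up u (e j) = dif X (n - 1) (x j)" by metis
      note b = bext_hom[OF R.cpx_obj[OF X] x(1)]
      let ?v = "pk (restrict (bext (obj X (n - 1)) x) (carrier Q))"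
      have v: "?v \<in> carrier (homf R Q (obj X (n - 1)))" using b by (simp add: homf_in)
      have "u = homf_map Q (dif X (n - 1)) ?v"
      proof (rule homf_ext[OF uc homf_map_in[OF R.cpx_dif'[OF X] v]])
        fix q assume q: "q \<in> carrier Q"
        have "up u q = bext (obj X n) (\<lambda>j. up u (e j)) q" by (rule hom_expand[OF R.cpx_obj[OF X] homf_cases(1)[OF uc] q])
        also have "\<dots> = bext (obj X n) (\<lambda>j. dif X (n - 1) (x j)) q"
          by (rule bext_cong[OF R.cpx_obj[OF X] x(2) hom_closed[OF R.cpx_dif'[OF X] x(1)] q])
        also have "\<dots> = dif X (n - 1) (bext (obj X (n - 1)) x q)"
          by (rule hom_bext[OF R.cpx_obj[OF X] R.cpx_obj[OF X] R.cpx_dif'[OF X] x(1) q, symmetric])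
        finally show "up u q = up (homf_map Q (dif X (n - 1)) ?v) q" using q by (simp add: up_homf)
      qed
      then show "\<exists>x\<in>carrier (obj (homc R Q X) (n - 1)). u = dif (homc R Q X) (n - 1) x" using v by (auto simp: homc_obj homc_dif)
    next
      fix w assume w: "w \<in> cocycles (homc R Q Y) n"
      then have wc: "w \<in> carrier (homf R Q (obj Y n))" by (simp add: cocycles_def homc_obj)
      define S where "S j z y \<longleftrightarrow> z \<in> cocycles X n \<and> y \<in> carrier (obj Y (n - 1)) \<and> up w (e j) = f n z \<oplus>\<^bsub>obj Y n\<^esub> dif Y (n - 1) y" for j z y
      have "\<exists>z y. S j z y" if j: "j \<in> J" for j
      proof -
        obtain z y where "z \<in> cocycles X n" "y \<in> carrier (obj Y (n - 1))" "up w (e j) = f n z \<oplus>\<^bsub>obj Y n\<^esub> dif Y (n - 1) y"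
          using R.quasi_isosE_surj[OF f X Y cocyc[OF w e_closed[OF j] Y]] .
        then show ?thesis unfolding S_def by blast
      qed
      then obtain z y where "\<And>j. j \<in> J \<Longrightarrow> S j (z j) (y j)" by metis
      then have z: "\<And>j. j \<in> J \<Longrightarrow> z j \<in> cocycles X n" and y: "\<And>j. j \<in> J \<Longrightarrow> y j \<in> carrier (obj Y (n - 1))"
        and weq: "\<And>j. j \<in> J \<Longrightarrow> up w (e j) = f n (z j) \<oplus>\<^bsub>obj Y n\<^esub> dif Y (n - 1) (y j)" unfolding S_def by blast+
      note zc = R.cocycles_closed[OF z]
      note bz = bext_hom[OF R.cpx_obj[OF X] zc] and by' = bext_hom[OF R.cpx_obj[OF Y] y]
      let ?z = "pk (restrict (bext (obj X n) z) (carrier Q))" and ?y = "pk (restrict (bext (obj Y (n - 1)) y) (carrier Q))"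
      have pz: "?z \<in> carrier (homf R Q (obj X n))" and py: "?y \<in> carrier (homf R Q (obj Y (n - 1)))"
        using bz by' by (simp_all add: homf_in)
      have "homf_map Q (dif X n) ?z = \<zero>\<^bsub>homf R Q (obj X (n + 1))\<^esub>"
      proof (rule homf_ext[OF homf_map_in[OF R.cpx_dif[OF X refl] pz] L.mod_zero[OF homf_modules[OF R.cpx_obj[OF X]]]])
        fix q assume q: "q \<in> carrier Q"
        have "dif X n (bext (obj X n) z q) = bext (obj X (n + 1)) (\<lambda>j. dif X n (z j)) q"
          by (rule hom_bext[OF R.cpx_obj[OF X] R.cpx_obj[OF X] R.cpx_dif[OF X refl] zc q])
        also have "\<dots> = \<zero>\<^bsub>obj X (n + 1)\<^esub>" by (rule bext_zero[OF R.cpx_obj[OF X] R.cocycles_dif[OF z] q])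
        finally show "up (homf_map Q (dif X n) ?z) q = up \<zero>\<^bsub>homf R Q (obj X (n + 1))\<^esub> q" using q by (simp add: up_homf)
      qed
      then have "?z \<in> cocycles (homc R Q X) n" using pz by (simp add: cocycles_def homc_obj homc_dif)
      moreover have "w = homf_map Q (f n) ?z \<oplus>\<^bsub>homf R Q (obj Y n)\<^esub> homf_map Q (dif Y (n - 1)) ?y" (is "w = ?r")
      proof (rule homf_ext[OF wc])
        show r: "?r \<in> carrier (homf R Q (obj Y n))"
          by (rule L.mod_add[OF homf_modules[OF R.cpx_obj[OF Y]] homf_map_in[OF R.cm_hom[OF fc] pz] homf_map_in[OF R.cpx_dif'[OF Y] py]])
        fix q assume q: "q \<in> carrier Q"
        show "up w q = up ?r q"
        proof (rule hom_ext_basis[OF R.cpx_obj[OF Y] homf_cases(1)[OF wc] homf_cases(1)[OF r] _ q])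
          fix j assume j: "j \<in> J"
          note ej = e_closed[OF j]
          have A: "f n (bext (obj X n) z q) = bext (obj Y n) (\<lambda>j. f n (z j)) q" if "q \<in> carrier Q" for q
            by (rule hom_bext[OF R.cpx_obj[OF X] R.cpx_obj[OF Y] R.cm_hom[OF fc] zc that])
          have B: "dif Y (n - 1) (bext (obj Y (n - 1)) y q) = bext (obj Y n) (\<lambda>j. dif Y (n - 1) (y j)) q" if "q \<in> carrier Q" for q
            by (rule hom_bext[OF R.cpx_obj[OF Y] R.cpx_obj[OF Y] R.cpx_dif'[OF Y] y that])
          interpret Y: abelian_group "obj Y n" by (rule R.cpx_group[OF Y])
          have cz: "f n (z i) \<in> carrier (obj Y n)" and cy: "dif Y (n - 1) (y i) \<in> carrier (obj Y n)" if "i \<in> J" for i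
            by (rule R.cm_closed[OF fc zc[OF that]], rule hom_closed[OF R.cpx_dif'[OF Y] y[OF that]])
          have "up w (e j) = bext (obj Y n) (\<lambda>i. up w (e i)) (e j)" by (rule hom_expand[OF R.cpx_obj[OF Y] homf_cases(1)[OF wc] ej])
          also have "\<dots> = bext (obj Y n) (\<lambda>i. f n (z i) \<oplus>\<^bsub>obj Y n\<^esub> dif Y (n - 1) (y i)) (e j)"
            by (rule bext_cong[OF R.cpx_obj[OF Y] weq _ ej]) (auto intro: cz cy)
          also have "\<dots> = (\<Oplus>\<^bsub>obj Y n\<^esub>i\<in>J. c i (e j) \<odot>\<^bsub>obj Y n\<^esub> f n (z i) \<oplus>\<^bsub>obj Y n\<^esub> c i (e j) \<odot>\<^bsub>obj Y n\<^esub> dif Y (n - 1) (y i))"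
            unfolding bext_def
            by (rule Y.finsum_cong') (auto simp: R.mod_smult_r[OF R.cpx_obj[OF Y]] c_closed ej cz cy intro!: Y.a_closed R.mod_smult[OF R.cpx_obj[OF Y]])
          also have "\<dots> = bext (obj Y n) (\<lambda>j. f n (z j)) (e j) \<oplus>\<^bsub>obj Y n\<^esub> bext (obj Y n) (\<lambda>j. dif Y (n - 1) (y j)) (e j)"
            unfolding bext_def by (rule Y.finsum_addf) (auto intro!: R.mod_smult[OF R.cpx_obj[OF Y]] c_closed ej cz cy)
          finally show "up w (e j) = up ?r (e j)" using ej by (simp add: up_homf A B)
        qed
      qed
      ultimately show "\<exists>z\<in>cocycles (homc R Q X) n. \<exists>y\<in>carrier (obj (homc R Q Y) (n - 1)).
        w = homc_map Q f n z \<oplus>\<^bsub>obj (homc R Q Y) n\<^esub> dif (homc R Q Y) (n - 1) y"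
        using py by (auto simp: homc_obj homc_dif homc_map_def)
    }
  qed
qed

text \<open>A homomorphism from Q to a direct sum has only finitely many nonzero components: it is
  determined by the finitely many images of the \<open>e j\<close>, each of finite support. So Hom
  out of Q commutes with direct sums as well as with products.\<close>

lemma homc_cprod:
  fixes I :: "'u set"
  assumes I: "small I" and X: "\<And>i. i \<in> I \<Longrightarrow> X i \<in> complexes R"
  shows "(\<lambda>n u. pk (\<lambda>i\<in>I. homf_map Q (\<lambda>v. up v i) u)) \<in> quasi_isos L (homc R Q (cprod b I X)) (cprod b I (\<lambda>i. homc R Q (X i)))"
    (is "?\<theta> \<in> _")
proof (rule L.quasi_isos_bij)
  have HX: "homc R Q (X i) \<in> complexes L" if "i \<in> I" for i by (rule homc_complexes[OF X[OF that]])
  let ?C = "cprod b I X" and ?D = "cprod b I (\<lambda>i. homc R Q (X i))"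
  have C: "?C \<in> complexes R" by (rule R.cprod_complexes[OF I X])
  have HC: "homc R Q ?C \<in> complexes L" by (rule homc_complexes[OF C])
  have D: "?D \<in> complexes L" by (rule L.cprod_complexes[OF I HX])
  show "homc R Q ?C \<in> complexes L" "?D \<in> complexes L" by fact+
  have uph: "(\<lambda>v. up v i) \<in> rmod_hom R (obj ?C n) (obj (X i) n)" if "i \<in> I" for i n
    unfolding R.cprod_obj[OF I] by (rule R.up_hom[OF I that])
  have upi: "up (?\<theta> n u) i = homf_map Q (\<lambda>v. up v i) u" if "i \<in> I" for n u i using that I by simp
  have cl: "?\<theta> n u \<in> carrier (obj ?D n)" if "u \<in> carrier (obj (homc R Q ?C) n)" for n u
  proof -
    have u: "u \<in> carrier (homf R Q (obj ?C n))" using that by (simp add: homc_obj)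
    have m: "homf_map Q (\<lambda>v. up v i) u \<in> carrier (homf R Q (obj (X i) n))" if "i \<in> I" for i by (rule homf_map_in[OF uph[OF that] u])
    have "finite {i \<in> I. homf_map Q (\<lambda>v. up v i) u \<noteq> \<zero>\<^bsub>homf R Q (obj (X i) n)\<^esub>}" if "\<not> b"
    proof (rule finite_subset)
      show "finite (\<Union>j\<in>J. {i \<in> I. up (up u (e j)) i \<noteq> \<zero>\<^bsub>obj (X i) n\<^esub>})"
        using finite_J R.pmod_cases(3)[OF I homf_closed[OF u e_closed, unfolded R.cprod_obj[OF I]]] \<open>\<not> b\<close> by auto
      show "{i \<in> I. homf_map Q (\<lambda>v. up v i) u \<noteq> \<zero>\<^bsub>homf R Q (obj (X i) n)\<^esub>} \<subseteq> (\<Union>j\<in>J. {i \<in> I. up (up u (e j)) i \<noteq> \<zero>\<^bsub>obj (X i) n\<^esub>})"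
      proof (rule subsetI, rule ccontr)
        fix i assume i: "i \<in> {i \<in> I. homf_map Q (\<lambda>v. up v i) u \<noteq> \<zero>\<^bsub>homf R Q (obj (X i) n)\<^esub>}"
          and n: "i \<notin> (\<Union>j\<in>J. {i \<in> I. up (up u (e j)) i \<noteq> \<zero>\<^bsub>obj (X i) n\<^esub>})"
        have iI: "i \<in> I" using i by simp
        note Xm = R.cpx_obj[OF X[OF iI], of n]
        have "homf_map Q (\<lambda>v. up v i) u = \<zero>\<^bsub>homf R Q (obj (X i) n)\<^esub>"
        proof (rule homf_ext[OF m[OF iI] L.mod_zero[OF homf_modules[OF Xm]]])
          fix q assume q: "q \<in> carrier Q"
          show "up (homf_map Q (\<lambda>v. up v i) u) q = up \<zero>\<^bsub>homf R Q (obj (X i) n)\<^esub> q"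
          proof (rule hom_ext_basis[OF Xm homf_cases(1)[OF m[OF iI]] homf_cases(1)[OF L.mod_zero[OF homf_modules[OF Xm]]] _ q])
            fix j assume j: "j \<in> J"
            then have "up (up u (e j)) i = \<zero>\<^bsub>obj (X i) n\<^esub>" using n iI by auto
            then show "up (homf_map Q (\<lambda>v. up v i) u) (e j) = up \<zero>\<^bsub>homf R Q (obj (X i) n)\<^esub> (e j)"
              using e_closed[OF j] by (simp add: up_homf)
          qed
        qed
        then show False using i by simp
      qed
    qed
    then have "b \<or> finite {i \<in> I. homf_map Q (\<lambda>v. up v i) u \<noteq> \<zero>\<^bsub>homf R Q (obj (X i) n)\<^esub>}" by blast
    then show ?thesis unfolding L.cprod_obj[OF I] homc_obj L.pk_in_pmod[OF I] using m by blast
  qed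
  have hom: "?\<theta> n \<in> rmod_hom L (obj (homc R Q ?C) n) (obj ?D n)" for n
  proof (rule rmod_homI[OF cl])
    have uh: "homf_map Q (\<lambda>v. up v i) \<in> rmod_hom L (obj (homc R Q ?C) n) (obj (homc R Q (X i)) n)" if "i \<in> I" for i
      unfolding homc_obj by (rule homf_map_hom[OF R.cpx_obj[OF C] R.cpx_obj[OF X[OF that]] uph[OF that]])
    fix u assume u: "u \<in> carrier (obj (homc R Q ?C) n)"
    show "?\<theta> n (u \<oplus>\<^bsub>obj (homc R Q ?C) n\<^esub> v) = ?\<theta> n u \<oplus>\<^bsub>obj ?D n\<^esub> ?\<theta> n v" if v: "v \<in> carrier (obj (homc R Q ?C) n)" for v
      by (rule L.cprod_ext[OF I cl[OF L.mod_add[OF L.cpx_obj[OF HC] u v]] L.mod_add[OF L.cpx_obj[OF D] cl[OF u] cl[OF v]]])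
        (simp only: upi L.up_cprod[OF I] hom_add[OF uh u v])
    show "?\<theta> n (l \<odot>\<^bsub>obj (homc R Q ?C) n\<^esub> u) = l \<odot>\<^bsub>obj ?D n\<^esub> ?\<theta> n u" if l: "l \<in> carrier L" for l
      by (rule L.cprod_ext[OF I cl[OF L.mod_smult[OF L.cpx_obj[OF HC] l u]] L.mod_smult[OF L.cpx_obj[OF D] l cl[OF u]]])
        (simp only: upi L.cprod_obj[OF I] L.up_pmod[OF I] hom_smult[OF uh l u])
  qed
  show "?\<theta> \<in> chain_maps L (homc R Q ?C) ?D"
  proof (rule L.chain_mapsI[OF hom])
    fix n u assume u: "u \<in> carrier (obj (homc R Q ?C) n)"
    then have u': "u \<in> carrier (homf R Q (obj ?C n))" by (simp add: homc_obj)
    show "?\<theta> (n + 1) (dif (homc R Q ?C) n u) = dif ?D n (?\<theta> n u)"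
    proof (rule L.cprod_ext[OF I cl[OF L.dif_closed[OF HC refl u]] L.dif_closed[OF D refl cl[OF u]]])
      fix i assume i: "i \<in> I"
      have du: "homf_map Q (dif ?C n) u \<in> carrier (homf R Q (obj ?C (n + 1)))" by (rule homf_map_in[OF R.cpx_dif[OF C refl] u'])
      have "homf_map Q (\<lambda>v. up v i) (homf_map Q (dif ?C n) u) = homf_map Q (dif (X i) n) (homf_map Q (\<lambda>v. up v i) u)"
        by (rule homf_ext[OF homf_map_in[OF uph[OF i] du] homf_map_in[OF R.cpx_dif[OF X[OF i] refl] homf_map_in[OF uph[OF i] u']]])
          (simp add: up_homf R.up_cprod[OF I i])
      then show "up (?\<theta> (n + 1) (dif (homc R Q ?C) n u)) i = up (dif ?D n (?\<theta> n u)) i"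
        unfolding upi[OF i] L.up_cprod(3)[OF I i] homc_dif .
    qed
  qed
    have g: "(\<lambda>q. pk (\<lambda>i\<in>I. up (up w i) q)) \<in> rmod_hom R Q (obj ?C n)" if w: "w \<in> carrier (obj ?D n)" for w n
    proof (rule rmod_homI)
      have wi: "up w i \<in> carrier (homf R Q (obj (X i) n))" if "i \<in> I" for i
        using L.cprod_up_closed[OF I w that] by (simp add: homc_obj)
      note wh = homf_cases(1)[OF wi]
      show c: "pk (\<lambda>i\<in>I. up (up w i) q) \<in> carrier (obj ?C n)" if q: "q \<in> carrier Q" for q
      proof -
        have "{i \<in> I. up (up w i) q \<noteq> \<zero>\<^bsub>obj (X i) n\<^esub>} \<subseteq> {i \<in> I. up w i \<noteq> \<zero>\<^bsub>obj (homc R Q (X i)) n\<^esub>}"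
          using q by (auto simp: homc_obj up_homf)
        then have "b \<or> finite {i \<in> I. up (up w i) q \<noteq> \<zero>\<^bsub>obj (X i) n\<^esub>}"
          using L.pmod_cases(3)[OF I w[unfolded L.cprod_obj[OF I]]] by (meson finite_subset)
        then show ?thesis unfolding R.cprod_obj[OF I] R.pk_in_pmod[OF I] using hom_closed[OF wh q] by blast
      qed
      fix q assume q: "q \<in> carrier Q"
      show "pk (\<lambda>i\<in>I. up (up w i) (q \<oplus>\<^bsub>Q\<^esub> q')) = pk (\<lambda>i\<in>I. up (up w i) q) \<oplus>\<^bsub>obj ?C n\<^esub> pk (\<lambda>i\<in>I. up (up w i) q')" if q': "q' \<in> carrier Q" for q'
        by (rule R.cprod_ext[OF I c[OF Q_add[OF q q']] R.mod_add[OF R.cpx_obj[OF C] c[OF q] c[OF q']]])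
          (simp add: R.up_cprod[OF I] I hom_add[OF wh q q'])
      show "pk (\<lambda>i\<in>I. up (up w i) (r \<odot>\<^bsub>Q\<^esub> q)) = r \<odot>\<^bsub>obj ?C n\<^esub> pk (\<lambda>i\<in>I. up (up w i) q)" if r: "r \<in> carrier R" for r
        by (rule R.cprod_ext[OF I c[OF rsmult_closed[OF r q]] R.mod_smult[OF R.cpx_obj[OF C] r c[OF q]]])
          (simp add: R.cprod_obj[OF I] R.up_pmod[OF I] I hom_smult[OF wh r q])
    qed
    then have g': "pk (\<lambda>q\<in>carrier Q. pk (\<lambda>i\<in>I. up (up w i) q)) \<in> carrier (obj (homc R Q ?C) n)" if "w \<in> carrier (obj ?D n)" for w n
      using that by (simp add: homc_obj homf_in)
  show "bij_betw (?\<theta> n) (carrier (obj (homc R Q ?C) n)) (carrier (obj ?D n))" for n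
  proof (rule bij_betwI[where g = "\<lambda>w. pk (\<lambda>q\<in>carrier Q. pk (\<lambda>i\<in>I. up (up w i) q))"])
    show "?\<theta> n \<in> carrier (obj (homc R Q ?C) n) \<rightarrow> carrier (obj ?D n)" using cl by blast
    show "(\<lambda>w. pk (\<lambda>q\<in>carrier Q. pk (\<lambda>i\<in>I. up (up w i) q))) \<in> carrier (obj ?D n) \<rightarrow> carrier (obj (homc R Q ?C) n)" using g' by blast
    fix u assume u: "u \<in> carrier (obj (homc R Q ?C) n)"
    then have u': "u \<in> carrier (homf R Q (obj ?C n))" by (simp add: homc_obj)
    show "pk (\<lambda>q\<in>carrier Q. pk (\<lambda>i\<in>I. up (up (?\<theta> n u) i) q)) = u"
    proof (rule homf_ext[OF _ u'])
      show "pk (\<lambda>q\<in>carrier Q. pk (\<lambda>i\<in>I. up (up (?\<theta> n u) i) q)) \<in> carrier (homf R Q (obj ?C n))"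
        using g'[OF cl[OF u]] by (simp add: homc_obj)
      fix q assume q: "q \<in> carrier Q"
      have "pk (\<lambda>i\<in>I. up (up (?\<theta> n u) i) q) = pk (restrict (up (up u q)) I)"
        by (rule arg_cong[of _ _ pk], rule restrict_ext) (use q in \<open>simp only: upi up_homf\<close>)
      also have "\<dots> = up u q" using homf_closed[OF u' q] unfolding R.cprod_obj[OF I] by (rule R.pmod_cases(1)[OF I])
      finally show "up (pk (\<lambda>q\<in>carrier Q. pk (\<lambda>i\<in>I. up (up (?\<theta> n u) i) q))) q = up u q" using q by (simp add: up_homf)
    qed
  next
    fix w assume w: "w \<in> carrier (obj ?D n)"
    let ?p = "pk (\<lambda>q\<in>carrier Q. pk (\<lambda>i\<in>I. up (up w i) q))"
    have p: "?p \<in> carrier (obj (homc R Q ?C) n)" by (rule g'[OF w])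
    show "?\<theta> n ?p = w"
    proof (rule L.cprod_ext[OF I cl[OF p] w])
      fix i assume i: "i \<in> I"
      have wi: "up w i \<in> carrier (homf R Q (obj (X i) n))"
        using L.cprod_up_closed[OF I w i] by (simp add: homc_obj)
      have p': "?p \<in> carrier (homf R Q (obj ?C n))" using p by (simp add: homc_obj)
      show "up (?\<theta> n ?p) i = up w i"
        unfolding upi[OF i]
        by (rule homf_ext[OF homf_map_in[OF uph[OF i] p'] wi]) (use i I in \<open>simp add: up_homf\<close>)
    qed
  qed
qed

end

section \<open>Transfer of generation and dual bimodules\<close>

definition generates :: "bool \<Rightarrow> 'u ring \<Rightarrow> ('u, 'u) module set \<Rightarrow> bool"
  where "generates b A G \<longleftrightarrow> \<Inter>{S. locsub b A S \<and> stalk ` G \<subseteq> S} = complexes A"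

context ring_universe
begin

lemma regular_group: "abelian_group (regular_bimodule A)"
  using abelian_groupE[OF ring.is_abelian_group[OF ring_A]] by (intro abelian_groupI) simp_all

lemma regular_modules: "right_part (regular_bimodule A) \<in> modules A"
proof -
  interpret ring A by (rule ring_A)
  have "abelian_group (right_part (regular_bimodule A))"
    using abelian_groupE[OF regular_group] by (intro abelian_groupI) simp_all
  then show ?thesis
    by (rule modulesI) (simp_all add: small_A l_distr r_distr m_assoc)
qed

text \<open>Puts the whole category among the subcategories intersected in \<open>generates\<close>,
  so that the intersection consists of complexes.\<close>

lemma complexes_locsub: "locsub b A (complexes A)"
proof (rule locsubI)
  show "complexes A \<noteq> {}" using stalk_complexes[OF regular_modules] by blast
qed (simp_all add: shift_complexes cone_complexes cprod_complexes)

end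

text \<open>In nonzero degrees the stalk is the zero submodule of J. Hom into it has a single packed
  element, which is the zero of \<open>homf R Q J\<close>, so the objects agree literally and the
  identity is the comparison map.\<close>

lemma (in bimod) homc_stalk:
  assumes J: "J \<in> modules R"
  shows "cid \<in> quasi_isos L (homc R Q (stalk J)) (stalk (homf R Q J))"
proof -
  let ?Z = "J\<lparr>carrier := {\<zero>\<^bsub>J\<^esub>}\<rparr>" and ?z = "\<lambda>\<phi>. \<forall>q\<in>carrier Q. \<phi> q = \<zero>\<^bsub>J\<^esub>" and ?c = "pk (\<lambda>q\<in>carrier Q. \<zero>\<^bsub>J\<^esub>)"
  have z: "?Z \<in> modules R" by (rule R.zero_submodule_modules[OF J])
  have "rmod_hom R Q ?Z = {\<phi>. ?z \<phi>}" (is "?H = _")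
  proof
    show "?H \<subseteq> {\<phi>. ?z \<phi>}" by (auto dest: hom_closed)
    have "\<zero>\<^bsub>J\<^esub> \<oplus>\<^bsub>J\<^esub> \<zero>\<^bsub>J\<^esub> = \<zero>\<^bsub>J\<^esub>" using R.mod_group[OF J] by algebra
    then show "{\<phi>. ?z \<phi>} \<subseteq> ?H"
      by (auto simp: rmod_hom_def Q_add rsmult_closed R.smult_zero[OF J])
  qed
  then have "carrier (homf R Q ?Z) = {pk (restrict \<phi> (carrier Q)) | \<phi>. ?z \<phi>}"
    by (simp add: homf_def)
  also have "\<dots> = {?c}"
  proof -
    have eq: "restrict \<phi> (carrier Q) = (\<lambda>q\<in>carrier Q. \<zero>\<^bsub>J\<^esub>)" if "?z \<phi>" for \<phi>
      using that by (intro restrict_ext) auto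
    have "{pk (restrict \<phi> (carrier Q)) | \<phi>. ?z \<phi>} \<subseteq> {?c}"
    proof (rule subsetI, elim CollectE exE conjE)
      fix x \<phi> assume x: "x = pk (restrict \<phi> (carrier Q))" and "?z \<phi>"
      show "x \<in> {?c}" unfolding x eq[OF \<open>?z \<phi>\<close>] by (rule singletonI)
    qed
    moreover have "?c \<in> {pk (restrict \<phi> (carrier Q)) | \<phi>. ?z \<phi>}"
      by (rule CollectI, rule exI[of _ "\<lambda>q. \<zero>\<^bsub>J\<^esub>"]) simp
    ultimately show ?thesis by blast
  qed
  finally have "homf R Q ?Z = (homf R Q J)\<lparr>carrier := {\<zero>\<^bsub>homf R Q J\<^esub>}\<rparr>"
    by (simp add: homf_def)
  then have o: "obj (homc R Q (stalk J)) n = obj (stalk (homf R Q J)) n" for n by (simp add: homc_obj stalk_def)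
  have d: "dif (homc R Q (stalk J)) n u = dif (stalk (homf R Q J)) n u" for n u
    by (simp add: homc_dif stalk_def homf_map_def homf_def)
  show ?thesis
  proof (rule L.quasi_isos_bij[OF homc_complexes[OF R.stalk_complexes[OF J]] L.stalk_complexes[OF homf_modules[OF J]]])
    show "cid \<in> chain_maps L (homc R Q (stalk J)) (stalk (homf R Q J))"
      by (rule L.chain_mapsI) (simp_all add: o d cid_def hom_id)
    show "bij_betw (cid n) (carrier (obj (homc R Q (stalk J)) n)) (carrier (obj (stalk (homf R Q J)) n))" for n
      by (simp add: o cid_def bij_betw_def)
  qed
qed

text \<open>The preimage of a (co)localising subcategory under the exact functor \<open>Hom\<^sub>R(Q, -)\<close> is again one.\<close>

lemma (in fgp_bimod) generates_transfer:
  assumes gen: "generates b R GR" and GR: "GR \<noteq> {}" "GR \<subseteq> modules R" and GL: "GL \<subseteq> modules L"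
    and pres: "\<And>J. J \<in> GR \<Longrightarrow> homf R Q J \<in> GL"
    and retract: "\<And>X. X \<in> complexes L \<Longrightarrow> \<exists>Z\<in>complexes R. \<exists>i\<in>chain_maps L X (homc R Q Z). \<exists>r\<in>chain_maps L (homc R Q Z) X.
      \<forall>n. \<forall>x\<in>carrier (obj X n). r n (i n x) = x"
  shows "generates b L GL"
proof -
  have "complexes L \<subseteq> S" if S: "locsub b L S" and G: "stalk ` GL \<subseteq> S" for S
  proof -
    define S' where "S' = {Z \<in> complexes R. homc R Q Z \<in> S}"
    have stalks: "stalk ` GR \<subseteq> S'"
    proof (rule image_subsetI)
      fix J assume J: "J \<in> GR"
      then have Jm: "J \<in> modules R" using GR by blast
      have "stalk (homf R Q J) \<in> S" using pres[OF J] G by blast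
      then have "homc R Q (stalk J) \<in> S"
        using L.locsub_quasi_iso[OF S homc_complexes[OF R.stalk_complexes[OF Jm]] L.stalk_complexes[OF homf_modules[OF Jm]] homc_stalk[OF Jm]] by blast
      then show "stalk J \<in> S'" using R.stalk_complexes[OF Jm] by (simp add: S'_def)
    qed
    have "locsub b R S'"
    proof (rule R.locsubI)
      show "S' \<subseteq> complexes R" by (auto simp: S'_def)
      show "S' \<noteq> {}" using stalks GR(1) by blast
      show "X \<in> S' \<longleftrightarrow> Y \<in> S'" if "X \<in> complexes R" "Y \<in> complexes R" "f \<in> quasi_isos R X Y" for X Y f
        using L.locsub_quasi_iso[OF S homc_complexes homc_complexes homc_map_quasi_iso] that by (auto simp: S'_def)
      show "X \<in> S' \<longleftrightarrow> shift X \<in> S'" if X: "X \<in> complexes R" for X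
        using L.locsub_shift[OF S homc_complexes[OF X]] X R.shift_complexes[OF X]
          L.locsub_quasi_iso[OF S homc_complexes[OF R.shift_complexes[OF X]] L.shift_complexes[OF homc_complexes[OF X]] homc_shift[OF X]]
        by (auto simp: S'_def)
      show "cone X Y f \<in> S'" if "X \<in> S'" "Y \<in> S'" and f: "f \<in> chain_maps R X Y" for X Y f
      proof -
        have X: "X \<in> complexes R" "homc R Q X \<in> S" and Y: "Y \<in> complexes R" "homc R Q Y \<in> S" using that by (auto simp: S'_def)
        note C = R.cone_complexes[OF X(1) Y(1) f] and Hf = homc_map_cm[OF X(1) Y(1) f]
        have "cone (homc R Q X) (homc R Q Y) (homc_map Q f) \<in> S" by (rule L.locsub_cone[OF S X(2) Y(2) Hf])
        then have "homc R Q (cone X Y f) \<in> S"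
          using L.locsub_quasi_iso[OF S homc_complexes[OF C] _ homc_cone[OF X(1) Y(1) f]] L.locsub_complexes[OF S] by blast
        then show ?thesis using C by (simp add: S'_def)
      qed
      show "cprod b I X \<in> S'" if I: "small I" and X: "\<And>i. i \<in> I \<Longrightarrow> X i \<in> S'" for I :: "'u set" and X
      proof -
        have Xc: "X i \<in> complexes R" and HX: "homc R Q (X i) \<in> S" if "i \<in> I" for i using X[OF that] by (auto simp: S'_def)
        have C: "cprod b I X \<in> complexes R" by (rule R.cprod_complexes[OF I Xc])
        have D: "cprod b I (\<lambda>i. homc R Q (X i)) \<in> S" by (rule L.locsub_cprod[OF S I HX])
        have "(\<lambda>n u. pk (\<lambda>i\<in>I. homf_map Q (\<lambda>v. up v i) u)) \<in> quasi_isos L (homc R Q (cprod b I X)) (cprod b I (\<lambda>i. homc R Q (X i)))"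
          by (rule homc_cprod[OF I Xc])
        from L.locsub_quasi_iso[OF S homc_complexes[OF C] L.locsub_complexes[OF S D] this] D
        show ?thesis using C by (simp add: S'_def)
      qed
    qed
    then have "complexes R \<subseteq> S'" using gen stalks unfolding generates_def by blast
    \<comment> \<open>Generation over R puts every complex over R into the preimage, so all values
      of the functor lie in S; the retraction then gives the remaining complexes over L.\<close>
    then have H: "homc R Q Z \<in> S" if "Z \<in> complexes R" for Z using that by (auto simp: S'_def)
    show ?thesis
    proof
      fix X assume X: "X \<in> complexes L"
      then obtain Z i r where "Z \<in> complexes R" "i \<in> chain_maps L X (homc R Q Z)" "r \<in> chain_maps L (homc R Q Z) X"
        "\<forall>n. \<forall>x\<in>carrier (obj X n). r n (i n x) = x" using retract by blast
      then show "X \<in> S" using L.locsub_retract[OF S H X] by blast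
    qed
  qed
  moreover have "stalk ` GL \<subseteq> complexes L" using GL L.stalk_complexes by blast
  ultimately show ?thesis unfolding generates_def using L.complexes_locsub[of b] by blast
qed

section \<open>Dual bimodules and their dual bases\<close>

lemma (in abelian_group) finsum_swap:
  assumes "finite I" "finite J" "\<And>i j. i \<in> I \<Longrightarrow> j \<in> J \<Longrightarrow> f i j \<in> carrier G"
  shows "(\<Oplus>i\<in>I. \<Oplus>j\<in>J. f i j) = (\<Oplus>j\<in>J. \<Oplus>i\<in>I. f i j)"
  using assms(1,3)
proof (induction I rule: finite_induct)
  case empty
  then show ?case by (simp add: finsum_zero)
next
  case (insert i I)
  have "(\<Oplus>i\<in>insert i I. \<Oplus>j\<in>J. f i j) = (\<Oplus>j\<in>J. f i j) \<oplus> (\<Oplus>j\<in>J. \<Oplus>i\<in>I. f i j)"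
    using insert by (simp add: finsum_closed Pi_iff)
  also have "\<dots> = (\<Oplus>j\<in>J. f i j \<oplus> (\<Oplus>i\<in>I. f i j))"
    using insert.prems by (intro finsum_addf[symmetric]) (auto intro!: finsum_closed)
  also have "\<dots> = (\<Oplus>j\<in>J. \<Oplus>i\<in>insert i I. f i j)"
    using insert by (intro finsum_cong') (auto intro!: finsum_closed a_closed)
  finally show ?case .
qed

text \<open>Left modules are right modules over the opposite ring, so exchanging the sides makes the
  left structure of P accessible to \<open>homf\<close>.\<close>

definition swapb :: "('u, 'u, 'u) bimodule \<Rightarrow> ('u, 'u, 'u) bimodule"
  where "swapb P = P\<lparr>smult := lsmult P, lsmult := smult P\<rparr>"

lemma swapb_simps [simp]:
  "carrier (swapb P) = carrier P" "ring.add (swapb P) = ring.add P" "\<zero>\<^bsub>swapb P\<^esub> = \<zero>\<^bsub>P\<^esub>"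
  "smult (swapb P) = lsmult P" "lsmult (swapb P) = smult P"
  "right_part (swapb P) = left_part P" "left_part (swapb P) = right_part P"
  by (simp_all add: swapb_def right_part_def left_part_def)

lemma opposite_opposite [simp]: "opposite (opposite R) = R"
  by (simp add: opposite_def)

text \<open>The dual \<open>Hom\<^sub>L(P, L)\<close> of the left module \<open>\<^sub>LP\<close>, an \<open>(R, L)\<close>-bimodule.\<close>

definition dualb :: "'u ring \<Rightarrow> ('u, 'u, 'u) bimodule \<Rightarrow> ('u, 'u, 'u) bimodule"
  where "dualb L P = (let H = homf (opposite L) (swapb P) (right_part (regular_bimodule (opposite L))) in
    \<lparr>carrier = carrier H, monoid.mult = monoid.mult H, monoid.one = \<one>\<^bsub>H\<^esub>, ring.zero = \<zero>\<^bsub>H\<^esub>, ring.add = ring.add H,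
     smult = (\<lambda>l \<xi>. homf_map P (\<lambda>x. x \<otimes>\<^bsub>L\<^esub> l) \<xi>), lsmult = smult H\<rparr>)"

lemma left_part_dualb: "left_part (dualb L P) = homf (opposite L) (swapb P) (right_part (regular_bimodule (opposite L)))"
  by (simp add: dualb_def Let_def left_part_def homf_def)

lemma (in ring_universe) opposite_universe: "ring_universe (opposite A)"
proof -
  interpret A: ring A by (rule ring_A)
  have g: "abelian_group (opposite A)"
    using abelian_groupE[OF A.abelian_group_axioms] by (intro abelian_groupI; simp)
  have "ring (opposite A)"
    by (rule ringI[OF g]) (auto simp: A.l_distr A.r_distr A.m_assoc intro!: monoidI)
  then show ?thesis
    using ring_universe_axioms by (auto simp: ring_universe_def ring_universe_axioms_def)
qed

text \<open>Here \<open>P\<close> is finitely generated projective on the left. Hom over L out of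
  its dual D then plays the role of tensoring with P over L, that is, of the left adjoint of Hom
  over R out of P; see \<open>adjunction\<close>.\<close>

locale dual_bimod = bimod L R P for L R :: "'u ring" and P +
  fixes J :: "'u set" and e :: "'u \<Rightarrow> 'u" and c :: "'u \<Rightarrow> 'u \<Rightarrow> 'u"
  assumes left_dual_basis: "dual_basis (opposite L) (left_part P) J e c"
begin

abbreviation "D \<equiv> dualb L P"
abbreviation "regL \<equiv> right_part (regular_bimodule (opposite L))"

sublocale O: ring_universe "opposite L" by (rule L.opposite_universe)

sublocale S: bimod "opposite R" "opposite L" "swapb P"
  using bimodule small_Q L.opposite_universe R.opposite_universe
  by (auto simp: bimod_def bimod_axioms_def is_bimodule_def)

abbreviation "lhom \<equiv> rmod_hom (opposite L) (left_part P) (regular_bimodule (opposite L))"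

lemma lhomI:
  assumes "\<And>p. p \<in> carrier P \<Longrightarrow> \<xi> p \<in> carrier L"
    "\<And>p q. p \<in> carrier P \<Longrightarrow> q \<in> carrier P \<Longrightarrow> \<xi> (p \<oplus>\<^bsub>P\<^esub> q) = \<xi> p \<oplus>\<^bsub>L\<^esub> \<xi> q"
    "\<And>l p. l \<in> carrier L \<Longrightarrow> p \<in> carrier P \<Longrightarrow> \<xi> (lsmult P l p) = l \<otimes>\<^bsub>L\<^esub> \<xi> p"
  shows "\<xi> \<in> lhom"
  using assms by (intro rmod_homI) auto

lemma lhom_swapb: "rmod_hom (opposite L) (swapb P) (regular_bimodule (opposite L)) = lhom"
  by (simp add: rmod_hom_def)

lemma
  assumes "\<xi> \<in> carrier D"
  shows D_H: "\<xi> \<in> carrier (homf (opposite L) (swapb P) regL)"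
    and D_closed: "p \<in> carrier P \<Longrightarrow> up \<xi> p \<in> carrier L"
    and D_add: "p \<in> carrier P \<Longrightarrow> q \<in> carrier P \<Longrightarrow> up \<xi> (p \<oplus>\<^bsub>P\<^esub> q) = up \<xi> p \<oplus>\<^bsub>L\<^esub> up \<xi> q"
    and D_lsmult: "l \<in> carrier L \<Longrightarrow> p \<in> carrier P \<Longrightarrow> up \<xi> (lsmult P l p) = l \<otimes>\<^bsub>L\<^esub> up \<xi> p"
    and D_hom: "up \<xi> \<in> lhom"
proof -
  show 1: "\<xi> \<in> carrier (homf (opposite L) (swapb P) regL)" using assms by (simp add: dualb_def Let_def)
  show h: "up \<xi> \<in> lhom" using S.homf_cases(1)[OF 1] by (simp add: lhom_swapb)
  show "p \<in> carrier P \<Longrightarrow> up \<xi> p \<in> carrier L" using hom_closed[OF h] by simp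
  show "p \<in> carrier P \<Longrightarrow> q \<in> carrier P \<Longrightarrow> up \<xi> (p \<oplus>\<^bsub>P\<^esub> q) = up \<xi> p \<oplus>\<^bsub>L\<^esub> up \<xi> q" using hom_add[OF h] by simp
  show "l \<in> carrier L \<Longrightarrow> p \<in> carrier P \<Longrightarrow> up \<xi> (lsmult P l p) = l \<otimes>\<^bsub>L\<^esub> up \<xi> p" using hom_smult[OF h] by simp
qed

lemma D_in: "pk (restrict \<xi> (carrier P)) \<in> carrier D \<longleftrightarrow> \<xi> \<in> lhom"
  using S.homf_in[of \<xi> regL] by (simp add: dualb_def Let_def lhom_swapb)

lemma D_ext: "\<xi> \<in> carrier D \<Longrightarrow> \<zeta> \<in> carrier D \<Longrightarrow> (\<And>p. p \<in> carrier P \<Longrightarrow> up \<xi> p = up \<zeta> p) \<Longrightarrow> \<xi> = \<zeta>"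
  using S.homf_ext[of \<xi> regL \<zeta>] by (simp add: dualb_def Let_def)

lemma up_D:
  assumes "p \<in> carrier P"
  shows "up \<zero>\<^bsub>D\<^esub> p = \<zero>\<^bsub>L\<^esub>" "up (\<xi> \<oplus>\<^bsub>D\<^esub> \<zeta>) p = up \<xi> p \<oplus>\<^bsub>L\<^esub> up \<zeta> p"
    "up (l \<odot>\<^bsub>D\<^esub> \<xi>) p = up \<xi> p \<otimes>\<^bsub>L\<^esub> l" "up (lsmult D r \<xi>) p = up \<xi> (r \<odot>\<^bsub>P\<^esub> p)"
    "up (pk (restrict \<phi> (carrier P))) p = \<phi> p"
  using assms S.up_homf(1,2,3)[of p regL] up_homf(4,5)[of p]
  by (simp_all add: dualb_def Let_def)

lemma D_bimodule: "is_bimodule R L D"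
proof -
  interpret L: ring L by (rule L.ring_A)
  have H: "left_part D \<in> modules (opposite R)"
    unfolding left_part_dualb by (rule S.homf_modules[OF O.regular_modules])
  have g: "abelian_group (left_part D)" using H by (simp add: modules_def right_module_def)
  have g': "abelian_group (right_part D)"
    using abelian_groupE[OF g] by (intro abelian_groupI) simp_all
  have cl: "l \<odot>\<^bsub>D\<^esub> \<xi> \<in> carrier D" if "l \<in> carrier L" "\<xi> \<in> carrier D" for l \<xi>
  proof -
    have "l \<odot>\<^bsub>D\<^esub> \<xi> = pk (\<lambda>p\<in>carrier P. up \<xi> p \<otimes>\<^bsub>L\<^esub> l)" by (simp add: dualb_def Let_def homf_map_def)
    moreover have "(\<lambda>p. up \<xi> p \<otimes>\<^bsub>L\<^esub> l) \<in> lhom"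
      using that by (intro lhomI) (auto simp: D_closed D_add D_lsmult L.l_distr L.m_assoc)
    ultimately show ?thesis by (simp add: D_in)
  qed
  have clb: "lsmult D r \<xi> \<in> carrier D" if "r \<in> carrier R" "\<xi> \<in> carrier D" for r \<xi>
    using right_module.smult_closed[of "opposite R" "left_part D" r \<xi>] H that by (simp add: modules_def)
  have cla: "\<xi> \<oplus>\<^bsub>D\<^esub> \<zeta> \<in> carrier D" if "\<xi> \<in> carrier D" "\<zeta> \<in> carrier D" for \<xi> \<zeta>
    using abelian_groupE(1)[OF g'] that by simp
  have "right_part D \<in> modules L"
  proof (rule L.modulesI[OF g'])
    show "small (carrier (right_part D))" using H by (simp add: modules_def)
    fix l l' \<xi> assume "l \<in> carrier L" "l' \<in> carrier L" "\<xi> \<in> carrier (right_part D)"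
    then have *: "l \<in> carrier L" "l' \<in> carrier L" "\<xi> \<in> carrier D" by simp_all
    show "(l \<oplus>\<^bsub>L\<^esub> l') \<odot>\<^bsub>right_part D\<^esub> \<xi> = l \<odot>\<^bsub>right_part D\<^esub> \<xi> \<oplus>\<^bsub>right_part D\<^esub> l' \<odot>\<^bsub>right_part D\<^esub> \<xi>"
      unfolding part_simps by (rule D_ext) (use * in \<open>auto intro!: cl cla simp: up_D D_closed L.r_distr\<close>)
    show "(l \<otimes>\<^bsub>L\<^esub> l') \<odot>\<^bsub>right_part D\<^esub> \<xi> = l' \<odot>\<^bsub>right_part D\<^esub> (l \<odot>\<^bsub>right_part D\<^esub> \<xi>)"
      unfolding part_simps by (rule D_ext) (use * in \<open>auto intro!: cl cla simp: up_D D_closed L.m_assoc\<close>)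
  next
    fix l \<xi> \<zeta> assume "l \<in> carrier L" "\<xi> \<in> carrier (right_part D)" "\<zeta> \<in> carrier (right_part D)"
    then have *: "l \<in> carrier L" "\<xi> \<in> carrier D" "\<zeta> \<in> carrier D" by simp_all
    show "l \<odot>\<^bsub>right_part D\<^esub> (\<xi> \<oplus>\<^bsub>right_part D\<^esub> \<zeta>) = l \<odot>\<^bsub>right_part D\<^esub> \<xi> \<oplus>\<^bsub>right_part D\<^esub> l \<odot>\<^bsub>right_part D\<^esub> \<zeta>"
      unfolding part_simps by (rule D_ext) (use * in \<open>auto intro!: cl cla simp: up_D D_closed L.l_distr\<close>)
    show "l \<odot>\<^bsub>right_part D\<^esub> \<xi> \<in> carrier (right_part D)" using * cl by simp
  next
    fix \<xi> assume "\<xi> \<in> carrier (right_part D)"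
    then have *: "\<xi> \<in> carrier D" by simp
    show "\<one>\<^bsub>L\<^esub> \<odot>\<^bsub>right_part D\<^esub> \<xi> = \<xi>"
      unfolding part_simps by (rule D_ext) (use * in \<open>auto intro!: cl cla simp: up_D D_closed\<close>)
  qed
  moreover have "\<forall>r\<in>carrier R. \<forall>l\<in>carrier L. \<forall>\<xi>\<in>carrier D. l \<odot>\<^bsub>D\<^esub> lsmult D r \<xi> = lsmult D r (l \<odot>\<^bsub>D\<^esub> \<xi>)"
  proof (intro ballI)
    fix r l \<xi> assume "r \<in> carrier R" "l \<in> carrier L" "\<xi> \<in> carrier D"
    then show "l \<odot>\<^bsub>D\<^esub> lsmult D r \<xi> = lsmult D r (l \<odot>\<^bsub>D\<^esub> \<xi>)"
      using cl clb by (auto simp: up_D rsmult_closed intro: D_ext[of "l \<odot>\<^bsub>D\<^esub> lsmult D r \<xi>" "lsmult D r (l \<odot>\<^bsub>D\<^esub> \<xi>)"])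
  qed
  ultimately show ?thesis using H by (auto simp: is_bimodule_def modules_def)
qed

lemma D_small: "small (carrier D)"
proof -
  have "left_part D \<in> modules (opposite R)"
    unfolding left_part_dualb by (rule S.homf_modules[OF O.regular_modules])
  then show ?thesis by (simp add: modules_def)
qed

text \<open>The two halves of a dual basis exchange roles in the dual module: the functionals become
  the elements, and evaluation at the old elements becomes the coordinates.\<close>

abbreviation "e' j \<equiv> pk (restrict (c j) (carrier P))"
abbreviation "c' j \<xi> \<equiv> up \<xi> (e j)"

lemma finite_basis: "finite J"
  and basis_closed: "j \<in> J \<Longrightarrow> e j \<in> carrier P"
  and coord_lhom: "j \<in> J \<Longrightarrow> c j \<in> lhom"
  and basis_expand: "p \<in> carrier P \<Longrightarrow> p = (\<Oplus>\<^bsub>P\<^esub>j\<in>J. lsmult P (c j p) (e j))"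
  using left_dual_basis by (simp_all add: dual_basis_def)

lemma coord_closed: "j \<in> J \<Longrightarrow> p \<in> carrier P \<Longrightarrow> c j p \<in> carrier L"
  using hom_closed[OF coord_lhom] by simp

lemma e'_closed: "j \<in> J \<Longrightarrow> e' j \<in> carrier D"
  by (simp add: D_in coord_lhom)

sublocale D: bimod R L D
  using D_bimodule D_small R.ring_universe_axioms L.ring_universe_axioms by (simp add: bimod_def bimod_axioms_def)

text \<open>Applying \<open>\<xi>\<close> to the expansion of p gives the sum of
  \<open>c j p\<close> times the value of \<open>\<xi>\<close> at \<open>e j\<close>, and this is
  the value at p of the claimed expansion of \<open>\<xi>\<close>.\<close>

sublocale D: fgp_bimod R L D J e' c'
proof (unfold_locales, unfold dual_basis_def, intro conjI ballI)
  show "finite J" by (rule finite_basis)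
  fix j assume j: "j \<in> J"
  show "e' j \<in> carrier D" using j by (rule e'_closed)
  show "c' j \<in> rmod_hom L D (right_part (regular_bimodule L))"
    by (rule rmod_homI) (use j basis_closed in \<open>auto simp: D_closed up_D\<close>)
next
  fix \<xi> assume \<xi>: "\<xi> \<in> carrier D"
  let ?RL = "regular_bimodule L"
  interpret RL: abelian_group ?RL by (rule L.regular_group)
  have cl: "c' j \<xi> \<odot>\<^bsub>D\<^esub> e' j \<in> carrier D" if "j \<in> J" for j
    by (intro D.rsmult_closed e'_closed D_closed \<xi> basis_closed that)
  have scl: "(\<Oplus>\<^bsub>D\<^esub>j\<in>J. c' j \<xi> \<odot>\<^bsub>D\<^esub> e' j) \<in> carrier D"
    using cl by (intro abelian_monoid.finsum_closed abelian_group.axioms(1) D.Q_group) auto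
  show "\<xi> = (\<Oplus>\<^bsub>D\<^esub>j\<in>J. c' j \<xi> \<odot>\<^bsub>D\<^esub> e' j)"
  proof (rule D_ext[OF \<xi> scl])
    fix p assume p: "p \<in> carrier P"
    have h: "(\<lambda>\<xi>. up \<xi> p) \<in> rmod_hom (L\<lparr>carrier := {}\<rparr>) D ?RL"
      by (rule rmod_homI) (auto simp: p D_closed up_D)
    have "up (\<Oplus>\<^bsub>D\<^esub>j\<in>J. c' j \<xi> \<odot>\<^bsub>D\<^esub> e' j) p = (\<Oplus>\<^bsub>?RL\<^esub>j\<in>J. up (c' j \<xi> \<odot>\<^bsub>D\<^esub> e' j) p)"
      by (rule L.hom_finsum[OF h D.Q_group L.regular_group finite_basis]) (use cl in auto)
    also have "\<dots> = (\<Oplus>\<^bsub>?RL\<^esub>j\<in>J. up \<xi> (lsmult P (c j p) (e j)))"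
      by (rule RL.finsum_cong') (use p \<xi> in \<open>auto simp: up_D D_lsmult coord_closed basis_closed D_closed intro!: monoid.m_closed[OF ring.is_monoid[OF L.ring_A]]\<close>)
    also have "\<dots> = up \<xi> (\<Oplus>\<^bsub>P\<^esub>j\<in>J. lsmult P (c j p) (e j))"
    proof (rule L.hom_finsum[symmetric, OF _ Q_group L.regular_group finite_basis])
      show "up \<xi> \<in> rmod_hom (L\<lparr>carrier := {}\<rparr>) P ?RL" by (rule rmod_homI) (auto simp: \<xi> D_closed D_add)
    qed (use p in \<open>auto intro: lsmult_closed coord_closed basis_closed\<close>)
    also have "\<dots> = up \<xi> p" using basis_expand[OF p] by simp
    finally show "up \<xi> p = up (\<Oplus>\<^bsub>D\<^esub>j\<in>J. c' j \<xi> \<odot>\<^bsub>D\<^esub> e' j) p" by simp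
  qed
qed

end

text \<open>An adjunction between module categories with L on the left, given by raw functions. The
  composition laws hold without typing conditions; the congruence laws express that only the values
  of a map on the carrier matter.\<close>

locale adjoint_functors =
  fixes A B :: "'u ring" and L R :: "('u, 'u) module \<Rightarrow> ('u, 'u) module"
    and Lm Rm :: "('u \<Rightarrow> 'u) \<Rightarrow> 'u \<Rightarrow> 'u" and \<eta> \<epsilon> :: "('u, 'u) module \<Rightarrow> 'u \<Rightarrow> 'u"
  assumes L_mod: "X \<in> modules A \<Longrightarrow> L X \<in> modules B"
    and R_mod: "X \<in> modules B \<Longrightarrow> R X \<in> modules A"
    and L_hom: "X \<in> modules A \<Longrightarrow> Y \<in> modules A \<Longrightarrow> f \<in> rmod_hom A X Y \<Longrightarrow> Lm f \<in> rmod_hom B (L X) (L Y)"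
    and R_hom: "X \<in> modules B \<Longrightarrow> Y \<in> modules B \<Longrightarrow> f \<in> rmod_hom B X Y \<Longrightarrow> Rm f \<in> rmod_hom A (R X) (R Y)"
    and L_comp: "Lm g (Lm f u) = Lm (\<lambda>x. g (f x)) u"
    and R_comp: "Rm g (Rm f u) = Rm (\<lambda>x. g (f x)) u"
    and L_cong: "X \<in> modules A \<Longrightarrow> (\<And>x. x \<in> carrier X \<Longrightarrow> f x = g x) \<Longrightarrow> u \<in> carrier (L X) \<Longrightarrow> Lm f u = Lm g u"
    and R_cong: "Y \<in> modules B \<Longrightarrow> (\<And>x. x \<in> carrier Y \<Longrightarrow> f x = g x) \<Longrightarrow> u \<in> carrier (R Y) \<Longrightarrow> Rm f u = Rm g u"
    and unit_hom: "X \<in> modules A \<Longrightarrow> \<eta> X \<in> rmod_hom A X (R (L X))"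
    and counit_hom: "Y \<in> modules B \<Longrightarrow> \<epsilon> Y \<in> rmod_hom B (L (R Y)) Y"
    and unit_natural: "X \<in> modules A \<Longrightarrow> Y \<in> modules A \<Longrightarrow> f \<in> rmod_hom A X Y \<Longrightarrow> x \<in> carrier X \<Longrightarrow>
      Rm (Lm f) (\<eta> X x) = \<eta> Y (f x)"
    and counit_natural: "X \<in> modules B \<Longrightarrow> Y \<in> modules B \<Longrightarrow> f \<in> rmod_hom B X Y \<Longrightarrow> u \<in> carrier (L (R X)) \<Longrightarrow>
      f (\<epsilon> X u) = \<epsilon> Y (Lm (Rm f) u)"
    and triangle_right: "Y \<in> modules B \<Longrightarrow> u \<in> carrier (R Y) \<Longrightarrow> Rm (\<epsilon> Y) (\<eta> (R Y) u) = u"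
    and triangle_left: "X \<in> modules A \<Longrightarrow> u \<in> carrier (L X) \<Longrightarrow> \<epsilon> (L X) (Lm (\<eta> X) u) = u"
begin

text \<open>The map f is transposed to a map from L X to J, extended along the injective L i, and
  transposed back.\<close>

lemma right_adjoint_preserves_injective:
  assumes mono: "\<And>X Y i. X \<in> modules A \<Longrightarrow> Y \<in> modules A \<Longrightarrow> i \<in> rmod_hom A X Y \<Longrightarrow> inj_on i (carrier X) \<Longrightarrow> inj_on (Lm i) (carrier (L X))"
    and J: "injective_module B J"
  shows "injective_module A (R J)"
  unfolding injective_module_def
proof (intro conjI ballI impI)
  have Jm: "J \<in> modules B" using J by (simp add: injective_module_def)
  show "R J \<in> modules A" by (rule R_mod[OF Jm])
  fix X Y i f assume X: "X \<in> modules A" and Y: "Y \<in> modules A" and i: "i \<in> rmod_hom A X Y" and f: "f \<in> rmod_hom A X (R J)"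
    and inj: "inj_on i (carrier X)"
  have Lf: "(\<lambda>u. \<epsilon> J (Lm f u)) \<in> rmod_hom B (L X) J"
    by (rule hom_comp[OF L_hom[OF X R_mod[OF Jm] f] counit_hom[OF Jm]])
  then obtain g where g: "g \<in> rmod_hom B (L Y) J" and gi: "\<And>u. u \<in> carrier (L X) \<Longrightarrow> g (Lm i u) = \<epsilon> J (Lm f u)"
    using J L_mod[OF X] L_mod[OF Y] L_hom[OF X Y i] mono[OF X Y i inj] unfolding injective_module_def by metis
  show "\<exists>g\<in>rmod_hom A Y (R J). \<forall>x\<in>carrier X. g (i x) = f x"
  proof (rule bexI[where x = "\<lambda>y. Rm g (\<eta> Y y)"], rule ballI)
    show "(\<lambda>y. Rm g (\<eta> Y y)) \<in> rmod_hom A Y (R J)" by (rule hom_comp[OF unit_hom[OF Y] R_hom[OF L_mod[OF Y] Jm g]])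
    fix x assume x: "x \<in> carrier X"
    note ux = hom_closed[OF unit_hom[OF X] x]
    have "Rm g (\<eta> Y (i x)) = Rm (\<lambda>u. g (Lm i u)) (\<eta> X x)"
      by (simp add: unit_natural[OF X Y i x, symmetric] R_comp)
    also have "\<dots> = Rm (\<lambda>u. \<epsilon> J (Lm f u)) (\<eta> X x)" by (rule R_cong[OF L_mod[OF X] gi ux])
    also have "\<dots> = Rm (\<epsilon> J) (\<eta> (R J) (f x))"
      by (simp add: unit_natural[OF X R_mod[OF Jm] f x, symmetric] R_comp)
    also have "\<dots> = f x" by (rule triangle_right[OF Jm hom_closed[OF f x]])
    finally show "Rm g (\<eta> Y (i x)) = f x" .
  qed
qed

text \<open>The map f is transposed to a map from F to R Y, lifted along the surjective R p, and
  transposed back.\<close>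

lemma left_adjoint_preserves_projective:
  assumes epi: "\<And>X Y p. X \<in> modules B \<Longrightarrow> Y \<in> modules B \<Longrightarrow> p \<in> rmod_hom B X Y \<Longrightarrow> p ` carrier X = carrier Y \<Longrightarrow> Rm p ` carrier (R X) = carrier (R Y)"
    and F: "projective_module A F"
  shows "projective_module B (L F)"
  unfolding projective_module_def
proof (intro conjI ballI impI)
  have Fm: "F \<in> modules A" using F by (simp add: projective_module_def)
  show "L F \<in> modules B" by (rule L_mod[OF Fm])
  fix X Y p f assume X: "X \<in> modules B" and Y: "Y \<in> modules B" and p: "p \<in> rmod_hom B X Y" and f: "f \<in> rmod_hom B (L F) Y"
    and surj: "p ` carrier X = carrier Y"
  have Rf: "(\<lambda>x. Rm f (\<eta> F x)) \<in> rmod_hom A F (R Y)"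
    by (rule hom_comp[OF unit_hom[OF Fm] R_hom[OF L_mod[OF Fm] Y f]])
  then obtain g where g: "g \<in> rmod_hom A F (R X)" and pg: "\<And>x. x \<in> carrier F \<Longrightarrow> Rm p (g x) = Rm f (\<eta> F x)"
    using F R_mod[OF X] R_mod[OF Y] R_hom[OF X Y p] epi[OF X Y p surj] unfolding projective_module_def by metis
  show "\<exists>g\<in>rmod_hom B (L F) X. \<forall>x\<in>carrier (L F). p (g x) = f x"
  proof (rule bexI[where x = "\<lambda>u. \<epsilon> X (Lm g u)"], rule ballI)
    show "(\<lambda>u. \<epsilon> X (Lm g u)) \<in> rmod_hom B (L F) X" by (rule hom_comp[OF L_hom[OF Fm R_mod[OF X] g] counit_hom[OF X]])
    fix u assume u: "u \<in> carrier (L F)"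
    have "p (\<epsilon> X (Lm g u)) = \<epsilon> Y (Lm (\<lambda>x. Rm p (g x)) u)"
      by (simp add: counit_natural[OF X Y p hom_closed[OF L_hom[OF Fm R_mod[OF X] g] u]] L_comp)
    also have "Lm (\<lambda>x. Rm p (g x)) u = Lm (\<lambda>x. Rm f (\<eta> F x)) u" by (rule L_cong[OF Fm pg u])
    also have "\<epsilon> Y \<dots> = f (\<epsilon> (L F) (Lm (\<eta> F) u))"
      by (simp add: counit_natural[OF L_mod[OF Fm] Y f hom_closed[OF L_hom[OF Fm R_mod[OF L_mod[OF Fm]] unit_hom[OF Fm]] u]] L_comp)
    also have "\<dots> = f u" by (simp add: triangle_left[OF Fm u])
    finally show "p (\<epsilon> X (Lm g u)) = f u" .
  qed
qed

end

lemma adjoint_functors_comp: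
  assumes "adjoint_functors A B L R Lm Rm \<eta> \<epsilon>" and "adjoint_functors B C L' R' Lm' Rm' \<eta>' \<epsilon>'"
  shows "adjoint_functors A C (\<lambda>X. L' (L X)) (\<lambda>Y. R (R' Y)) (\<lambda>f. Lm' (Lm f)) (\<lambda>f. Rm (Rm' f))
    (\<lambda>X x. Rm (\<eta>' (L X)) (\<eta> X x)) (\<lambda>Y u. \<epsilon>' Y (Lm' (\<epsilon> (R' Y)) u))"
proof -
  interpret F: adjoint_functors A B L R Lm Rm \<eta> \<epsilon> by fact
  interpret G: adjoint_functors B C L' R' Lm' Rm' \<eta>' \<epsilon>' by fact
  have Lcong: "Lm' (Lm f) u = Lm' (Lm g) u" if "X \<in> modules A" "\<And>x. x \<in> carrier X \<Longrightarrow> f x = g x" "u \<in> carrier (L' (L X))" for X f g u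
    by (rule G.L_cong[OF F.L_mod[OF that(1)] F.L_cong[OF that(1,2)] that(3)])
  have Rcong: "Rm (Rm' f) u = Rm (Rm' g) u" if "X \<in> modules C" "\<And>x. x \<in> carrier X \<Longrightarrow> f x = g x" "u \<in> carrier (R (R' X))" for X f g u
    by (rule F.R_cong[OF G.R_mod[OF that(1)] G.R_cong[OF that(1,2)] that(3)])
  note [simp] = F.L_mod F.R_mod G.L_mod G.R_mod
  have Lc: "Lm' (Lm g) (Lm' (Lm f) u) = Lm' (Lm (\<lambda>x. g (f x))) u" for g f u
    by (simp add: G.L_comp F.L_comp)
  have Rc: "Rm (Rm' g) (Rm (Rm' f) u) = Rm (Rm' (\<lambda>x. g (f x))) u" for g f u
    by (simp add: G.R_comp F.R_comp)
  show ?thesis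
  proof (unfold_locales, goal_cases)
    case (5 g f u) then show ?case by (rule Lc)
  next
    case (6 g f u) then show ?case by (rule Rc)
  next
    case (7 X f g u) then show ?case by (rule Lcong)
  next
    case (8 Y f g u) then show ?case by (rule Rcong)
  next
    case (9 X) then show ?case
      by (intro hom_comp[OF F.unit_hom] F.R_hom G.unit_hom) auto
  next
    case (10 Y) then show ?case
      by (intro hom_comp[OF _ G.counit_hom] G.L_hom F.counit_hom) auto
  next
    case (11 X Y f x)
    have "Rm (Rm' (Lm' (Lm f))) (Rm (\<eta>' (L X)) (\<eta> X x)) = Rm (\<lambda>v. Rm' (Lm' (Lm f)) (\<eta>' (L X) v)) (\<eta> X x)"
      by (rule F.R_comp)
    also have "\<dots> = Rm (\<lambda>v. \<eta>' (L Y) (Lm f v)) (\<eta> X x)"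
      by (rule F.R_cong[OF F.L_mod[OF 11(1)] G.unit_natural[OF _ _ F.L_hom] hom_closed[OF F.unit_hom]]) (use 11 in auto)
    also have "\<dots> = Rm (\<eta>' (L Y)) (\<eta> Y (f x))"
      by (simp add: F.unit_natural[OF 11, symmetric] F.R_comp)
    finally show ?case .
  next
    case (12 X Y f u)
    have "f (\<epsilon>' X (Lm' (\<epsilon> (R' X)) u)) = \<epsilon>' Y (Lm' (Rm' f) (Lm' (\<epsilon> (R' X)) u))"
      by (rule G.counit_natural[OF 12(1-3) hom_closed[OF G.L_hom[OF _ _ F.counit_hom]]]) (use 12 in auto)
    also have "\<dots> = \<epsilon>' Y (Lm' (\<lambda>v. Rm' f (\<epsilon> (R' X) v)) u)" by (simp add: G.L_comp)
    also have "Lm' (\<lambda>v. Rm' f (\<epsilon> (R' X) v)) u = Lm' (\<lambda>v. \<epsilon> (R' Y) (Lm (Rm (Rm' f)) v)) u"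
      by (rule G.L_cong[OF F.L_mod[OF F.R_mod[OF G.R_mod[OF 12(1)]]] F.counit_natural[OF _ _ G.R_hom]]) (use 12 in auto)
    finally show ?case by (simp add: G.L_comp)
  next
    case (13 Y u)
    have "Rm (Rm' (\<lambda>u. \<epsilon>' Y (Lm' (\<epsilon> (R' Y)) u))) (Rm (\<eta>' (L (R (R' Y)))) (\<eta> (R (R' Y)) u))
      = Rm (\<lambda>v. Rm' (\<epsilon>' Y) (Rm' (Lm' (\<epsilon> (R' Y))) (\<eta>' (L (R (R' Y))) v))) (\<eta> (R (R' Y)) u)"
      by (simp add: F.R_comp G.R_comp)
    also have "\<dots> = Rm (\<epsilon> (R' Y)) (\<eta> (R (R' Y)) u)"
    proof (rule F.R_cong[OF F.L_mod[OF F.R_mod[OF G.R_mod[OF 13(1)]]] _ hom_closed[OF F.unit_hom]])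
      fix v assume v: "v \<in> carrier (L (R (R' Y)))"
      have "Rm' (Lm' (\<epsilon> (R' Y))) (\<eta>' (L (R (R' Y))) v) = \<eta>' (R' Y) (\<epsilon> (R' Y) v)"
        by (rule G.unit_natural[OF _ _ F.counit_hom v]) (use 13 in auto)
      then show "Rm' (\<epsilon>' Y) (Rm' (Lm' (\<epsilon> (R' Y))) (\<eta>' (L (R (R' Y))) v)) = \<epsilon> (R' Y) v"
        using G.triangle_right[OF 13(1) hom_closed[OF F.counit_hom v]] 13(1) by simp
    qed (use 13 in auto)
    also have "\<dots> = u" by (rule F.triangle_right) (use 13 in auto)
    finally show ?case .
  next
    case (14 X u)
    have "Lm' (\<epsilon> (R' (L' (L X)))) (Lm' (Lm (\<lambda>x. Rm (\<eta>' (L X)) (\<eta> X x))) u)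
      = Lm' (\<lambda>v. \<epsilon> (R' (L' (L X))) (Lm (Rm (\<eta>' (L X))) (Lm (\<eta> X) v))) u"
      by (simp add: G.L_comp F.L_comp)
    also have "\<dots> = Lm' (\<eta>' (L X)) u"
    proof (rule G.L_cong[OF F.L_mod[OF 14(1)] _ 14(2)])
      fix v assume v: "v \<in> carrier (L X)"
      have "\<epsilon> (R' (L' (L X))) (Lm (Rm (\<eta>' (L X))) (Lm (\<eta> X) v)) = \<eta>' (L X) (\<epsilon> (L X) (Lm (\<eta> X) v))"
        by (rule F.counit_natural[symmetric, OF _ _ G.unit_hom hom_closed[OF F.L_hom[OF _ _ F.unit_hom] v]]) (use 14 in auto)
      then show "\<epsilon> (R' (L' (L X))) (Lm (Rm (\<eta>' (L X))) (Lm (\<eta> X) v)) = \<eta>' (L X) v"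
        using F.triangle_left[OF 14(1) v] by simp
    qed
    finally show ?case using G.triangle_left[OF F.L_mod[OF 14(1)] 14(2)] by simp
  qed (auto intro: F.L_hom F.R_hom G.L_hom G.R_hom)
qed

text \<open>\<open>Tm\<close> is the action of \<open>T\<close> on maps. Naturality of both families
  permits termwise application to complexes (\<open>chain_retract\<close>) and the passage to
  mates.\<close>

definition natural_retract :: "'u ring \<Rightarrow> (('u, 'u) module \<Rightarrow> ('u, 'u) module) \<Rightarrow> (('u \<Rightarrow> 'u) \<Rightarrow> 'u \<Rightarrow> 'u) \<Rightarrow> bool"
  where "natural_retract B T Tm \<longleftrightarrow> (\<exists>i p.
    (\<forall>X\<in>modules B. i X \<in> rmod_hom B X (T X) \<and> p X \<in> rmod_hom B (T X) X \<and> (\<forall>x\<in>carrier X. p X (i X x) = x)) \<and>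
    (\<forall>X\<in>modules B. \<forall>Y\<in>modules B. \<forall>f\<in>rmod_hom B X Y.
      (\<forall>x\<in>carrier X. Tm f (i X x) = i Y (f x)) \<and> (\<forall>u\<in>carrier (T X). f (p X u) = p Y (Tm f u))))"

text \<open>Retractions of the identity transfer to the left adjoint by passing to mates.\<close>

lemma (in adjoint_functors) natural_retract_mates:
  assumes "natural_retract B (\<lambda>X. R X) Rm" and AB: "A = B"
  shows "natural_retract B (\<lambda>X. L X) Lm"
proof -
  obtain i p where
    *: "\<forall>X\<in>modules B. i X \<in> rmod_hom B X (R X) \<and> p X \<in> rmod_hom B (R X) X \<and> (\<forall>x\<in>carrier X. p X (i X x) = x)" and
    **: "\<forall>X\<in>modules B. \<forall>Y\<in>modules B. \<forall>f\<in>rmod_hom B X Y.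
      (\<forall>x\<in>carrier X. Rm f (i X x) = i Y (f x)) \<and> (\<forall>u\<in>carrier (R X). f (p X u) = p Y (Rm f u))"
    using assms(1) unfolding natural_retract_def by (elim exE conjE)
  have i: "i X \<in> rmod_hom B X (R X)" and p: "p X \<in> rmod_hom B (R X) X" if "X \<in> modules B" for X
    using * that by blast+
  have pi: "p X (i X x) = x" if "X \<in> modules B" "x \<in> carrier X" for X x using * that by blast
  have inat: "Rm f (i X x) = i Y (f x)" if "X \<in> modules B" "Y \<in> modules B" "f \<in> rmod_hom B X Y" "x \<in> carrier X" for X Y f x
    using ** that by blast
  have pnat: "f (p X u) = p Y (Rm f u)" if "X \<in> modules B" "Y \<in> modules B" "f \<in> rmod_hom B X Y" "u \<in> carrier (R X)" for X Y f u
    using ** that by blast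
  note Lmod = L_mod[unfolded AB] and Rmod = R_mod[unfolded AB] and Lhom = L_hom[unfolded AB] and Rhom = R_hom[unfolded AB]
    and uh = unit_hom[unfolded AB] and ch = counit_hom[unfolded AB] and un = unit_natural[unfolded AB] and cn = counit_natural[unfolded AB]
    and tr = triangle_right[unfolded AB] and Lcong = L_cong[unfolded AB]
  \<comment> \<open>Taking mates reverses the direction of a transformation, so the new section
    comes from the old retraction \<open>p\<close> and the new retraction from the old section
    \<open>i\<close>.\<close>
  define i' where "i' X x = p (L X) (\<eta> X x)" for X x
  define p' where "p' X u = \<epsilon> X (Lm (i X) u)" for X u
  have i': "i' X \<in> rmod_hom B X (L X)" and p': "p' X \<in> rmod_hom B (L X) X" if X: "X \<in> modules B" for X
  proof -
    show "i' X \<in> rmod_hom B X (L X)" unfolding i'_def[abs_def] by (rule hom_comp[OF uh[OF X] p[OF Lmod[OF X]]])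
    show "p' X \<in> rmod_hom B (L X) X" unfolding p'_def[abs_def] by (rule hom_comp[OF Lhom[OF X Rmod[OF X] i[OF X]] ch[OF X]])
  qed
  have "p' X (i' X x) = x" if X: "X \<in> modules B" and x: "x \<in> carrier X" for X x
  proof -
    \<comment> \<open>Naturality moves \<open>p\<close> outwards, first past the section and then
      past the counit, until the triangle identity for the unit at R X applies and \<open>p\<close>
      meets \<open>i\<close>.\<close>
    have "Lm (i X) (p (L X) (\<eta> X x)) = p (L (R X)) (Rm (Lm (i X)) (\<eta> X x))"
      by (rule pnat[OF Lmod[OF X] Lmod[OF Rmod[OF X]] Lhom[OF X Rmod[OF X] i[OF X]] hom_closed[OF uh[OF X] x]])
    also have "Rm (Lm (i X)) (\<eta> X x) = \<eta> (R X) (i X x)" by (rule un[OF X Rmod[OF X] i[OF X] x])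
    finally have "p' X (i' X x) = \<epsilon> X (p (L (R X)) (\<eta> (R X) (i X x)))" by (simp add: p'_def i'_def)
    also have "\<dots> = p X (Rm (\<epsilon> X) (\<eta> (R X) (i X x)))"
      by (rule pnat[OF Lmod[OF Rmod[OF X]] X ch[OF X] hom_closed[OF uh[OF Rmod[OF X]] hom_closed[OF i[OF X] x]]])
    also have "\<dots> = x" by (simp add: tr[OF X hom_closed[OF i[OF X] x]] pi[OF X x])
    finally show ?thesis .
  qed
  moreover have "Lm f (i' X x) = i' Y (f x)" if "X \<in> modules B" "Y \<in> modules B" "f \<in> rmod_hom B X Y" "x \<in> carrier X" for X Y f x
    unfolding i'_def pnat[OF Lmod[OF that(1)] Lmod[OF that(2)] Lhom[OF that(1-3)] hom_closed[OF uh[OF that(1)] that(4)]] un[OF that] ..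
  moreover have "f (p' X u) = p' Y (Lm f u)" if XY: "X \<in> modules B" "Y \<in> modules B" "f \<in> rmod_hom B X Y" and u: "u \<in> carrier (L X)" for X Y f u
  proof -
    have "f (p' X u) = \<epsilon> Y (Lm (\<lambda>x. Rm f (i X x)) u)"
      unfolding p'_def cn[OF XY hom_closed[OF Lhom[OF XY(1) Rmod[OF XY(1)] i[OF XY(1)]] u]] L_comp ..
    also have "Lm (\<lambda>x. Rm f (i X x)) u = Lm (\<lambda>x. i Y (f x)) u" by (rule Lcong[OF XY(1) inat[OF XY] u])
    finally show ?thesis by (simp add: p'_def L_comp)
  qed
  ultimately show ?thesis unfolding natural_retract_def using i' p'
    by (intro exI[of _ i'] exI[of _ p']) blast
qed

section \<open>The adjunction between Hom out of the dual and Hom out of the bimodule\<close>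

context dual_bimod
begin

text \<open>With Hom over L out of D read as the tensor product with P, this is the usual unit: x
  goes to the map that sends p to x tensor p.\<close>

definition unit :: "('u, 'u) module \<Rightarrow> 'u \<Rightarrow> 'u"
  where "unit X x = pk (\<lambda>p\<in>carrier P. pk (\<lambda>\<xi>\<in>carrier D. up \<xi> p \<odot>\<^bsub>X\<^esub> x))"

text \<open>An element \<open>\<psi>\<close> of Hom out of D stands for the sum of
  \<open>up \<psi> (e' j)\<close> tensor \<open>e j\<close>; the counit evaluates each first factor
  at the second.\<close>

definition counit :: "('u, 'u) module \<Rightarrow> 'u \<Rightarrow> 'u"
  where "counit Y \<psi> = (\<Oplus>\<^bsub>Y\<^esub>j\<in>J. up (up \<psi> (e' j)) (e j))"

lemma up_unit: "p \<in> carrier P \<Longrightarrow> \<xi> \<in> carrier D \<Longrightarrow> up (up (unit X x) p) \<xi> = up \<xi> p \<odot>\<^bsub>X\<^esub> x"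
  by (simp add: unit_def small_Q D_small)

lemma unit_closed:
  assumes X: "X \<in> modules L" and x: "x \<in> carrier X"
  shows "unit X x \<in> carrier (homf R P (homf L D X))"
proof -
  have 1: "pk (\<lambda>\<xi>\<in>carrier D. up \<xi> p \<odot>\<^bsub>X\<^esub> x) \<in> carrier (homf L D X)" if p: "p \<in> carrier P" for p
    unfolding D.homf_in
    by (rule rmod_homI) (use p x X in \<open>auto simp: up_D D_closed L.mod_smult L.mod_smult_l L.mod_smult_assoc\<close>)
  note m = D.homf_modules[OF X]
  show ?thesis
    unfolding unit_def homf_in
  proof (rule rmod_homI[OF 1])
    fix p assume p: "p \<in> carrier P"
    show "pk (\<lambda>\<xi>\<in>carrier D. up \<xi> (p \<oplus>\<^bsub>P\<^esub> q) \<odot>\<^bsub>X\<^esub> x) = pk (\<lambda>\<xi>\<in>carrier D. up \<xi> p \<odot>\<^bsub>X\<^esub> x) \<oplus>\<^bsub>homf L D X\<^esub> pk (\<lambda>\<xi>\<in>carrier D. up \<xi> q \<odot>\<^bsub>X\<^esub> x)"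
      if q: "q \<in> carrier P" for q
      by (rule D.homf_ext[OF 1[OF Q_add[OF p q]] R.mod_add[OF m 1[OF p] 1[OF q]]])
        (use p q x X in \<open>simp add: D.up_homf D_add D_closed L.mod_smult_l\<close>)
    show "pk (\<lambda>\<xi>\<in>carrier D. up \<xi> (r \<odot>\<^bsub>P\<^esub> p) \<odot>\<^bsub>X\<^esub> x) = r \<odot>\<^bsub>homf L D X\<^esub> pk (\<lambda>\<xi>\<in>carrier D. up \<xi> p \<odot>\<^bsub>X\<^esub> x)" if r: "r \<in> carrier R" for r
      by (rule D.homf_ext[OF 1[OF rsmult_closed[OF r p]] R.mod_smult[OF m r 1[OF p]]])
        (use p r in \<open>simp add: D.up_homf D.lsmult_closed up_D\<close>)
  qed
qed

lemma double_ext: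
  assumes "u \<in> carrier (homf R P (homf L D X))" "v \<in> carrier (homf R P (homf L D X))"
    "\<And>p \<xi>. p \<in> carrier P \<Longrightarrow> \<xi> \<in> carrier D \<Longrightarrow> up (up u p) \<xi> = up (up v p) \<xi>"
  shows "u = v"
  by (rule homf_ext[OF assms(1,2)]) (rule D.homf_ext[OF homf_closed[OF assms(1)] homf_closed[OF assms(2)] assms(3)])

lemma unit_hom:
  assumes X: "X \<in> modules L"
  shows "unit X \<in> rmod_hom L X (homf R P (homf L D X))"
proof (rule rmod_homI[OF unit_closed[OF X]])
  note m = homf_modules[OF D.homf_modules[OF X]]
  fix x assume x: "x \<in> carrier X"
  show "unit X (x \<oplus>\<^bsub>X\<^esub> y) = unit X x \<oplus>\<^bsub>homf R P (homf L D X)\<^esub> unit X y" if y: "y \<in> carrier X" for y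
    by (rule double_ext[OF unit_closed[OF X L.mod_add[OF X x y]] L.mod_add[OF m unit_closed[OF X x] unit_closed[OF X y]]])
      (use x y X in \<open>simp add: up_homf D.up_homf up_unit D_closed L.mod_smult_r\<close>)
  show "unit X (l \<odot>\<^bsub>X\<^esub> x) = l \<odot>\<^bsub>homf R P (homf L D X)\<^esub> unit X x" if l: "l \<in> carrier L" for l
    by (rule double_ext[OF unit_closed[OF X L.mod_smult[OF X l x]] L.mod_smult[OF m l unit_closed[OF X x]]])
      (use x l X in \<open>simp add: up_homf D.up_homf up_unit D_closed lsmult_closed D_lsmult L.mod_smult_assoc\<close>)
qed

lemma counit_summand:
  assumes "\<psi> \<in> carrier (homf L D (homf R P Y))"
  shows "\<xi> \<in> carrier D \<Longrightarrow> p \<in> carrier P \<Longrightarrow> up (up \<psi> \<xi>) p \<in> carrier Y"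
  by (rule homf_closed[OF D.homf_closed[OF assms]])

text \<open>Linearity over R is the point, since the dual basis belongs to the L-structure and the
  action of R moves its elements.\<close>

lemma counit_hom:
  assumes Y: "Y \<in> modules R"
  shows "counit Y \<in> rmod_hom R (homf L D (homf R P Y)) Y"
proof (rule rmod_homI)
  interpret Y: abelian_group Y by (rule R.mod_group[OF Y])
  let ?F = "homf L D (homf R P Y)"
  note PY = homf_modules[OF Y]
  note m = D.homf_modules[OF PY]
  note cs = counit_summand
  fix \<psi> assume \<psi>: "\<psi> \<in> carrier ?F"
  note \<psi>h = D.homf_cases(1)[OF \<psi>]
  show "counit Y \<psi> \<in> carrier Y" unfolding counit_def by (rule Y.finsum_closed) (auto intro: cs[OF \<psi>] e'_closed basis_closed)
  show "counit Y (\<psi> \<oplus>\<^bsub>?F\<^esub> \<psi>') = counit Y \<psi> \<oplus>\<^bsub>Y\<^esub> counit Y \<psi>'" if \<psi>': "\<psi>' \<in> carrier ?F" for \<psi>'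
  proof -
    have "counit Y (\<psi> \<oplus>\<^bsub>?F\<^esub> \<psi>') = (\<Oplus>\<^bsub>Y\<^esub>j\<in>J. up (up \<psi> (e' j)) (e j) \<oplus>\<^bsub>Y\<^esub> up (up \<psi>' (e' j)) (e j))"
      unfolding counit_def
      by (rule Y.finsum_cong') (auto simp: D.up_homf e'_closed up_homf basis_closed intro!: Y.a_closed cs[OF \<psi>] cs[OF \<psi>'])
    also have "\<dots> = counit Y \<psi> \<oplus>\<^bsub>Y\<^esub> counit Y \<psi>'"
      unfolding counit_def by (rule Y.finsum_addf) (auto intro: cs[OF \<psi>] cs[OF \<psi>'] e'_closed basis_closed)
    finally show ?thesis .
  qed
  fix r assume r: "r \<in> carrier R"
  \<comment> \<open>Expanding r times \<open>e' j\<close> in D and \<open>e i\<close> times r in P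
    leads to the same coefficients, the values of \<open>c j\<close> at \<open>e i\<close> times r.
    After the two sums are exchanged, the inner one is therefore the expansion of a single element
    of P.\<close>
  let ?s = "\<lambda>i j. up (up \<psi> (e' i)) (lsmult P (c j (r \<odot>\<^bsub>P\<^esub> e i)) (e j))"
  have re: "r \<odot>\<^bsub>P\<^esub> e i \<in> carrier P" if "i \<in> J" for i using that r basis_closed rsmult_closed by blast
  have *: "up (up \<psi> (lsmult D r (e' j))) (e j) = (\<Oplus>\<^bsub>Y\<^esub>i\<in>J. ?s i j)" if j: "j \<in> J" for j
  proof -
    have d: "lsmult D r (e' j) \<in> carrier D" by (rule D.lsmult_closed[OF r e'_closed[OF j]])
    have e: "up \<psi> (lsmult D r (e' j)) = D.bext (homf R P Y) (\<lambda>i. up \<psi> (e' i)) (lsmult D r (e' j))"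
      by (rule D.hom_expand[OF PY \<psi>h d])
    have h: "(\<lambda>u. up u (e j)) \<in> rmod_hom (L\<lparr>carrier := {}\<rparr>) (homf R P Y) Y"
      by (rule rmod_homI) (auto simp: up_homf basis_closed[OF j] intro: homf_closed basis_closed[OF j])
    have cl: "c' i (lsmult D r (e' j)) \<odot>\<^bsub>homf R P Y\<^esub> up \<psi> (e' i) \<in> carrier (homf R P Y)" if "i \<in> J" for i
      by (intro L.mod_smult[OF PY] D_closed d basis_closed D.homf_closed[OF \<psi>] e'_closed that)
    have "up (up \<psi> (lsmult D r (e' j))) (e j) = (\<Oplus>\<^bsub>Y\<^esub>i\<in>J. up (c' i (lsmult D r (e' j)) \<odot>\<^bsub>homf R P Y\<^esub> up \<psi> (e' i)) (e j))"
      unfolding e D.bext_def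
      by (rule L.hom_finsum[OF h L.mod_group[OF PY] Y.abelian_group_axioms finite_basis]) (use cl in auto)
    also have "\<dots> = (\<Oplus>\<^bsub>Y\<^esub>i\<in>J. ?s i j)"
      by (rule Y.finsum_cong') (auto simp: up_homf basis_closed j up_D re intro!: cs[OF \<psi>] e'_closed lsmult_closed coord_closed)
    finally show ?thesis .
  qed
  have cl2: "?s i j \<in> carrier Y" if "i \<in> J" "j \<in> J" for i j
    using that by (intro cs[OF \<psi>] e'_closed lsmult_closed coord_closed re basis_closed)
  have "counit Y (r \<odot>\<^bsub>?F\<^esub> \<psi>) = (\<Oplus>\<^bsub>Y\<^esub>j\<in>J. \<Oplus>\<^bsub>Y\<^esub>i\<in>J. ?s i j)"
    unfolding counit_def
    by (rule Y.finsum_cong') (auto simp: D.up_homf e'_closed * intro!: Y.finsum_closed cl2)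
  also have "\<dots> = (\<Oplus>\<^bsub>Y\<^esub>i\<in>J. \<Oplus>\<^bsub>Y\<^esub>j\<in>J. ?s i j)"
    by (rule Y.finsum_swap[OF finite_basis finite_basis cl2])
  also have "\<dots> = (\<Oplus>\<^bsub>Y\<^esub>i\<in>J. up (up \<psi> (e' i)) (r \<odot>\<^bsub>P\<^esub> e i))"
  proof (rule Y.finsum_cong')
    fix i assume i: "i \<in> J"
    have h: "up (up \<psi> (e' i)) \<in> rmod_hom R P Y" by (rule homf_cases(1)[OF D.homf_closed[OF \<psi> e'_closed[OF i]]])
    have "up (up \<psi> (e' i)) (\<Oplus>\<^bsub>P\<^esub>j\<in>J. lsmult P (c j (r \<odot>\<^bsub>P\<^esub> e i)) (e j)) = (\<Oplus>\<^bsub>Y\<^esub>j\<in>J. ?s i j)"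
      by (rule L.hom_finsum[OF h Q_group Y.abelian_group_axioms finite_basis]) (auto intro: lsmult_closed coord_closed re basis_closed i)
    then show "(\<Oplus>\<^bsub>Y\<^esub>j\<in>J. ?s i j) = up (up \<psi> (e' i)) (r \<odot>\<^bsub>P\<^esub> e i)"
      using basis_expand[OF re[OF i]] by simp
  qed (auto intro!: cs[OF \<psi>] e'_closed re)
  also have "\<dots> = (\<Oplus>\<^bsub>Y\<^esub>i\<in>J. r \<odot>\<^bsub>Y\<^esub> up (up \<psi> (e' i)) (e i))"
    by (rule Y.finsum_cong') (auto simp: hom_smult[OF homf_cases(1)[OF D.homf_closed[OF \<psi> e'_closed]] r basis_closed] intro!: R.mod_smult[OF Y r] cs[OF \<psi>] e'_closed basis_closed)
  also have "\<dots> = r \<odot>\<^bsub>Y\<^esub> counit Y \<psi>"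
    unfolding counit_def
  proof (rule L.hom_finsum[symmetric, OF _ Y.abelian_group_axioms Y.abelian_group_axioms finite_basis])
    show "(\<lambda>y. r \<odot>\<^bsub>Y\<^esub> y) \<in> rmod_hom (R\<lparr>carrier := {}\<rparr>) Y Y"
      by (rule rmod_homI) (auto simp: r Y R.mod_smult R.mod_smult_r)
  qed (auto intro: cs[OF \<psi>] e'_closed basis_closed)
  finally show "counit Y (r \<odot>\<^bsub>?F\<^esub> \<psi>) = r \<odot>\<^bsub>Y\<^esub> counit Y \<psi>" .
qed

lemma (in bimod) homf_map_comp: "homf_map Q g (homf_map Q f u) = homf_map Q (\<lambda>x. g (f x)) u"
  unfolding homf_map_def by (rule arg_cong[of _ _ pk], rule restrict_ext) (simp add: small_Q)

lemma (in bimod) homf_map_cong: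
  assumes "\<And>x. x \<in> carrier X \<Longrightarrow> f x = g x" "u \<in> carrier (homf R Q X)"
  shows "homf_map Q f u = homf_map Q g u"
  unfolding homf_map_def by (rule arg_cong[of _ _ pk], rule restrict_ext) (use assms homf_closed[OF assms(2)] in auto)

text \<open>Both triangle identities are dual basis expansions, one of an element p of P and the
  other of a homomorphism on D.\<close>

lemma adjunction: "adjoint_functors L R (homf L D) (homf R P) (homf_map D) (homf_map P) unit counit"
proof (unfold_locales, goal_cases)
  case (1 X) then show ?case by (rule D.homf_modules)
next
  case (2 X) then show ?case by (rule homf_modules)
next
  case (3 X Y f) then show ?case by (rule D.homf_map_hom)
next
  case (4 X Y f) then show ?case by (rule homf_map_hom)
next
  case 5 show ?case by (rule D.homf_map_comp)
next
  case 6 show ?case by (rule homf_map_comp)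
next
  case 7 then show ?case by (rule_tac D.homf_map_cong)
next
  case 8 then show ?case by (rule_tac homf_map_cong)
next
  case (9 X) then show ?case by (rule unit_hom)
next
  case (10 Y) then show ?case by (rule counit_hom)
next
  case (11 X Y f x)
  show ?case
    by (rule double_ext[OF homf_map_in[OF D.homf_map_hom[OF 11(1-3)] unit_closed[OF 11(1,4)]] unit_closed[OF 11(2) hom_closed[OF 11(3,4)]]])
      (simp add: up_homf D.up_homf up_unit hom_smult[OF 11(3)] D_closed 11)
next
  case (12 X Y f u)
  interpret Y: abelian_group Y by (rule R.mod_group[OF 12(2)])
  have "f (counit X u) = (\<Oplus>\<^bsub>Y\<^esub>j\<in>J. f (up (up u (e' j)) (e j)))"
    unfolding counit_def
    by (rule L.hom_finsum[OF 12(3) R.mod_group[OF 12(1)] Y.abelian_group_axioms finite_basis]) (auto intro: counit_summand[OF 12(4)] e'_closed basis_closed)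
  also have "\<dots> = counit Y (homf_map D (homf_map P f) u)"
    unfolding counit_def
    by (rule Y.finsum_cong') (auto simp: D.up_homf up_homf e'_closed basis_closed intro!: hom_closed[OF 12(3)] counit_summand[OF 12(4)] e'_closed basis_closed)
  finally show ?case .
next
  case (13 Y u)
  note PY = homf_modules[OF 13(1)]
  have uu: "unit (homf R P Y) u \<in> carrier (homf R P (homf L D (homf R P Y)))" by (rule unit_closed[OF PY 13(2)])
  show ?case
  proof (rule homf_ext[OF homf_map_in[OF counit_hom[OF 13(1)] uu] 13(2)])
    fix p assume p: "p \<in> carrier P"
    interpret Y: abelian_group Y by (rule R.mod_group[OF 13(1)])
    have "up (homf_map P (counit Y) (unit (homf R P Y) u)) p = (\<Oplus>\<^bsub>Y\<^esub>j\<in>J. up (up (up (unit (homf R P Y) u) p) (e' j)) (e j))"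
      using p by (simp add: up_homf counit_def)
    also have "\<dots> = (\<Oplus>\<^bsub>Y\<^esub>j\<in>J. up u (lsmult P (c j p) (e j)))"
      by (rule Y.finsum_cong') (auto simp: up_unit p e'_closed up_homf basis_closed intro!: homf_closed[OF 13(2)] lsmult_closed coord_closed)
    also have "\<dots> = up u (\<Oplus>\<^bsub>P\<^esub>j\<in>J. lsmult P (c j p) (e j))"
      by (rule L.hom_finsum[OF homf_cases(1)[OF 13(2)] Q_group Y.abelian_group_axioms finite_basis, symmetric]) (auto intro: lsmult_closed coord_closed basis_closed p)
    also have "\<dots> = up u p" using basis_expand[OF p] by simp
    finally show "up (homf_map P (counit Y) (unit (homf R P Y) u)) p = up u p" .
  qed
next
  case (14 X u)
  note DX = D.homf_modules[OF 14(1)]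
  have mu: "homf_map D (unit X) u \<in> carrier (homf L D (homf R P (homf L D X)))" by (rule D.homf_map_in[OF unit_hom[OF 14(1)] 14(2)])
  show ?case
  proof (rule D.homf_ext[OF hom_closed[OF counit_hom[OF DX] mu] 14(2)])
    fix \<xi> assume \<xi>: "\<xi> \<in> carrier D"
    interpret X: abelian_group X by (rule L.mod_group[OF 14(1)])
    have h: "(\<lambda>v. up v \<xi>) \<in> rmod_hom (L\<lparr>carrier := {}\<rparr>) (homf L D X) X"
      by (rule rmod_homI) (auto simp: D.up_homf \<xi> intro: D.homf_closed \<xi>)
    have "up (counit (homf L D X) (homf_map D (unit X) u)) \<xi> = (\<Oplus>\<^bsub>X\<^esub>j\<in>J. up (up (up (homf_map D (unit X) u) (e' j)) (e j)) \<xi>)"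
      unfolding counit_def
      by (rule L.hom_finsum[OF h R.mod_group[OF DX] X.abelian_group_axioms finite_basis]) (auto intro: counit_summand[OF mu] e'_closed basis_closed)
    also have "\<dots> = D.bext X (\<lambda>j. up u (e' j)) \<xi>"
      unfolding D.bext_def
      by (rule X.finsum_cong') (auto simp: D.up_homf e'_closed up_unit basis_closed \<xi> intro!: L.mod_smult[OF 14(1)] D_closed \<xi> basis_closed D.homf_closed[OF 14(2)] e'_closed)
    also have "\<dots> = up u \<xi>" by (rule D.hom_expand[OF 14(1) D.homf_cases(1)[OF 14(2)] \<xi>, symmetric])
    finally show "up (counit (homf L D X) (homf_map D (unit X) u)) \<xi> = up u \<xi>" .
  qed
qed

text \<open>The left adjoint, Hom out of D, preserves injective maps because these can be tested
  pointwise.\<close>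

lemma homf_preserves_injective:
  assumes "injective_module R E"
  shows "injective_module L (homf R P E)"
proof (rule adjoint_functors.right_adjoint_preserves_injective[OF adjunction _ assms])
  fix X Y i assume *: "X \<in> modules L" "Y \<in> modules L" "i \<in> rmod_hom L X Y" "inj_on i (carrier X)"
  show "inj_on (homf_map D i) (carrier (homf L D X))"
  proof (rule inj_onI)
    fix u v assume u: "u \<in> carrier (homf L D X)" and v: "v \<in> carrier (homf L D X)" and eq: "homf_map D i u = homf_map D i v"
    show "u = v"
    proof (rule D.homf_ext[OF u v])
      fix \<xi> assume \<xi>: "\<xi> \<in> carrier D"
      have "i (up u \<xi>) = i (up v \<xi>)" using arg_cong[OF eq, of "\<lambda>w. up w \<xi>"] \<xi> by (simp add: D.up_homf)
      then show "up u \<xi> = up v \<xi>" using *(4) D.homf_closed[OF u \<xi>] D.homf_closed[OF v \<xi>] by (auto dest: inj_onD)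
    qed
  qed
qed

text \<open>Projectivity of P over R makes the right adjoint, Hom out of P, preserve surjective
  maps.\<close>

lemma dual_homf_preserves_projective:
  assumes P: "projective_module R (right_part P)" and "projective_module L F"
  shows "projective_module R (homf L D F)"
proof (rule adjoint_functors.left_adjoint_preserves_projective[OF adjunction _ assms(2)])
  fix X Y p assume *: "X \<in> modules R" "Y \<in> modules R" "p \<in> rmod_hom R X Y" "p ` carrier X = carrier Y"
  show "homf_map P p ` carrier (homf R P X) = carrier (homf R P Y)"
  proof
    show "homf_map P p ` carrier (homf R P X) \<subseteq> carrier (homf R P Y)" using homf_map_in[OF *(3)] by blast
    show "carrier (homf R P Y) \<subseteq> homf_map P p ` carrier (homf R P X)"
    proof
      fix u assume u: "u \<in> carrier (homf R P Y)"
      obtain g where g: "g \<in> rmod_hom R P X" and pg: "\<And>x. x \<in> carrier P \<Longrightarrow> p (g x) = up u x"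
        using P * homf_cases(1)[OF u] unfolding projective_module_def by (auto simp: Ball_def) metis
      have gp: "pk (restrict g (carrier P)) \<in> carrier (homf R P X)" using g by (simp add: homf_in)
      have "u = homf_map P p (pk (restrict g (carrier P)))"
        by (rule homf_ext[OF u homf_map_in[OF *(3) gp]]) (simp add: up_homf pg)
      then show "u \<in> homf_map P p ` carrier (homf R P X)" using gp by blast
    qed
  qed
qed

end

section \<open>Dual bases and the tensor product\<close>

text \<open>Finitely many generators define a surjection from a finite power of the ring.
  Projectivity splits it, and the coordinates of a splitting are the required functionals.\<close>

lemma (in ring_universe) dual_basis_exists:
  assumes fg: "finitely_generated A M" and proj: "projective_module A M"
  shows "\<exists>J c. dual_basis A M J (\<lambda>j. j) c"
proof -
  have M: "M \<in> modules A" using proj by (simp add: projective_module_def)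
  interpret M: abelian_group M by (rule mod_group[OF M])
  interpret RA: abelian_group "regular_bimodule A" by (rule regular_group)
  obtain S where S: "finite S" "S \<subseteq> carrier M"
    and gen: "\<forall>x\<in>carrier M. \<exists>c\<in>S \<rightarrow> carrier A. x = (\<Oplus>\<^bsub>M\<^esub>s\<in>S. c s \<odot>\<^bsub>M\<^esub> s)"
    using fg unfolding finitely_generated_def by blast
  have I: "small S" by (rule small_finite[OF S(1)])
  \<comment> \<open>For the finite index set S the product is the free module on S. It is small, so
    it belongs to the modules over which the lifting property of M quantifies.\<close>
  define F where "F = pmod True S (\<lambda>_. right_part (regular_bimodule A))"
  have F: "F \<in> modules A" unfolding F_def by (rule pmod_modules[OF I regular_modules])
  define \<pi> where "\<pi> u = (\<Oplus>\<^bsub>M\<^esub>s\<in>S. up u s \<odot>\<^bsub>M\<^esub> s)" for u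
  have upc: "up u s \<in> carrier A" if "u \<in> carrier F" "s \<in> S" for u s
    using pmod_cases(2)[OF I that(1)[unfolded F_def] that(2)] by simp
  have cl: "up u s \<odot>\<^bsub>M\<^esub> s \<in> carrier M" if "u \<in> carrier F" "s \<in> S" for u s
    using mod_smult[OF M upc[OF that]] S that by blast
  have \<pi>: "\<pi> \<in> rmod_hom A F M"
  proof (rule rmod_homI)
    fix u assume u: "u \<in> carrier F"
    show "\<pi> u \<in> carrier M" unfolding \<pi>_def using cl u by (intro M.finsum_closed) auto
    show "\<pi> (u \<oplus>\<^bsub>F\<^esub> v) = \<pi> u \<oplus>\<^bsub>M\<^esub> \<pi> v" if v: "v \<in> carrier F" for v
    proof -
      have "\<pi> (u \<oplus>\<^bsub>F\<^esub> v) = (\<Oplus>\<^bsub>M\<^esub>s\<in>S. up u s \<odot>\<^bsub>M\<^esub> s \<oplus>\<^bsub>M\<^esub> up v s \<odot>\<^bsub>M\<^esub> s)"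
        unfolding \<pi>_def
        by (rule M.finsum_cong') (use S u v in \<open>auto simp: F_def up_pmod[OF I] subset_iff mod_smult_l[OF M] upc[unfolded F_def] intro!: M.a_closed cl[unfolded F_def]\<close>)
      also have "\<dots> = \<pi> u \<oplus>\<^bsub>M\<^esub> \<pi> v" unfolding \<pi>_def by (rule M.finsum_addf) (use cl u v in auto)
      finally show ?thesis .
    qed
    show "\<pi> (r \<odot>\<^bsub>F\<^esub> u) = r \<odot>\<^bsub>M\<^esub> \<pi> u" if r: "r \<in> carrier A" for r
    proof -
      have h: "(\<lambda>y. r \<odot>\<^bsub>M\<^esub> y) \<in> rmod_hom (A\<lparr>carrier := {}\<rparr>) M M"
        by (rule rmod_homI) (auto simp: r M mod_smult mod_smult_r)
      have "\<pi> (r \<odot>\<^bsub>F\<^esub> u) = (\<Oplus>\<^bsub>M\<^esub>s\<in>S. r \<odot>\<^bsub>M\<^esub> (up u s \<odot>\<^bsub>M\<^esub> s))"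
        unfolding \<pi>_def
        by (rule M.finsum_cong') (use S u r in \<open>auto simp: F_def up_pmod[OF I] subset_iff mod_smult_assoc[OF M] upc[unfolded F_def] intro!: mod_smult[OF M] cl[unfolded F_def]\<close>)
      also have "\<dots> = r \<odot>\<^bsub>M\<^esub> \<pi> u"
        unfolding \<pi>_def by (rule hom_finsum[OF h M.abelian_group_axioms M.abelian_group_axioms S(1), symmetric]) (use cl u in auto)
      finally show ?thesis .
    qed
  qed
  have surj: "\<pi> ` carrier F = carrier M"
  proof
    show "\<pi> ` carrier F \<subseteq> carrier M" using hom_closed[OF \<pi>] by blast
    show "carrier M \<subseteq> \<pi> ` carrier F"
    proof
      fix x assume "x \<in> carrier M"
      then obtain c where c: "c \<in> S \<rightarrow> carrier A" "x = (\<Oplus>\<^bsub>M\<^esub>s\<in>S. c s \<odot>\<^bsub>M\<^esub> s)" using gen by blast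
      have "pk (restrict c S) \<in> carrier F" using c(1) unfolding F_def pk_in_pmod[OF I] by auto
      moreover have "\<pi> (pk (restrict c S)) = x"
        unfolding \<pi>_def c(2) by (rule M.finsum_cong') (use c(1) S I in \<open>auto simp: subset_iff intro!: mod_smult[OF M]\<close>)
      ultimately show "x \<in> \<pi> ` carrier F" by blast
    qed
  qed
  have "\<exists>g\<in>rmod_hom A M F. \<forall>x\<in>carrier M. \<pi> (g x) = x"
    using proj[unfolded projective_module_def, THEN conjunct2, rule_format, OF F M \<pi> hom_id surj] .
  then obtain g where g: "g \<in> rmod_hom A M F" and \<pi>g: "\<forall>x\<in>carrier M. \<pi> (g x) = x" by blast
  have c: "(\<lambda>x. up (g x) s) \<in> rmod_hom A M (right_part (regular_bimodule A))" if "s \<in> S" for s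
    by (rule hom_comp[OF g[unfolded F_def] up_hom[OF I that]])
  have "dual_basis A M S (\<lambda>j. j) (\<lambda>s x. up (g x) s)"
    unfolding dual_basis_def using S c \<pi>g by (auto simp: \<pi>_def)
  then show ?thesis by blast
qed

lemma dual_basis_part:
  "dual_basis R (right_part Q) J e c \<longleftrightarrow> dual_basis R Q J e c"
  by (simp add: dual_basis_def del: rmod_hom_right_part(2))

text \<open>The extension of \<open>g\<close> to a homomorphism on the free abelian group. If
  \<open>g\<close> has values in the carrier of \<open>G\<close> it exists and is unique on the
  carrier of the free group (\<open>frag_hom_unique\<close>), so the choice does no harm.\<close>

definition frag_ev :: "'a set \<Rightarrow> ('b, 's) ring_scheme \<Rightarrow> ('a \<Rightarrow> 'b) \<Rightarrow> ('a \<Rightarrow>\<^sub>0 int) \<Rightarrow> 'b"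
  where "frag_ev S G g = (SOME h. h \<in> hom (free_Abelian_group S) (add_monoid G) \<and> (\<forall>x\<in>S. h (frag_of x) = g x))"

context abelian_group
begin

lemma
  assumes "\<And>x. x \<in> S \<Longrightarrow> g x \<in> carrier G"
  shows frag_ev_hom: "frag_ev S G g \<in> hom (free_Abelian_group S) (add_monoid G)"
    and frag_ev_of: "x \<in> S \<Longrightarrow> frag_ev S G g (frag_of x) = g x"
proof -
  obtain h where "h \<in> hom (free_Abelian_group S) (add_monoid G)" "\<And>x. x \<in> S \<Longrightarrow> h (frag_of x) = g x"
    using comm_group.free_Abelian_group_universal[OF a_comm_group, of g S] assms by auto
  then have "\<exists>h. h \<in> hom (free_Abelian_group S) (add_monoid G) \<and> (\<forall>x\<in>S. h (frag_of x) = g x)" by blast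
  from someI_ex[OF this]
  show "frag_ev S G g \<in> hom (free_Abelian_group S) (add_monoid G)" "x \<in> S \<Longrightarrow> frag_ev S G g (frag_of x) = g x"
    unfolding frag_ev_def by blast+
qed

context
  fixes S :: "'c set" and h
  assumes h: "h \<in> hom (free_Abelian_group S) (add_monoid G)"
begin

lemma frag_hom_closed: "t \<in> carrier (free_Abelian_group S) \<Longrightarrow> h t \<in> carrier G"
  using hom_in_carrier[OF h] by simp

lemma frag_hom_add: "s \<in> carrier (free_Abelian_group S) \<Longrightarrow> t \<in> carrier (free_Abelian_group S) \<Longrightarrow> h (s + t) = h s \<oplus> h t"
  using hom_mult[OF h, of s t] by simp

lemma frag_hom_zero: "h 0 = \<zero>"
  using hom_one[OF h group_free_Abelian_group a_group] by simp

lemma frag_hom_uminus: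
  assumes t: "t \<in> carrier (free_Abelian_group S)" shows "h (- t) = \<ominus> h t"
proof (rule a_inv_unique[OF frag_hom_closed[OF t]])
  have mt: "- t \<in> carrier (free_Abelian_group S)" using t by simp
  show "h (- t) \<in> carrier G" by (rule frag_hom_closed[OF mt])
  show "h t \<oplus> h (- t) = \<zero>" using frag_hom_add[OF t mt] frag_hom_zero by simp
qed

lemma frag_hom_diff:
  assumes s: "s \<in> carrier (free_Abelian_group S)" and t: "t \<in> carrier (free_Abelian_group S)"
  shows "h (s - t) = h s \<ominus> h t"
proof -
  have mt: "- t \<in> carrier (free_Abelian_group S)" using t by simp
  show ?thesis using frag_hom_add[OF s mt] frag_hom_uminus[OF t] by (simp add: a_minus_def)
qed

lemma frag_hom_unique:
  assumes h': "h' \<in> hom (free_Abelian_group S) (add_monoid G)" and eq: "\<And>x. x \<in> S \<Longrightarrow> h (frag_of x) = h' (frag_of x)"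
    and t: "t \<in> carrier (free_Abelian_group S)"
  shows "h t = h' t"
proof -
  have "Poly_Mapping.keys t \<subseteq> S" using t by simp
  then have "t \<in> carrier (free_Abelian_group S) \<and> h t = h' t"
  proof (induction t rule: frag_induction)
    case zero
    show ?case using frag_hom_zero hom_one[OF h' group_free_Abelian_group a_group] by simp
  next
    case (one x)
    then show ?case using eq by simp
  next
    case (diff a b)
    have "a - b \<in> carrier (free_Abelian_group S)" using diff keys_diff[of a b] by auto
    moreover have "h' (a - b) = h' a \<ominus> h' b"
    proof -
      have mb: "- b \<in> carrier (free_Abelian_group S)" using diff by simp
      have "h' (a - b) = h' a \<oplus> h' (- b)" using hom_mult[OF h', of a "- b"] diff mb by simp
      also have "h' (- b) = \<ominus> h' b"
      proof (rule a_inv_unique)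
        show "h' b \<in> carrier G" "h' (- b) \<in> carrier G" using hom_in_carrier[OF h', of b] hom_in_carrier[OF h', of "- b"] diff mb by simp_all
        show "h' b \<oplus> h' (- b) = \<zero>" using hom_mult[OF h', of b "- b"] diff mb hom_one[OF h' group_free_Abelian_group a_group] by simp
      qed
      finally show ?thesis by (simp add: a_minus_def)
    qed
    ultimately show ?case using diff by (simp add: frag_hom_diff)
  qed
  then show ?thesis ..
qed

end

end

section \<open>The tensor product by generators and relations, and the maps out of it\<close>

lemma tensor_carrier: "carrier (tensor A N M) = tensor_class A N M ` carrier (free_Abelian_group (carrier N \<times> carrier M))"
  by (simp add: tensor_def Let_def tensor_class_def carrier_FactGroup del: carrier_free_Abelian_group_iff)

lemma tensor_simps:
  "c \<oplus>\<^bsub>tensor A N M\<^esub> c' = c <#>\<^bsub>free_Abelian_group (carrier N \<times> carrier M)\<^esub> c'"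
  "r \<odot>\<^bsub>tensor A N M\<^esub> c = (\<Union>t\<in>c. tensor_class A N M (frag_extend (\<lambda>(n, m). frag_of (n, r \<odot>\<^bsub>M\<^esub> m)) t))"
  "lsmult (tensor A N M) l c = (\<Union>t\<in>c. tensor_class A N M (frag_extend (\<lambda>(n, m). frag_of (lsmult N l n, m)) t))"
  by (simp_all add: tensor_def Let_def)

locale bimod_pair = N: bimod B A N + M: bimod A B M for A B :: "'u ring" and N M
begin

abbreviation "F \<equiv> free_Abelian_group (carrier N \<times> carrier M)"
abbreviation "cls \<equiv> tensor_class A N M"
abbreviation "K \<equiv> tensor_kernel A N M"
abbreviation "lmul b \<equiv> frag_extend (\<lambda>(n, m). frag_of (lsmult N b n, m))"
abbreviation "rmul b \<equiv> frag_extend (\<lambda>(n, m). frag_of (n, b \<odot>\<^bsub>M\<^esub> m))"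

lemma relations_closed: "tensor_relations A N M \<subseteq> carrier F"
  unfolding tensor_relations_def
  by (auto dest!: subsetD[OF keys_diff] simp: N.Q_add M.Q_add N.rsmult_closed M.lsmult_closed)

lemma kernel_subgroup: "subgroup K F"
  unfolding tensor_kernel_def by (rule group.generate_is_subgroup[OF group_free_Abelian_group relations_closed])

lemma kernel_normal: "K \<lhd> F"
  using kernel_subgroup comm_group.normal_iff_subgroup[OF abelian_free_Abelian_group] by blast

lemma cls_eq:
  assumes s: "s \<in> carrier F" and t: "t \<in> carrier F"
  shows "cls s = cls t \<longleftrightarrow> s - t \<in> K"
proof
  have mt: "- t \<in> carrier F" using t by simp
  have st: "(s - t) + t = s" by simp
  {
    assume "s - t \<in> K"
    then have "s \<in> cls t" unfolding tensor_class_def r_coset_def by (intro UN_I[of "s - t"]) simp_all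
    then show "cls s = cls t" unfolding tensor_class_def
      using group.repr_independence[OF group_free_Abelian_group _ t kernel_subgroup] by metis
  next
    assume "cls s = cls t"
    then have "s \<in> cls t" unfolding tensor_class_def using group.rcos_self[OF group_free_Abelian_group s kernel_subgroup] by simp
    then show "s - t \<in> K" unfolding tensor_class_def r_coset_def by auto
  }
qed

lemma cls_mem:
  assumes t: "t \<in> carrier F" and s: "s \<in> cls t"
  shows "s \<in> carrier F" "cls s = cls t"
proof -
  obtain k where k: "k \<in> K" "s = k + t" using s unfolding tensor_class_def r_coset_def by auto
  then have kc: "k \<in> carrier F" using subgroup.subset[OF kernel_subgroup] by blast
  show sc: "s \<in> carrier F" using kc t keys_add[of k t] k(2) by auto
  show "cls s = cls t" using cls_eq[OF sc t] k by simp
qed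

lemma cls_self: "t \<in> carrier F \<Longrightarrow> t \<in> cls t"
  unfolding tensor_class_def by (rule group.rcos_self[OF group_free_Abelian_group _ kernel_subgroup])

lemma cls_add:
  assumes "s \<in> carrier F" "t \<in> carrier F"
  shows "cls s \<oplus>\<^bsub>tensor A N M\<^esub> cls t = cls (s + t)"
  using normal.rcos_sum[OF kernel_normal assms] by (simp add: tensor_simps tensor_class_def)

text \<open>\<open>generate\<close> has clauses for the unit, generators, inverses and products; in
  this abelian group closure under differences covers the last two.\<close>

lemma kernel_induct:
  assumes k: "k \<in> K" and 0: "P 0" and rel: "\<And>x. x \<in> tensor_relations A N M \<Longrightarrow> P x"
    and diff: "\<And>x y. x \<in> carrier F \<Longrightarrow> y \<in> carrier F \<Longrightarrow> P x \<Longrightarrow> P y \<Longrightarrow> P (x - y)"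
  shows "P k"
proof -
  have "k \<in> carrier F \<and> P k"
    using k unfolding tensor_kernel_def
  proof (induction k rule: generate.induct)
    case one
    show ?case using 0 by simp
  next
    case (incl h)
    then show ?case using rel relations_closed by blast
  next
    case (inv h)
    then have h: "h \<in> carrier F" using relations_closed by blast
    have "P (0 - h)" by (rule diff[OF _ h 0 rel[OF inv]]) simp
    then show ?case using h by simp
  next
    case (eng h k)
    have "P (0 - k)" by (rule diff[OF _ _ 0]) (use eng in auto)
    moreover have "h + k = h - (0 - k)" by simp
    moreover have "0 - k \<in> carrier F" using eng by simp
    ultimately have "P (h + k)" using diff[of h "0 - k"] eng by metis
    moreover have "h + k \<in> carrier F" using eng keys_add[of h k] by auto
    ultimately show ?case by simp
  qed
  then show ?thesis ..
qed

lemma tensor_relations_cases: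
  assumes "x \<in> tensor_relations A N M"
  obtains (left) n n' m where "x = frag_of (n \<oplus>\<^bsub>N\<^esub> n', m) - frag_of (n, m) - frag_of (n', m)" "n \<in> carrier N" "n' \<in> carrier N" "m \<in> carrier M"
    | (right) n m m' where "x = frag_of (n, m \<oplus>\<^bsub>M\<^esub> m') - frag_of (n, m) - frag_of (n, m')" "n \<in> carrier N" "m \<in> carrier M" "m' \<in> carrier M"
    | (middle) a n m where "x = frag_of (a \<odot>\<^bsub>N\<^esub> n, m) - frag_of (n, lsmult M a m)" "a \<in> carrier A" "n \<in> carrier N" "m \<in> carrier M"
  using assms unfolding tensor_relations_def by blast

text \<open>A map of the form \<open>\<nu>\<close> tensor \<open>\<mu>\<close> sends each defining
  relation to another relation, so it preserves the subgroup that they generate. This makes the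
  outer actions well defined.\<close>

lemma kernel_extend:
  assumes \<nu>: "\<nu> \<in> rmod_hom A N N" and \<mu>c: "\<And>m. m \<in> carrier M \<Longrightarrow> \<mu> m \<in> carrier M"
    and \<mu>: "\<And>m m'. m \<in> carrier M \<Longrightarrow> m' \<in> carrier M \<Longrightarrow> \<mu> (m \<oplus>\<^bsub>M\<^esub> m') = \<mu> m \<oplus>\<^bsub>M\<^esub> \<mu> m'"
    and \<mu>l: "\<And>a m. a \<in> carrier A \<Longrightarrow> m \<in> carrier M \<Longrightarrow> \<mu> (lsmult M a m) = lsmult M a (\<mu> m)"
    and k: "k \<in> K"
  shows "frag_extend (\<lambda>(n, m). frag_of (\<nu> n, \<mu> m)) k \<in> K" (is "frag_extend ?\<sigma> k \<in> K")
proof (rule kernel_induct[OF k])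
  interpret K: subgroup K F by (rule kernel_subgroup)
  show "frag_extend ?\<sigma> 0 \<in> K" using K.one_closed by simp
  show "frag_extend ?\<sigma> x \<in> K" if x: "x \<in> tensor_relations A N M" for x
  proof -
    have "frag_extend ?\<sigma> x \<in> tensor_relations A N M"
      using x
    proof (cases rule: tensor_relations_cases)
      case (left n n' m)
      then have "frag_extend ?\<sigma> x = frag_of (\<nu> n \<oplus>\<^bsub>N\<^esub> \<nu> n', \<mu> m) - frag_of (\<nu> n, \<mu> m) - frag_of (\<nu> n', \<mu> m)"
        by (simp add: frag_extend_diff hom_add[OF \<nu>])
      then show ?thesis unfolding tensor_relations_def using left hom_closed[OF \<nu>] \<mu>c by blast
    next
      case (right n m m')
      then have "frag_extend ?\<sigma> x = frag_of (\<nu> n, \<mu> m \<oplus>\<^bsub>M\<^esub> \<mu> m') - frag_of (\<nu> n, \<mu> m) - frag_of (\<nu> n, \<mu> m')"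
        by (simp add: frag_extend_diff \<mu>)
      then show ?thesis unfolding tensor_relations_def using right hom_closed[OF \<nu>] \<mu>c by blast
    next
      case (middle a n m)
      then have "frag_extend ?\<sigma> x = frag_of (a \<odot>\<^bsub>N\<^esub> \<nu> n, \<mu> m) - frag_of (\<nu> n, lsmult M a (\<mu> m))"
        by (simp add: frag_extend_diff hom_smult[OF \<nu>] \<mu>l)
      then show ?thesis unfolding tensor_relations_def using middle hom_closed[OF \<nu>] \<mu>c by blast
    qed
    then show ?thesis unfolding tensor_kernel_def by (rule generate.incl)
  qed
  show "frag_extend ?\<sigma> (x - y) \<in> K" if "frag_extend ?\<sigma> x \<in> K" "frag_extend ?\<sigma> y \<in> K" for x y
  proof -
    have "frag_extend ?\<sigma> y \<in> carrier F" using K.subset that(2) by blast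
    then show ?thesis using K.m_closed[OF that(1) K.m_inv_closed[OF that(2)]] by (simp add: frag_extend_diff)
  qed
qed

lemma extend_closed:
  assumes \<sigma>: "\<And>n m. n \<in> carrier N \<Longrightarrow> m \<in> carrier M \<Longrightarrow> \<sigma> (n, m) \<in> carrier F"
    and t: "t \<in> carrier F"
  shows "frag_extend \<sigma> t \<in> carrier F"
  using keys_frag_extend[of \<sigma> t] \<sigma> t by fastforce

text \<open>The actions on \<open>tensor\<close> are unions over all representatives of a class. By
  \<open>kernel_extend\<close> all representatives lead to one class, so the union
  collapses.\<close>

lemma cls_extend:
  assumes \<nu>: "\<nu> \<in> rmod_hom A N N" and \<mu>c: "\<And>m. m \<in> carrier M \<Longrightarrow> \<mu> m \<in> carrier M"
    and \<mu>: "\<And>m m'. m \<in> carrier M \<Longrightarrow> m' \<in> carrier M \<Longrightarrow> \<mu> (m \<oplus>\<^bsub>M\<^esub> m') = \<mu> m \<oplus>\<^bsub>M\<^esub> \<mu> m'"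
    and \<mu>l: "\<And>a m. a \<in> carrier A \<Longrightarrow> m \<in> carrier M \<Longrightarrow> \<mu> (lsmult M a m) = lsmult M a (\<mu> m)"
    and t: "t \<in> carrier F"
  shows "(\<Union>s\<in>cls t. cls (frag_extend (\<lambda>(n, m). frag_of (\<nu> n, \<mu> m)) s)) = cls (frag_extend (\<lambda>(n, m). frag_of (\<nu> n, \<mu> m)) t)"
proof -
  let ?\<sigma> = "\<lambda>(n, m). frag_of (\<nu> n, \<mu> m)"
  have \<sigma>: "frag_of (\<nu> n, \<mu> m) \<in> carrier F" if "n \<in> carrier N" "m \<in> carrier M" for n m
    using hom_closed[OF \<nu> that(1)] \<mu>c[OF that(2)] by simp
  have "cls (frag_extend ?\<sigma> s) = cls (frag_extend ?\<sigma> t)" if s: "s \<in> cls t" for s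
  proof -
    have "s - t \<in> K" using cls_mem[OF t s] cls_eq[OF _ t] by blast
    from kernel_extend[OF \<nu> _ _ _ this, of \<mu>] have "frag_extend ?\<sigma> (s - t) \<in> K" using \<mu>c \<mu> \<mu>l by blast
    then show ?thesis using cls_eq[OF extend_closed extend_closed, of ?\<sigma> s ?\<sigma> t] cls_mem(1)[OF t s] t \<sigma> by (simp add: frag_extend_diff)
  qed
  then show ?thesis using cls_self[OF t] by blast
qed

lemma
  assumes b: "b \<in> carrier B" and t: "t \<in> carrier F"
  shows cls_smult: "b \<odot>\<^bsub>tensor A N M\<^esub> cls t = cls (rmul b t)"
    and cls_lsmult: "lsmult (tensor A N M) b (cls t) = cls (lmul b t)"
proof -
  show "b \<odot>\<^bsub>tensor A N M\<^esub> cls t = cls (rmul b t)"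
    unfolding tensor_simps
    by (rule cls_extend[OF hom_id _ _ _ t]) (use b N.L.mod_smult_r[OF M.Q_modules b] in \<open>auto simp: M.rsmult_closed M.lsmult_rsmult\<close>)
  show "lsmult (tensor A N M) b (cls t) = cls (lmul b t)"
    unfolding tensor_simps by (rule cls_extend[OF N.lsmult_hom[OF b] _ _ _ t]) auto
qed

text \<open>\<open>balanced X g\<close>: \<open>g\<close> induces a homomorphism from \<open>N \<otimes>\<^sub>A M\<close> to the abelian group \<open>X\<close>.\<close>

definition balanced :: "('b, 's) ring_scheme \<Rightarrow> ('u \<times> 'u \<Rightarrow> 'b) \<Rightarrow> bool"
  where "balanced X g \<longleftrightarrow> (\<forall>n\<in>carrier N. \<forall>m\<in>carrier M. g (n, m) \<in> carrier X \<and>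
    (\<forall>n'\<in>carrier N. g (n \<oplus>\<^bsub>N\<^esub> n', m) = g (n, m) \<oplus>\<^bsub>X\<^esub> g (n', m)) \<and>
    (\<forall>m'\<in>carrier M. g (n, m \<oplus>\<^bsub>M\<^esub> m') = g (n, m) \<oplus>\<^bsub>X\<^esub> g (n, m')) \<and>
    (\<forall>a\<in>carrier A. g (a \<odot>\<^bsub>N\<^esub> n, m) = g (n, lsmult M a m)))"

abbreviation "ev X g t \<equiv> frag_ev (carrier N \<times> carrier M) X g t"

lemma
  assumes X: "abelian_group X" and g: "balanced X g"
  shows ev_hom: "ev X g \<in> hom F (add_monoid X)"
    and ev_of: "x \<in> carrier N \<times> carrier M \<Longrightarrow> ev X g (frag_of x) = g x"
    and ev_eqI: "h \<in> hom F (add_monoid X) \<Longrightarrow>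
      (\<And>n m. n \<in> carrier N \<Longrightarrow> m \<in> carrier M \<Longrightarrow> g (n, m) = h (frag_of (n, m))) \<Longrightarrow> t \<in> carrier F \<Longrightarrow> ev X g t = h t"
proof -
  interpret X: abelian_group X by (rule X)
  have gc: "g x \<in> carrier X" if "x \<in> carrier N \<times> carrier M" for x using g that unfolding balanced_def by blast
  show h: "ev X g \<in> hom F (add_monoid X)" by (rule X.frag_ev_hom[OF gc])
  show of: "ev X g (frag_of x) = g x" if "x \<in> carrier N \<times> carrier M" for x by (rule X.frag_ev_of[OF gc that])
  show "ev X g t = h t" if "h \<in> hom F (add_monoid X)" "\<And>n m. n \<in> carrier N \<Longrightarrow> m \<in> carrier M \<Longrightarrow> g (n, m) = h (frag_of (n, m))"
    "t \<in> carrier F"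
    by (rule X.frag_hom_unique[OF h that(1) _ that(3)]) (use of that(2) in auto)
qed

text \<open>The conditions in \<open>balanced\<close> say that \<open>g\<close> kills the three
  kinds of relations, so the induced map depends only on the class and descends to the tensor
  product.\<close>

lemma ev_cls:
  assumes X: "abelian_group X" and g: "balanced X g" and s: "s \<in> carrier F" and t: "t \<in> carrier F" and eq: "cls s = cls t"
  shows "ev X g s = ev X g t"
proof -
  interpret X: abelian_group X by (rule X)
  have gc: "g x \<in> carrier X" if "x \<in> carrier N \<times> carrier M" for x using g that unfolding balanced_def by blast
  note h = ev_hom[OF X g] and ho = ev_of[OF X g]
  have "ev X g k = \<zero>\<^bsub>X\<^esub>" if "k \<in> K" for k
  proof (rule kernel_induct[OF that])
    show "ev X g 0 = \<zero>\<^bsub>X\<^esub>" by (rule X.frag_hom_zero[OF h])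
    show "ev X g (x - y) = \<zero>\<^bsub>X\<^esub>" if "x \<in> carrier F" "y \<in> carrier F" "ev X g x = \<zero>\<^bsub>X\<^esub>" "ev X g y = \<zero>\<^bsub>X\<^esub>" for x y
      using X.frag_hom_diff[OF h that(1,2)] that(3,4) by (simp add: X.minus_eq X.a_inv_zero)
    have d2: "ev X g (frag_of p - frag_of q) = g p \<ominus>\<^bsub>X\<^esub> g q" if "p \<in> carrier N \<times> carrier M" "q \<in> carrier N \<times> carrier M" for p q
      using X.frag_hom_diff[OF h, of "frag_of p" "frag_of q"] ho that by simp
    have d3: "ev X g (frag_of p - frag_of q - frag_of r) = g p \<ominus>\<^bsub>X\<^esub> g q \<ominus>\<^bsub>X\<^esub> g r"
      if "p \<in> carrier N \<times> carrier M" "q \<in> carrier N \<times> carrier M" "r \<in> carrier N \<times> carrier M" for p q r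
    proof -
      have "frag_of p - frag_of q \<in> carrier F" using that keys_diff[of "frag_of p" "frag_of q"] by auto
      then show ?thesis using X.frag_hom_diff[OF h, of "frag_of p - frag_of q" "frag_of r"] d2[OF that(1,2)] ho[OF that(3)] that(3) by simp
    qed
    fix x assume "x \<in> tensor_relations A N M"
    then show "ev X g x = \<zero>\<^bsub>X\<^esub>"
    proof (cases rule: tensor_relations_cases)
      case (left n n' m)
      have e: "g (n \<oplus>\<^bsub>N\<^esub> n', m) = g (n, m) \<oplus>\<^bsub>X\<^esub> g (n', m)" using g left(2-4) unfolding balanced_def by blast
      have "ev X g x = (g (n, m) \<oplus>\<^bsub>X\<^esub> g (n', m)) \<ominus>\<^bsub>X\<^esub> g (n, m) \<ominus>\<^bsub>X\<^esub> g (n', m)"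
        unfolding left(1) e[symmetric] by (rule d3) (use left(2-4) in \<open>auto intro: N.Q_add\<close>)
      also have "\<dots> = \<zero>\<^bsub>X\<^esub>" using gc[of "(n, m)"] gc[of "(n', m)"] left(2-4) X by (simp add: X.abelian_group_simprules)
      finally show ?thesis .
    next
      case (right n m m')
      have e: "g (n, m \<oplus>\<^bsub>M\<^esub> m') = g (n, m) \<oplus>\<^bsub>X\<^esub> g (n, m')" using g right(2-4) unfolding balanced_def by blast
      have "ev X g x = (g (n, m) \<oplus>\<^bsub>X\<^esub> g (n, m')) \<ominus>\<^bsub>X\<^esub> g (n, m) \<ominus>\<^bsub>X\<^esub> g (n, m')"
        unfolding right(1) e[symmetric] by (rule d3) (use right(2-4) in \<open>auto intro: M.Q_add\<close>)
      also have "\<dots> = \<zero>\<^bsub>X\<^esub>" using gc[of "(n, m)"] gc[of "(n, m')"] right(2-4) X by (simp add: X.abelian_group_simprules)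
      finally show ?thesis .
    next
      case (middle a n m)
      have e: "g (a \<odot>\<^bsub>N\<^esub> n, m) = g (n, lsmult M a m)" using g middle(2-4) unfolding balanced_def by blast
      have "ev X g x = g (a \<odot>\<^bsub>N\<^esub> n, m) \<ominus>\<^bsub>X\<^esub> g (n, lsmult M a m)"
        unfolding middle(1) by (rule d2) (use middle(2-4) in \<open>auto intro: M.lsmult_closed N.rsmult_closed\<close>)
      also have "\<dots> = \<zero>\<^bsub>X\<^esub>" unfolding e using gc[of "(n, lsmult M a m)"] middle(2-4) M.lsmult_closed by (simp add: X.abelian_group_simprules)
      finally show ?thesis .
    qed
  qed
  then have "ev X g (s - t) = \<zero>\<^bsub>X\<^esub>" using eq cls_eq[OF s t] by blast
  then have "ev X g s \<ominus>\<^bsub>X\<^esub> ev X g t = \<zero>\<^bsub>X\<^esub>" using X.frag_hom_diff[OF h s t] by simp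
  moreover have "ev X g s = (ev X g s \<ominus>\<^bsub>X\<^esub> ev X g t) \<oplus>\<^bsub>X\<^esub> ev X g t"
    using X.frag_hom_closed[OF h s] X.frag_hom_closed[OF h t] by (simp add: X.minus_eq X.a_assoc X.l_neg)
  ultimately show ?thesis using X.frag_hom_closed[OF h t] by simp
qed

text \<open>Naturality of the induced map under \<open>\<nu>\<close> tensor \<open>\<mu>\<close>; it
  is applied to the two outer actions of B.\<close>

lemma ev_extend:
  assumes X: "abelian_group X" and g: "balanced X g" and g': "balanced X g'"
    and \<nu>: "\<And>n. n \<in> carrier N \<Longrightarrow> \<nu> n \<in> carrier N" and \<mu>: "\<And>m. m \<in> carrier M \<Longrightarrow> \<mu> m \<in> carrier M"
    and eq: "\<And>n m. n \<in> carrier N \<Longrightarrow> m \<in> carrier M \<Longrightarrow> g' (n, m) = g (\<nu> n, \<mu> m)" and t: "t \<in> carrier F"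
  shows "ev X g' t = ev X g (frag_extend (\<lambda>(n, m). frag_of (\<nu> n, \<mu> m)) t)"
proof (rule ev_eqI[OF X g' homI _ t])
  interpret X: abelian_group X by (rule X)
  let ?\<sigma> = "frag_extend (\<lambda>(n, m). frag_of (\<nu> n, \<mu> m))"
  note h = ev_hom[OF X g]
  have ec: "?\<sigma> s \<in> carrier F" if "s \<in> carrier F" for s by (rule extend_closed[OF _ that]) (simp add: \<nu> \<mu>)
  show "ev X g (?\<sigma> s) \<in> carrier (add_monoid X)" if "s \<in> carrier F" for s using X.frag_hom_closed[OF h ec[OF that]] by simp
  show "ev X g (?\<sigma> (s \<otimes>\<^bsub>F\<^esub> s')) = ev X g (?\<sigma> s) \<otimes>\<^bsub>add_monoid X\<^esub> ev X g (?\<sigma> s')" if "s \<in> carrier F" "s' \<in> carrier F" for s s'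
    using X.frag_hom_add[OF h ec[OF that(1)] ec[OF that(2)]] by (simp add: frag_extend_add)
qed (simp add: ev_of[OF X g] eq \<nu> \<mu>)

text \<open>The unit of \<open>B\<close> lifts to a central element \<open>t\<close> of \<open>N \<otimes>\<^sub>A M\<close>, and the projection to \<open>B\<close> is a pairing \<open>\<mu>\<close> with \<open>\<mu> t = 1\<close>.\<close>

lemma separable_pairing:
  assumes iso: "bimodule_isomorphic B B (tensor A N M) (bimodule_sum (regular_bimodule B) Y)" and Y: "is_bimodule B B Y"
  shows "\<exists>\<mu> t. balanced (regular_bimodule B) \<mu> \<and> t \<in> carrier F \<and> ev (regular_bimodule B) \<mu> t = \<one>\<^bsub>B\<^esub> \<and>
    (\<forall>b\<in>carrier B. \<forall>n\<in>carrier N. \<forall>m\<in>carrier M. \<mu> (lsmult N b n, m) = b \<otimes>\<^bsub>B\<^esub> \<mu> (n, m) \<and> \<mu> (n, b \<odot>\<^bsub>M\<^esub> m) = \<mu> (n, m) \<otimes>\<^bsub>B\<^esub> b) \<and>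
    (\<forall>b\<in>carrier B. cls (lmul b t) = cls (rmul b t))"
proof -
  let ?T = "tensor A N M" and ?RB = "regular_bimodule B"
  let ?S = "bimodule_sum ?RB Y"
  interpret B: ring B by (rule N.L.ring_A)
  interpret RB: abelian_group ?RB by (rule N.L.regular_group)
  obtain f where bij: "bij_betw f (carrier ?T) (carrier ?S)" and fr: "f \<in> rmod_hom B (right_part ?T) (right_part ?S)"
    and fl: "f \<in> rmod_hom (opposite B) (left_part ?T) (left_part ?S)"
    using iso unfolding bimodule_isomorphic_def by blast
  have clsT: "cls s \<in> carrier ?T" if "s \<in> carrier F" for s using that unfolding tensor_carrier by blast
  have S_simps: "carrier ?S = carrier B \<times> carrier Y" "u \<oplus>\<^bsub>?S\<^esub> v = (fst u \<oplus>\<^bsub>B\<^esub> fst v, snd u \<oplus>\<^bsub>Y\<^esub> snd v)"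
    "b \<odot>\<^bsub>?S\<^esub> u = (fst u \<otimes>\<^bsub>B\<^esub> b, b \<odot>\<^bsub>Y\<^esub> snd u)" "lsmult ?S b u = (b \<otimes>\<^bsub>B\<^esub> fst u, lsmult Y b (snd u))" for u v b
    by (simp_all add: bimodule_sum_def case_prod_unfold)
  \<comment> \<open>The quotient map, the given isomorphism and the projection to the summand B in
    succession. The pairing \<open>\<mu>\<close> is its restriction to pure tensors.\<close>
  define \<phi> where "\<phi> s = fst (f (cls s))" for s
  have \<phi>c: "\<phi> s \<in> carrier B" if "s \<in> carrier F" for s
  proof -
    have "f (cls s) \<in> carrier ?S" using bij_betwE[OF bij] clsT[OF that] by blast
    then show ?thesis unfolding S_simps \<phi>_def by auto
  qed
  have \<phi>: "\<phi> \<in> hom F (add_monoid ?RB)"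
  proof (rule homI)
    fix s s' assume s: "s \<in> carrier F" "s' \<in> carrier F"
    show "\<phi> s \<in> carrier (add_monoid ?RB)" using \<phi>c[OF s(1)] by simp
    have "f (cls (s + s')) = f (cls s) \<oplus>\<^bsub>?S\<^esub> f (cls s')"
      using hom_add[OF fr, of "cls s" "cls s'"] clsT s by (simp add: cls_add[OF s])
    then show "\<phi> (s \<otimes>\<^bsub>F\<^esub> s') = \<phi> s \<otimes>\<^bsub>add_monoid ?RB\<^esub> \<phi> s'" by (simp add: \<phi>_def S_simps)
  qed
  define \<mu> where "\<mu> p = \<phi> (frag_of p)" for p
  have fo: "frag_of (n, m) \<in> carrier F" if "n \<in> carrier N" "m \<in> carrier M" for n m using that by simp
  have \<mu>c: "\<mu> x \<in> carrier ?RB" if "x \<in> carrier N \<times> carrier M" for x using \<phi>c[OF fo] that by (auto simp: \<mu>_def)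
  have bal: "balanced ?RB \<mu>" unfolding balanced_def
  proof (intro ballI conjI)
    fix n m assume n: "n \<in> carrier N" and m: "m \<in> carrier M"
    show "\<mu> (n, m) \<in> carrier ?RB" using \<mu>c n m by simp
    have add: "\<mu> p = \<mu> q \<oplus>\<^bsub>?RB\<^esub> \<mu> r" if rel3: "frag_of p - frag_of q - frag_of r \<in> tensor_relations A N M"
      and pqr: "frag_of p \<in> carrier F" "frag_of q \<in> carrier F" "frag_of r \<in> carrier F" for p q r
    proof -
      have qr: "frag_of q + frag_of r \<in> carrier F" using pqr keys_add[of "frag_of q" "frag_of r"] by auto
      have "frag_of p - (frag_of q + frag_of r) \<in> tensor_relations A N M" using rel3 by (simp add: diff_diff_eq)
      then have "cls (frag_of p) = cls (frag_of q + frag_of r)" using cls_eq[OF pqr(1) qr] by (simp add: tensor_kernel_def generate.incl)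
      then have "\<phi> (frag_of p) = \<phi> (frag_of q + frag_of r)" by (simp add: \<phi>_def)
      then show ?thesis using RB.frag_hom_add[OF \<phi> pqr(2,3)] by (simp add: \<mu>_def)
    qed
    show "\<mu> (n \<oplus>\<^bsub>N\<^esub> n', m) = \<mu> (n, m) \<oplus>\<^bsub>?RB\<^esub> \<mu> (n', m)" if n': "n' \<in> carrier N" for n'
      by (rule add[OF _ fo[OF N.Q_add[OF n n'] m] fo[OF n m] fo[OF n' m]]) (use n n' m in \<open>unfold tensor_relations_def, blast\<close>)
    show "\<mu> (n, m \<oplus>\<^bsub>M\<^esub> m') = \<mu> (n, m) \<oplus>\<^bsub>?RB\<^esub> \<mu> (n, m')" if m': "m' \<in> carrier M" for m'
      by (rule add[OF _ fo[OF n M.Q_add[OF m m']] fo[OF n m] fo[OF n m']]) (use n m m' in \<open>unfold tensor_relations_def, blast\<close>)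
    show "\<mu> (a \<odot>\<^bsub>N\<^esub> n, m) = \<mu> (n, lsmult M a m)" if a: "a \<in> carrier A" for a
    proof -
      have "frag_of (a \<odot>\<^bsub>N\<^esub> n, m) - frag_of (n, lsmult M a m) \<in> tensor_relations A N M"
        using n m a unfolding tensor_relations_def by blast
      then have "cls (frag_of (a \<odot>\<^bsub>N\<^esub> n, m)) = cls (frag_of (n, lsmult M a m))"
        using cls_eq[OF fo[OF N.rsmult_closed[OF a n] m] fo[OF n M.lsmult_closed[OF a m]]] by (simp add: tensor_kernel_def generate.incl)
      then show ?thesis by (simp add: \<mu>_def \<phi>_def)
    qed
  qed
  have \<mu>ev: "ev ?RB \<mu> s = \<phi> s" if "s \<in> carrier F" for s
    by (rule ev_eqI[OF N.L.regular_group bal \<phi> _ that]) (simp add: \<mu>_def)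
  have fcr: "f (cls (rmul b s)) = b \<odot>\<^bsub>?S\<^esub> f (cls s)"
    and fcl: "f (cls (lmul b s)) = lsmult ?S b (f (cls s))" if "b \<in> carrier B" "s \<in> carrier F" for b s
    using hom_smult[OF fr, of b "cls s"] hom_smult[OF fl, of b "cls s"] clsT[OF that(2)] that(1)
    by (simp_all only: cls_smult[OF that] cls_lsmult[OF that] part_simps opposite_simps)
  interpret Yr: right_module B "right_part Y" using Y by (simp add: is_bimodule_def)
  interpret Yl: right_module "opposite B" "left_part Y" using Y by (simp add: is_bimodule_def)
  have YG: "abelian_group Y" by (rule abelian_group_right_part[OF Yr.M.abelian_group_axioms])
  have y0: "b \<odot>\<^bsub>Y\<^esub> \<zero>\<^bsub>Y\<^esub> = \<zero>\<^bsub>Y\<^esub>" "lsmult Y b \<zero>\<^bsub>Y\<^esub> = \<zero>\<^bsub>Y\<^esub>" if b: "b \<in> carrier B" for b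
  proof -
    have "(\<lambda>y. b \<odot>\<^bsub>Y\<^esub> y) \<in> rmod_hom (B\<lparr>carrier := {}\<rparr>) Y Y"
      by (rule rmod_homI) (use Yr.smult_closed Yr.smult_r_distr b in auto)
    from hom_zero[OF this YG YG] show "b \<odot>\<^bsub>Y\<^esub> \<zero>\<^bsub>Y\<^esub> = \<zero>\<^bsub>Y\<^esub>" .
    have "(\<lambda>y. lsmult Y b y) \<in> rmod_hom (B\<lparr>carrier := {}\<rparr>) Y Y"
      by (rule rmod_homI) (use Yl.smult_closed Yl.smult_r_distr b in auto)
    from hom_zero[OF this YG YG] show "lsmult Y b \<zero>\<^bsub>Y\<^esub> = \<zero>\<^bsub>Y\<^esub>" .
  qed
  have "(\<one>\<^bsub>B\<^esub>, \<zero>\<^bsub>Y\<^esub>) \<in> carrier ?S" unfolding S_simps using abelian_groupE(2)[OF YG] by simp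
  then have "(\<one>\<^bsub>B\<^esub>, \<zero>\<^bsub>Y\<^esub>) \<in> f ` carrier ?T" using bij by (simp add: bij_betw_def)
  \<comment> \<open>The preimage of (1, 0). In the direct sum, b (1, 0) = (b, 0) = (1, 0) b, so the
    class of t is central, and its first component 1 is the value of the pairing at t.\<close>
  then obtain t where t: "t \<in> carrier F" and ft: "f (cls t) = (\<one>\<^bsub>B\<^esub>, \<zero>\<^bsub>Y\<^esub>)" unfolding tensor_carrier by force
  show ?thesis
  proof (intro exI[of _ \<mu>] exI[of _ t] conjI ballI bal t)
    show "ev ?RB \<mu> t = \<one>\<^bsub>B\<^esub>" unfolding \<mu>ev[OF t] \<phi>_def ft by simp
  next
    fix b n m assume b: "b \<in> carrier B" and n: "n \<in> carrier N" and m: "m \<in> carrier M"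
    show "\<mu> (lsmult N b n, m) = b \<otimes>\<^bsub>B\<^esub> \<mu> (n, m)" using fcl[OF b fo[OF n m]] by (simp add: \<mu>_def \<phi>_def S_simps)
    show "\<mu> (n, b \<odot>\<^bsub>M\<^esub> m) = \<mu> (n, m) \<otimes>\<^bsub>B\<^esub> b" using fcr[OF b fo[OF n m]] by (simp add: \<mu>_def \<phi>_def S_simps)
  next
    fix b assume b: "b \<in> carrier B"
    have l: "lmul b t \<in> carrier F"
      by (rule extend_closed[OF _ t]) (use b N.lsmult_closed in auto)
    have r: "rmul b t \<in> carrier F"
      by (rule extend_closed[OF _ t]) (use b M.rsmult_closed in auto)
    have "f (cls (lmul b t)) = f (cls (rmul b t))"
      unfolding fcl[OF b t] fcr[OF b t] ft S_simps using y0[OF b] b by simp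
    then show "cls (lmul b t) = cls (rmul b t)"
      using bij clsT[OF l] clsT[OF r] by (auto simp: bij_betw_def dest: inj_onD)
  qed
qed

lemma ev_comp:
  assumes X: "abelian_group X" and X': "abelian_group X'" and g: "balanced X g" and g': "balanced X' g'"
    and k: "\<And>x y. x \<in> carrier X \<Longrightarrow> y \<in> carrier X \<Longrightarrow> k (x \<oplus>\<^bsub>X\<^esub> y) = k x \<oplus>\<^bsub>X'\<^esub> k y" "\<And>x. x \<in> carrier X \<Longrightarrow> k x \<in> carrier X'"
    and eq: "\<And>n m. n \<in> carrier N \<Longrightarrow> m \<in> carrier M \<Longrightarrow> g' (n, m) = k (g (n, m))" and t: "t \<in> carrier F"
  shows "ev X' g' t = k (ev X g t)"
proof -
  interpret X: abelian_group X by (rule X)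
  note h = ev_hom[OF X g]
  have "(\<lambda>s. k (ev X g s)) \<in> hom F (add_monoid X')"
    by (rule homI) (simp_all add: X.frag_hom_closed[OF h] X.frag_hom_add[OF h] k)
  then show ?thesis by (rule ev_eqI[OF X' g' _ _ t]) (simp add: ev_of[OF X g] eq)
qed

lemma ev_add:
  assumes X: "abelian_group X" and g: "balanced X g" and g': "balanced X g'" and g'': "balanced X g''"
    and eq: "\<And>n m. n \<in> carrier N \<Longrightarrow> m \<in> carrier M \<Longrightarrow> g'' (n, m) = g (n, m) \<oplus>\<^bsub>X\<^esub> g' (n, m)" and t: "t \<in> carrier F"
  shows "ev X g'' t = ev X g t \<oplus>\<^bsub>X\<^esub> ev X g' t"
proof (rule ev_eqI[OF X g'' homI _ t])
  interpret X: abelian_group X by (rule X)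
  note h = ev_hom[OF X g] and h' = ev_hom[OF X g']
  note cl = X.frag_hom_closed[OF h] X.frag_hom_closed[OF h']
  show "ev X g s \<oplus>\<^bsub>X\<^esub> ev X g' s \<in> carrier (add_monoid X)" if "s \<in> carrier F" for s using cl that by simp
  show "ev X g (s \<otimes>\<^bsub>F\<^esub> s') \<oplus>\<^bsub>X\<^esub> ev X g' (s \<otimes>\<^bsub>F\<^esub> s') = (ev X g s \<oplus>\<^bsub>X\<^esub> ev X g' s) \<otimes>\<^bsub>add_monoid X\<^esub> (ev X g s' \<oplus>\<^bsub>X\<^esub> ev X g' s')"
    if "s \<in> carrier F" "s' \<in> carrier F" for s s'
    using cl[OF that(1)] cl[OF that(2)] X.frag_hom_add[OF h that] X.frag_hom_add[OF h' that] by (simp add: X.a_ac)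
qed (simp add: ev_of[OF X g] ev_of[OF X g'] eq)

text \<open>By currying, the composite functor is Hom over B out of the tensor product. The section
  sends x to the map with value x \<open>\<mu> (n, m)\<close> at n and m, the retraction evaluates
  at t, and their composite multiplies x by the value 1 of \<open>\<mu>\<close> at t. The section is
  linear because \<open>\<mu>\<close> is left linear, the retraction because t is central.\<close>

lemma natural_retract_homf:
  assumes iso: "bimodule_isomorphic B B (tensor A N M) (bimodule_sum (regular_bimodule B) Y)" and Y: "is_bimodule B B Y"
  shows "natural_retract B (\<lambda>X. homf A N (homf B M X)) (\<lambda>f. homf_map N (homf_map M f))"
proof -
  let ?RB = "regular_bimodule B"
  obtain \<mu> t where \<mu>: "balanced ?RB \<mu>" and t: "t \<in> carrier F" and \<mu>t: "ev ?RB \<mu> t = \<one>\<^bsub>B\<^esub>"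
    and \<mu>lr: "\<forall>b\<in>carrier B. \<forall>n\<in>carrier N. \<forall>m\<in>carrier M. \<mu> (lsmult N b n, m) = b \<otimes>\<^bsub>B\<^esub> \<mu> (n, m) \<and> \<mu> (n, b \<odot>\<^bsub>M\<^esub> m) = \<mu> (n, m) \<otimes>\<^bsub>B\<^esub> b"
    and "\<forall>b\<in>carrier B. cls (lmul b t) = cls (rmul b t)"
    using separable_pairing[OF iso Y] by (elim exE conjE)
  note central = bspec[OF this(5)]
  have \<mu>l: "\<mu> (lsmult N b n, m) = b \<otimes>\<^bsub>B\<^esub> \<mu> (n, m)" and \<mu>r: "\<mu> (n, b \<odot>\<^bsub>M\<^esub> m) = \<mu> (n, m) \<otimes>\<^bsub>B\<^esub> b"
    if "b \<in> carrier B" "n \<in> carrier N" "m \<in> carrier M" for b n m using \<mu>lr that by blast+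
  interpret B: ring B by (rule N.L.ring_A)
  have \<mu>c: "\<mu> (n, m) \<in> carrier B" and \<mu>nadd: "n' \<in> carrier N \<Longrightarrow> \<mu> (n \<oplus>\<^bsub>N\<^esub> n', m) = \<mu> (n, m) \<oplus>\<^bsub>B\<^esub> \<mu> (n', m)"
    and \<mu>madd: "m' \<in> carrier M \<Longrightarrow> \<mu> (n, m \<oplus>\<^bsub>M\<^esub> m') = \<mu> (n, m) \<oplus>\<^bsub>B\<^esub> \<mu> (n, m')"
    and \<mu>mid: "a \<in> carrier A \<Longrightarrow> \<mu> (a \<odot>\<^bsub>N\<^esub> n, m) = \<mu> (n, lsmult M a m)"
    if "n \<in> carrier N" "m \<in> carrier M" for n m n' m' a
    using \<mu> that unfolding balanced_def regular_simps by blast+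
  define i where "i X x = pk (\<lambda>n\<in>carrier N. pk (\<lambda>m\<in>carrier M. \<mu> (n, m) \<odot>\<^bsub>X\<^esub> x))" for X :: "('u, 'u) module" and x
  define p where "p X \<psi> = ev X (\<lambda>(n, m). up (up \<psi> n) m) t" for X :: "('u, 'u) module" and \<psi>
  let ?T = "\<lambda>X. homf A N (homf B M X)"
  have Tm: "?T X \<in> modules B" if "X \<in> modules B" for X by (rule N.homf_modules[OF M.homf_modules[OF that]])
  have ext: "u = v" if "u \<in> carrier (?T X)" "v \<in> carrier (?T X)" "\<And>n m. n \<in> carrier N \<Longrightarrow> m \<in> carrier M \<Longrightarrow> up (up u n) m = up (up v n) m" for u v X
    by (rule N.homf_ext[OF that(1,2)]) (rule M.homf_ext[OF N.homf_closed[OF that(1)] N.homf_closed[OF that(2)] that(3)])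
  have upi: "up (up (i X x) n) m = \<mu> (n, m) \<odot>\<^bsub>X\<^esub> x" if "n \<in> carrier N" "m \<in> carrier M" for X x n m
    using that by (simp add: i_def N.up_homf M.up_homf N.small_Q M.small_Q)
  have ic: "i X x \<in> carrier (?T X)" if X: "X \<in> modules B" and x: "x \<in> carrier X" for X x
    unfolding i_def N.homf_in
  proof (rule rmod_homI)
    fix n assume n: "n \<in> carrier N"
    have 1: "pk (\<lambda>m\<in>carrier M. \<mu> (n, m) \<odot>\<^bsub>X\<^esub> x) \<in> carrier (homf B M X)" if n: "n \<in> carrier N" for n
      unfolding M.homf_in by (rule rmod_homI) (use n x X in \<open>auto simp: \<mu>c \<mu>madd \<mu>r N.L.mod_smult N.L.mod_smult_l N.L.mod_smult_assoc\<close>)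
    show "pk (\<lambda>m\<in>carrier M. \<mu> (n, m) \<odot>\<^bsub>X\<^esub> x) \<in> carrier (homf B M X)" by (rule 1[OF n])
    note m = M.homf_modules[OF X]
    show "pk (\<lambda>m\<in>carrier M. \<mu> (n \<oplus>\<^bsub>N\<^esub> n', m) \<odot>\<^bsub>X\<^esub> x) = pk (\<lambda>m\<in>carrier M. \<mu> (n, m) \<odot>\<^bsub>X\<^esub> x) \<oplus>\<^bsub>homf B M X\<^esub> pk (\<lambda>m\<in>carrier M. \<mu> (n', m) \<odot>\<^bsub>X\<^esub> x)"
      if n': "n' \<in> carrier N" for n'
      by (rule M.homf_ext[OF 1[OF N.Q_add[OF n n']] N.R.mod_add[OF m 1[OF n] 1[OF n']]])
        (use n n' x X in \<open>simp add: M.up_homf \<mu>c \<mu>nadd N.L.mod_smult_l\<close>)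
    show "pk (\<lambda>m\<in>carrier M. \<mu> (a \<odot>\<^bsub>N\<^esub> n, m) \<odot>\<^bsub>X\<^esub> x) = a \<odot>\<^bsub>homf B M X\<^esub> pk (\<lambda>m\<in>carrier M. \<mu> (n, m) \<odot>\<^bsub>X\<^esub> x)" if a: "a \<in> carrier A" for a
      by (rule M.homf_ext[OF 1[OF N.rsmult_closed[OF a n]] N.R.mod_smult[OF m a 1[OF n]]])
        (use n a in \<open>simp add: M.up_homf M.lsmult_closed \<mu>mid\<close>)
  qed
  have ih: "i X \<in> rmod_hom B X (?T X)" if X: "X \<in> modules B" for X
  proof (rule rmod_homI[OF ic[OF X]])
    fix x assume x: "x \<in> carrier X"
    show "i X (x \<oplus>\<^bsub>X\<^esub> y) = i X x \<oplus>\<^bsub>?T X\<^esub> i X y" if y: "y \<in> carrier X" for y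
      by (rule ext[OF ic[OF X N.L.mod_add[OF X x y]] N.L.mod_add[OF Tm[OF X] ic[OF X x] ic[OF X y]]])
        (use x y X in \<open>simp add: N.up_homf M.up_homf upi \<mu>c N.L.mod_smult_r\<close>)
    show "i X (b \<odot>\<^bsub>X\<^esub> x) = b \<odot>\<^bsub>?T X\<^esub> i X x" if b: "b \<in> carrier B" for b
      by (rule ext[OF ic[OF X N.L.mod_smult[OF X b x]] N.L.mod_smult[OF Tm[OF X] b ic[OF X x]]])
        (use x b X in \<open>simp add: N.up_homf M.up_homf upi \<mu>c \<mu>l N.lsmult_closed N.L.mod_smult_assoc\<close>)
  qed
  have bal: "balanced X (\<lambda>(n, m). up (up \<psi> n) m)" if X: "X \<in> modules B" and \<psi>: "\<psi> \<in> carrier (?T X)" for X \<psi>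
    unfolding balanced_def prod.case
  proof (intro ballI conjI)
    fix n m assume n: "n \<in> carrier N" and m: "m \<in> carrier M"
    note h = N.homf_cases(1)[OF \<psi>] and h' = M.homf_cases(1)[OF N.homf_closed[OF \<psi> n]]
    show "up (up \<psi> n) m \<in> carrier X" by (rule hom_closed[OF h' m])
    show "up (up \<psi> (n \<oplus>\<^bsub>N\<^esub> n')) m = up (up \<psi> n) m \<oplus>\<^bsub>X\<^esub> up (up \<psi> n') m" if "n' \<in> carrier N" for n'
      using hom_add[OF h n that] m by (simp add: M.up_homf)
    show "up (up \<psi> n) (m \<oplus>\<^bsub>M\<^esub> m') = up (up \<psi> n) m \<oplus>\<^bsub>X\<^esub> up (up \<psi> n) m'" if "m' \<in> carrier M" for m'
      by (rule hom_add[OF h' m that])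
    show "up (up \<psi> (a \<odot>\<^bsub>N\<^esub> n)) m = up (up \<psi> n) (lsmult M a m)" if "a \<in> carrier A" for a
      using hom_smult[OF h that n] m by (simp add: M.up_homf)
  qed
  have ph: "p X \<in> rmod_hom B (?T X) X" if X: "X \<in> modules B" for X
  proof (rule rmod_homI)
    fix \<psi> assume \<psi>: "\<psi> \<in> carrier (?T X)"
    note XG = N.L.mod_group[OF X]
    interpret X: abelian_group X by (rule XG)
    from X.frag_hom_closed[OF ev_hom[OF XG bal[OF X \<psi>]] t] show "p X \<psi> \<in> carrier X" by (simp add: p_def)
    show "p X (\<psi> \<oplus>\<^bsub>?T X\<^esub> \<psi>') = p X \<psi> \<oplus>\<^bsub>X\<^esub> p X \<psi>'" if \<psi>': "\<psi>' \<in> carrier (?T X)" for \<psi>'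
      unfolding p_def by (rule ev_add[OF XG bal[OF X \<psi>] bal[OF X \<psi>'] bal[OF X N.L.mod_add[OF Tm[OF X] \<psi> \<psi>']] _ t]) (simp add: N.up_homf M.up_homf)
    show "p X (b \<odot>\<^bsub>?T X\<^esub> \<psi>) = b \<odot>\<^bsub>X\<^esub> p X \<psi>" if b: "b \<in> carrier B" for b
    proof -
      let ?g = "\<lambda>(n, m). up (up \<psi> n) m"
      have b\<psi>: "b \<odot>\<^bsub>?T X\<^esub> \<psi> \<in> carrier (?T X)" by (rule N.L.mod_smult[OF Tm[OF X] b \<psi>])
      have gr: "?g (n, b \<odot>\<^bsub>M\<^esub> m) = b \<odot>\<^bsub>X\<^esub> ?g (n, m)" if "n \<in> carrier N" "m \<in> carrier M" for n m
        using hom_smult[OF M.homf_cases(1)[OF N.homf_closed[OF \<psi> that(1)]] b that(2)] by simp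
      have rb: "balanced X (\<lambda>(n, m). ?g (n, b \<odot>\<^bsub>M\<^esub> m))"
        using bal[OF X \<psi>] M.rsmult_closed[OF b] M.lsmult_rsmult[OF _ b] N.L.mod_smult_r[OF M.Q_modules b] unfolding balanced_def by simp
      have l: "lmul b t \<in> carrier F"
        by (rule extend_closed[OF _ t]) (use b N.lsmult_closed in auto)
      have r: "rmul b t \<in> carrier F"
        by (rule extend_closed[OF _ t]) (use b M.rsmult_closed in auto)
      \<comment> \<open>Acting by b on \<open>\<psi>\<close> means evaluating at b t. Centrality
        turns b t into t b, and right linearity of the values of \<open>\<psi>\<close> moves b
        outside.\<close>
      have "p X (b \<odot>\<^bsub>?T X\<^esub> \<psi>) = ev X ?g (lmul b t)"
        unfolding p_def by (rule ev_extend[OF XG bal[OF X \<psi>] bal[OF X b\<psi>] _ _ _ t]) (simp_all add: N.up_homf N.lsmult_closed b)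
      also have "\<dots> = ev X ?g (rmul b t)" by (rule ev_cls[OF XG bal[OF X \<psi>] l r central[OF b]])
      also have "\<dots> = ev X (\<lambda>(n, m). ?g (n, b \<odot>\<^bsub>M\<^esub> m)) t" by (rule ev_extend[symmetric, OF XG bal[OF X \<psi>] rb _ _ _ t]) (simp_all add: M.rsmult_closed b)
      also have "\<dots> = b \<odot>\<^bsub>X\<^esub> ev X ?g t"
        by (rule ev_comp[OF XG XG bal[OF X \<psi>] rb _ _ _ t]) (use gr X b in \<open>simp_all add: N.L.mod_smult N.L.mod_smult_r\<close>)
      finally show ?thesis by (simp add: p_def)
    qed
  qed
  have pi: "p X (i X x) = x" if X: "X \<in> modules B" and x: "x \<in> carrier X" for X x
  proof -
    have "p X (i X x) = ev ?RB \<mu> t \<odot>\<^bsub>X\<^esub> x"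
      unfolding p_def
      by (rule ev_comp[OF N.L.regular_group N.L.mod_group[OF X] \<mu> bal[OF X ic[OF X x]] _ _ _ t])
        (use X x in \<open>simp_all add: upi N.L.mod_smult N.L.mod_smult_l\<close>)
    then show ?thesis using N.L.mod_one[OF X x] by (simp add: \<mu>t)
  qed
  have inat: "homf_map N (homf_map M f) (i X x) = i X' (f x)"
    if X: "X \<in> modules B" "X' \<in> modules B" and f: "f \<in> rmod_hom B X X'" and x: "x \<in> carrier X" for X X' f x
    by (rule ext[OF hom_closed[OF N.homf_map_hom[OF M.homf_modules[OF X(1)] M.homf_modules[OF X(2)] M.homf_map_hom[OF X f]] ic[OF X(1) x]] ic[OF X(2) hom_closed[OF f x]]])
      (use x in \<open>simp add: N.up_homf M.up_homf upi hom_smult[OF f] \<mu>c\<close>)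
  have pnat: "f (p X u) = p X' (homf_map N (homf_map M f) u)"
    if X: "X \<in> modules B" "X' \<in> modules B" and f: "f \<in> rmod_hom B X X'" and u: "u \<in> carrier (?T X)" for X X' f u
    unfolding p_def
    by (rule ev_comp[symmetric, OF N.L.mod_group[OF X(1)] N.L.mod_group[OF X(2)] bal[OF X(1) u]
          bal[OF X(2) hom_closed[OF N.homf_map_hom[OF M.homf_modules[OF X(1)] M.homf_modules[OF X(2)] M.homf_map_hom[OF X f]] u]] _ _ _ t])
      (simp_all add: N.up_homf M.up_homf hom_add[OF f] hom_closed[OF f])
  show ?thesis unfolding natural_retract_def
    by (intro exI[of _ i] exI[of _ p] conjI ballI ih ph pi inat pnat)
qed

end

section \<open>From a separable division to the transfer of generation\<close>

context ring_universe
begin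

text \<open>Supplies a member of each class of generators, which \<open>generates_transfer\<close>
  uses to see that the preimage subcategory is nonempty.\<close>

lemma zero_module_injective_projective:
  assumes M: "M \<in> modules A"
  shows "injective_module A (M\<lparr>carrier := {\<zero>\<^bsub>M\<^esub>}\<rparr>)" "projective_module A (M\<lparr>carrier := {\<zero>\<^bsub>M\<^esub>}\<rparr>)"
proof -
  let ?Z = "M\<lparr>carrier := {\<zero>\<^bsub>M\<^esub>}\<rparr>"
  have Z: "?Z \<in> modules A" by (rule zero_submodule_modules[OF M])
  show "injective_module A ?Z" unfolding injective_module_def
  proof (intro conjI ballI impI Z)
    fix X Y i f assume Y: "Y \<in> modules A" and f: "f \<in> rmod_hom A X ?Z"
    show "\<exists>g\<in>rmod_hom A Y ?Z. \<forall>x\<in>carrier X. g (i x) = f x"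
      using hom_closed[OF f] by (intro bexI[OF _ hom_const_zero[OF Y Z]]) auto
  qed
  show "projective_module A ?Z" unfolding projective_module_def
  proof (intro conjI ballI impI Z)
    fix X Y p f assume X: "X \<in> modules A" and Y: "Y \<in> modules A" and p: "p \<in> rmod_hom A X Y" and f: "f \<in> rmod_hom A ?Z Y"
    show "\<exists>g\<in>rmod_hom A ?Z X. \<forall>x\<in>carrier ?Z. p (g x) = f x"
      using hom_zero[OF p mod_group[OF X] mod_group[OF Y]] hom_zero[OF f mod_group[OF Z] mod_group[OF Y]]
      by (intro bexI[OF _ hom_const_zero[OF Z X]]) auto
  qed
qed

end

text \<open>Naturality with respect to the differentials of X turns the modulewise retraction into
  chain maps.\<close>

lemma (in bimod_pair) chain_retract:
  assumes retract: "natural_retract B (\<lambda>X. homf A N (homf B M X)) (\<lambda>f. homf_map N (homf_map M f))"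
    and X: "X \<in> complexes B"
  shows "\<exists>Z\<in>complexes A. \<exists>i\<in>chain_maps B X (homc A N Z). \<exists>r\<in>chain_maps B (homc A N Z) X. \<forall>n. \<forall>x\<in>carrier (obj X n). r n (i n x) = x"
proof -
  let ?T = "\<lambda>X. homf A N (homf B M X)"
  obtain i p where
    *: "\<forall>X\<in>modules B. i X \<in> rmod_hom B X (?T X) \<and> p X \<in> rmod_hom B (?T X) X \<and> (\<forall>x\<in>carrier X. p X (i X x) = x)" and
    **: "\<forall>X\<in>modules B. \<forall>Y\<in>modules B. \<forall>f\<in>rmod_hom B X Y.
      (\<forall>x\<in>carrier X. homf_map N (homf_map M f) (i X x) = i Y (f x)) \<and> (\<forall>u\<in>carrier (?T X). f (p X u) = p Y (homf_map N (homf_map M f) u))"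
    using retract unfolding natural_retract_def by (elim exE conjE)
  note o = N.L.cpx_obj[OF X] and d = N.L.cpx_dif[OF X refl]
  have ob: "obj (homc A N (homc B M X)) n = ?T (obj X n)" for n by (simp add: N.homc_obj M.homc_obj)
  have di: "dif (homc A N (homc B M X)) n u = homf_map N (homf_map M (dif X n)) u" for n u
    by (simp add: N.homc_dif M.homc_dif)
  have "(\<lambda>n. i (obj X n)) \<in> chain_maps B X (homc A N (homc B M X))"
  proof (rule N.L.chain_mapsI)
    show "i (obj X n) \<in> rmod_hom B (obj X n) (obj (homc A N (homc B M X)) n)" for n using * o unfolding ob by blast
    show "i (obj X (n + 1)) (dif X n x) = dif (homc A N (homc B M X)) n (i (obj X n) x)" if "x \<in> carrier (obj X n)" for n x
      using **[rule_format, OF o o d, THEN conjunct1] that unfolding di by simp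
  qed
  moreover have "(\<lambda>n. p (obj X n)) \<in> chain_maps B (homc A N (homc B M X)) X"
  proof (rule N.L.chain_mapsI)
    show "p (obj X n) \<in> rmod_hom B (obj (homc A N (homc B M X)) n) (obj X n)" for n using * o unfolding ob by blast
    show "p (obj X (n + 1)) (dif (homc A N (homc B M X)) n u) = dif X n (p (obj X n) u)" if "u \<in> carrier (obj (homc A N (homc B M X)) n)" for n u
      using **[rule_format, OF o o d, THEN conjunct2] that unfolding di ob by simp
  qed
  moreover have "\<forall>n. \<forall>x\<in>carrier (obj X n). p (obj X n) (i (obj X n) x) = x" using * o by blast
  ultimately show ?thesis
    by (intro bexI[where x = "homc B M X", OF bexI[where x = "\<lambda>n. i (obj X n)", OF bexI[where x = "\<lambda>n. p (obj X n)"]]] M.homc_complexes[OF X])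
qed

text \<open>Both functors go from A to B. For injectives it is Hom over A out of N, whose left
  adjoint comes from a dual basis of N as a left B-module. For projectives it is Hom over A out of
  the dual of M, the left adjoint of Hom over B out of M.\<close>

lemma separably_divides_generates:
  fixes A B :: "'u ring"
  assumes univ: "grothendieck_universe TYPE('u)"
    and A: "ring A" "small (carrier A)" and B: "ring B" "small (carrier B)"
    and div: "separably_divides B A M N"
  shows "generates False A {J. injective_module A J} \<Longrightarrow> generates False B {J. injective_module B J}" (is "?I \<Longrightarrow> _")
    and "generates True A {P. projective_module A P} \<Longrightarrow> generates True B {P. projective_module B P}" (is "?P \<Longrightarrow> _")
proof -
  interpret A: ring_universe A using univ A by (simp add: ring_universe_def ring_universe_axioms_def universe_def)
  interpret B: ring_universe B using univ B by (simp add: ring_universe_def ring_universe_axioms_def universe_def)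
  interpret Ao: ring_universe "opposite A" by (rule A.opposite_universe)
  interpret Bo: ring_universe "opposite B" by (rule B.opposite_universe)
  have bim: "is_bimodule A B M" "is_bimodule B A N"
    and Ml: "finitely_generated (opposite A) (left_part M)" "projective_module (opposite A) (left_part M)"
    and Mr: "projective_module B (right_part M)"
    and Nl: "finitely_generated (opposite B) (left_part N)" "projective_module (opposite B) (left_part N)"
    and Nr: "finitely_generated A (right_part N)" "projective_module A (right_part N)"
    using div unfolding separably_divides_def by blast+
  obtain Y :: "('u, 'u, 'u) bimodule" where Y: "is_bimodule B B Y"
    and iso: "bimodule_isomorphic B B (tensor A N M) (bimodule_sum (regular_bimodule B) Y)"
    using div unfolding separably_divides_def by blast
  have "small (carrier (right_part M))" "small (carrier (right_part N))"
    using Mr Nr(2) by (simp_all only: projective_module_def modules_def mem_Collect_eq)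
  then have small: "small (carrier M)" "small (carrier N)" by simp_all
  interpret M: bimod A B M by unfold_locales (rule bim small)+
  interpret N: bimod B A N by unfold_locales (rule bim small)+
  interpret NM: bimod_pair A B N M by unfold_locales
  obtain JM cM where "dual_basis (opposite A) (left_part M) JM (\<lambda>j. j) cM" using Ao.dual_basis_exists[OF Ml] by blast
  then interpret dM: dual_bimod A B M JM "\<lambda>j. j" cM by unfold_locales
  obtain JN cN where "dual_basis (opposite B) (left_part N) JN (\<lambda>j. j) cN" using Bo.dual_basis_exists[OF Nl] by blast
  then interpret dN: dual_bimod B A N JN "\<lambda>j. j" cN by unfold_locales
  obtain J c where "dual_basis A (right_part N) J (\<lambda>j. j) c" using A.dual_basis_exists[OF Nr] by blast
  then have "dual_basis A N J (\<lambda>j. j) c" by (simp only: dual_basis_part)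
  then interpret fN: fgp_bimod B A N J "\<lambda>j. j" c by unfold_locales
  interpret D: bimod_pair A B "dualb A M" "dualb B N" by unfold_locales
  have retract: "natural_retract B (\<lambda>X. homf A N (homf B M X)) (\<lambda>f. homf_map N (homf_map M f))"
    by (rule NM.natural_retract_homf[OF iso Y])
  \<comment> \<open>The left adjoint of Hom out of N after Hom out of M is Hom out of the dual of M
    after Hom out of the dual of N, again an endofunctor for B, so mates carry the retraction over
    to it.\<close>
  have retract': "natural_retract B (\<lambda>X. homf A (dualb A M) (homf B (dualb B N) X)) (\<lambda>f. homf_map (dualb A M) (homf_map (dualb B N) f))"
    by (rule adjoint_functors.natural_retract_mates[OF adjoint_functors_comp[OF dN.adjunction dM.adjunction] retract refl])
  {
    assume ?I
    then show "generates False B {J. injective_module B J}"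
    proof (rule fN.generates_transfer)
      show "{J. injective_module A J} \<noteq> {}" using A.zero_module_injective_projective(1)[OF A.regular_modules] by blast
      show "{J. injective_module A J} \<subseteq> modules A" "{J. injective_module B J} \<subseteq> modules B" by (auto simp: injective_module_def)
      show "homf A N J \<in> {J. injective_module B J}" if "J \<in> {J. injective_module A J}" for J
        using dN.homf_preserves_injective that by blast
    qed (rule NM.chain_retract[OF retract])
  next
    assume ?P
    then show "generates True B {P. projective_module B P}"
    \<comment> \<open>The exact functor is now Hom over A out of the dual of M, with the dual basis
      that the dual inherits from M.\<close>
    proof (rule dM.D.generates_transfer)
      show "{P. projective_module A P} \<noteq> {}" using A.zero_module_injective_projective(2)[OF A.regular_modules] by blast
      show "{P. projective_module A P} \<subseteq> modules A" "{P. projective_module B P} \<subseteq> modules B" by (auto simp: projective_module_def)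
      show "homf A (dualb A M) P \<in> {P. projective_module B P}" if "P \<in> {P. projective_module A P}" for P
        using dM.dual_homf_preserves_projective[OF Mr] that by blast
    qed (rule D.chain_retract[OF retract'])
  }
qed

lemma injectives_generate_iff: "injectives_generate A \<longleftrightarrow> generates False A {J. injective_module A J}"
  by (simp add: injectives_generate_def generates_def locsub_def)

lemma projectives_cogenerate_iff: "projectives_cogenerate A \<longleftrightarrow> generates True A {P. projective_module A P}"
  by (simp add: projectives_cogenerate_def generates_def locsub_def)

theorem corollary4p4p1:
  fixes A B :: "'u ring"
  assumes "grothendieck_universe TYPE('u)"
    and "ring A" and "small (carrier A)"
    and "ring B" and "small (carrier B)"
    and "separably_equivalent A B"
  shows "(injectives_generate A \<longleftrightarrow> injectives_generate B) \<and>
         (projectives_cogenerate A \<longleftrightarrow> projectives_cogenerate B)"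
proof -
  obtain M N where "separably_divides A B N M" "separably_divides B A M N"
    using assms(6) unfolding separably_equivalent_def by blast
  then show ?thesis
    unfolding injectives_generate_iff projectives_cogenerate_iff
    using separably_divides_generates assms(1-5) by metis
qed

end
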